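(* Let $X$ be a $C^1$ incompressible vector field on a compact finite dimensional manifold $M$ which is $\mathcal J$-non-negative and strictly $\mathcal J$-separated on $M$ for a field $\mathcal J$ of non-degenerate and indefinite quadratic forms on $TM$ with constant index $\dim(M)-2$. Then $X_t$ is an Anosov flow.
   Context: $M$ is a connected compact Riemannian manifold (closed) of dimension $n\ge 3$; $X_t$ is the flow of $X$, $DX_t$ the derivative cocycle. $X$ is incompressible if it has null divergence, i.e. its flow is volume-preserving on $M$. Standing assumption: all singularities (zeros) of $X$ (if any) are hyperbolic, i.e. the eigenvalues of $DX(\sigma)$ have nonzero real part. A field of quadratic forms $\mathcal J$ on $TM$ is a continuous family of quadratic forms $\mathcal J_x:T_xM\to\mathbb R$, $x\in M$, continuously differentiable along the flow; its index is $q$, $0<q<n$, if the maximal dimension of subspaces of non-positive vectors is $q$. Put $C_\pm(x)=\{0\}\cup\{v:\pm\mathcal J_x(v)>0\}$, $C_0(x)=\mathcal J_x^{-1}(\{0\})$. $X$ is strictly $\mathcal J$-separated if $DX_t(x)(C_+(x)\cup C_0(x))\subset C_+(X_t(x))$ for all $t>0$, $x\in M$. $X$ is $\mathcal J$-non-negative if $\mathcal J_x(X(x))\ge0$ for all $x\in M$. $X_t$ is Anosov if $M$ is a hyperbolic set: there is a continuous $DX_t$-invariant splitting $TM=E^s\oplus E^X\oplus E^u$, where $E^X$ is the flow direction, and $K,\lambda>0$ with $\|DX_t|_{E^s_x}\|\le Ke^{-\lambda t}$ and $\|(DX_t|_{E^u_x})^{-1}\|\le Ke^{-\lambda t}$ for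 all $x\in M$, $t>0$. *)

theory Defs
  imports "HOL-Analysis.Analysis"
begin

section \<open>Maps of class C^k\<close>

text \<open>Meant for open \<open>S\<close> in a finite-dimensional space: all iterated directional derivatives
  up to order \<open>k\<close> exist and are continuous.\<close>

primrec Ck_on ::
  "nat \<Rightarrow> ('a::real_normed_vector \<Rightarrow> 'b::real_normed_vector) \<Rightarrow> 'a set \<Rightarrow> bool" where
  "Ck_on 0 f S \<longleftrightarrow> continuous_on S f"
| "Ck_on (Suc k) f S \<longleftrightarrow>
     (\<forall>x\<in>S. f differentiable (at x)) \<and> (\<forall>v. Ck_on k (\<lambda>x. frechet_derivative f (at x) v) S)"

section \<open>Smooth manifolds without boundary\<close>

text \<open>The manifold is the whole type \<open>'m\<close>, of dimension \<open>CARD('n)\<close>. A chart is a pair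
  \<open>(U, \<psi>)\<close>; the values of \<open>\<psi>\<close> outside \<open>U\<close> are irrelevant.\<close>

type_synonym ('m, 'n) chart = "'m set \<times> ('m \<Rightarrow> real ^ 'n)"

definition chart_inv :: "('m, 'n) chart \<Rightarrow> real ^ 'n \<Rightarrow> 'm" where
  "chart_inv c = inv_into (fst c) (snd c)"

definition smooth_atlas :: "('m::topological_space, 'n::finite) chart set \<Rightarrow> bool" where
  "smooth_atlas A \<longleftrightarrow>
     (\<Union>c\<in>A. fst c) = UNIV \<and>
     (\<forall>c\<in>A. open (fst c) \<and> open (snd c ` fst c) \<and>
        homeomorphism (fst c) (snd c ` fst c) (snd c) (chart_inv c)) \<and>
     (\<forall>c\<in>A. \<forall>d\<in>A. \<forall>k. Ck_on k (snd d \<circ> chart_inv c) (snd c ` (fst c \<inter> fst d)))"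

text \<open>The tangent space at \<open>x\<close> is realised as \<open>real ^ 'n\<close>: a tangent vector at \<open>x\<close> is given by its
  components in one selected chart around \<open>x\<close>. Its components in any other chart around \<open>x\<close> are
  obtained from \<open>to_coords\<close>; \<open>from_coords A c x w\<close> is the tangent vector at \<open>x\<close> with
  components \<open>w\<close> in the chart \<open>c\<close>. As the selected chart varies discontinuously with the
  base point, continuity and differentiability of tensor fields are always expressed through the
  components in a fixed chart.\<close>

definition chart_at :: "('m, 'n) chart set \<Rightarrow> 'm \<Rightarrow> ('m, 'n) chart" where
  "chart_at A x = (SOME c. c \<in> A \<and> x \<in> fst c)"

definition change_coords ::
  "('m, 'n::finite) chart \<Rightarrow> ('m, 'n) chart \<Rightarrow> 'm \<Rightarrow> real ^ 'n \<Rightarrow> real ^ 'n" where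
  "change_coords c d x = frechet_derivative (snd d \<circ> chart_inv c) (at (snd c x))"

definition to_coords ::
  "('m, 'n::finite) chart set \<Rightarrow> ('m, 'n) chart \<Rightarrow> 'm \<Rightarrow> real ^ 'n \<Rightarrow> real ^ 'n" where
  "to_coords A c x = change_coords (chart_at A x) c x"

definition from_coords ::
  "('m, 'n::finite) chart set \<Rightarrow> ('m, 'n) chart \<Rightarrow> 'm \<Rightarrow> real ^ 'n \<Rightarrow> real ^ 'n" where
  "from_coords A c x = change_coords c (chart_at A x) x"

text \<open>The derivative of a self-map \<open>f\<close> at \<open>x\<close>, as a map from the tangent space at \<open>x\<close> to the one
  at \<open>f x\<close>.\<close>

definition tangent_map ::
  "('m, 'n::finite) chart set \<Rightarrow> ('m \<Rightarrow> 'm) \<Rightarrow> 'm \<Rightarrow> real ^ 'n \<Rightarrow> real ^ 'n" where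
  "tangent_map A f x =
     frechet_derivative (snd (chart_at A (f x)) \<circ> f \<circ> chart_inv (chart_at A x))
       (at (snd (chart_at A x) x))"

section \<open>Riemannian metrics\<close>

definition riemannian_metric ::
  "('m, 'n::finite) chart set \<Rightarrow> ('m \<Rightarrow> real ^ 'n \<Rightarrow> real ^ 'n \<Rightarrow> real) \<Rightarrow> bool" where
  "riemannian_metric A g \<longleftrightarrow>
     (\<forall>x. bilinear (g x) \<and> (\<forall>v w. g x v w = g x w v) \<and> (\<forall>v. v \<noteq> 0 \<longrightarrow> g x v v > 0)) \<and>
     (\<forall>c\<in>A. \<forall>v w k. Ck_on k
        (\<lambda>u. g (chart_inv c u) (from_coords A c (chart_inv c u) v)
               (from_coords A c (chart_inv c u) w))
        (snd c ` fst c))"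

definition riemannian_norm ::
  "('m \<Rightarrow> real ^ 'n::finite \<Rightarrow> real ^ 'n \<Rightarrow> real) \<Rightarrow> 'm \<Rightarrow> real ^ 'n \<Rightarrow> real" where
  "riemannian_norm g x v = sqrt (g x v v)"

definition gram_matrix ::
  "('m, 'n::finite) chart set \<Rightarrow> ('m \<Rightarrow> real ^ 'n \<Rightarrow> real ^ 'n \<Rightarrow> real) \<Rightarrow> ('m, 'n) chart \<Rightarrow>
     real ^ 'n \<Rightarrow> real ^ 'n ^ 'n" where
  "gram_matrix A g c u =
     (\<chi> i j. g (chart_inv c u) (from_coords A c (chart_inv c u) (axis i 1))
                             (from_coords A c (chart_inv c u) (axis j 1)))"

section \<open>Vector fields and flows\<close>

definition local_rep ::
  "('m, 'n::finite) chart set \<Rightarrow> ('m, 'n) chart \<Rightarrow> ('m \<Rightarrow> real ^ 'n) \<Rightarrow> real ^ 'n \<Rightarrow> real ^ 'n" where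
  "local_rep A c X u = to_coords A c (chart_inv c u) (X (chart_inv c u))"

definition Ck_vector_field ::
  "('m, 'n::finite) chart set \<Rightarrow> nat \<Rightarrow> ('m \<Rightarrow> real ^ 'n) \<Rightarrow> bool" where
  "Ck_vector_field A k X \<longleftrightarrow> (\<forall>c\<in>A. Ck_on k (local_rep A c X) (snd c ` fst c))"

definition flow_of ::
  "('m::topological_space, 'n::finite) chart set \<Rightarrow> ('m \<Rightarrow> real ^ 'n) \<Rightarrow> (real \<Rightarrow> 'm \<Rightarrow> 'm) \<Rightarrow> bool" where
  "flow_of A X \<phi> \<longleftrightarrow>
     (\<forall>x. \<phi> 0 x = x) \<and>
     (\<forall>s t x. \<phi> (s + t) x = \<phi> s (\<phi> t x)) \<and>
     (\<forall>x. continuous_on UNIV (\<lambda>t. \<phi> t x)) \<and>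
     (\<forall>x t. ((\<lambda>s. snd (chart_at A (\<phi> t x)) (\<phi> s x)) has_vector_derivative X (\<phi> t x)) (at t))"

text \<open>The Riemannian divergence \<open>(1 / sqrt |g|) * (\<Sum>i. \<partial>\<^sub>i (sqrt |g| * X\<^sub>i))\<close>,
  computed in the chart \<open>c\<close> at the point with coordinates \<open>u\<close>.\<close>

definition divergence ::
  "('m, 'n::finite) chart set \<Rightarrow> ('m \<Rightarrow> real ^ 'n \<Rightarrow> real ^ 'n \<Rightarrow> real) \<Rightarrow> ('m \<Rightarrow> real ^ 'n) \<Rightarrow>
     ('m, 'n) chart \<Rightarrow> real ^ 'n \<Rightarrow> real" where
  "divergence A g X c u =
     (\<Sum>i\<in>UNIV. frechet_derivative
        (\<lambda>w. sqrt (det (gram_matrix A g c w)) * local_rep A c X w $ i) (at u) (axis i 1))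
     / sqrt (det (gram_matrix A g c u))"

definition incompressible ::
  "('m, 'n::finite) chart set \<Rightarrow> ('m \<Rightarrow> real ^ 'n \<Rightarrow> real ^ 'n \<Rightarrow> real) \<Rightarrow> ('m \<Rightarrow> real ^ 'n) \<Rightarrow> bool" where
  "incompressible A g X \<longleftrightarrow> (\<forall>c\<in>A. \<forall>u\<in>snd c ` fst c. divergence A g X c u = 0)"

definition complex_eigenvalue :: "real ^ 'n ^ 'n \<Rightarrow> complex \<Rightarrow> bool" where
  "complex_eigenvalue B z \<longleftrightarrow>
     (\<exists>v. v \<noteq> 0 \<and> (\<chi> i j. complex_of_real (B $ i $ j)) *v v = z *s v)"

definition hyperbolic_singularity ::
  "('m, 'n::finite) chart set \<Rightarrow> ('m \<Rightarrow> real ^ 'n) \<Rightarrow> 'm \<Rightarrow> bool" where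
  "hyperbolic_singularity A X p \<longleftrightarrow>
     X p = 0 \<and>
     (\<forall>z. complex_eigenvalue
        (matrix (frechet_derivative (local_rep A (chart_at A p) X) (at (snd (chart_at A p) p)))) z
        \<longrightarrow> Re z \<noteq> 0)"

section \<open>Fields of quadratic forms\<close>

definition quadratic_form :: "('a::real_vector \<Rightarrow> real) \<Rightarrow> bool" where
  "quadratic_form Q \<longleftrightarrow> (\<exists>B. bilinear B \<and> (\<forall>v. Q v = B v v))"

definition polar_form :: "('a::real_vector \<Rightarrow> real) \<Rightarrow> 'a \<Rightarrow> 'a \<Rightarrow> real" where
  "polar_form Q v w = (Q (v + w) - Q v - Q w) / 2"

definition nondegenerate :: "('a::real_vector \<Rightarrow> real) \<Rightarrow> bool" where
  "nondegenerate Q \<longleftrightarrow> (\<forall>v. (\<forall>w. polar_form Q v w = 0) \<longrightarrow> v = 0)"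

definition indefinite :: "('a \<Rightarrow> real) \<Rightarrow> bool" where
  "indefinite Q \<longleftrightarrow> (\<exists>v. Q v > 0) \<and> (\<exists>v. Q v < 0)"

definition form_index :: "('a::euclidean_space \<Rightarrow> real) \<Rightarrow> nat" where
  "form_index Q = Max {dim S |S. subspace S \<and> (\<forall>v\<in>S. Q v \<le> 0)}"

text \<open>Both regularity conditions are tested on the coordinate fields of the charts, i.e. on the
  vector fields with constant components \<open>w\<close>; since \<open>w\<close> is arbitrary, polarisation gives
  all coefficients of the form. Differentiability along the flow is required
  orbit by orbit.\<close>

definition quadratic_form_field ::
  "('m::topological_space, 'n::finite) chart set \<Rightarrow> (real \<Rightarrow> 'm \<Rightarrow> 'm) \<Rightarrow>
     ('m \<Rightarrow> real ^ 'n \<Rightarrow> real) \<Rightarrow> bool" where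
  "quadratic_form_field A \<phi> J \<longleftrightarrow>
     (\<forall>x. quadratic_form (J x)) \<and>
     (\<forall>c\<in>A. \<forall>w. continuous_on (fst c) (\<lambda>x. J x (from_coords A c x w))) \<and>
     (\<forall>c\<in>A. \<forall>w x. Ck_on 1 (\<lambda>t. J (\<phi> t x) (from_coords A c (\<phi> t x) w)) {t. \<phi> t x \<in> fst c})"

definition pos_cone :: "('m \<Rightarrow> real ^ 'n \<Rightarrow> real) \<Rightarrow> 'm \<Rightarrow> (real ^ 'n) set" where
  "pos_cone J x = {0} \<union> {v. J x v > 0}"

definition null_cone :: "('m \<Rightarrow> real ^ 'n \<Rightarrow> real) \<Rightarrow> 'm \<Rightarrow> (real ^ 'n) set" where
  "null_cone J x = J x -` {0}"

definition strictly_separated ::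
  "('m, 'n::finite) chart set \<Rightarrow> (real \<Rightarrow> 'm \<Rightarrow> 'm) \<Rightarrow> ('m \<Rightarrow> real ^ 'n \<Rightarrow> real) \<Rightarrow> bool" where
  "strictly_separated A \<phi> J \<longleftrightarrow>
     (\<forall>t>0. \<forall>x. tangent_map A (\<phi> t) x ` (pos_cone J x \<union> null_cone J x) \<subseteq> pos_cone J (\<phi> t x))"

definition form_nonnegative :: "('m \<Rightarrow> real ^ 'n \<Rightarrow> real) \<Rightarrow> ('m \<Rightarrow> real ^ 'n) \<Rightarrow> bool" where
  "form_nonnegative J X \<longleftrightarrow> (\<forall>x. J x (X x) \<ge> 0)"

section \<open>Anosov flows\<close>

text \<open>A continuous subbundle is one that has continuous local frames; in particular its
  fibre dimension is locally constant.\<close>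

definition continuous_subbundle ::
  "('m::topological_space, 'n::finite) chart set \<Rightarrow> ('m \<Rightarrow> (real ^ 'n) set) \<Rightarrow> bool" where
  "continuous_subbundle A E \<longleftrightarrow>
     (\<forall>x. \<exists>U k Z. open U \<and> x \<in> U \<and>
        (\<forall>i<k::nat. \<forall>c\<in>A. continuous_on (U \<inter> fst c) (\<lambda>y. to_coords A c y (Z i y))) \<and>
        (\<forall>y\<in>U. inj_on (\<lambda>i. Z i y) {..<k} \<and> independent ((\<lambda>i. Z i y) ` {..<k}) \<and>
               span ((\<lambda>i. Z i y) ` {..<k}) = E y))"

definition flow_invariant ::
  "('m, 'n::finite) chart set \<Rightarrow> (real \<Rightarrow> 'm \<Rightarrow> 'm) \<Rightarrow> ('m \<Rightarrow> (real ^ 'n) set) \<Rightarrow> bool" where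
  "flow_invariant A \<phi> E \<longleftrightarrow> (\<forall>t x. tangent_map A (\<phi> t) x ` E x = E (\<phi> t x))"

definition direct_sum3 :: "'a::real_vector set \<Rightarrow> 'a set \<Rightarrow> 'a set \<Rightarrow> bool" where
  "direct_sum3 P Q R \<longleftrightarrow> subspace P \<and> subspace Q \<and> subspace R \<and>
     (\<forall>v. \<exists>!p. p \<in> P \<times> Q \<times> R \<and> v = (case p of (a, b, c) \<Rightarrow> a + b + c))"

definition flow_direction :: "('m \<Rightarrow> real ^ 'n::finite) \<Rightarrow> 'm \<Rightarrow> (real ^ 'n) set" where
  "flow_direction X x = span {X x}"

definition anosov_flow ::
  "('m::topological_space, 'n::finite) chart set \<Rightarrow> ('m \<Rightarrow> real ^ 'n \<Rightarrow> real ^ 'n \<Rightarrow> real) \<Rightarrow>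
     ('m \<Rightarrow> real ^ 'n) \<Rightarrow> (real \<Rightarrow> 'm \<Rightarrow> 'm) \<Rightarrow> bool" where
  "anosov_flow A g X \<phi> \<longleftrightarrow>
     (\<exists>Es Eu.
        (\<forall>x. direct_sum3 (Es x) (flow_direction X x) (Eu x)) \<and>
        (\<forall>E\<in>{Es, flow_direction X, Eu}. continuous_subbundle A E \<and> flow_invariant A \<phi> E) \<and>
        (\<exists>K>0. \<exists>r>0. \<forall>x. \<forall>t>0.
           (\<forall>v\<in>Es x. riemannian_norm g (\<phi> t x) (tangent_map A (\<phi> t) x v)
                       \<le> K * exp (- r * t) * riemannian_norm g x v) \<and>
           (\<forall>w\<in>Eu (\<phi> t x). riemannian_norm g x (inv_into (Eu x) (tangent_map A (\<phi> t) x) w)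
                       \<le> K * exp (- r * t) * riemannian_norm g (\<phi> t x) w)))"

end

theory Submission
  imports Defs
begin

text \<open>At a zero \<open>p\<close> of \<open>X\<close> the derivative \<open>DX(p)\<close> is invertible by hyperbolicity, and
  \<open>J(X) \<ge> 0\<close> gives \<open>J(DX(p) v) \<ge> 0\<close> for all \<open>v\<close> in the limit, contradicting indefiniteness; so \<open>X\<close>
  has no zeros. By compactness strict separation is uniform at time one, and the S-lemma turns it
  into \<open>J(DX\<^sub>1 v) \<ge> \<mu> J(v) + c |v|\<^sup>2\<close> with \<open>\<mu>\<close> bounded above and below. Hence the vectors whose forward
  orbits stay nonpositive form a subspace \<open>S\<close> of dimension \<open>n - 2\<close>, those whose backward orbits
  stay nonnegative form a plane \<open>F\<close> containing \<open>X\<close>, and \<open>F\<close> dominates \<open>S\<close>. As \<open>X\<close> is bounded, domination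
  by \<open>F\<close> contracts \<open>S\<close>. As volume is preserved, \<open>F\<close> modulo \<open>X\<close> is expanded, so the coefficient of \<open>X\<close>
  along a backward orbit in \<open>F\<close> converges geometrically; the vectors with limit \<open>0\<close> form the unstable
  line. The stable and unstable spaces are cut out by closed conditions, hence they are continuous.\<close>

section \<open>Quadratic forms\<close>

text \<open>The index \<open>CARD('n) - 2\<close> makes \<open>F\<close> a plane; as
  \<open>X\<close> lies in it, a single direction of \<open>F\<close> is left undecided, and one
  scalar piece of information, the preserved volume, settles it. Neither \<open>S\<close> nor
  \<open>F\<close> is visibly a subspace, since the cones are not convex: both are also growth
  classes relative to the product of the multipliers \<mu>, and this gives linearity. The
  multipliers are bounded above because \<open>J\<close> is bounded, and bounded away from 0, along
  the invariant field \<open>X\<close>. Tangent spaces are read in charts that jump with the base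
  point, so no continuous frame is at hand. The dynamical argument therefore runs in pointwise
  chosen orthonormal frames and uses uniform bounds only; continuity of the splitting is recovered
  at the end from the closed graphs of three complementary fields. The flow is given only through
  the differential equation, so its C1 dependence on the point has to be established before the
  derivative cocycle makes sense; the first-order expansion of the derivative at time 0 then turns
  zero divergence into preserved volume.\<close>

lemma quadratic_formE:
  assumes "quadratic_form Q"
  obtains B where "bilinear B" "\<And>v w. B v w = B w v" "\<And>v. Q v = B v v"
proof -
  obtain B where B: "bilinear B" "\<And>v. Q v = B v v"
    using assms unfolding quadratic_form_def by blast
  define B' where "B' v w = (B v w + B w v) / 2" for v w
  have "bilinear B'"
    unfolding bilinear_def B'_def using B(1)
    by (auto intro!: linearI simp: bilinear_ladd bilinear_radd bilinear_lmul bilinear_rmul field_simps)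
  then show ?thesis using that[of B'] B by (simp add: B'_def)
qed

lemma bilinear_inner: "bilinear (\<lambda>v w::'a::real_inner. v \<bullet> w)"
  by (auto simp: bilinear_def intro!: linearI simp: inner_add_left inner_add_right)

lemma bilinear_combine:
  assumes "bilinear B" "bilinear B'"
  shows "bilinear (\<lambda>v w. a * B v w + b * B' v w :: real)"
  using assms unfolding bilinear_def[of "\<lambda>v w. a * B v w + b * B' v w"]
  by (auto intro!: linearI simp: bilinear_ladd bilinear_radd bilinear_lmul bilinear_rmul algebra_simps)

lemma quadratic_form_combine:
  assumes "quadratic_form Q" "quadratic_form R"
  shows "quadratic_form (\<lambda>v. a * Q v + b * R v)"
proof -
  obtain B B' where "bilinear B" "\<And>v. Q v = B v v" "bilinear B'" "\<And>v. R v = B' v v"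
    using assms unfolding quadratic_form_def by blast
  then show ?thesis unfolding quadratic_form_def
    by (intro exI[of _ "\<lambda>v w. a * B v w + b * B' v w"]) (simp add: bilinear_combine)
qed

lemma quadratic_form_norm_square: "quadratic_form (\<lambda>v::'a::real_inner. (norm v)\<^sup>2)"
  unfolding quadratic_form_def using bilinear_inner dot_square_norm by metis

lemma quadratic_form_compose:
  assumes "quadratic_form Q" "linear T"
  shows "quadratic_form (\<lambda>v. Q (T v))"
proof -
  obtain B where B: "bilinear B" "\<And>v. Q v = B v v"
    using assms unfolding quadratic_form_def by blast
  have "bilinear (\<lambda>v w. B (T v) (T w))"
    using B(1) assms(2) unfolding bilinear_def[of "\<lambda>v w. B (T v) (T w)"]
    by (auto intro!: linearI simp: linear_add linear_scale bilinear_ladd bilinear_radd bilinear_lmul bilinear_rmul)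
  then show ?thesis unfolding quadratic_form_def using B(2) by blast
qed

lemma quadratic_form_scale:
  assumes "quadratic_form Q" shows "Q (a *\<^sub>R v) = a\<^sup>2 * Q v"
proof -
  obtain B where "bilinear B" "\<And>v. Q v = B v v"
    using assms unfolding quadratic_form_def by blast
  then show ?thesis by (simp add: bilinear_lmul bilinear_rmul power2_eq_square)
qed

lemma quadratic_form_0: "quadratic_form Q \<Longrightarrow> Q 0 = 0"
  using quadratic_form_scale[of Q 0 0] by simp

lemma continuous_on_quadratic_form:
  fixes Q :: "'a::euclidean_space \<Rightarrow> real"
  assumes "quadratic_form Q" shows "continuous_on S Q"
proof -
  obtain B where B: "bilinear B" "\<And>v. Q v = B v v"
    using assms unfolding quadratic_form_def by blast
  interpret bounded_bilinear B
    using B(1) by (simp add: bilinear_conv_bounded_bilinear)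
  have "Q = (\<lambda>v. B v v)" using B(2) by auto
  then show ?thesis by (auto intro!: continuous_intros continuous_on)
qed

text \<open>The roots of \<open>s \<mapsto> B0 (v + s w) (v + s w)\<close> have opposite signs, so at one of them the cross
  term of \<open>B1 - \<gamma> B0\<close> is nonpositive.\<close>
lemma quadratic_pencil_compare:
  fixes B0 B1 :: "'a::real_vector \<Rightarrow> 'a \<Rightarrow> real"
  assumes "bilinear B0" "bilinear B1"
    and sym: "\<And>v w. B0 v w = B0 w v" "\<And>v w. B1 v w = B1 w v"
    and null: "\<And>v. v \<noteq> 0 \<Longrightarrow> B0 v v = 0 \<Longrightarrow> B1 v v > 0"
    and v: "B0 v v > 0" and w: "B0 w w < 0"
  shows "B1 w w / B0 w w < B1 v v / B0 v v"
proof (rule ccontr)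
  assume neg: "\<not> ?thesis"
  define \<gamma> where "\<gamma> = B1 w w / B0 w w"
  have le: "B1 v v \<le> \<gamma> * B0 v v"
    using neg v by (simp add: \<gamma>_def not_less pos_divide_le_eq)
  have ww: "B1 w w = \<gamma> * B0 w w" using w by (simp add: \<gamma>_def)
  define a b e h where "a = B0 v v" and "b = - B0 w w" and "e = B0 v w" and "h = B1 v w - \<gamma> * B0 v w"
  have ab: "a > 0" "b > 0" using v w by (auto simp: a_def b_def)
  define r where "r = sqrt (e\<^sup>2 + a * b)"
  have r2: "r\<^sup>2 = e\<^sup>2 + a * b" using ab by (simp add: r_def)
  have "r > \<bar>e\<bar>" unfolding r_def using ab
    by (simp flip: real_sqrt_abs)
  define s where "s = (if h \<le> 0 then (e + r) / b else (e - r) / b)"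
  have "s * h \<le> 0"
  proof (cases "h \<le> 0")
    case True
    then show ?thesis using \<open>r > \<bar>e\<bar>\<close> ab by (auto simp: s_def intro!: divide_nonpos_pos mult_nonneg_nonpos)
  next
    case False
    then show ?thesis using \<open>r > \<bar>e\<bar>\<close> ab
      by (auto simp: s_def intro!: divide_nonpos_pos mult_nonpos_nonneg)
  qed
  have root: "a + 2 * s * e - s\<^sup>2 * b = 0"
  proof -
    have "(s * b - e)\<^sup>2 = r\<^sup>2" using ab by (simp add: s_def)
    then have "b * (a + 2 * s * e - s\<^sup>2 * b) = 0"
      unfolding r2 by (simp add: power2_eq_square algebra_simps)
    then show ?thesis using ab by simp
  qed
  let ?u = "v + s *\<^sub>R w"
  note ex = bilinear_ladd bilinear_radd bilinear_lmul bilinear_rmul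
  have 0: "B0 ?u ?u = a + 2 * s * e - s\<^sup>2 * b"
    using assms(1) sym(1)[of w v]
    by (simp add: ex a_def b_def e_def power2_eq_square algebra_simps)
  have 1: "B1 ?u ?u - \<gamma> * B0 ?u ?u = B1 v v - \<gamma> * B0 v v + 2 * (s * h)"
    using assms(1,2) sym(1)[of w v] sym(2)[of w v] ww
    by (simp add: ex h_def algebra_simps)
  have "?u \<noteq> 0"
  proof
    assume "?u = 0"
    then have "v = (- s) *\<^sub>R w" by (simp add: eq_neg_iff_add_eq_0)
    then have "B0 v v = s\<^sup>2 * B0 w w"
      using assms(1) by (simp add: ex bilinear_lneg bilinear_rneg power2_eq_square)
    then show False using v w by (simp add: mult_less_0_iff zero_less_mult_iff)
  qed
  then have "B1 ?u ?u > 0" using null 0 root by simp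
  then show False using 1 0 root le \<open>s * h \<le> 0\<close> by simp
qed

text \<open>By \<open>quadratic_pencil_compare\<close> each ratio \<open>Q1 v / Q0 v\<close> on
  negative vectors lies below every ratio on positive ones, so the infimum of the latter separates
  the two ranges and serves as multiplier. It inherits their lower bound \<open>m\<close>.\<close>

lemma quadratic_form_domination:
  fixes Q0 Q1 :: "'a::real_vector \<Rightarrow> real"
  assumes "quadratic_form Q0" "quadratic_form Q1"
    and pos: "\<And>v. v \<noteq> 0 \<Longrightarrow> Q0 v \<ge> 0 \<Longrightarrow> Q1 v > 0"
    and m: "\<And>v. Q0 v > 0 \<Longrightarrow> Q1 v \<ge> m * Q0 v"
    and ex: "Q0 v0 > 0"
  obtains \<mu> where "\<mu> \<ge> m" "\<And>v. Q1 v \<ge> \<mu> * Q0 v"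
proof -
  obtain B0 where B0: "bilinear B0" "\<And>v w. B0 v w = B0 w v" "\<And>v. Q0 v = B0 v v"
    using quadratic_formE[OF assms(1)] by metis
  obtain B1 where B1: "bilinear B1" "\<And>v w. B1 v w = B1 w v" "\<And>v. Q1 v = B1 v v"
    using quadratic_formE[OF assms(2)] by metis
  define S where "S = {Q1 v / Q0 v | v. Q0 v > 0}"
  have ne: "S \<noteq> {}" using ex by (auto simp: S_def)
  have lb: "\<And>s. s \<in> S \<Longrightarrow> m \<le> s"
    using m by (auto simp: S_def field_simps)
  then have bdd: "bdd_below S" by (auto simp: bdd_below_def)
  show ?thesis
  proof (rule that[of "Inf S"])
    show "m \<le> Inf S" using ne lb by (rule cInf_greatest)
    fix v
    consider "Q0 v > 0" | "Q0 v = 0" | "Q0 v < 0" by linarith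
    then show "Inf S * Q0 v \<le> Q1 v"
    proof cases
      case 1
      then have "Inf S \<le> Q1 v / Q0 v" using bdd by (intro cInf_lower) (auto simp: S_def)
      then show ?thesis using 1 by (simp add: field_simps)
    next
      case 2
      then show ?thesis using pos[of v] B1 by (cases "v = 0") (auto simp: bilinear_lzero)
    next
      case 3
      have "Q1 v / Q0 v \<le> Inf S"
      proof (rule cInf_greatest[OF ne])
        fix s assume "s \<in> S"
        then obtain u where u: "s = Q1 u / Q0 u" "Q0 u > 0" by (auto simp: S_def)
        show "Q1 v / Q0 v \<le> s"
          using quadratic_pencil_compare[OF B0(1) B1(1) B0(2) B1(2), of u v] pos u 3
          by (auto simp: B0(3) B1(3))
      qed
      then show ?thesis using 3 by (simp add: field_simps)
    qed
  qed
qed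

text \<open>The S-lemma is applied to \<open>Q1\<close> minus \<open>c / 2\<close> times the squared
  norm: half of the gain \<open>c\<close> becomes the final error term, the other half keeps the
  difference positive on the cone and, weighed against the bound \<open>C\<close> of
  \<open>Q0\<close>, yields the lower bound of the multiplier.\<close>

lemma quadratic_form_uniform_domination:
  fixes Q0 Q1 :: "'a::real_inner \<Rightarrow> real"
  assumes "quadratic_form Q0" "quadratic_form Q1"
    and bound: "\<And>v. \<bar>Q0 v\<bar> \<le> C * (norm v)\<^sup>2"
    and pos: "\<And>v. Q0 v \<ge> 0 \<Longrightarrow> Q1 v \<ge> c * (norm v)\<^sup>2"
    and "c > 0" "C > 0" "Q0 v0 > 0"
  obtains \<mu> where "\<mu> \<ge> c / (2 * C)" "\<And>v. Q1 v \<ge> \<mu> * Q0 v + c / 2 * (norm v)\<^sup>2"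
proof -
  let ?Q = "\<lambda>v. 1 * Q1 v + (- (c / 2)) * (norm v)\<^sup>2"
  have q: "quadratic_form ?Q"
    by (rule quadratic_form_combine[OF assms(2) quadratic_form_norm_square])
  have *: "?Q v \<ge> c / 2 * (norm v)\<^sup>2" if "Q0 v \<ge> 0" for v
    using pos[OF that] by linarith
  have "?Q v > 0" if "v \<noteq> 0" "Q0 v \<ge> 0" for v
  proof -
    have "c / 2 * (norm v)\<^sup>2 > 0" using that \<open>c > 0\<close> by simp
    then show ?thesis using *[OF that(2)] by linarith
  qed
  moreover have "?Q v \<ge> c / (2 * C) * Q0 v" if "Q0 v > 0" for v
  proof -
    have "c / (2 * C) * Q0 v \<le> c / (2 * C) * (C * (norm v)\<^sup>2)"
      using bound[of v] \<open>c > 0\<close> \<open>C > 0\<close> by (intro mult_left_mono) auto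
    also have "\<dots> = c / 2 * (norm v)\<^sup>2" using \<open>C > 0\<close> by simp
    also have "\<dots> \<le> ?Q v" using * that by simp
    finally show ?thesis .
  qed
  ultimately show ?thesis
  proof (rule quadratic_form_domination[OF assms(1) q _ _ assms(7)])
    fix \<mu> assume "\<mu> \<ge> c / (2 * C)" and \<mu>: "\<And>v. ?Q v \<ge> \<mu> * Q0 v"
    have "Q1 v \<ge> \<mu> * Q0 v + c / 2 * (norm v)\<^sup>2" for v using \<mu>[of v] by linarith
    with \<open>\<mu> \<ge> c / (2 * C)\<close> show thesis by (rule that)
  qed
qed

text \<open>Otherwise the orthogonal complement of \<open>E\<close> has dimension at least
  \<open>d\<close>, and a \<open>d\<close>-dimensional \<open>W\<close> inside it meets
  \<open>E\<close> only in 0.\<close>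

lemma dim_ge_if_meets_all:
  fixes E :: "'a::euclidean_space set"
  assumes "subspace E" and d: "d \<le> DIM('a)" "d > 0"
    and meets: "\<And>W. subspace W \<Longrightarrow> dim W = d \<Longrightarrow> \<exists>w\<in>W. w \<noteq> 0 \<and> w \<in> E"
  shows "dim E + d > DIM('a)"
proof (rule ccontr)
  assume neg: "\<not> ?thesis"
  let ?P = "{y. \<forall>x\<in>E. orthogonal x y}"
  have "dim {y \<in> UNIV. \<forall>x\<in>E. orthogonal x y} + dim E = dim (UNIV::'a set)"
    by (rule dim_subspace_orthogonal_to_vectors[OF assms(1) subspace_UNIV subset_UNIV])
  then have "dim ?P + dim E = DIM('a)" by simp
  then have "d \<le> dim ?P" using neg by simp
  then obtain W where W: "subspace W" "W \<subseteq> span ?P" "dim W = d"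
    by (rule choose_subspace_of_subspace)
  have "subspace ?P" by (simp add: subspace_def orthogonal_def inner_add_right)
  have WP: "W \<subseteq> ?P" using W(2) unfolding span_eq_iff[THEN iffD2, OF \<open>subspace ?P\<close>] .
  obtain w where "w \<in> W" "w \<noteq> 0" "w \<in> E" using meets[OF W(1,3)] by blast
  then have "w \<bullet> w = 0" using WP by (auto simp only: orthogonal_def)
  then show False using \<open>w \<noteq> 0\<close> by simp
qed

section \<open>Cones along one orbit\<close>

text \<open>\<open>D n\<close> is the accumulated map from time 0 to time \<open>n\<close>, not a
  single step. The locale is instantiated twice, with \<open>J\<close> along forward orbits and with
  \<open>- J\<close> along backward ones. The common bound \<open>M\<close> of the multipliers turns
  the additive gain \<open>c\<close> into a fixed factor.\<close>

locale cone_sequence =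
  fixes D :: "nat \<Rightarrow> 'a::euclidean_space \<Rightarrow> 'a" and Q :: "nat \<Rightarrow> 'a \<Rightarrow> real"
    and \<mu> :: "nat \<Rightarrow> real" and c C M :: real
  assumes D0: "D 0 v = v" and D_linear: "linear (D n)" and Q_quadratic: "quadratic_form (Q n)"
    and Q_bound: "\<bar>Q n v\<bar> \<le> C * (norm v)\<^sup>2"
    and Q_step: "Q (Suc n) (D (Suc n) v) \<ge> \<mu> n * Q n (D n v) + c * (norm (D n v))\<^sup>2"
    and c: "c > 0" and C: "C > 0" and \<mu>: "0 < \<mu> n" "\<mu> n \<le> M"
begin

definition E :: "'a set" where "E = {v. \<forall>n. Q n (D n v) \<le> 0}"
text \<open>Per step the gain is at least \<open>c / C\<close> times the size of the form, hence at
  least \<open>c / (C * M)\<close> times \<open>\<mu> n\<close> times that size. So positive values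
  grow by at least \<open>\<mu> n / \<rho>\<close>, and on \<open>E\<close> the size changes by a
  factor of at most \<open>\<rho> * \<mu> n\<close>. The product \<open>P n\<close> itself may grow
  or decay; all rates are relative to it.\<close>

definition \<rho> :: real where "\<rho> = 1 / (1 + c / (C * M))"
definition P :: "nat \<Rightarrow> real" where "P n = (\<Prod>i<n. \<mu> i)"

lemma M: "M > 0" using \<mu>[of 0] by simp
lemma \<rho>: "0 < \<rho>" "\<rho> < 1"
proof -
  have "c / (C * M) > 0" using c C M by simp
  then show "0 < \<rho>" "\<rho> < 1" by (simp_all add: \<rho>_def)
qed

lemma P_pos: "P n > 0" using \<mu>(1) by (simp add: P_def prod_pos)
lemma P_Suc: "P (Suc n) = \<mu> n * P n" by (simp add: P_def)

lemma growth_step: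
  assumes "Q n (D n v) \<ge> 0"
  shows "Q (Suc n) (D (Suc n) v) \<ge> \<mu> n / \<rho> * Q n (D n v)"
proof -
  let ?q = "Q n (D n v)"
  have "\<mu> n / \<rho> * ?q = \<mu> n * ?q + c / C * (\<mu> n / M) * ?q"
    using C M by (simp add: \<rho>_def field_simps)
  also have "c / C * (\<mu> n / M) * ?q \<le> c / C * 1 * ?q"
    using \<mu>[of n] M c C assms by (intro mult_right_mono mult_left_mono) auto
  also have "c / C * 1 * ?q \<le> c / C * (C * (norm (D n v))\<^sup>2)"
    using Q_bound[of n "D n v"] c C unfolding mult_1_right by (intro mult_left_mono) auto
  also have "\<dots> = c * (norm (D n v))\<^sup>2" using C by simp
  finally show ?thesis using Q_step[of n v] by linarith
qed

lemma growth:
  assumes "Q k (D k v) \<ge> 0"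
  shows "Q (k + m) (D (k + m) v) \<ge> P (k + m) / P k / \<rho> ^ m * Q k (D k v)"
proof (induction m)
  case 0
  then show ?case using P_pos[of k] by simp
next
  case (Suc m)
  have "0 \<le> P (k + m) / P k / \<rho> ^ m * Q k (D k v)"
    using assms P_pos \<rho> by (simp add: less_imp_le)
  then have nn: "Q (k + m) (D (k + m) v) \<ge> 0" using Suc by linarith
  have "P (k + Suc m) / P k / \<rho> ^ Suc m * Q k (D k v)
      = \<mu> (k + m) / \<rho> * (P (k + m) / P k / \<rho> ^ m * Q k (D k v))"
    by (simp add: P_Suc mult_ac)
  also have "\<dots> \<le> \<mu> (k + m) / \<rho> * Q (k + m) (D (k + m) v)"
    using Suc \<rho> \<mu>(1)[of "k + m"] by (intro mult_left_mono) auto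
  also have "\<dots> \<le> Q (Suc (k + m)) (D (Suc (k + m)) v)" using nn by (rule growth_step)
  finally show ?case by simp
qed

lemma positive_persists:
  assumes "Q k (D k v) > 0" "k \<le> n" shows "Q n (D n v) > 0"
proof -
  obtain m where "n = k + m" using assms(2) le_Suc_ex by blast
  moreover have "P (k + m) / P k / \<rho> ^ m * Q k (D k v) > 0"
    using assms P_pos \<rho> by simp
  ultimately show ?thesis using growth[of k v m] assms by simp
qed

text \<open>On \<open>E\<close> the next value is still nonpositive, so the gain \<open>c\<close>
  must be paid for by the current negative value: vectors that never leave the closed nonpositive
  cone stay uniformly inside it.\<close>

lemma norm_le_E:
  assumes "v \<in> E" shows "c * (norm (D n v))\<^sup>2 \<le> M * (- Q n (D n v))"
proof -
  have "Q n (D n v) \<le> 0" "Q (Suc n) (D (Suc n) v) \<le> 0" using assms by (auto simp: E_def)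
  moreover have "\<mu> n * (- Q n (D n v)) \<le> M * (- Q n (D n v))"
    using \<mu>[of n] calculation by (intro mult_right_mono) auto
  ultimately show ?thesis using Q_step[of n v] by simp
qed

lemma decay_step:
  assumes "v \<in> E" shows "- Q (Suc n) (D (Suc n) v) \<le> \<rho> * \<mu> n * (- Q n (D n v))"
proof -
  let ?q = "- Q n (D n v)"
  have q: "?q \<ge> 0" using assms by (auto simp: E_def)
  have "?q \<le> C * (norm (D n v))\<^sup>2" using Q_bound[of n "D n v"] by linarith
  then have "c / C * ?q \<le> c / C * (C * (norm (D n v))\<^sup>2)"
    using c C by (intro mult_left_mono) auto
  then have 1: "c / C * ?q \<le> c * (norm (D n v))\<^sup>2" using C by simp
  \<comment> \<open>This is \<open>\<mu> n - c / C \<le> \<rho> * \<mu> n\<close> multiplied out; it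
    rests on \<open>\<mu> n \<le> M\<close>.\<close>
  have "(\<mu> n - c / C) * (1 + c / (C * M)) \<le> \<mu> n"
  proof -
    have "(\<mu> n - c / C) * (1 + c / (C * M)) = \<mu> n - c / C * (1 - \<mu> n / M) - (c / C)\<^sup>2 / M"
      using C M by (simp add: field_simps power2_eq_square)
    moreover have "c / C * (1 - \<mu> n / M) \<ge> 0" using \<mu>[of n] c C M by simp
    ultimately show ?thesis using divide_nonneg_pos[OF zero_le_power2[of "c / C"] M] by linarith
  qed
  then have "\<mu> n - c / C \<le> \<rho> * \<mu> n"
    using c C M by (simp add: \<rho>_def pos_le_divide_eq add_pos_pos)
  then have "(\<mu> n - c / C) * ?q \<le> \<rho> * \<mu> n * ?q" using q by (rule mult_right_mono)
  then show ?thesis using 1 Q_step[of n v] by (simp add: algebra_simps)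
qed

lemma decay:
  assumes "v \<in> E" shows "- Q n (D n v) \<le> \<rho> ^ n * P n * (- Q 0 v)"
proof (induction n)
  case 0
  then show ?case by (simp add: P_def D0)
next
  case (Suc n)
  have "- Q (Suc n) (D (Suc n) v) \<le> \<rho> * \<mu> n * (- Q n (D n v))" using assms by (rule decay_step)
  also have "\<dots> \<le> \<rho> * \<mu> n * (\<rho> ^ n * P n * (- Q 0 v))"
    using Suc \<rho> \<mu>(1)[of n] by (intro mult_left_mono) auto
  finally show ?case by (simp add: P_Suc mult_ac)
qed

lemma norm_decay:
  assumes "v \<in> E" shows "(norm (D n v))\<^sup>2 \<le> M * C / c * \<rho> ^ n * P n * (norm v)\<^sup>2"
proof -
  have "c * (norm (D n v))\<^sup>2 \<le> M * (\<rho> ^ n * P n * (- Q 0 v))"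
    using norm_le_E[OF assms, of n] decay[OF assms, of n] M
    by (intro order_trans[OF norm_le_E[OF assms, of n]] mult_left_mono) auto
  also have "\<dots> \<le> M * (\<rho> ^ n * P n * (C * (norm v)\<^sup>2))"
    using Q_bound[of 0 v] M \<rho> P_pos[of n] by (intro mult_left_mono) auto
  finally show ?thesis using c by (simp add: field_simps)
qed

text \<open>One positive value at time \<open>k\<close> forces the squared norm to grow at least
  like \<open>P n / \<rho> ^ n\<close>, which the assumed bound excludes. So \<open>E\<close>
  consists of the vectors of slow growth, a description that is stable under addition, unlike the
  cone condition.\<close>

lemma E_characterization:
  assumes "\<And>n. (norm (D n v))\<^sup>2 \<le> K * \<rho> ^ n * P n" shows "v \<in> E"
proof (rule ccontr)
  assume "v \<notin> E"
  then obtain k where k: "Q k (D k v) > 0" by (auto simp: E_def not_le)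
  define a where "a = Q k (D k v) / P k"
  have "a > 0" using k P_pos by (simp add: a_def)
  have K: "a \<le> C * K * \<rho> ^ m" for m
  proof -
    have "P (k + m) * (a / \<rho> ^ m) \<le> Q (k + m) (D (k + m) v)"
      using growth[of k v m] k by (simp add: a_def field_simps)
    also have "\<dots> \<le> C * (norm (D (k + m) v))\<^sup>2" using Q_bound[of "k + m" "D (k + m) v"] by linarith
    also have "\<dots> \<le> C * (K * \<rho> ^ (k + m) * P (k + m))" using assms C by (intro mult_left_mono) auto
    finally have "P (k + m) * (a / \<rho> ^ m) \<le> P (k + m) * (C * K * \<rho> ^ (k + m))" by (simp add: mult_ac)
    then have "a / \<rho> ^ m \<le> C * K * \<rho> ^ (k + m)" by (subst (asm) mult_le_cancel_left_pos) (rule P_pos)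
    then have "a \<le> C * K * \<rho> ^ (k + m) * \<rho> ^ m" using \<rho> by (simp add: field_simps)
    moreover have "K \<ge> 0" using order_trans[OF zero_le_power2 assms[of 0]] by (simp add: P_def)
    then have "C * K * \<rho> ^ (k + m) * \<rho> ^ m \<le> C * K * 1 * \<rho> ^ m"
      using C \<rho> by (intro mult_right_mono mult_left_mono power_le_one) auto
    ultimately show ?thesis by simp
  qed
  have "(\<lambda>m. C * K * \<rho> ^ m) \<longlonglongrightarrow> C * K * 0"
    using \<rho> by (intro tendsto_intros LIMSEQ_power_zero) auto
  then have "a \<le> 0" using K by (intro LIMSEQ_le_const) auto
  then show False using \<open>a > 0\<close> by simp
qed

lemma subspace_E: "subspace E"
proof (rule subspaceI)
  show "0 \<in> E" using D_linear Q_quadratic by (simp add: E_def linear_0 quadratic_form_0)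
next
  fix v w assume v: "v \<in> E" and w: "w \<in> E"
  show "v + w \<in> E"
  proof (rule E_characterization[of _ "2 * (M * C / c) * ((norm v)\<^sup>2 + (norm w)\<^sup>2)"])
    fix n
    let ?k = "M * C / c * \<rho> ^ n * P n"
    have "(norm (D n (v + w)))\<^sup>2 \<le> (norm (D n v) + norm (D n w))\<^sup>2"
      using D_linear[of n] by (simp add: linear_add power_mono norm_triangle_ineq)
    also have "\<dots> \<le> 2 * (norm (D n v))\<^sup>2 + 2 * (norm (D n w))\<^sup>2"
      using sum_squares_bound[of "norm (D n v)" "norm (D n w)"] by (simp add: power2_sum)
    also have "\<dots> \<le> 2 * (?k * (norm v)\<^sup>2) + 2 * (?k * (norm w)\<^sup>2)"
      using norm_decay[OF v, of n] norm_decay[OF w, of n] by linarith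
    finally show "(norm (D n (v + w)))\<^sup>2
      \<le> (2 * (M * C / c) * ((norm v)\<^sup>2 + (norm w)\<^sup>2)) * \<rho> ^ n * P n" by (simp add: algebra_simps)
  qed
next
  fix a v assume "v \<in> E"
  then show "a *\<^sub>R v \<in> E"
    using D_linear Q_quadratic
    by (simp add: E_def linear_scale quadratic_form_scale mult_nonneg_nonpos)
qed

text \<open>Since positivity persists, the unit vectors of \<open>W\<close> that are nonpositive at
  time \<open>n\<close> form a decreasing sequence of compact sets. A common point lies in
  \<open>E\<close>, so \<open>E\<close> meets every \<open>W\<close> of dimension
  \<open>d\<close>.\<close>

lemma dim_E:
  assumes "d \<le> DIM('a)" "d > 0"
    and meets: "\<And>W n. subspace W \<Longrightarrow> dim W = d \<Longrightarrow> \<exists>w\<in>W. w \<noteq> 0 \<and> Q n (D n w) \<le> 0"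
  shows "dim E + d > DIM('a)"
proof (rule dim_ge_if_meets_all[OF subspace_E assms(1,2)])
  fix W :: "'a set" assume W: "subspace W" "dim W = d"
  define S where "S n = {w \<in> W. norm w = 1 \<and> Q n (D n w) \<le> 0}" for n
  have cl: "compact (S n)" for n
  proof -
    have "continuous_on UNIV (\<lambda>v. Q n (D n v))"
      by (rule continuous_on_quadratic_form[OF quadratic_form_compose[OF Q_quadratic D_linear]])
    then have "closed {w. Q n (D n w) \<le> 0}"
      by (rule closed_Collect_le) (rule continuous_on_const)
    then have "compact (sphere 0 1 \<inter> (W \<inter> {w. Q n (D n w) \<le> 0}))"
      by (intro compact_Int_closed closed_Int closed_subspace[OF W(1)] compact_sphere)
    moreover have "S n = sphere 0 1 \<inter> (W \<inter> {w. Q n (D n w) \<le> 0})"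
      unfolding S_def by (auto simp only: mem_sphere_0)
    ultimately show ?thesis by simp
  qed
  have mono: "S n \<subseteq> S m" if "m \<le> n" for m n
    unfolding S_def using positive_persists[OF _ that] by (fastforce simp: not_le[symmetric])
  have ne: "S n \<noteq> {}" for n
  proof -
    obtain w where w: "w \<in> W" "w \<noteq> 0" "Q n (D n w) \<le> 0" using meets[OF W] by blast
    have "(1 / norm w) *\<^sub>R w \<in> S n"
    proof -
      have "Q n (D n ((1 / norm w) *\<^sub>R w)) = (1 / norm w)\<^sup>2 * Q n (D n w)"
        by (simp add: linear_scale[OF D_linear] quadratic_form_scale[OF Q_quadratic] del: scaleR_scaleR)
      moreover have "(1 / norm w)\<^sup>2 * Q n (D n w) \<le> 0"
        using w(3) by (intro mult_nonneg_nonpos) auto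
      ultimately show ?thesis using w W(1) by (simp add: S_def subspace_scale)
    qed
    then show ?thesis by auto
  qed
  have "\<Inter>(range S) \<noteq> {}"
    using cl ne mono by (intro compact_nest) simp_all
  then obtain w where "\<And>n. w \<in> S n" by auto
  then have "w \<in> W" "norm w = 1" "w \<in> E" unfolding S_def E_def by blast+
  then show "\<exists>w\<in>W. w \<noteq> 0 \<and> w \<in> E" by (intro bexI[of _ w]) auto
qed

end

section \<open>Volume preserving cocycles with a cone field\<close>

text \<open>Hadamard's inequality up to a factorial, read off the Leibniz expansion. Only
  exponential rates are extracted from it, so the constant is harmless.\<close>

lemma abs_det_rows_le:
  fixes b :: "'n::finite \<Rightarrow> real ^ 'n"
  shows "\<bar>det (\<chi> i. b i)\<bar> \<le> fact CARD('n) * (\<Prod>i\<in>UNIV. norm (b i))"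
proof -
  let ?P = "{p. p permutes (UNIV::'n set)}"
  have "\<bar>det (\<chi> i. b i)\<bar> \<le> (\<Sum>p\<in>?P. \<bar>of_int (sign p) * (\<Prod>i\<in>UNIV. b i $ p i)\<bar>)"
    unfolding det_def by (simp add: sum_abs)
  also have "\<dots> \<le> (\<Sum>p\<in>?P. \<Prod>i\<in>UNIV. norm (b i))"
  proof (rule sum_mono)
    fix p
    have "\<bar>of_int (sign p) * (\<Prod>i\<in>UNIV. b i $ p i)\<bar> = (\<Prod>i\<in>UNIV. \<bar>b i $ p i\<bar>)"
      by (simp add: abs_mult sign_def abs_prod flip: of_int_abs)
    also have "\<dots> \<le> (\<Prod>i\<in>UNIV. norm (b i))"
      by (intro prod_mono) (auto simp: component_le_norm_cart)
    finally show "\<bar>of_int (sign p) * (\<Prod>i\<in>UNIV. b i $ p i)\<bar> \<le> (\<Prod>i\<in>UNIV. norm (b i))" .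
  qed
  also have "\<dots> = fact CARD('n) * (\<Prod>i\<in>UNIV. norm (b i))"
    using card_permutations[of "UNIV::'n set" "CARD('n)"] by simp
  finally show ?thesis .
qed

text \<open>The hypothesis says that the inverse of the transposed matrix has columns of norm at
  most \<open>K\<close>; the crude Hadamard bound for that inverse bounds the determinant from
  below.\<close>

lemma abs_det_rows_ge:
  fixes b :: "'n::finite \<Rightarrow> real ^ 'n"
  assumes K: "\<And>a. norm a \<le> K * norm (\<Sum>i\<in>UNIV. a $ i *\<^sub>R b i)"
  shows "1 \<le> \<bar>det (\<chi> i. b i)\<bar> * (fact CARD('n) * K ^ CARD('n))"
proof -
  let ?A = "\<chi> i. b i"
  have tr: "transpose ?A *v a = (\<Sum>i\<in>UNIV. a $ i *\<^sub>R b i)" for a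
    by (simp add: matrix_vector_mult_def transpose_def vec_eq_iff mult.commute)
  have "a = 0" if "transpose ?A *v a = 0" for a using K[of a] that tr by simp
  then obtain B where B: "B ** transpose ?A = mat 1"
    using matrix_left_invertible_ker[of "transpose ?A"] by blast
  then have B': "transpose ?A ** B = mat 1" by (simp add: matrix_left_right_inverse)
  have col: "norm (column j B) \<le> K" for j
  proof -
    have "transpose ?A *v column j B = axis j 1"
    proof -
      have "column j B = B *v axis j 1" by (simp add: matrix_vector_mult_basis)
      then show ?thesis by (simp add: matrix_vector_mul_assoc B')
    qed
    then have "(\<Sum>i\<in>UNIV. column j B $ i *\<^sub>R b i) = axis j 1" using tr[of "column j B"] by metis
    then show ?thesis using K[of "column j B"] by simp
  qed
  have "transpose B = (\<chi> j. column j B)" by (simp add: vec_eq_iff transpose_def column_def)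
  then have "\<bar>det B\<bar> = \<bar>det (\<chi> j. column j B)\<bar>" by (metis det_transpose)
  also have "\<dots> \<le> fact CARD('n) * (\<Prod>j\<in>UNIV. norm (column j B))" by (rule abs_det_rows_le)
  also have "\<dots> \<le> fact CARD('n) * (\<Prod>j\<in>(UNIV::'n set). K)"
    using col by (intro mult_left_mono prod_mono) auto
  finally have "\<bar>det B\<bar> \<le> fact CARD('n) * K ^ CARD('n)" by simp
  moreover have "det B * det ?A = 1"
    using arg_cong[OF B, of det] by (simp add: det_mul det_I)
  then have "\<bar>det ?A\<bar> * \<bar>det B\<bar> = 1" by (metis abs_mult abs_one mult.commute)
  ultimately show ?thesis by (metis abs_ge_zero mult_left_mono)
qed

lemma geometric_increments_limit:
  fixes a :: "nat \<Rightarrow> real"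
  assumes inc: "\<And>n. \<bar>a (Suc n) - a n\<bar> \<le> K * \<rho> ^ n" and \<rho>: "0 < \<rho>" "\<rho> < 1"
  obtains l where "\<And>n. \<bar>a n - l\<bar> \<le> K / (1 - \<rho>) * \<rho> ^ n"
proof -
  have K: "K \<ge> 0" using inc[of 0] by simp
  \<comment> \<open>The factor \<open>1 - \<rho> ^ m\<close> records the exact partial geometric
    sum, without which the induction would not close.\<close>
  have step: "\<bar>a (n + m) - a n\<bar> \<le> K / (1 - \<rho>) * \<rho> ^ n * (1 - \<rho> ^ m)" for n m
  proof (induction m)
    case (Suc m)
    have "K / (1 - \<rho>) * \<rho> ^ n * (1 - \<rho> ^ m) + K * \<rho> ^ (n + m)
      = K / (1 - \<rho>) * \<rho> ^ n * (1 - \<rho> ^ Suc m)"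
      using \<rho> by (simp add: power_add field_simps)
    then show ?case using inc[of "n + m"] Suc by simp
  qed simp
  have step': "\<bar>a (n + m) - a n\<bar> \<le> K / (1 - \<rho>) * \<rho> ^ n" for n m
  proof -
    have "K / (1 - \<rho>) * \<rho> ^ n * (1 - \<rho> ^ m) \<le> K / (1 - \<rho>) * \<rho> ^ n * 1"
      using K \<rho> by (intro mult_left_mono) auto
    then show ?thesis using step[of n m] by simp
  qed
  have "(\<lambda>n. K / (1 - \<rho>) * \<rho> ^ n) \<longlonglongrightarrow> K / (1 - \<rho>) * 0"
    using \<rho> by (intro tendsto_intros LIMSEQ_power_zero) auto
  then have lim0: "(\<lambda>n. K / (1 - \<rho>) * \<rho> ^ n) \<longlonglongrightarrow> 0" by simp
  have "Cauchy a"
    unfolding Cauchy_altdef2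
  proof (intro allI impI)
    fix e :: real assume "e > 0"
    then obtain N where "K / (1 - \<rho>) * \<rho> ^ N < e"
      using order_tendstoD(2)[OF lim0, of e] by (auto simp: eventually_sequentially)
    then show "\<exists>N. \<forall>n\<ge>N. dist (a n) (a N) < e"
      using step'[of N] by (intro exI[of _ N]) (auto simp: dist_real_def le_iff_add intro: le_less_trans)
  qed
  then obtain l where l: "a \<longlonglongrightarrow> l" using Cauchy_convergent_iff convergent_def by blast
  have "\<bar>a n - l\<bar> \<le> K / (1 - \<rho>) * \<rho> ^ n" for n
  proof -
    have "(\<lambda>m. \<bar>a (n + m) - a n\<bar>) \<longlonglongrightarrow> \<bar>l - a n\<bar>"
      using LIMSEQ_ignore_initial_segment[OF l, of n] by (intro tendsto_intros) (simp add: add.commute)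
    then have "\<bar>l - a n\<bar> \<le> K / (1 - \<rho>) * \<rho> ^ n"
      using step'[of n] by (intro LIMSEQ_le_const2) auto
    then show ?thesis by (simp add: abs_minus_commute)
  qed
  then show ?thesis by (rule that)
qed

lemma bilinear_bound_of_diagonal:
  fixes B :: "'a::real_normed_vector \<Rightarrow> 'a \<Rightarrow> real"
  assumes B: "bilinear B" "\<And>v w. B v w = B w v" and C: "\<And>v. \<bar>B v v\<bar> \<le> C * (norm v)\<^sup>2" and "C \<ge> 0"
  shows "2 * \<bar>B v w\<bar> \<le> C * (norm v + norm w)\<^sup>2"
proof -
  have "B (v + w) (v + w) - B (v - w) (v - w) = 4 * B v w"
    using B(1) B(2)[of w v] by (simp add: bilinear_ladd bilinear_radd bilinear_lsub bilinear_rsub)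
  moreover have "C * (norm (v + w))\<^sup>2 \<le> C * (norm v + norm w)\<^sup>2"
    using \<open>C \<ge> 0\<close> by (intro mult_left_mono power_mono norm_triangle_ineq) auto
  moreover have "C * (norm (v - w))\<^sup>2 \<le> C * (norm v + norm w)\<^sup>2"
    using \<open>C \<ge> 0\<close> by (intro mult_left_mono power_mono norm_triangle_ineq4) auto
  ultimately show ?thesis using C[of "v + w"] C[of "v - w"] by linarith
qed

text \<open>A uniformly positive and a uniformly negative vector cannot nearly cancel: with
  \<open>r = e + f\<close>, the cross term in \<open>Q f = Q (r - e)\<close> is of order
  \<open>norm r * norm e\<close> and is absorbed by the negative \<open>Q e\<close>.\<close>

lemma cone_angle_bound:
  fixes Q :: "'a::real_normed_vector \<Rightarrow> real"
  assumes "quadratic_form Q" and C: "\<And>v. \<bar>Q v\<bar> \<le> C * (norm v)\<^sup>2" and "a > 0" "C > 0"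
    and e: "Q e \<le> - a * (norm e)\<^sup>2" and f: "Q f \<ge> a * (norm f)\<^sup>2"
  shows "(norm f)\<^sup>2 \<le> (C / a + 4 * C\<^sup>2 / a\<^sup>2) * (norm (e + f))\<^sup>2"
proof -
  obtain B where B: "bilinear B" "\<And>v w. B v w = B w v" "\<And>v. Q v = B v v"
    using quadratic_formE[OF assms(1)] by metis
  define r where "r = e + f"
  define E where "E = norm e"
  define R where "R = norm r"
  have Bre: "\<bar>B r e\<bar> \<le> 2 * C * (R * E)"
  proof (cases "r = 0 \<or> e = 0")
    case True
    then show ?thesis using B(1) by (auto simp: R_def E_def bilinear_lzero bilinear_rzero)
  next
    case False
    then have pos: "R > 0" "E > 0" by (auto simp: R_def E_def)
    \<comment> \<open>Passing to unit vectors turns the bound by a sum of norms into one by their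
      product.\<close>
    have "2 * \<bar>B ((1 / R) *\<^sub>R r) ((1 / E) *\<^sub>R e)\<bar>
      \<le> C * (norm ((1 / R) *\<^sub>R r) + norm ((1 / E) *\<^sub>R e))\<^sup>2"
      using B C \<open>C > 0\<close> by (intro bilinear_bound_of_diagonal) auto
    also have "norm ((1 / R) *\<^sub>R r) + norm ((1 / E) *\<^sub>R e) = 2" using pos by (simp add: R_def E_def)
    also have "B ((1 / R) *\<^sub>R r) ((1 / E) *\<^sub>R e) = B r e / (R * E)"
      using B(1) by (simp add: bilinear_lmul bilinear_rmul mult_ac)
    finally have "\<bar>B r e\<bar> / (R * E) \<le> 2 * C" using pos by (simp add: abs_mult)
    then show ?thesis using pos by (simp add: pos_divide_le_eq)
  qed
  have fe: "f = r - e" by (simp add: r_def)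
  have "Q f = Q r - 2 * B r e + Q e"
    using B(1) B(2)[of r e] unfolding fe B(3) by (simp add: bilinear_lsub bilinear_rsub)
  moreover have "Q r \<le> C * R\<^sup>2" using C[of r] by (simp add: R_def abs_le_iff)
  ultimately have "a * (norm f)\<^sup>2 \<le> C * R\<^sup>2 + 4 * C * (R * E) - a * E\<^sup>2"
    using e f Bre by (simp add: E_def abs_le_iff)
  also have "\<dots> \<le> C * R\<^sup>2 + 4 * C\<^sup>2 / a * R\<^sup>2"
  proof -
    \<comment> \<open>Completing the square: the cross term \<open>4 * C * (R * E)\<close> is
      swallowed by the negative square of \<open>E\<close>, at the price of a multiple of the square
      of \<open>R\<close>.\<close>
    have "0 \<le> (2 * C * R - a * E)\<^sup>2 / a" using \<open>a > 0\<close> by simp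
    also have "\<dots> = 4 * C\<^sup>2 / a * R\<^sup>2 - 4 * C * (R * E) + a * E\<^sup>2"
      using \<open>a > 0\<close> by (simp add: power2_eq_square field_simps)
    finally show ?thesis by simp
  qed
  also have "\<dots> = a * ((C / a + 4 * C\<^sup>2 / a\<^sup>2) * R\<^sup>2)"
    using \<open>a > 0\<close> by (simp add: power2_eq_square field_simps)
  finally show ?thesis using \<open>a > 0\<close> by (simp add: R_def r_def)
qed

text \<open>Uniform bounds are all that enters; the base carries no topology, because the frames
  identifying tangent spaces with \<open>real ^ 'n\<close> are chosen pointwise and may jump.
  \<open>c\<close> collects the lower bounds and \<open>C\<close> the upper ones.\<close>

locale volume_cone_cocycle =
  fixes \<phi> :: "real \<Rightarrow> 'm \<Rightarrow> 'm" and D :: "real \<Rightarrow> 'm \<Rightarrow> real ^ 'n \<Rightarrow> real ^ 'n::finite"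
    and J :: "'m \<Rightarrow> real ^ 'n \<Rightarrow> real" and X :: "'m \<Rightarrow> real ^ 'n" and c C :: real
  assumes dimension: "CARD('n) \<ge> 3"
    and flow_0: "\<phi> 0 x = x" and flow_add: "\<phi> (s + t) x = \<phi> s (\<phi> t x)"
    and D_linear: "linear (D t x)" and D_0: "D 0 x v = v"
    and D_add: "D (s + t) x v = D s (\<phi> t x) (D t x v)"
    and D_bound: "\<bar>t\<bar> \<le> 1 \<Longrightarrow> norm (D t x v) \<le> C * norm v"
    and D_det: "\<bar>det (matrix (D t x))\<bar> = 1"
    and J_quadratic: "quadratic_form (J x)"
    and J_bound: "\<bar>J x v\<bar> \<le> C * (norm v)\<^sup>2"
    and J_separated: "J x v \<ge> 0 \<Longrightarrow> J (\<phi> 1 x) (D 1 x v) \<ge> c * (norm v)\<^sup>2"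
    and J_index_ex: "\<exists>N. subspace N \<and> dim N = CARD('n) - 2 \<and> (\<forall>v\<in>N. J x v \<le> 0)"
    and J_index_max: "subspace N \<Longrightarrow> (\<And>v. v \<in> N \<Longrightarrow> J x v \<le> 0) \<Longrightarrow> dim N \<le> CARD('n) - 2"
    and X_invariant: "D t x (X x) = X (\<phi> t x)"
    and X_lower: "c \<le> norm (X x)" and X_upper: "norm (X x) \<le> C" and X_nonneg: "J x (X x) \<ge> 0"
    and c: "c > 0" and C: "C > 0"
begin

lemma flow_inverse: "\<phi> (- t) (\<phi> t x) = x" "\<phi> t (\<phi> (- t) x) = x"
  using flow_add[of "- t" t x] flow_add[of t "- t" x] by (simp_all add: flow_0)

lemma D_inverse: "D (- t) (\<phi> t x) (D t x v) = v" "D t (\<phi> (- t) x) (D (- t) x v) = v"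
  using D_add[of "- t" t x] D_add[of t "- t" x] by (simp_all add: D_0)

lemma D_inj: "inj (D t x)"
  by (rule inj_on_inverseI[of _ "D (- t) (\<phi> t x)"]) (rule D_inverse)

lemma dim_image_D: "dim (D t x ` W) = dim W"
  by (rule dim_image_eq[OF D_linear inj_on_subset[OF D_inj subset_UNIV]])

lemma X_nonzero: "X x \<noteq> 0"
  using X_lower[of x] c by auto

text \<open>\<open>X x\<close> is the time-one image of the nonnegative vector
  \<open>X (\<phi> (-1) x)\<close>, so one step of uniform separation makes it uniformly
  positive.\<close>

lemma X_J_lower: "J x (X x) \<ge> c ^ 3"
proof -
  have "c * (norm (X (\<phi> (-1) x)))\<^sup>2 \<le> J (\<phi> 1 (\<phi> (-1) x)) (D 1 (\<phi> (-1) x) (X (\<phi> (-1) x)))"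
    by (rule J_separated) (rule X_nonneg)
  also have "\<dots> = J x (X x)" by (simp add: X_invariant flow_inverse)
  finally have "c * (norm (X (\<phi> (-1) x)))\<^sup>2 \<le> J x (X x)" .
  moreover have "c * c\<^sup>2 \<le> c * (norm (X (\<phi> (-1) x)))\<^sup>2"
    using c X_lower by (intro mult_left_mono power_mono) auto
  ultimately show ?thesis by (simp add: power2_eq_square power3_eq_cube)
qed

lemma X_J_upper: "J x (X x) \<le> C ^ 3"
proof -
  have "J x (X x) \<le> C * (norm (X x))\<^sup>2" using J_bound[of x "X x"] by linarith
  also have "\<dots> \<le> C * C\<^sup>2" using C X_upper by (intro mult_left_mono power_mono) auto
  finally show ?thesis by (simp add: power2_eq_square power3_eq_cube)
qed

definition \<mu> :: "'m \<Rightarrow> real" where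
  "\<mu> x = (SOME m. m \<ge> c / (2 * C) \<and> (\<forall>v. J (\<phi> 1 x) (D 1 x v) \<ge> m * J x v + c / 2 * (norm v)\<^sup>2))"

definition M :: real where "M = C ^ 3 / c ^ 3"

lemma M_pos: "M > 0" using c C by (simp add: M_def)

lemma \<mu>: "\<mu> x \<ge> c / (2 * C)" "J (\<phi> 1 x) (D 1 x v) \<ge> \<mu> x * J x v + c / 2 * (norm v)\<^sup>2"
proof -
  have "J x (X x) > 0" using X_J_lower[of x] zero_less_power[OF c, of 3] by linarith
  then obtain m where "m \<ge> c / (2 * C)" "\<And>v. J (\<phi> 1 x) (D 1 x v) \<ge> m * J x v + c / 2 * (norm v)\<^sup>2"
    using quadratic_form_uniform_domination[OF J_quadratic
      quadratic_form_compose[OF J_quadratic D_linear] J_bound J_separated c C] by metis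
  then have "\<exists>m. m \<ge> c / (2 * C) \<and> (\<forall>v. J (\<phi> 1 x) (D 1 x v) \<ge> m * J x v + c / 2 * (norm v)\<^sup>2)"
    by blast
  from someI_ex[OF this] show "\<mu> x \<ge> c / (2 * C)"
    "J (\<phi> 1 x) (D 1 x v) \<ge> \<mu> x * J x v + c / 2 * (norm v)\<^sup>2" unfolding \<mu>_def by blast+
qed

lemma \<mu>_pos: "\<mu> x > 0"
  using \<mu>(1)[of x] c C by (meson divide_pos_pos less_le_trans mult_pos_pos zero_less_numeral)

text \<open>The multiplier is tested on \<open>X\<close>: along this invariant field
  \<open>J\<close> stays between \<open>c ^ 3\<close> and \<open>C ^ 3\<close>, so no single step
  can multiply it by more than their quotient.\<close>

lemma \<mu>_le: "\<mu> x \<le> M"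
proof -
  have "\<mu> x * c ^ 3 \<le> \<mu> x * J x (X x)" using \<mu>_pos[of x] X_J_lower[of x] by simp
  also have "\<dots> \<le> J (\<phi> 1 x) (X (\<phi> 1 x)) - c / 2 * (norm (X x))\<^sup>2"
    using \<mu>(2)[of x "X x"] by (simp add: X_invariant)
  also have "\<dots> \<le> C ^ 3"
  proof -
    have "c / 2 * (norm (X x))\<^sup>2 \<ge> 0" using c by simp
    then show ?thesis using X_J_upper[of "\<phi> 1 x"] by linarith
  qed
  finally show ?thesis using c by (simp add: M_def field_simps)
qed

definition S :: "'m \<Rightarrow> (real ^ 'n) set" where
  "S x = {v. \<forall>n::nat. J (\<phi> n x) (D n x v) \<le> 0}"

text \<open>Written with \<open>- J\<close> so that \<open>F x\<close> is literally the space
  \<open>E\<close> of the cone sequence along the backward orbit.\<close>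

definition F :: "'m \<Rightarrow> (real ^ 'n) set" where
  "F x = {v. \<forall>n::nat. - J (\<phi> (- real n) x) (D (- real n) x v) \<le> 0}"

lemma forward_sequence:
  "cone_sequence (\<lambda>n. D (real n) x) (\<lambda>n. J (\<phi> (real n) x)) (\<lambda>n. \<mu> (\<phi> (real n) x)) (c / 2) C M"
proof (rule cone_sequence.intro)
  fix n v
  have "D (real (Suc n)) x v = D 1 (\<phi> (real n) x) (D (real n) x v)"
    "\<phi> (real (Suc n)) x = \<phi> 1 (\<phi> (real n) x)"
    using D_add[of 1 "real n"] flow_add[of 1 "real n"] by (simp_all add: add.commute)
  then show "\<mu> (\<phi> (real n) x) * J (\<phi> (real n) x) (D (real n) x v) + c / 2 * (norm (D (real n) x v))\<^sup>2
    \<le> J (\<phi> (real (Suc n)) x) (D (real (Suc n)) x v)"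
    using \<mu>(2) by simp
next
  fix n show "linear (D (real n) x)" by (rule D_linear)
qed (use D_0 J_quadratic J_bound \<mu>_pos \<mu>_le c C in simp_all)

definition c' :: real where "c' = c / (2 * M * C\<^sup>2)"

lemma c': "c' > 0" using c C M_pos by (simp add: c'_def)

text \<open>Dividing the domination inequality by its multiplier turns it into one for
  \<open>- J\<close> in backward time; the lower bound of \<mu> bounds the new multiplier
  \<open>1 / \<mu>\<close>. The gain sits at time \<open>- (n + 1)\<close>, whereas
  \<open>cone_sequence\<close> wants it at time \<open>- n\<close>; the bound \<open>C\<close> on
  the time-one map moves it, and together with \<open>\<mu> \<le> M\<close> this gives
  \<open>c'\<close>.\<close>

lemma backward_sequence:
  "cone_sequence (\<lambda>n. D (- real n) x) (\<lambda>n v. - J (\<phi> (- real n) x) v)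
     (\<lambda>n. 1 / \<mu> (\<phi> (- real (Suc n)) x)) c' C (2 * C / c)"
proof (rule cone_sequence.intro)
  fix n v
  let ?y = "\<phi> (- real (Suc n)) x" and ?w = "D (- real (Suc n)) x v"
  have eq: "D 1 ?y ?w = D (- real n) x v" "\<phi> 1 ?y = \<phi> (- real n) x"
    using D_add[of 1 "- real (Suc n)" x] flow_add[of 1 "- real (Suc n)" x] by simp_all
  have pos: "\<mu> ?y > 0" by (rule \<mu>_pos)
  have "norm (D (- real n) x v) \<le> C * norm ?w"
    using D_bound[of 1 ?y ?w] unfolding eq by simp
  then have "(norm (D (- real n) x v))\<^sup>2 \<le> C\<^sup>2 * (norm ?w)\<^sup>2"
    by (metis norm_ge_zero power_mono power_mult_distrib)
  then have "c' * (norm (D (- real n) x v))\<^sup>2 \<le> c' * (C\<^sup>2 * (norm ?w)\<^sup>2)"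
    using c' by simp
  also have "\<dots> = c / 2 * (norm ?w)\<^sup>2 / M" using C by (simp add: c'_def)
  also have "\<dots> \<le> c / 2 * (norm ?w)\<^sup>2 / \<mu> ?y"
    using \<mu>_le[of ?y] pos c M_pos by (intro divide_left_mono) auto
  also have "\<dots> \<le> (J (\<phi> (- real n) x) (D (- real n) x v) - \<mu> ?y * J ?y ?w) / \<mu> ?y"
    using \<mu>(2)[of ?y ?w] pos unfolding eq by (intro divide_right_mono) linarith+
  also have "\<dots> = J (\<phi> (- real n) x) (D (- real n) x v) / \<mu> ?y - J ?y ?w"
    using pos by (simp add: diff_divide_distrib)
  finally show "1 / \<mu> ?y * - J (\<phi> (- real n) x) (D (- real n) x v) + c' * (norm (D (- real n) x v))\<^sup>2
    \<le> - J ?y ?w" by simp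
next
  fix n
  show "1 / \<mu> (\<phi> (- real (Suc n)) x) \<le> 2 * C / c"
    using \<mu>(1)[of "\<phi> (- real (Suc n)) x"] \<mu>_pos[of "\<phi> (- real (Suc n)) x"] c C by (simp add: field_simps)
next
  fix n show "quadratic_form (\<lambda>v. - J (\<phi> (- real n) x) v)"
    using quadratic_form_combine[OF J_quadratic J_quadratic, of "-1" _ 0] by simp
next
  fix n show "linear (D (- real n) x)" by (rule D_linear)
qed (use D_0 J_bound \<mu>_pos c' C in simp_all)

lemma S_eq: "S x = cone_sequence.E (\<lambda>n. D (real n) x) (\<lambda>n. J (\<phi> (real n) x))"
  unfolding S_def cone_sequence.E_def[OF forward_sequence] ..

lemma F_eq: "F x = cone_sequence.E (\<lambda>n. D (- real n) x) (\<lambda>n v. - J (\<phi> (- real n) x) v)"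
  unfolding F_def cone_sequence.E_def[OF backward_sequence] ..

lemma subspace_S: "subspace (S x)"
  unfolding S_eq by (rule cone_sequence.subspace_E[OF forward_sequence])

lemma subspace_F: "subspace (F x)"
  unfolding F_eq by (rule cone_sequence.subspace_E[OF backward_sequence])

text \<open>By counting dimensions, the image at time \<open>n\<close> of a three-dimensional
  \<open>W\<close> meets a nonpositive subspace of dimension \<open>CARD('n) - 2\<close>, so
  \<open>dim_E\<close> applies with \<open>d = 3\<close>.\<close>

lemma dim_S_ge: "dim (S x) \<ge> CARD('n) - 2"
proof -
  have "dim (S x) + 3 > DIM(real ^ 'n)"
    unfolding S_eq
  proof (rule cone_sequence.dim_E[OF forward_sequence])
    fix W :: "(real ^ 'n) set" and n
    assume W: "subspace W" "dim W = 3"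
    obtain N where N: "subspace N" "dim N = CARD('n) - 2" "\<forall>v\<in>N. J (\<phi> (real n) x) v \<le> 0"
      using J_index_ex by blast
    let ?W = "D (real n) x ` W"
    have W': "subspace ?W" "dim ?W = 3"
      using W by (auto simp: dim_image_D intro: linear_subspace_image[OF D_linear])
    have "dim {a + b |a b. a \<in> ?W \<and> b \<in> N} + dim (?W \<inter> N) = dim ?W + dim N"
      by (rule dim_sums_Int[OF W'(1) N(1)])
    moreover have "dim {a + b |a b. a \<in> ?W \<and> b \<in> N} \<le> CARD('n)"
      using dim_subset_UNIV[of "{a + b |a b. a \<in> ?W \<and> b \<in> N}"] by simp
    ultimately have "dim (?W \<inter> N) \<noteq> 0" using W' N dimension by linarith
    then obtain u where "u \<in> ?W" "u \<in> N" "u \<noteq> 0" unfolding dim_eq_0 by blast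
    then obtain w where "w \<in> W" "D (real n) x w \<in> N" "D (real n) x w \<noteq> 0" by auto
    then show "\<exists>w\<in>W. w \<noteq> 0 \<and> J (\<phi> (real n) x) (D (real n) x w) \<le> 0"
      using N(3) linear_0[OF D_linear] by metis
  qed (use dimension in auto)
  then show ?thesis by simp
qed

text \<open>A subspace of dimension \<open>CARD('n) - 1\<close> exceeds the index and therefore
  contains a positive vector at each backward time, so \<open>dim_E\<close> applies with
  \<open>d = CARD('n) - 1\<close>.\<close>

lemma dim_F_ge: "dim (F x) \<ge> 2"
proof -
  have "dim (F x) + (CARD('n) - 1) > DIM(real ^ 'n)"
    unfolding F_eq
  proof (rule cone_sequence.dim_E[OF backward_sequence])
    fix W :: "(real ^ 'n) set" and n
    assume W: "subspace W" "dim W = CARD('n) - 1"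
    let ?W = "D (- real n) x ` W"
    have W': "subspace ?W" "dim ?W = CARD('n) - 1"
      using W by (auto simp: dim_image_D intro: linear_subspace_image[OF D_linear])
    then obtain u where "u \<in> ?W" "J (\<phi> (- real n) x) u > 0"
      using J_index_max[OF W'(1), of "\<phi> (- real n) x"] dimension by force
    then obtain w where w: "w \<in> W" "J (\<phi> (- real n) x) (D (- real n) x w) > 0" by auto
    moreover have "w \<noteq> 0"
      using w(2) linear_0[OF D_linear] quadratic_form_0[OF J_quadratic] by (metis less_irrefl)
    ultimately show "\<exists>w\<in>W. w \<noteq> 0 \<and> - J (\<phi> (- real n) x) (D (- real n) x w) \<le> 0"
      by (intro bexI[of _ w]) auto
  qed (use dimension in auto)
  then show ?thesis by simp
qed

lemma X_in_F: "X x \<in> F x"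
  by (simp add: F_def X_invariant X_nonneg)

definition a :: real where "a = min (c / 2 / M) (c' / (2 * C / c))"

lemma a: "a > 0" using c C c' M_pos by (simp add: a_def)

lemma J_on_S: assumes "v \<in> S x" shows "J x v \<le> - a * (norm v)\<^sup>2"
proof -
  have "c / 2 * (norm v)\<^sup>2 \<le> M * - J x v"
    using cone_sequence.norm_le_E[OF forward_sequence, of v x 0] assms unfolding S_eq[symmetric]
    by (simp add: flow_0 D_0)
  then have "c / 2 / M * (norm v)\<^sup>2 \<le> - J x v" using M_pos by (simp add: field_simps)
  moreover have "a * (norm v)\<^sup>2 \<le> c / 2 / M * (norm v)\<^sup>2" by (intro mult_right_mono) (auto simp: a_def)
  ultimately show ?thesis by simp
qed

lemma J_on_F: assumes "v \<in> F x" shows "J x v \<ge> a * (norm v)\<^sup>2"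
proof -
  have "c' * (norm v)\<^sup>2 \<le> (2 * C / c) * J x v"
    using cone_sequence.norm_le_E[OF backward_sequence, of v x 0] assms unfolding F_eq[symmetric]
    by (simp add: flow_0 D_0)
  then have "c' / (2 * C / c) * (norm v)\<^sup>2 \<le> J x v" using c C by (simp add: field_simps)
  moreover have "a * (norm v)\<^sup>2 \<le> c' / (2 * C / c) * (norm v)\<^sup>2" by (intro mult_right_mono) (auto simp: a_def)
  ultimately show ?thesis by simp
qed

definition angle :: real where "angle = sqrt (C / a + 4 * C\<^sup>2 / a\<^sup>2)"

lemma angle_nonneg: "angle \<ge> 0" using a C by (simp add: angle_def)

lemma norm_F_le: assumes "e \<in> S x" "f \<in> F x" shows "norm f \<le> angle * norm (e + f)"
proof -
  have "(norm f)\<^sup>2 \<le> (C / a + 4 * C\<^sup>2 / a\<^sup>2) * (norm (e + f))\<^sup>2"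
    by (rule cone_angle_bound[OF J_quadratic J_bound a C J_on_S[OF assms(1)] J_on_F[OF assms(2)]])
  also have "\<dots> = (angle * norm (e + f))\<^sup>2"
    using a C by (simp add: angle_def power_mult_distrib)
  finally show ?thesis using angle_nonneg by (metis power2_le_imp_le mult_nonneg_nonneg norm_ge_zero)
qed

lemma norm_S_le: assumes "e \<in> S x" "f \<in> F x" shows "norm e \<le> (1 + angle) * norm (e + f)"
proof -
  have "norm e \<le> norm (e + f) + norm f" using norm_triangle_ineq4[of "e + f" f] by simp
  then show ?thesis using norm_F_le[OF assms] by (simp add: algebra_simps)
qed

lemma S_Int_F: "S x \<inter> F x = {0}"
proof -
  have "v = 0" if "v \<in> S x" "v \<in> F x" for v
  proof -
    have "a * (norm v)\<^sup>2 \<le> 0" using J_on_S[OF that(1)] J_on_F[OF that(2)] by simp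
    then show ?thesis using a by (simp add: mult_le_0_iff)
  qed
  then show ?thesis using subspace_0[OF subspace_S] subspace_0[OF subspace_F] by blast
qed

text \<open>The two lower bounds add up to the full dimension while \<open>S x\<close> and
  \<open>F x\<close> meet only in 0, so both are equalities.\<close>

lemma dims: "dim {e + f |e f. e \<in> S x \<and> f \<in> F x} = CARD('n)"
  "dim (S x) = CARD('n) - 2" "dim (F x) = 2"
proof -
  have "dim {e + f |e f. e \<in> S x \<and> f \<in> F x} = dim (S x) + dim (F x)"
    using dim_sums_Int[OF subspace_S[of x] subspace_F[of x]] by (simp add: S_Int_F)
  moreover have "dim {e + f |e f. e \<in> S x \<and> f \<in> F x} \<le> CARD('n)"
    using dim_subset_UNIV[of "{e + f |e f. e \<in> S x \<and> f \<in> F x}"] by simp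
  ultimately show "dim {e + f |e f. e \<in> S x \<and> f \<in> F x} = CARD('n)"
    "dim (S x) = CARD('n) - 2" "dim (F x) = 2"
    using dim_S_ge[of x] dim_F_ge[of x] dimension by auto
qed

lemma S_F_decomposition: obtains e f where "e \<in> S x" "f \<in> F x" "v = e + f"
proof -
  have "subspace {e + f |e f. e \<in> S x \<and> f \<in> F x}"
    by (rule subspace_sums[OF subspace_S subspace_F])
  then have "{e + f |e f. e \<in> S x \<and> f \<in> F x} = span {e + f |e f. e \<in> S x \<and> f \<in> F x}"
    by (simp only: span_eq_iff[THEN iffD2])
  also have "\<dots> = UNIV"
    using dims(1)[of x] dim_eq_full[of "{e + f |e f. e \<in> S x \<and> f \<in> F x}"] by simp
  finally have "{e + f |e f. e \<in> S x \<and> f \<in> F x} = UNIV" .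
  then show ?thesis using that by blast
qed

text \<open>The definition shows only the forward inclusion. Equal dimensions upgrade it to an
  equality, which carries \<open>S\<close> backward in time as well; \<open>D_F\<close> is the same
  for \<open>F\<close> with time reversed.\<close>

lemma D_S: "D (real n) x ` S x = S (\<phi> (real n) x)"
proof (rule subspace_dim_equal)
  show "D (real n) x ` S x \<subseteq> S (\<phi> (real n) x)"
  proof safe
    fix v assume v: "v \<in> S x"
    have "J (\<phi> (real k) (\<phi> (real n) x)) (D (real k) (\<phi> (real n) x) (D (real n) x v)) \<le> 0" for k
      using v unfolding S_def flow_add[symmetric] D_add[symmetric] of_nat_add[symmetric] by blast
    then show "D (real n) x v \<in> S (\<phi> (real n) x)" by (simp add: S_def)
  qed
qed (auto simp: subspace_S linear_subspace_image[OF D_linear] dim_image_D dims)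

lemma D_F: "D (- real n) x ` F x = F (\<phi> (- real n) x)"
proof (rule subspace_dim_equal)
  show "D (- real n) x ` F x \<subseteq> F (\<phi> (- real n) x)"
  proof safe
    fix v assume v: "v \<in> F x"
    have "- J (\<phi> (- real k) (\<phi> (- real n) x)) (D (- real k) (\<phi> (- real n) x) (D (- real n) x v)) \<le> 0" for k
    proof -
      have "- real k + - real n = - real (k + n)" by simp
      then show ?thesis
        using v unfolding F_def flow_add[symmetric] D_add[symmetric] by (metis (mono_tags) mem_Collect_eq)
    qed
    then show "D (- real n) x v \<in> F (\<phi> (- real n) x)" by (simp add: F_def)
  qed
qed (auto simp: subspace_F linear_subspace_image[OF D_linear] dim_image_D dims)

lemma D_F_in: "v \<in> F x \<Longrightarrow> D (- real n) x v \<in> F (\<phi> (- real n) x)"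
  using D_F by blast

lemma D_F_forward: assumes "f \<in> F x" shows "D (real n) x f \<in> F (\<phi> (real n) x)"
proof -
  have "f \<in> D (- real n) (\<phi> (real n) x) ` F (\<phi> (real n) x)"
    using assms D_F[of n "\<phi> (real n) x"] by (simp add: flow_inverse)
  then obtain g where "g \<in> F (\<phi> (real n) x)" "f = D (- real n) (\<phi> (real n) x) g" by blast
  then show ?thesis using D_inverse(2)[of "real n" "\<phi> (real n) x" g] by (simp add: flow_inverse)
qed

lemma D_S_backward: assumes "e \<in> S x" shows "D (- real n) x e \<in> S (\<phi> (- real n) x)"
proof -
  have "e \<in> D (real n) (\<phi> (- real n) x) ` S (\<phi> (- real n) x)"
    using assms D_S[of n "\<phi> (- real n) x"] by (simp add: flow_inverse)
  then obtain g where "g \<in> S (\<phi> (- real n) x)" "e = D (real n) (\<phi> (- real n) x) g" by blast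
  then show ?thesis using D_inverse(1)[of "real n" "\<phi> (- real n) x" g] by (simp add: flow_inverse)
qed

definition \<rho> :: real where "\<rho> = 1 / (1 + c / 2 / (C * M))"

lemma \<rho>: "0 < \<rho>" "\<rho> < 1"
  using cone_sequence.\<rho>[OF forward_sequence] unfolding cone_sequence.\<rho>_def[OF forward_sequence] \<rho>_def
  by auto

text \<open>\<open>M * C / (c / 2)\<close> is the constant of \<open>norm_decay\<close>;
  \<open>C ^ 3 / c ^ 3\<close> bounds the product of the first \<open>n\<close> multipliers against
  \<open>\<rho> ^ n\<close>.\<close>

definition K0 :: real where "K0 = M * C / (c / 2) * (C ^ 3 / c ^ 3)"
definition K1 :: real where "K1 = max 1 (sqrt K0)"

lemma K0: "K0 \<ge> 0" using M_pos c C by (simp add: K0_def)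
lemma K1: "K1 \<ge> 1" by (simp add: K1_def)

text \<open>Comparison with the bounded positive vector \<open>X\<close> turns domination into contraction.\<close>
lemma S_contracts:
  assumes "v \<in> S x" shows "norm (D (real n) x v) \<le> K1 * \<rho> ^ n * norm v"
proof -
  interpret fwd: cone_sequence "\<lambda>n. D (real n) x" "\<lambda>n. J (\<phi> (real n) x)" "\<lambda>n. \<mu> (\<phi> (real n) x)" "c / 2" C M
    by (rule forward_sequence)
  have \<rho>_eq: "fwd.\<rho> = \<rho>" by (simp only: fwd.\<rho>_def \<rho>_def)
  have P0: "fwd.P 0 = 1" by (simp add: fwd.P_def)
  have "J (\<phi> (real (0 + n)) x) (D (real (0 + n)) x (X x))
    \<ge> fwd.P (0 + n) / fwd.P 0 / fwd.\<rho> ^ n * J (\<phi> (real 0) x) (D (real 0) x (X x))"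
    by (rule fwd.growth) (simp add: flow_0 D_0 X_nonneg)
  then have "fwd.P n / \<rho> ^ n * J x (X x) \<le> J (\<phi> n x) (X (\<phi> n x))"
    by (simp add: flow_0 D_0 X_invariant P0 \<rho>_eq)
  also have "\<dots> \<le> C ^ 3" by (rule X_J_upper)
  finally have "fwd.P n / \<rho> ^ n * J x (X x) \<le> C ^ 3" .
  moreover have "fwd.P n / \<rho> ^ n * c ^ 3 \<le> fwd.P n / \<rho> ^ n * J x (X x)"
    using fwd.P_pos[of n] \<rho> X_J_lower[of x] by (intro mult_left_mono) auto
  ultimately have "fwd.P n / \<rho> ^ n * c ^ 3 \<le> C ^ 3" by linarith
  then have "fwd.P n / \<rho> ^ n \<le> C ^ 3 / c ^ 3" using c by (simp only: pos_le_divide_eq zero_less_power)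
  then have Pn: "fwd.P n \<le> C ^ 3 / c ^ 3 * \<rho> ^ n" using \<rho> by (simp only: pos_divide_le_eq zero_less_power)
  have nn: "0 \<le> M * C / (c / 2) * \<rho> ^ n" using \<rho> M_pos c C by simp
  have "(norm (D (real n) x v))\<^sup>2 \<le> M * C / (c / 2) * fwd.\<rho> ^ n * fwd.P n * (norm v)\<^sup>2"
    using assms unfolding S_eq by (rule fwd.norm_decay)
  also have "\<dots> \<le> M * C / (c / 2) * \<rho> ^ n * (C ^ 3 / c ^ 3 * \<rho> ^ n) * (norm v)\<^sup>2"
    unfolding \<rho>_eq using Pn nn by (intro mult_right_mono mult_left_mono) simp_all
  also have "\<dots> = K0 * (\<rho> ^ n)\<^sup>2 * (norm v)\<^sup>2"
    unfolding K0_def power2_eq_square by (simp only: mult_ac)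
  also have "\<dots> = (sqrt K0 * \<rho> ^ n * norm v)\<^sup>2"
    using K0 by (simp only: power_mult_distrib real_sqrt_pow2)
  finally have "norm (D (real n) x v) \<le> sqrt K0 * \<rho> ^ n * norm v"
    by (rule power2_le_imp_le) (use K0 \<rho> in simp)
  also have "\<dots> \<le> K1 * \<rho> ^ n * norm v"
    using \<rho> by (intro mult_right_mono) (simp_all add: K1_def)
  finally show ?thesis .
qed

end

section \<open>Expansion of \<open>F\<close> modulo \<open>X\<close>\<close>

context volume_cone_cocycle
begin

text \<open>The orthogonal projection along \<open>X x\<close>; it represents the quotient by the
  flow direction inside the tangent space itself.\<close>

definition p :: "'m \<Rightarrow> real ^ 'n \<Rightarrow> real ^ 'n" where
  "p x v = v - ((v \<bullet> X x) / (X x \<bullet> X x)) *\<^sub>R X x"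

lemma p_linear: "linear (p x)"
  by (rule linearI) (simp_all add: p_def inner_add_left algebra_simps add_divide_distrib)

lemma p_X: "p x (X x) = 0"
  using X_nonzero[of x] by (simp add: p_def)

lemma p_orthogonal: "p x v \<bullet> X x = 0"
  using X_nonzero[of x] by (simp add: p_def inner_diff_left)

lemma p_decompose: "v = p x v + ((v \<bullet> X x) / (X x \<bullet> X x)) *\<^sub>R X x"
  by (simp add: p_def)

lemma norm_p_le: "norm (p x v) \<le> norm v"
proof -
  have "(norm v)\<^sup>2 = (norm (p x v))\<^sup>2 + (norm (((v \<bullet> X x) / (X x \<bullet> X x)) *\<^sub>R X x))\<^sup>2"
    by (subst p_decompose[of v x]) (rule norm_add_Pythagorean, simp add: orthogonal_def p_orthogonal)
  then have "(norm (p x v))\<^sup>2 \<le> (norm v)\<^sup>2" by simp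
  then show ?thesis by (rule power2_le_imp_le) simp
qed

lemma p_in_F: "v \<in> F x \<Longrightarrow> p x v \<in> F x"
  unfolding p_def by (intro subspace_diff subspace_scale subspace_F X_in_F)

text \<open>\<open>D t x\<close> maps \<open>X x\<close> to \<open>X (\<phi> t x)\<close> and so
  descends to the quotients by \<open>X\<close>; followed by \<open>p\<close> it is this induced
  cocycle.\<close>

lemma p_D: "p (\<phi> t x) (D t x (p x v)) = p (\<phi> t x) (D t x v)"
  using p_linear D_linear
  by (simp add: p_def[of x] linear_diff linear_scale X_invariant p_X)

text \<open>The first factor is the constant of \<open>abs_det_rows_ge\<close> for a basis adapted
  to the splitting; the second is the Hadamard bound for its image, with \<open>K1\<close> for each
  direction of \<open>S\<close> and \<open>C / c\<close> for the normalised
  \<open>X\<close>.\<close>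

definition K2 :: real where
  "K2 = (fact CARD('n) * (2 + angle + angle) ^ CARD('n)) * (fact CARD('n) * (K1 ^ (CARD('n) - 2) * (C / c)))"

lemma K2: "K2 > 0"
  using angle_nonneg K1 c C unfolding K2_def by (intro mult_pos_pos zero_less_power) auto

lemma D_rows:
  fixes b :: "'n \<Rightarrow> real ^ 'n"
  shows "\<bar>det (\<chi> i. D t x (b i))\<bar> = \<bar>det (\<chi> i. b i)\<bar>"
proof -
  have "(\<chi> i. D t x (b i)) = (\<chi> i. b i) ** transpose (matrix (D t x))"
  proof -
    have "D t x (b i) = matrix (D t x) *v b i" for i using matrix_works[of "D t x" "b i"] D_linear[of t x] by simp
    then show ?thesis
      by (simp add: vec_eq_iff matrix_matrix_mult_def matrix_vector_mult_def transpose_def mult.commute)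
  qed
  then show ?thesis by (simp add: det_mul det_transpose abs_mult D_det)
qed

text \<open>Since volume is preserved and \<open>S\<close> is contracted, \<open>F\<close> modulo \<open>X\<close> must be expanded.\<close>
lemma F_expands_unit:
  assumes u: "u \<in> F x" "norm u = 1" "u \<bullet> X x = 0"
  shows "1 \<le> K2 * \<rho> ^ n * norm (p (\<phi> (real n) x) (D (real n) x u))"
proof -
  define x1 where "x1 = (1 / norm (X x)) *\<^sub>R X x"
  have x1: "norm x1 = 1" "x1 \<in> F x" "u \<bullet> x1 = 0"
    using X_nonzero[of x] u X_in_F by (auto simp: x1_def subspace_scale[OF subspace_F])
  obtain B where B: "B \<subseteq> S x" "pairwise orthogonal B" "\<And>v. v \<in> B \<Longrightarrow> norm v = 1"
    "independent B" "card B = dim (S x)" "span B = S x"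
    by (rule orthonormal_basis_subspace[OF subspace_S[of x]]) (rule that)
  have finB: "finite B" using B(4) by (rule independent_imp_finite)
  have SF: "w = 0" if "w \<in> B" "w \<in> F x" for w using that B(1) S_Int_F[of x] by blast
  have nF: "x1 \<notin> B" "u \<notin> B" using SF[of x1] SF[of u] x1 u by auto
  have "u \<noteq> x1" using x1 by auto
  \<comment> \<open>This basis is orthonormal within \<open>S x\<close> and within
    \<open>F x\<close>, so its quantitative independence depends only on the angle between the
    two.\<close>
  define T where "T = insert u (insert x1 B)"
  have T: "finite T" "card T = CARD('n)"
    using finB nF \<open>u \<noteq> x1\<close> B(5) dims(2)[of x] dimension by (auto simp: T_def)
  then obtain b where b: "bij_betw b (UNIV::'n set) T"
    using finite_same_card_bij[of "UNIV::'n set" T] by auto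
  define inv where "inv = the_inv_into UNIV b"
  have inv: "b (inv t) = t" if "t \<in> T" for t
    using b that unfolding inv_def by (intro f_the_inv_into_f) (auto simp: bij_betw_def)
  have inv': "inv (b i) = i" for i
    using b unfolding inv_def by (intro the_inv_into_f_f) (auto simp: bij_betw_def)
  have sumT: "(\<Sum>i\<in>UNIV. h i) = (\<Sum>t\<in>T. h (inv t))" for h :: "'n \<Rightarrow> 'b::comm_monoid_add"
    using sum.reindex_bij_betw[OF b, of "\<lambda>t. h (inv t)"] by (simp add: inv')
  have lower: "norm a \<le> (2 + angle + angle) * norm (\<Sum>i\<in>UNIV. a $ i *\<^sub>R b i)" for a :: "real ^ 'n"
  proof -
    define e where "e = (\<Sum>t\<in>B. a $ inv t *\<^sub>R t)"
    define f where "f = a $ inv u *\<^sub>R u + a $ inv x1 *\<^sub>R x1"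
    have "(\<Sum>i\<in>UNIV. a $ i *\<^sub>R b i) = (\<Sum>t\<in>T. a $ inv t *\<^sub>R t)"
      using sumT[of "\<lambda>i. a $ i *\<^sub>R b i"] inv by simp
    then have sum: "(\<Sum>i\<in>UNIV. a $ i *\<^sub>R b i) = e + f"
      using finB nF \<open>u \<noteq> x1\<close> by (simp add: T_def e_def f_def algebra_simps)
    have e: "e \<in> S x" unfolding e_def
      using B(1) by (intro subspace_sum subspace_S subspace_scale) auto
    have f: "f \<in> F x" unfolding f_def
      by (intro subspace_add subspace_scale subspace_F u x1)
    have e2: "(norm e)\<^sup>2 = (\<Sum>t\<in>B. (a $ inv t)\<^sup>2)"
    proof -
      have "(norm e)\<^sup>2 = (\<Sum>t\<in>B. (norm (a $ inv t *\<^sub>R t))\<^sup>2)"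
        unfolding e_def using finB B(2)
        by (intro norm_sum_Pythagorean) (auto simp: pairwise_def orthogonal_def)
      then show ?thesis using B(3) by simp
    qed
    have f2: "(norm f)\<^sup>2 = (a $ inv u)\<^sup>2 + (a $ inv x1)\<^sup>2"
    proof -
      have "(norm f)\<^sup>2 = (norm (a $ inv u *\<^sub>R u))\<^sup>2 + (norm (a $ inv x1 *\<^sub>R x1))\<^sup>2"
        unfolding f_def by (rule norm_add_Pythagorean) (simp add: orthogonal_def x1)
      then show ?thesis using u x1 by simp
    qed
    have "(norm a)\<^sup>2 = (\<Sum>i\<in>UNIV. (a $ i)\<^sup>2)"
      by (simp add: norm_vec_def L2_set_def sum_nonneg)
    also have "\<dots> = (\<Sum>t\<in>T. (a $ inv t)\<^sup>2)" by (rule sumT)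
    also have "\<dots> = (norm e)\<^sup>2 + (norm f)\<^sup>2"
      using finB nF \<open>u \<noteq> x1\<close> by (simp add: T_def e2 f2)
    also have "\<dots> \<le> (norm e + norm f)\<^sup>2" by (simp add: power2_sum)
    finally have "norm a \<le> norm e + norm f" by (rule power2_le_imp_le) simp
    also have "\<dots> \<le> (1 + angle) * norm (e + f) + angle * norm (e + f)"
      using norm_S_le[OF e f] norm_F_le[OF e f] by linarith
    also have "\<dots> \<le> (2 + angle + angle) * norm (e + f)"
      by (simp add: algebra_simps)
    finally show ?thesis by (simp add: sum)
  qed
  let ?k = "inv u" and ?j = "inv x1" and ?y = "\<phi> (real n) x"
  let ?r = "\<lambda>i. D (real n) x (b i)"
  define w where "w = p ?y (D (real n) x u)"
  \<comment> \<open>Replacing the image of \<open>u\<close> by its projection adds a multiple of the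
    row of \<open>X\<close>; the determinant is unchanged, and the row becomes the quantity to be
    estimated.\<close>
  define r' where "r' i = (if i = ?k then w else ?r i)" for i
  have kj: "?k \<noteq> ?j" using inv[of u] inv[of x1] \<open>u \<noteq> x1\<close> by (auto simp: T_def)
  obtain s where s: "w = D (real n) x u + s *\<^sub>R D (real n) x x1"
  proof
    show "w = D (real n) x u
      + (- ((D (real n) x u \<bullet> X ?y) / (X ?y \<bullet> X ?y)) * norm (X x)) *\<^sub>R D (real n) x x1"
      using X_nonzero[of x]
      by (simp add: w_def p_def x1_def linear_scale[OF D_linear] X_invariant)
  qed
  have "(\<chi> i. r' i) = (\<chi> i. if i = ?k then row ?k (\<chi> i. ?r i) + s *\<^sub>R row ?j (\<chi> i. ?r i)
      else row i (\<chi> i. ?r i))"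
    by (simp add: vec_eq_iff r'_def row_def s inv T_def)
  then have "det (\<chi> i. r' i) = det (\<chi> i. ?r i)"
    using det_row_operation[OF kj, of "\<chi> i. ?r i" s] unfolding scalar_mult_eq_scaleR by simp
  then have det: "\<bar>det (\<chi> i. b i)\<bar> = \<bar>det (\<chi> i. r' i)\<bar>" by (simp add: D_rows)
  also have "\<dots> \<le> fact CARD('n) * (\<Prod>i\<in>UNIV. norm (r' i))" by (rule abs_det_rows_le)
  also have "(\<Prod>i\<in>UNIV. norm (r' i)) = (\<Prod>t\<in>T. norm (r' (inv t)))"
    using prod.reindex_bij_betw[OF b, of "\<lambda>t. norm (r' (inv t))"] by (simp add: inv')
  also have "\<dots> = norm w * (norm (D (real n) x x1) * (\<Prod>t\<in>B. norm (D (real n) x t)))"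
  proof -
    have "r' (inv t) = D (real n) x t" if "t \<in> T" "t \<noteq> u" for t
      using that inv[of t] inv[of u] by (auto simp: r'_def T_def)
    then have "r' (inv x1) = D (real n) x x1" "\<And>t. t \<in> B \<Longrightarrow> r' (inv t) = D (real n) x t"
      using nF \<open>u \<noteq> x1\<close> by (auto simp: T_def)
    moreover have "r' (inv u) = w" by (simp add: r'_def)
    ultimately show ?thesis using finB nF \<open>u \<noteq> x1\<close> by (simp add: T_def)
  qed
  also have "\<dots> \<le> norm w * ((C / c) * (K1 ^ (CARD('n) - 2) * \<rho> ^ n))"
  proof (intro mult_left_mono mult_mono)
    have "norm (D (real n) x x1) = norm (X ?y) / norm (X x)"
      by (simp add: x1_def linear_scale[OF D_linear] X_invariant)
    also have "\<dots> \<le> C / c" using X_upper X_lower c C by (intro frac_le) auto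
    finally show "norm (D (real n) x x1) \<le> C / c" .
    have "(\<Prod>t\<in>B. norm (D (real n) x t)) \<le> (\<Prod>t\<in>B. K1 * \<rho> ^ n)"
      using S_contracts[of _ x n] B(1,3) by (intro prod_mono) fastforce
    also have "\<dots> = K1 ^ (CARD('n) - 2) * (\<rho> ^ n) ^ (CARD('n) - 2)"
      using B(5) dims(2)[of x] by (simp add: power_mult_distrib)
    \<comment> \<open>As \<open>CARD('n) - 2 \<ge> 1\<close>, at least one contracted direction
      exists, and a single factor \<open>\<rho> ^ n\<close> suffices.\<close>
    also have "\<dots> \<le> K1 ^ (CARD('n) - 2) * (\<rho> ^ n) ^ 1"
      using \<rho> K1 dimension by (intro mult_left_mono power_decreasing) (auto simp: power_le_one)
    finally show "(\<Prod>t\<in>B. norm (D (real n) x t)) \<le> K1 ^ (CARD('n) - 2) * \<rho> ^ n" by simp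
  qed (use c C in \<open>auto intro: prod_nonneg\<close>)
  finally have upper: "\<bar>det (\<chi> i. b i)\<bar> \<le>
    fact CARD('n) * (norm w * ((C / c) * (K1 ^ (CARD('n) - 2) * \<rho> ^ n)))" by simp
  have "1 \<le> \<bar>det (\<chi> i. b i)\<bar> * (fact CARD('n) * (2 + angle + angle) ^ CARD('n))"
    using abs_det_rows_ge[of "2 + angle + angle" b] lower by blast
  also have "\<dots> \<le> (fact CARD('n) * (norm w * ((C / c) * (K1 ^ (CARD('n) - 2) * \<rho> ^ n))))
      * (fact CARD('n) * (2 + angle + angle) ^ CARD('n))"
    using upper angle_nonneg by (intro mult_right_mono) auto
  finally show ?thesis by (simp add: K2_def w_def mult_ac)
qed

lemma F_expands:
  assumes "u \<in> F x"
  shows "norm (p x u) \<le> K2 * \<rho> ^ n * norm (p (\<phi> (real n) x) (D (real n) x u))"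
proof (cases "p x u = 0")
  case True
  then show ?thesis using K2 \<rho> by simp
next
  case False
  define w where "w = (1 / norm (p x u)) *\<^sub>R p x u"
  have w: "w \<in> F x" "norm w = 1" "w \<bullet> X x = 0"
    using assms False by (auto simp: w_def p_orthogonal intro!: subspace_scale subspace_F p_in_F)
  have "p (\<phi> (real n) x) (D (real n) x w) = (1 / norm (p x u)) *\<^sub>R p (\<phi> (real n) x) (D (real n) x u)"
    by (simp add: w_def linear_scale[OF D_linear] linear_scale[OF p_linear] p_D)
  then have "norm (p (\<phi> (real n) x) (D (real n) x w)) = norm (p (\<phi> (real n) x) (D (real n) x u)) / norm (p x u)"
    by simp
  then have eq: "norm (p x u) * norm (p (\<phi> (real n) x) (D (real n) x w)) = norm (p (\<phi> (real n) x) (D (real n) x u))"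
    using False by simp
  have "norm (p x u) * 1 \<le> norm (p x u) * (K2 * \<rho> ^ n * norm (p (\<phi> (real n) x) (D (real n) x w)))"
    by (rule mult_left_mono[OF F_expands_unit[OF w]]) simp
  also have "\<dots> = K2 * \<rho> ^ n * norm (p (\<phi> (real n) x) (D (real n) x u))"
    by (simp only: eq[symmetric] mult_ac)
  finally show ?thesis by simp
qed

lemma F_contracts_backward:
  assumes "v \<in> F x"
  shows "norm (p (\<phi> (- real n) x) (D (- real n) x v)) \<le> K2 * \<rho> ^ n * norm v"
proof -
  have "norm (p (\<phi> (- real n) x) (D (- real n) x v)) \<le> K2 * \<rho> ^ n * norm (p x v)"
    using F_expands[OF D_F_in[OF assms], of n n] by (simp add: flow_inverse D_inverse)
  also have "\<dots> \<le> K2 * \<rho> ^ n * norm v" using norm_p_le[of x v] K2 \<rho> by (intro mult_left_mono) auto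
  finally show ?thesis .
qed

text \<open>The coefficient of \<open>X\<close> in the backward image. For \<open>v\<close> in
  \<open>F x\<close> its limit is the coordinate of \<open>v\<close> along \<open>X x\<close>,
  relative to the sum of flow direction and unstable line.\<close>

definition \<beta> :: "'m \<Rightarrow> real ^ 'n \<Rightarrow> nat \<Rightarrow> real" where
  "\<beta> x v n = (D (- real n) x v \<bullet> X (\<phi> (- real n) x)) / (X (\<phi> (- real n) x) \<bullet> X (\<phi> (- real n) x))"

lemma coefficient_le: "\<bar>(v \<bullet> X x) / (X x \<bullet> X x)\<bar> \<le> norm v / c"
proof -
  have pos: "norm (X x) > 0" using X_nonzero by simp
  have "\<bar>v \<bullet> X x\<bar> \<le> norm v * norm (X x)" by (rule Cauchy_Schwarz_ineq2)
  then have "\<bar>v \<bullet> X x\<bar> / (X x \<bullet> X x) \<le> norm v * norm (X x) / (X x \<bullet> X x)"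
    by (intro divide_right_mono) auto
  also have "\<dots> = norm v / norm (X x)" using pos by (simp add: power2_norm_eq_inner[symmetric] power2_eq_square)
  also have "\<dots> \<le> norm v / c" using X_lower[of x] c pos by (intro divide_left_mono) auto
  finally show ?thesis by simp
qed

text \<open>The time-minus-one derivative carries the \<open>X\<close> part over with the same
  coefficient, so the coefficient changes only by what the transverse part contributes, and that
  part decays geometrically in backward time.\<close>

lemma \<beta>_step:
  assumes "v \<in> F x" shows "\<bar>\<beta> x v (Suc n) - \<beta> x v n\<bar> \<le> (C * K2 / c * norm v) * \<rho> ^ n"
proof -
  let ?y = "\<phi> (- real n) x" and ?z = "\<phi> (- real (Suc n)) x"
  let ?w = "p ?y (D (- real n) x v)"
  have z: "\<phi> (-1) ?y = ?z" "D (- real (Suc n)) x v = D (-1) ?y (D (- real n) x v)"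
    using flow_add[of "-1" "- real n" x] D_add[of "-1" "- real n" x v] by simp_all
  have dec: "D (- real n) x v = ?w + \<beta> x v n *\<^sub>R X ?y"
    using p_decompose[of "D (- real n) x v" ?y] by (simp add: \<beta>_def)
  have "D (- real (Suc n)) x v = D (-1) ?y (?w + \<beta> x v n *\<^sub>R X ?y)"
    unfolding z(2) dec[symmetric] ..
  also have "\<dots> = D (-1) ?y ?w + \<beta> x v n *\<^sub>R X ?z"
    by (simp only: linear_add[OF D_linear] linear_scale[OF D_linear] X_invariant z(1))
  finally have "D (- real (Suc n)) x v = D (-1) ?y ?w + \<beta> x v n *\<^sub>R X ?z" .
  then have "\<beta> x v (Suc n) = (D (-1) ?y ?w \<bullet> X ?z) / (X ?z \<bullet> X ?z) + \<beta> x v n"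
    using X_nonzero[of ?z] unfolding \<beta>_def[of x v "Suc n"] by (simp add: inner_add_left add_divide_distrib)
  then have "\<bar>\<beta> x v (Suc n) - \<beta> x v n\<bar> \<le> norm (D (-1) ?y ?w) / c"
    using coefficient_le by simp
  also have "\<dots> \<le> C * (K2 * \<rho> ^ n * norm v) / c"
  proof (rule divide_right_mono)
    have "norm (D (-1) ?y ?w) \<le> C * norm ?w" by (rule D_bound) simp
    also have "\<dots> \<le> C * (K2 * \<rho> ^ n * norm v)"
      by (rule mult_left_mono[OF F_contracts_backward[OF assms]]) (use C in simp)
    finally show "norm (D (-1) ?y ?w) \<le> C * (K2 * \<rho> ^ n * norm v)" .
  qed (use c in simp)
  finally show ?thesis by (simp add: mult_ac)
qed

definition K3 :: real where "K3 = C * K2 / c / (1 - \<rho>)"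

lemma K3: "K3 > 0" using c C K2 \<rho> by (simp add: K3_def)

lemma \<beta>_limit:
  assumes "v \<in> F x" obtains l where "\<And>n. \<bar>\<beta> x v n - l\<bar> \<le> K3 * \<rho> ^ n * norm v"
proof -
  obtain l where "\<And>n. \<bar>\<beta> x v n - l\<bar> \<le> (C * K2 / c * norm v) / (1 - \<rho>) * \<rho> ^ n"
    using geometric_increments_limit[OF \<beta>_step[OF assms] \<rho>] by blast
  then have "\<And>n. \<bar>\<beta> x v n - l\<bar> \<le> K3 * \<rho> ^ n * norm v" by (simp add: K3_def mult_ac)
  then show ?thesis by (rule that)
qed

section \<open>The stable and unstable spaces\<close>

lemma geometric_tendsto_0: "(\<lambda>n. K * \<rho> ^ n * k) \<longlonglongrightarrow> 0"
proof -
  have "(\<lambda>n. K * \<rho> ^ n * k) \<longlonglongrightarrow> K * 0 * k"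
    using \<rho> by (intro tendsto_intros LIMSEQ_power_zero) auto
  then show ?thesis by simp
qed

text \<open>Defined by asymptotics: the cones behind \<open>S\<close> and \<open>F\<close> are
  sampled at integer times, whereas convergence to 0 is visibly preserved by \<open>D t\<close> for
  every real \<open>t\<close>.\<close>

definition Es :: "'m \<Rightarrow> (real ^ 'n) set" where
  "Es x = {v. (\<lambda>n. D (real n) x v) \<longlonglongrightarrow> 0}"

definition Eu :: "'m \<Rightarrow> (real ^ 'n) set" where
  "Eu x = {v. (\<lambda>n. D (- real n) x v) \<longlonglongrightarrow> 0}"

lemma tendsto_0_of_le:
  fixes h :: "nat \<Rightarrow> real ^ 'n"
  assumes "\<And>n. norm (h n) \<le> k n" "k \<longlonglongrightarrow> 0" shows "h \<longlonglongrightarrow> 0"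
  using assms by (intro Lim_null_comparison[of h k]) auto

lemma X_not_tendsto_0:
  assumes "(\<lambda>n. s *\<^sub>R X (h n)) \<longlonglongrightarrow> 0" shows "s = 0"
proof -
  have "(\<lambda>n::nat. \<bar>s\<bar> * norm (X (h n))) \<longlonglongrightarrow> 0"
    using tendsto_norm[OF assms] by simp
  moreover have "\<bar>s\<bar> * c \<le> \<bar>s\<bar> * norm (X (h n))" for n by (intro mult_left_mono X_lower) simp
  ultimately have "\<bar>s\<bar> * c \<le> 0" by (intro LIMSEQ_le_const) auto
  then show ?thesis using c by (simp add: mult_le_0_iff)
qed

text \<open>If the images of \<open>v\<close> tend to 0, then so do those of its \<open>F\<close>
  part, by the angle bound. Transverse expansion leaves only a multiple of \<open>X x\<close> for
  that part, and \<open>X\<close> stays away from 0.\<close>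

lemma Es_eq_S: "Es x = S x"
proof safe
  fix v assume "v \<in> S x"
  then show "v \<in> Es x" unfolding Es_def
    using tendsto_0_of_le[OF S_contracts geometric_tendsto_0] by simp
next
  fix v assume v: "v \<in> Es x"
  obtain e f where ef: "e \<in> S x" "f \<in> F x" "v = e + f" by (rule S_F_decomposition)
  have Dn: "D (real n) x e \<in> S (\<phi> (real n) x)" "D (real n) x f \<in> F (\<phi> (real n) x)" for n
    using D_S ef D_F_forward by auto
  have lim: "(\<lambda>n. angle * norm (D (real n) x v)) \<longlonglongrightarrow> 0"
    using v unfolding Es_def by (intro tendsto_mult_right_zero tendsto_norm_zero) simp
  have le: "norm (D (real n) x f) \<le> angle * norm (D (real n) x v)" for n
    using norm_F_le[OF Dn, of n] ef(3) linear_add[OF D_linear] by simp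
  have f0: "(\<lambda>n. D (real n) x f) \<longlonglongrightarrow> 0" using le lim by (rule tendsto_0_of_le)
  have "norm (p x f) \<le> K2 * norm (D (real n) x f)" for n
  proof -
    have "norm (p x f) \<le> K2 * \<rho> ^ n * norm (p (\<phi> (real n) x) (D (real n) x f))"
      by (rule F_expands[OF ef(2)])
    also have "\<dots> \<le> K2 * 1 * norm (D (real n) x f)"
      using K2 \<rho> norm_p_le by (intro mult_mono power_le_one) auto
    finally show ?thesis by simp
  qed
  moreover have "(\<lambda>n. K2 * norm (D (real n) x f)) \<longlonglongrightarrow> 0"
    using f0 by (intro tendsto_mult_right_zero tendsto_norm_zero)
  ultimately have "norm (p x f) \<le> 0" by (intro LIMSEQ_le_const) auto
  then obtain s where s: "f = s *\<^sub>R X x" using p_decompose[of f x] by force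
  then have "(\<lambda>n. s *\<^sub>R X (\<phi> (real n) x)) \<longlonglongrightarrow> 0"
    using f0 by (simp add: linear_scale[OF D_linear] X_invariant)
  then have "s = 0" by (rule X_not_tendsto_0)
  then show "v \<in> S x" using ef s by simp
qed

definition K4 :: real where "K4 = K2 + K3 * C"

lemma K4: "K4 > 0" using K2 K3 C by (simp add: K4_def add_pos_pos)

text \<open>The \<open>S\<close> part of \<open>v\<close> is the forward image of its backward
  images, which tend to 0 by the angle bound, so contraction makes it vanish. The limiting
  coefficient of \<open>X\<close> is then 0 as well, and both the coefficient and the transverse
  part decay like \<open>\<rho> ^ n\<close>.\<close>

lemma Eu_bounds:
  assumes v: "v \<in> Eu x"
  shows "v \<in> F x" "norm (D (- real n) x v) \<le> K4 * \<rho> ^ n * norm v"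
proof -
  obtain e f where ef: "e \<in> S x" "f \<in> F x" "v = e + f" by (rule S_F_decomposition)
  have Dn: "D (- real n) x e \<in> S (\<phi> (- real n) x)" "D (- real n) x f \<in> F (\<phi> (- real n) x)" for n
    using ef D_S_backward D_F_in by auto
  have v0: "(\<lambda>n. D (- real n) x v) \<longlonglongrightarrow> 0" using v by (simp add: Eu_def)
  have "norm e \<le> K1 * ((1 + angle) * norm (D (- real n) x v))" for n
  proof -
    have "norm e = norm (D (real n) (\<phi> (- real n) x) (D (- real n) x e))" by (simp add: D_inverse)
    also have "\<dots> \<le> K1 * \<rho> ^ n * norm (D (- real n) x e)" by (rule S_contracts[OF Dn(1)])
    also have "\<dots> \<le> K1 * 1 * norm (D (- real n) x e)"
      using K1 \<rho> by (intro mult_right_mono mult_left_mono power_le_one) auto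
    also have "\<dots> \<le> K1 * 1 * ((1 + angle) * norm (D (- real n) x v))"
      using norm_S_le[OF Dn, of n] ef(3) linear_add[OF D_linear] K1 by (intro mult_left_mono) auto
    finally show ?thesis by simp
  qed
  moreover have "(\<lambda>n. K1 * ((1 + angle) * norm (D (- real n) x v))) \<longlonglongrightarrow> 0"
    using v0 by (intro tendsto_mult_right_zero tendsto_norm_zero)
  ultimately have "norm e \<le> 0" by (intro LIMSEQ_le_const) auto
  then show F: "v \<in> F x" using ef by simp
  obtain l where l: "\<And>n. \<bar>\<beta> x v n - l\<bar> \<le> K3 * \<rho> ^ n * norm v" using \<beta>_limit[OF F] by blast
  have "\<bar>l\<bar> \<le> norm (D (- real n) x v) / c + K3 * \<rho> ^ n * norm v" for n
    using l[of n] coefficient_le[of "D (- real n) x v" "\<phi> (- real n) x"] unfolding \<beta>_def by linarith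
  moreover have "(\<lambda>n. norm (D (- real n) x v) / c + K3 * \<rho> ^ n * norm v) \<longlonglongrightarrow> 0"
    by (intro tendsto_add_zero geometric_tendsto_0 tendsto_divide_zero tendsto_norm_zero v0)
  ultimately have "\<bar>l\<bar> \<le> 0" by (intro LIMSEQ_le_const) auto
  then have \<beta>n: "\<bar>\<beta> x v n\<bar> \<le> K3 * \<rho> ^ n * norm v" using l[of n] by simp
  let ?y = "\<phi> (- real n) x"
  have "norm (D (- real n) x v) \<le> norm (p ?y (D (- real n) x v)) + \<bar>\<beta> x v n\<bar> * norm (X ?y)"
    using norm_triangle_ineq[of "p ?y (D (- real n) x v)" "\<beta> x v n *\<^sub>R X ?y"]
      p_decompose[of "D (- real n) x v" ?y] unfolding \<beta>_def[of x v n] norm_scaleR by simp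
  also have "\<dots> \<le> K2 * \<rho> ^ n * norm v + (K3 * \<rho> ^ n * norm v) * C"
    by (rule add_mono[OF F_contracts_backward[OF F] mult_mono[OF \<beta>n X_upper]]) (use \<rho> K3 in simp_all)
  finally show "norm (D (- real n) x v) \<le> K4 * \<rho> ^ n * norm v" by (simp add: K4_def algebra_simps)
qed

lemma F_decomposition:
  assumes v: "v \<in> F x" obtains s where "v - s *\<^sub>R X x \<in> Eu x"
proof -
  obtain l where l: "\<And>n. \<bar>\<beta> x v n - l\<bar> \<le> K3 * \<rho> ^ n * norm v" using \<beta>_limit[OF v] by blast
  have "(\<lambda>n. D (- real n) x (v - l *\<^sub>R X x)) \<longlonglongrightarrow> 0"
  proof (rule tendsto_0_of_le)
    fix n
    let ?y = "\<phi> (- real n) x"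
    have "D (- real n) x (v - l *\<^sub>R X x) = D (- real n) x v - l *\<^sub>R X ?y"
      by (simp add: linear_diff[OF D_linear] linear_scale[OF D_linear] X_invariant)
    also have "\<dots> = p ?y (D (- real n) x v) + (\<beta> x v n - l) *\<^sub>R X ?y"
      by (simp add: p_def \<beta>_def algebra_simps)
    finally have "norm (D (- real n) x (v - l *\<^sub>R X x))
      \<le> norm (p ?y (D (- real n) x v)) + \<bar>\<beta> x v n - l\<bar> * norm (X ?y)"
      using norm_triangle_ineq[of "p ?y (D (- real n) x v)" "(\<beta> x v n - l) *\<^sub>R X ?y"] by simp
    also have "\<dots> \<le> K2 * \<rho> ^ n * norm v + (K3 * \<rho> ^ n * norm v) * C"
      by (rule add_mono[OF F_contracts_backward[OF v] mult_mono[OF l X_upper]]) (use \<rho> K3 in simp_all)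
    finally show "norm (D (- real n) x (v - l *\<^sub>R X x)) \<le> K4 * \<rho> ^ n * norm v"
      by (simp add: K4_def algebra_simps)
  qed (rule geometric_tendsto_0)
  then show ?thesis using that by (simp add: Eu_def)
qed

lemma subspace_Es: "subspace (Es x)"
  unfolding Es_eq_S by (rule subspace_S)

lemma subspace_Eu: "subspace (Eu x)"
  unfolding Eu_def
proof (rule subspaceI; safe)
  show "(\<lambda>n. D (- real n) x 0) \<longlonglongrightarrow> 0" by (simp add: linear_0[OF D_linear])
next
  fix v w assume "(\<lambda>n. D (- real n) x v) \<longlonglongrightarrow> 0" "(\<lambda>n. D (- real n) x w) \<longlonglongrightarrow> 0"
  then show "(\<lambda>n. D (- real n) x (v + w)) \<longlonglongrightarrow> 0"
    by (simp add: linear_add[OF D_linear] tendsto_add_zero)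
next
  fix a v assume "(\<lambda>n. D (- real n) x v) \<longlonglongrightarrow> 0"
  then show "(\<lambda>n. D (- real n) x (a *\<^sub>R v)) \<longlonglongrightarrow> 0"
    using tendsto_scaleR[of "\<lambda>_. a" a sequentially] by (fastforce simp: linear_scale[OF D_linear])
qed

lemma splitting: "direct_sum3 (Es x) (span {X x}) (Eu x)"
proof -
  have zero: "s = 0 \<and> w = 0 \<and> u = 0"
    if h: "s \<in> Es x" "w \<in> span {X x}" "u \<in> Eu x" "s + w + u = 0" for s w u
  proof -
    obtain k where k: "w = k *\<^sub>R X x" using h(2) by (auto simp: span_singleton)
    have "w + u \<in> F x"
      unfolding k using Eu_bounds(1)[OF h(3)] by (intro subspace_add subspace_F subspace_scale X_in_F)
    moreover have "w + u = - s" using h(4) by (metis add.assoc minus_unique)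
    moreover have "- s \<in> S x" using h(1) subspace_neg[OF subspace_S] by (simp add: Es_eq_S)
    ultimately have "w + u \<in> S x \<inter> F x" by simp
    then have "w + u = 0" unfolding S_Int_F by simp
    then have "u = (- k) *\<^sub>R X x" unfolding k scaleR_minus_left by (metis minus_unique)
    then have "(\<lambda>n. (- k) *\<^sub>R X (\<phi> (- real n) x)) \<longlonglongrightarrow> 0"
      using h(3) unfolding Eu_def by (simp only: mem_Collect_eq linear_scale[OF D_linear] X_invariant)
    then have "- k = 0" by (rule X_not_tendsto_0)
    then show ?thesis using \<open>w + u = 0\<close> k h(4) by simp
  qed
  have "\<exists>!q. q \<in> Es x \<times> span {X x} \<times> Eu x \<and> v = (case q of (s, w, u) \<Rightarrow> s + w + u)" for v
  proof -
    obtain e f where ef: "e \<in> S x" "f \<in> F x" "v = e + f" by (rule S_F_decomposition)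
    obtain k where k: "f - k *\<^sub>R X x \<in> Eu x" using F_decomposition[OF ef(2)] by blast
    let ?q = "(e, k *\<^sub>R X x, f - k *\<^sub>R X x)"
    have q: "?q \<in> Es x \<times> span {X x} \<times> Eu x" using ef k by (simp add: Es_eq_S span_mul span_base)
    show ?thesis
    proof (rule ex1I[of _ ?q])
      show "?q \<in> Es x \<times> span {X x} \<times> Eu x \<and> v = (case ?q of (s, w, u) \<Rightarrow> s + w + u)"
        using q ef(3) by simp
      fix q' assume q': "q' \<in> Es x \<times> span {X x} \<times> Eu x \<and> v = (case q' of (s, w, u) \<Rightarrow> s + w + u)"
      obtain s w u where abc: "q' = (s, w, u)" by (cases q') auto
      have "s - e = 0 \<and> w - k *\<^sub>R X x = 0 \<and> u - (f - k *\<^sub>R X x) = 0"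
      proof (rule zero)
        show "s - e \<in> Es x" "w - k *\<^sub>R X x \<in> span {X x}" "u - (f - k *\<^sub>R X x) \<in> Eu x"
          using q q' unfolding abc
          by (simp_all add: subspace_diff[OF subspace_Es] subspace_diff[OF subspace_Eu] span_diff)
        have "s + w + u = e + f" using q' ef(3) unfolding abc by simp
        then show "s - e + (w - k *\<^sub>R X x) + (u - (f - k *\<^sub>R X x)) = 0" by (simp add: algebra_simps)
      qed
      then show "q' = ?q" by (simp add: abc)
    qed
  qed
  then show ?thesis by (simp add: direct_sum3_def subspace_Es subspace_Eu)
qed

section \<open>From integer to real times\<close>

lemma D_bound_int: "norm (D (real n) x v) \<le> C ^ n * norm v" "norm (D (- real n) x v) \<le> C ^ n * norm v"
proof (induction n)
  case (Suc n)
  have "D (real (Suc n)) x v = D 1 (\<phi> (real n) x) (D (real n) x v)"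
    "D (- real (Suc n)) x v = D (- 1) (\<phi> (- real n) x) (D (- real n) x v)"
    using D_add[of 1 "real n" x v] D_add[of "-1" "- real n" x v] by simp_all
  then have "norm (D (real (Suc n)) x v) \<le> C * norm (D (real n) x v)"
    "norm (D (- real (Suc n)) x v) \<le> C * norm (D (- real n) x v)" using D_bound by simp_all
  moreover have "C * norm (D (real n) x v) \<le> C ^ Suc n * norm v" "C * norm (D (- real n) x v) \<le> C ^ Suc n * norm v"
    using mult_left_mono[OF Suc(1), of C] mult_left_mono[OF Suc(2), of C] C by (simp_all add: mult_ac)
  ultimately show "norm (D (real (Suc n)) x v) \<le> C ^ Suc n * norm v"
    "norm (D (- real (Suc n)) x v) \<le> C ^ Suc n * norm v" by linarith+
qed (simp_all add: D_0)

lemma D_bound_real: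
  obtains k where "k > 0" "\<And>x v. norm (D t x v) \<le> k * norm v"
proof -
  define n where "n = nat \<lfloor>\<bar>t\<bar>\<rfloor>"
  define r where "r = (if t \<ge> 0 then t - real n else t + real n)"
  have "real n = of_int \<lfloor>\<bar>t\<bar>\<rfloor>" by (simp add: n_def)
  then have "real n \<le> \<bar>t\<bar>" "\<bar>t\<bar> < real n + 1" by linarith+
  then have nr: "\<bar>r\<bar> \<le> 1" "t = r + real n \<or> t = r + - real n" by (auto simp: r_def)
  have "norm (D t x v) \<le> (C * C ^ n) * norm v" for x v
  proof -
    have "norm (D (r + s) x v) \<le> C * norm (D s x v)" for s
      using D_bound[OF nr(1)] by (simp add: D_add)
    then have "norm (D t x v) \<le> C * norm (D (real n) x v) \<or> norm (D t x v) \<le> C * norm (D (- real n) x v)"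
      using nr(2) by blast
    moreover have "C * norm (D (real n) x v) \<le> C * (C ^ n * norm v)"
      "C * norm (D (- real n) x v) \<le> C * (C ^ n * norm v)"
      using D_bound_int[of n x v] C by simp_all
    ultimately show ?thesis by (auto simp: mult.assoc)
  qed
  then show ?thesis using that[of "C * C ^ n"] C by simp
qed

lemma invariant:
  "D t x ` Es x = Es (\<phi> t x)" "D t x ` Eu x = Eu (\<phi> t x)"
proof -
  have sub: "D t x v \<in> Es (\<phi> t x)" if "v \<in> Es x" for t x v
  proof -
    obtain k where k: "k > 0" "\<And>x v. norm (D t x v) \<le> k * norm v" by (rule D_bound_real[of t]) (rule that)
    have "norm (D (real n) (\<phi> t x) (D t x v)) \<le> k * norm (D (real n) x v)" for n
      using k(2)[of "\<phi> (real n) x" "D (real n) x v"] by (simp add: D_add[symmetric] add.commute)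
    moreover have "(\<lambda>n. k * norm (D (real n) x v)) \<longlonglongrightarrow> 0"
      using that unfolding Es_def by (intro tendsto_mult_right_zero tendsto_norm_zero) simp
    ultimately show ?thesis unfolding Es_def by (intro CollectI tendsto_0_of_le)
  qed
  have sub': "D t x v \<in> Eu (\<phi> t x)" if "v \<in> Eu x" for t x v
  proof -
    obtain k where k: "k > 0" "\<And>x v. norm (D t x v) \<le> k * norm v" by (rule D_bound_real[of t]) (rule that)
    have "norm (D (- real n) (\<phi> t x) (D t x v)) \<le> k * norm (D (- real n) x v)" for n
      using k(2)[of "\<phi> (- real n) x" "D (- real n) x v"] by (simp add: D_add[symmetric] add.commute)
    moreover have "(\<lambda>n. k * norm (D (- real n) x v)) \<longlonglongrightarrow> 0"
      using that unfolding Eu_def by (intro tendsto_mult_right_zero tendsto_norm_zero) simp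
    ultimately show ?thesis unfolding Eu_def by (intro CollectI tendsto_0_of_le)
  qed
  show "D t x ` Es x = Es (\<phi> t x)"
  proof safe
    fix v assume "v \<in> Es (\<phi> t x)"
    then have "D (- t) (\<phi> t x) v \<in> Es x" using sub[of v "\<phi> t x" "- t"] by (simp add: flow_inverse)
    then show "v \<in> D t x ` Es x"
      using D_inverse(2)[of t "\<phi> t x" v] by (intro image_eqI) (auto simp: flow_inverse)
  qed (rule sub)
  show "D t x ` Eu x = Eu (\<phi> t x)"
  proof safe
    fix v assume "v \<in> Eu (\<phi> t x)"
    then have "D (- t) (\<phi> t x) v \<in> Eu x" using sub'[of v "\<phi> t x" "- t"] by (simp add: flow_inverse)
    then show "v \<in> D t x ` Eu x"
      using D_inverse(2)[of t "\<phi> t x" v] by (intro image_eqI) (auto simp: flow_inverse)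
  qed (rule sub')
qed

definition rate :: real where "rate = - ln \<rho>"
text \<open>\<open>C\<close> pays for the fractional part of the time, \<open>1 / \<rho>\<close> for
  rounding the exponent down to an integer.\<close>

definition K :: real where "K = max K1 K4 * C / \<rho>"

lemma rate: "rate > 0" using \<rho> by (simp add: rate_def)
lemma K: "K > 0" using \<rho> C K1 by (simp add: K_def)

lemma rate_real:
  assumes "t \<ge> 0" obtains n r where "t = r + real n" "\<bar>r\<bar> \<le> 1" "\<rho> ^ n \<le> exp (- rate * t) / \<rho>"
proof
  let ?n = "nat \<lfloor>t\<rfloor>"
  have n: "real ?n = of_int \<lfloor>t\<rfloor>" using assms by simp
  show "t = (t - ?n) + ?n" by simp
  show "\<bar>t - ?n\<bar> \<le> 1" unfolding n by linarith
  have "ln \<rho> * real ?n \<le> ln \<rho> * (t - 1)"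
    using \<rho> unfolding n by (intro mult_left_mono_neg) (linarith, simp)
  then have "exp (ln \<rho> * real ?n) \<le> exp (ln \<rho> * (t - 1))" by simp
  also have "\<dots> = exp (- rate * t) / \<rho>"
    using \<rho> by (simp add: rate_def right_diff_distrib exp_diff)
  also have "exp (ln \<rho> * real ?n) = \<rho> ^ ?n"
    using \<rho> by (simp add: exp_of_nat2_mult)
  finally show "\<rho> ^ ?n \<le> exp (- rate * t) / \<rho>" .
qed

text \<open>All vectors tending to 0 do so with the same constant and rate. In this form membership
  is a family of closed conditions on point and vector together, from which the continuity of the
  bundle is derived.\<close>

lemma Es_characterization: "Es x = {v. \<forall>t\<ge>0. norm (D t x v) \<le> K * exp (- rate * t) * norm v}"
proof safe
  fix v and t :: real assume v: "v \<in> Es x" and "t \<ge> 0"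
  obtain n r where n: "t = r + real n" "\<bar>r\<bar> \<le> 1" "\<rho> ^ n \<le> exp (- rate * t) / \<rho>"
    using rate_real[OF \<open>t \<ge> 0\<close>] by blast
  have "norm (D t x v) \<le> C * norm (D (real n) x v)" unfolding n D_add by (rule D_bound[OF n(2)])
  also have "\<dots> \<le> C * (max K1 K4 * (exp (- rate * t) / \<rho>) * norm v)"
  proof (rule mult_left_mono)
    have "norm (D (real n) x v) \<le> K1 * \<rho> ^ n * norm v" using S_contracts v by (simp add: Es_eq_S)
    also have "\<dots> \<le> max K1 K4 * (exp (- rate * t) / \<rho>) * norm v"
      using n(3) K1 \<rho> by (intro mult_mono) auto
    finally show "norm (D (real n) x v) \<le> max K1 K4 * (exp (- rate * t) / \<rho>) * norm v" .
  qed (use C in simp)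
  finally show "norm (D t x v) \<le> K * exp (- rate * t) * norm v" by (simp add: K_def mult_ac)
next
  fix v assume v: "\<forall>t\<ge>0. norm (D t x v) \<le> K * exp (- rate * t) * norm v"
  have "norm (D (real n) x v) \<le> K * \<rho> ^ n * norm v" for n
  proof -
    have "exp (- rate * real n) = \<rho> ^ n"
      using \<rho> by (simp add: rate_def exp_of_nat2_mult)
    then show ?thesis using v[rule_format, of "real n"] by simp
  qed
  then have "(\<lambda>n. D (real n) x v) \<longlonglongrightarrow> 0" by (rule tendsto_0_of_le[OF _ geometric_tendsto_0])
  then show "v \<in> Es x" by (simp add: Es_def)
qed

lemma Eu_characterization: "Eu x = {v. \<forall>t\<ge>0. norm (D (- t) x v) \<le> K * exp (- rate * t) * norm v}"
proof safe
  fix v and t :: real assume v: "v \<in> Eu x" and "t \<ge> 0"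
  obtain n r where n: "t = r + real n" "\<bar>r\<bar> \<le> 1" "\<rho> ^ n \<le> exp (- rate * t) / \<rho>"
    using rate_real[OF \<open>t \<ge> 0\<close>] by blast
  have "- t = - r + - real n" by (simp add: n(1))
  then have "norm (D (- t) x v) \<le> C * norm (D (- real n) x v)"
    using D_add[of "- r" "- real n" x v] D_bound[of "- r"] n(2) by simp
  also have "\<dots> \<le> C * (max K1 K4 * (exp (- rate * t) / \<rho>) * norm v)"
  proof (rule mult_left_mono)
    have "norm (D (- real n) x v) \<le> K4 * \<rho> ^ n * norm v" using Eu_bounds v by blast
    also have "\<dots> \<le> max K1 K4 * (exp (- rate * t) / \<rho>) * norm v"
      using n(3) K1 \<rho> by (intro mult_mono) auto
    finally show "norm (D (- real n) x v) \<le> max K1 K4 * (exp (- rate * t) / \<rho>) * norm v" .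
  qed (use C in simp)
  finally show "norm (D (- t) x v) \<le> K * exp (- rate * t) * norm v" by (simp add: K_def mult_ac)
next
  fix v assume v: "\<forall>t\<ge>0. norm (D (- t) x v) \<le> K * exp (- rate * t) * norm v"
  have "norm (D (- real n) x v) \<le> K * \<rho> ^ n * norm v" for n
  proof -
    have "exp (- rate * real n) = \<rho> ^ n"
      using \<rho> by (simp add: rate_def exp_of_nat2_mult)
    then show ?thesis using v[rule_format, of "real n"] by simp
  qed
  then have "(\<lambda>n. D (- real n) x v) \<longlonglongrightarrow> 0" by (rule tendsto_0_of_le[OF _ geometric_tendsto_0])
  then show "v \<in> Eu x" by (simp add: Eu_def)
qed

end

section \<open>Differentiable dependence on initial values\<close>

text \<open>The square of the norm is differentiable where the norm need not be. Splitting
  \<open>2 * norm (z s) * b\<close> into two squares costs the extra 1 in the exponent and makes the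
  comparison function \<open>w\<close> nonincreasing.\<close>

lemma gronwall_square_nonneg:
  fixes z :: "real \<Rightarrow> 'a::real_inner"
  assumes z: "\<And>s. 0 \<le> s \<Longrightarrow> s \<le> t \<Longrightarrow> (z has_vector_derivative z' s) (at s)"
    and bound: "\<And>s. 0 \<le> s \<Longrightarrow> s \<le> t \<Longrightarrow> norm (z' s) \<le> L * norm (z s) + b"
    and "t \<ge> 0" "L \<ge> 0"
  shows "(norm (z t))\<^sup>2 \<le> exp ((2 * L + 1) * t) * ((norm (z 0))\<^sup>2 + b\<^sup>2 * t)"
proof -
  define w where "w s = exp (- (2 * L + 1) * s) * (z s \<bullet> z s) - b\<^sup>2 * s" for s
  have "w t \<le> w 0"
  proof (rule DERIV_nonpos_imp_nonincreasing[OF \<open>t \<ge> 0\<close>])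
    fix s assume s: "0 \<le> s" "s \<le> t"
    have d: "(z has_derivative (\<lambda>h. h *\<^sub>R z' s)) (at s)"
      using z[OF s] by (simp add: has_vector_derivative_def)
    have "((\<lambda>s. z s \<bullet> z s) has_derivative (\<lambda>h. z s \<bullet> (h *\<^sub>R z' s) + (h *\<^sub>R z' s) \<bullet> z s)) (at s)"
      by (rule has_derivative_inner[OF d d])
    then have dz: "((\<lambda>s. z s \<bullet> z s) has_real_derivative 2 * (z s \<bullet> z' s)) (at s)"
      unfolding has_field_derivative_def
      by (rule has_derivative_eq_rhs) (simp add: fun_eq_iff inner_commute algebra_simps)
    let ?e = "exp (- (2 * L + 1) * s)"
    have "DERIV w s :> ?e * (2 * (z s \<bullet> z' s) - (2 * L + 1) * (z s \<bullet> z s)) - b\<^sup>2"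
      unfolding w_def
      by (rule derivative_eq_intros dz refl)+ (simp add: algebra_simps)
    moreover have "?e * (2 * (z s \<bullet> z' s) - (2 * L + 1) * (z s \<bullet> z s)) \<le> ?e * b\<^sup>2"
    proof (rule mult_left_mono)
      have "z s \<bullet> z' s \<le> norm (z s) * norm (z' s)" by (rule norm_cauchy_schwarz)
      also have "\<dots> \<le> norm (z s) * (L * norm (z s) + b)"
        using bound[OF s] by (intro mult_left_mono) auto
      finally have "z s \<bullet> z' s \<le> norm (z s) * (L * norm (z s) + b)" .
      moreover have "2 * (norm (z s) * (L * norm (z s) + b))
        = 2 * L * (norm (z s))\<^sup>2 + 2 * norm (z s) * b" by (simp add: power2_eq_square algebra_simps)
      moreover have "2 * norm (z s) * b \<le> (norm (z s))\<^sup>2 + b\<^sup>2" by (rule sum_squares_bound)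
      moreover have "(2 * L + 1) * (z s \<bullet> z s) = 2 * L * (norm (z s))\<^sup>2 + (norm (z s))\<^sup>2"
        by (simp add: power2_norm_eq_inner algebra_simps)
      ultimately show "2 * (z s \<bullet> z' s) - (2 * L + 1) * (z s \<bullet> z s) \<le> b\<^sup>2" by linarith
    qed simp
    moreover have "?e * b\<^sup>2 \<le> 1 * b\<^sup>2"
    proof (rule mult_right_mono)
      have "(2 * L + 1) * s \<ge> 0" using s \<open>L \<ge> 0\<close> by simp
      then show "?e \<le> 1" by (simp add: algebra_simps)
    qed simp
    ultimately show "\<exists>y. DERIV w s :> y \<and> y \<le> 0" by (intro exI conjI) (assumption, linarith)
  qed
  then have le: "exp (- (2 * L + 1) * t) * (norm (z t))\<^sup>2 \<le> (norm (z 0))\<^sup>2 + b\<^sup>2 * t"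
    by (simp add: w_def power2_norm_eq_inner)
  have "exp ((2 * L + 1) * t) * exp (- (2 * L + 1) * t) = 1"
    unfolding mult_minus_left by (rule exp_minus_inverse)
  then have "(norm (z t))\<^sup>2 = exp ((2 * L + 1) * t) * (exp (- (2 * L + 1) * t) * (norm (z t))\<^sup>2)"
    by (simp only: mult.assoc[symmetric] mult_1_left)
  also have "\<dots> \<le> exp ((2 * L + 1) * t) * ((norm (z 0))\<^sup>2 + b\<^sup>2 * t)"
    by (rule mult_left_mono[OF le]) simp
  finally show ?thesis .
qed

lemma has_vector_derivative_reflect:
  assumes "(z has_vector_derivative d) (at (- s))"
  shows "((\<lambda>s. z (- s)) has_vector_derivative - d) (at (s::real))"
proof -
  have "((\<lambda>s. z (- s)) has_vector_derivative (- 1) *\<^sub>R d) (at s)"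
    using vector_diff_chain_at[of uminus "- 1" s z d] assms
    by (auto simp: o_def has_vector_derivative_minus intro!: derivative_eq_intros)
  then show ?thesis by simp
qed

lemma gronwall_square:
  fixes z :: "real \<Rightarrow> 'a::real_inner"
  assumes z: "\<And>s. \<bar>s\<bar> \<le> \<bar>t\<bar> \<Longrightarrow> (z has_vector_derivative z' s) (at s)"
    and bound: "\<And>s. \<bar>s\<bar> \<le> \<bar>t\<bar> \<Longrightarrow> norm (z' s) \<le> L * norm (z s) + b"
    and "L \<ge> 0"
  shows "(norm (z t))\<^sup>2 \<le> exp ((2 * L + 1) * \<bar>t\<bar>) * ((norm (z 0))\<^sup>2 + b\<^sup>2 * \<bar>t\<bar>)"
proof (cases "t \<ge> 0")
  case True
  then show ?thesis using gronwall_square_nonneg[of t z z' L b] assms by simp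
next
  case False
  have "(norm (z (- (- t))))\<^sup>2 \<le> exp ((2 * L + 1) * (- t)) * ((norm (z (- 0)))\<^sup>2 + b\<^sup>2 * (- t))"
  proof (rule gronwall_square_nonneg[of "- t" "\<lambda>s. z (- s)" "\<lambda>s. - z' (- s)"])
    fix s assume s: "0 \<le> s" "s \<le> - t"
    show "((\<lambda>s. z (- s)) has_vector_derivative - z' (- s)) (at s)"
      by (rule has_vector_derivative_reflect) (rule z, use s in simp)
    show "norm (- z' (- s)) \<le> L * norm (z (- s)) + b"
      using bound[of "- s"] s by simp
  qed (use False \<open>L \<ge> 0\<close> in auto)
  then show ?thesis using False by simp
qed

lemma vector_increment_bound:
  fixes z :: "real \<Rightarrow> 'a::real_normed_vector"
  assumes z: "\<And>s. \<bar>s\<bar> \<le> \<bar>t\<bar> \<Longrightarrow> (z has_vector_derivative z' s) (at s)"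
    and bound: "\<And>s. \<bar>s\<bar> \<le> \<bar>t\<bar> \<Longrightarrow> norm (z' s) \<le> B"
  shows "norm (z t - z 0) \<le> B * \<bar>t\<bar>"
proof -
  have "norm (z t - z 0) \<le> B * norm (t - 0)"
  proof (rule differentiable_bound[of "cball 0 \<bar>t\<bar>" z "\<lambda>s h. h *\<^sub>R z' s"])
    fix s :: real assume s: "s \<in> cball 0 \<bar>t\<bar>"
    then show "(z has_derivative (\<lambda>h. h *\<^sub>R z' s)) (at s within cball 0 \<bar>t\<bar>)"
      using z[of s] by (auto simp: has_vector_derivative_def intro: has_derivative_at_withinI)
    show "onorm (\<lambda>h. h *\<^sub>R z' s) \<le> B"
    proof (rule onorm_le)
      fix h :: real
      have "norm (h *\<^sub>R z' s) = \<bar>h\<bar> * norm (z' s)" by simp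
      also have "\<dots> \<le> \<bar>h\<bar> * B" using bound[of s] s by (intro mult_left_mono) auto
      finally show "norm (h *\<^sub>R z' s) \<le> B * norm h" by (simp add: mult.commute)
    qed
  qed auto
  then show ?thesis by simp
qed

text \<open>A local flow in one chart, known only through the differential equation; its
  differentiability in the initial value is the goal. Orbits starting in the ball of radius
  \<open>r\<close> stay in the compact convex ball \<open>K\<close>, where \<open>f\<close> has
  uniform constants, and \<open>\<epsilon> \<le> 1\<close> lets one Gronwall constant serve all
  times considered.\<close>

locale smooth_local_flow =
  fixes f :: "'a::euclidean_space \<Rightarrow> 'a" and F :: "'a \<Rightarrow> 'a \<Rightarrow>\<^sub>L 'a" and u0 :: 'a and r \<epsilon> :: real
    and \<xi> :: "real \<Rightarrow> 'a \<Rightarrow> 'a"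
  assumes F_on_cball: "x \<in> cball u0 (2 * r) \<Longrightarrow> (f has_derivative blinfun_apply (F x)) (at x)"
    and F_continuous_on_cball: "continuous_on (cball u0 (2 * r)) F"
    and r: "r > 0" and \<epsilon>: "\<epsilon> > 0" "\<epsilon> \<le> 1"
    and \<xi>_in_cball: "u \<in> ball u0 r \<Longrightarrow> \<bar>t\<bar> \<le> \<epsilon> \<Longrightarrow> \<xi> t u \<in> cball u0 (2 * r)"
    and \<xi>_0: "u \<in> ball u0 r \<Longrightarrow> \<xi> 0 u = u"
    and \<xi>_ode: "u \<in> ball u0 r \<Longrightarrow> \<bar>t\<bar> \<le> \<epsilon> \<Longrightarrow> ((\<lambda>s. \<xi> s u) has_vector_derivative f (\<xi> t u)) (at t)"
begin

definition K :: "'a set" where "K = cball u0 (2 * r)"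

lemmas F = F_on_cball[folded K_def]
  and F_continuous = F_continuous_on_cball[folded K_def]
  and \<xi>_in = \<xi>_in_cball[folded K_def]

lemma compact_K: "compact K" and convex_K: "convex K"
  by (simp_all add: K_def)

definition L :: real where "L = (SOME L. L > 0 \<and> (\<forall>x\<in>K. norm (F x) \<le> L))"

lemma L: "L > 0" "x \<in> K \<Longrightarrow> norm (F x) \<le> L"
proof -
  have "bounded (F ` K)"
    by (rule compact_imp_bounded[OF compact_continuous_image[OF F_continuous compact_K]])
  then have "\<exists>L>0. \<forall>x\<in>K. norm (F x) \<le> L" unfolding bounded_pos by auto
  then have "L > 0 \<and> (\<forall>x\<in>K. norm (F x) \<le> L)"
    unfolding L_def by (rule someI_ex)
  then show "L > 0" "x \<in> K \<Longrightarrow> norm (F x) \<le> L" by auto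
qed

lemma F_bound: "x \<in> K \<Longrightarrow> norm (F x h) \<le> L * norm h"
  using norm_blinfun[of "F x" h] L(2)[of x] by (meson mult_right_mono norm_ge_zero order_trans)

text \<open>A relation instead of a function, so that each estimate holds for any admissible pair
  and \<eta> can be chosen last.\<close>

definition modulus :: "real \<Rightarrow> real \<Rightarrow> bool" where
  "modulus \<eta> \<delta> \<longleftrightarrow> 0 < \<eta> \<and> 0 < \<delta> \<and> (\<forall>x\<in>K. \<forall>y\<in>K. norm (x - y) \<le> \<delta> \<longrightarrow> norm (F x - F y) \<le> \<eta>)"

lemma modulus_exists:
  assumes "\<eta> > 0" obtains \<delta> where "modulus \<eta> \<delta>"
proof -
  have "uniformly_continuous_on K F"
    by (rule compact_uniformly_continuous[OF F_continuous compact_K])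
  then obtain d where d: "d > 0" "\<And>x y. x \<in> K \<Longrightarrow> y \<in> K \<Longrightarrow> dist y x < d \<Longrightarrow> dist (F y) (F x) < \<eta>"
    using assms unfolding uniformly_continuous_on_def by metis
  have "modulus \<eta> (d / 2)"
    unfolding modulus_def
  proof (intro conjI ballI impI)
    fix x y assume "x \<in> K" "y \<in> K" "norm (x - y) \<le> d / 2"
    then show "norm (F x - F y) \<le> \<eta>" using d(1) d(2)[of y x] by (simp add: dist_norm)
  qed (use assms d in auto)
  then show ?thesis by (rule that)
qed

lemma f_lipschitz: "x \<in> K \<Longrightarrow> y \<in> K \<Longrightarrow> norm (f x - f y) \<le> L * norm (x - y)"
proof (rule differentiable_bound[OF convex_K, of f "\<lambda>x. blinfun_apply (F x)"])
  fix x assume "x \<in> K"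
  then show "(f has_derivative blinfun_apply (F x)) (at x within K)"
    by (rule has_derivative_at_withinI[OF F])
  show "onorm (blinfun_apply (F x)) \<le> L" using L(2)[OF \<open>x \<in> K\<close>] by (simp add: norm_blinfun.rep_eq)
qed

text \<open>The mean value inequality on \<open>K \<inter> cball x \<delta>\<close>, which is convex
  and on which \<open>F\<close> differs from \<open>F x\<close> by at most \<eta>.\<close>

lemma f_linearization:
  assumes m: "modulus \<eta> \<delta>" and x: "x \<in> K" and y: "y \<in> K" and d: "norm (y - x) \<le> \<delta>"
  shows "norm (f y - f x - F x (y - x)) \<le> \<eta> * norm (y - x)"
proof -
  let ?S = "K \<inter> cball x \<delta>"
  have conv: "convex ?S" by (intro convex_Int convex_K convex_cball)
  have S: "x \<in> ?S" "y \<in> ?S" using x y d m by (auto simp: modulus_def dist_norm norm_minus_commute)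
  have "norm (f y - f x - F x (y - x)) \<le> norm (y - x) * \<eta>"
  proof (rule differentiable_bound_linearization[of x y ?S f "\<lambda>x. blinfun_apply (F x)"])
    fix t :: real assume "t \<in> {0..1}"
    then show "x + t *\<^sub>R (y - x) \<in> ?S"
      using convexD_alt[OF conv S, of t] by (simp add: algebra_simps)
  next
    fix z assume z: "z \<in> ?S"
    then show "(f has_derivative blinfun_apply (F z)) (at z within ?S)"
      using F by (auto intro: has_derivative_at_withinI)
    have "norm (F z - F x) \<le> \<eta>" using m z x by (auto simp: modulus_def dist_norm norm_minus_commute)
    then show "onorm (blinfun_apply (F z) - blinfun_apply (F x)) \<le> \<eta>"
      by (simp add: norm_blinfun.rep_eq minus_blinfun.rep_eq fun_diff_def)
  qed (rule S)
  then show ?thesis by (simp add: mult.commute)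
qed

definition \<Delta> :: "real \<Rightarrow> 'a \<Rightarrow> 'a \<Rightarrow> 'a" where "\<Delta> t u h = \<xi> t (u + h) - \<xi> t u"

definition B :: real where "B = exp (2 * L + 1)"

lemma B: "B \<ge> 1" using L(1) by (simp add: B_def)

lemma gronwall_unit:
  assumes z: "\<And>s. \<bar>s\<bar> \<le> \<bar>t\<bar> \<Longrightarrow> (z has_vector_derivative z' s) (at s)"
    and bound: "\<And>s. \<bar>s\<bar> \<le> \<bar>t\<bar> \<Longrightarrow> norm (z' s) \<le> L * norm (z s) + b"
    and t: "\<bar>t\<bar> \<le> \<epsilon>" and "b \<ge> 0"
  shows "norm (z t :: 'a) \<le> B * (norm (z 0) + b)"
proof -
  have "(norm (z t))\<^sup>2 \<le> exp ((2 * L + 1) * \<bar>t\<bar>) * ((norm (z 0))\<^sup>2 + b\<^sup>2 * \<bar>t\<bar>)"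
    by (rule gronwall_square[OF z bound]) (use L(1) in auto)
  also have "\<dots> \<le> B * ((norm (z 0) + b)\<^sup>2)"
  proof (rule mult_mono)
    have "(2 * L + 1) * \<bar>t\<bar> \<le> (2 * L + 1) * 1" using L(1) t \<epsilon> by (intro mult_left_mono) auto
    then show "exp ((2 * L + 1) * \<bar>t\<bar>) \<le> B" by (simp add: B_def)
    have "b\<^sup>2 * \<bar>t\<bar> \<le> b\<^sup>2 * 1" using t \<epsilon> by (intro mult_left_mono) auto
    then show "(norm (z 0))\<^sup>2 + b\<^sup>2 * \<bar>t\<bar> \<le> (norm (z 0) + b)\<^sup>2"
      using mult_nonneg_nonneg[OF norm_ge_zero[of "z 0"] \<open>b \<ge> 0\<close>] unfolding power2_sum by linarith
  qed (use B in auto)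
  also have "\<dots> \<le> B\<^sup>2 * (norm (z 0) + b)\<^sup>2"
    using B by (intro mult_right_mono) (auto simp: power2_eq_square)
  also have "\<dots> = (B * (norm (z 0) + b))\<^sup>2" by (simp add: power_mult_distrib)
  finally show ?thesis by (rule power2_le_imp_le) (use B \<open>b \<ge> 0\<close> in simp)
qed

lemma \<Delta>_ode:
  assumes "u \<in> ball u0 r" "u + h \<in> ball u0 r" "\<bar>t\<bar> \<le> \<epsilon>"
  shows "((\<lambda>s. \<Delta> s u h) has_vector_derivative f (\<xi> t (u + h)) - f (\<xi> t u)) (at t)"
  unfolding \<Delta>_def by (intro has_vector_derivative_diff \<xi>_ode assms)

lemma \<Delta>_0: "u \<in> ball u0 r \<Longrightarrow> u + h \<in> ball u0 r \<Longrightarrow> \<Delta> 0 u h = h"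
  by (simp add: \<Delta>_def \<xi>_0)

lemma \<Delta>_bound:
  assumes u: "u \<in> ball u0 r" "u + h \<in> ball u0 r" and t: "\<bar>t\<bar> \<le> \<epsilon>"
  shows "norm (\<Delta> t u h) \<le> B * norm h"
proof -
  have "norm (\<Delta> t u h) \<le> B * (norm (\<Delta> 0 u h) + 0)"
  proof (rule gronwall_unit[of t "\<lambda>s. \<Delta> s u h" "\<lambda>s. f (\<xi> s (u + h)) - f (\<xi> s u)" 0, OF _ _ t])
    fix s assume s: "\<bar>s\<bar> \<le> \<bar>t\<bar>"
    show "((\<lambda>s. \<Delta> s u h) has_vector_derivative f (\<xi> s (u + h)) - f (\<xi> s u)) (at s)"
      using s t by (intro \<Delta>_ode u) simp
    show "norm (f (\<xi> s (u + h)) - f (\<xi> s u)) \<le> L * norm (\<Delta> s u h) + 0"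
      unfolding \<Delta>_def using f_lipschitz[OF \<xi>_in[OF u(2)] \<xi>_in[OF u(1)]] s t by simp
  qed simp
  then show ?thesis by (simp add: \<Delta>_0[OF u])
qed

text \<open>The condition on \<open>B * norm h\<close> keeps the two orbits within \<delta> of each
  other, so that linearising \<open>f\<close> along the orbit of \<open>u\<close> costs only the
  relative error \<eta>.\<close>

lemma remainder:
  assumes m: "modulus \<eta> \<delta>" and u: "u \<in> ball u0 r" "u + h \<in> ball u0 r" and t: "\<bar>t\<bar> \<le> \<epsilon>"
    and h: "B * norm h \<le> \<delta>"
  shows "norm (f (\<xi> t (u + h)) - f (\<xi> t u) - F (\<xi> t u) (\<Delta> t u h)) \<le> \<eta> * (B * norm h)"
proof -
  have "norm (\<xi> t (u + h) - \<xi> t u) \<le> \<delta>"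
    using \<Delta>_bound[OF u t] h unfolding \<Delta>_def by linarith
  then have "norm (f (\<xi> t (u + h)) - f (\<xi> t u) - F (\<xi> t u) (\<Delta> t u h)) \<le> \<eta> * norm (\<Delta> t u h)"
    unfolding \<Delta>_def by (intro f_linearization[OF m] \<xi>_in u t)
  also have "\<dots> \<le> \<eta> * (B * norm h)"
    using \<Delta>_bound[OF u t] m by (intro mult_left_mono) (auto simp: modulus_def)
  finally show ?thesis .
qed

text \<open>Increments of the flow are almost linear in the initial displacement; the derivative is
  obtained from this alone, without solving the variational equation.\<close>
lemma \<Delta>_almost_linear:
  assumes m: "modulus \<eta> \<delta>" and u: "u \<in> ball u0 r" "u + k \<in> ball u0 r" "u + h \<in> ball u0 r" "u + h' \<in> ball u0 r"
    and t: "\<bar>t\<bar> \<le> \<epsilon>" and small: "B * norm k \<le> \<delta>" "B * norm h \<le> \<delta>" "B * norm h' \<le> \<delta>"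
    and k: "k = a *\<^sub>R h + b *\<^sub>R h'"
  shows "norm (\<Delta> t u k - a *\<^sub>R \<Delta> t u h - b *\<^sub>R \<Delta> t u h')
    \<le> B\<^sup>2 * \<eta> * (norm k + \<bar>a\<bar> * norm h + \<bar>b\<bar> * norm h')"
proof -
  define z where "z s = \<Delta> s u k - a *\<^sub>R \<Delta> s u h - b *\<^sub>R \<Delta> s u h'" for s
  define g where "g s h = f (\<xi> s (u + h)) - f (\<xi> s u)" for s h
  define q where "q s h = g s h - F (\<xi> s u) (\<Delta> s u h)" for s h
  define N where "N = norm k + \<bar>a\<bar> * norm h + \<bar>b\<bar> * norm h'"
  have "norm (z t) \<le> B * (norm (z 0) + B * \<eta> * N)"
  proof (rule gronwall_unit[of t z "\<lambda>s. g s k - a *\<^sub>R g s h - b *\<^sub>R g s h'", OF _ _ t])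
    fix s assume "\<bar>s\<bar> \<le> \<bar>t\<bar>"
    then have s: "\<bar>s\<bar> \<le> \<epsilon>" using t by simp
    show "(z has_vector_derivative g s k - a *\<^sub>R g s h - b *\<^sub>R g s h') (at s)"
      unfolding z_def g_def
      by (rule has_vector_derivative_diff[OF has_vector_derivative_diff[OF \<Delta>_ode[OF u(1,2) s]
            bounded_linear.has_vector_derivative[OF bounded_linear_scaleR_right \<Delta>_ode[OF u(1,3) s]]]
            bounded_linear.has_vector_derivative[OF bounded_linear_scaleR_right \<Delta>_ode[OF u(1,4) s]]])
    \<comment> \<open>The increments solve the variational equation along the orbit of
      \<open>u\<close> up to the remainders \<open>q\<close>. As \<open>z\<close> starts at 0,
      Gronwall bounds it by the remainders alone.\<close>
    have "g s k - a *\<^sub>R g s h - b *\<^sub>R g s h'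
      = F (\<xi> s u) (z s) + (q s k - a *\<^sub>R q s h - b *\<^sub>R q s h')"
    proof -
      have "x - a *\<^sub>R y - b *\<^sub>R y' = (p - a *\<^sub>R p1 - b *\<^sub>R p2) + ((x - p) - a *\<^sub>R (y - p1) - b *\<^sub>R (y' - p2))"
        for x y y' p p1 p2 :: 'a by (simp add: algebra_simps)
      then show ?thesis unfolding q_def z_def blinfun.diff_right blinfun.scaleR_right .
    qed
    also have "norm \<dots> \<le> norm (F (\<xi> s u) (z s)) + (norm (q s k) + \<bar>a\<bar> * norm (q s h) + \<bar>b\<bar> * norm (q s h'))"
      using norm_triangle_ineq[of "F (\<xi> s u) (z s)" "q s k - a *\<^sub>R q s h - b *\<^sub>R q s h'"]
        norm_triangle_ineq4[of "q s k - a *\<^sub>R q s h" "b *\<^sub>R q s h'"]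
        norm_triangle_ineq4[of "q s k" "a *\<^sub>R q s h"] by simp
    also have "\<dots> \<le> L * norm (z s) + (\<eta> * (B * norm k) + \<bar>a\<bar> * (\<eta> * (B * norm h)) + \<bar>b\<bar> * (\<eta> * (B * norm h')))"
      unfolding q_def g_def
      using remainder[OF m u(1) u(2) s small(1)] remainder[OF m u(1) u(3) s small(2)]
        remainder[OF m u(1) u(4) s small(3)] F_bound[OF \<xi>_in[OF u(1) s], of "z s"]
      by (intro add_mono mult_left_mono) auto
    also have "\<dots> = L * norm (z s) + B * \<eta> * N" by (simp add: N_def algebra_simps)
    finally show "norm (g s k - a *\<^sub>R g s h - b *\<^sub>R g s h') \<le> L * norm (z s) + B * \<eta> * N" .
  next
    show "B * \<eta> * N \<ge> 0" using B m by (auto simp: N_def modulus_def)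
  qed
  moreover have "z 0 = 0" unfolding z_def using \<Delta>_0 u k by simp
  ultimately show ?thesis by (simp add: z_def N_def power2_eq_square mult_ac)
qed

section \<open>The derivative of the flow as a limit of difference quotients\<close>

definition q :: "real \<Rightarrow> 'a \<Rightarrow> 'a \<Rightarrow> nat \<Rightarrow> 'a" where
  "q t u h n = real (Suc n) *\<^sub>R \<Delta> t u ((1 / real (Suc n)) *\<^sub>R h)"

text \<open>The directional derivative of \<open>\<xi> t\<close> at \<open>u\<close>. Only the
  scales \<open>1 / real (Suc n)\<close> enter; other scales are compared with them through
  \<open>q_close\<close>.\<close>

definition Y :: "real \<Rightarrow> 'a \<Rightarrow> 'a \<Rightarrow> 'a" where "Y t u h = lim (q t u h)"

lemma eventually_small:
  assumes "u \<in> ball u0 r" "\<delta> > 0"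
  shows "\<forall>\<^sub>F n in sequentially. u + (1 / real (Suc n)) *\<^sub>R h \<in> ball u0 r \<and> B * norm ((1 / real (Suc n)) *\<^sub>R h) \<le> \<delta>"
proof -
  have "(\<lambda>n. (1 / real (Suc n)) *\<^sub>R h) \<longlonglongrightarrow> 0 *\<^sub>R h"
    using LIMSEQ_inverse_real_of_nat by (intro tendsto_scaleR tendsto_const) (simp add: inverse_eq_divide)
  then have lim: "(\<lambda>n. (1 / real (Suc n)) *\<^sub>R h) \<longlonglongrightarrow> 0" by simp
  have "(\<lambda>n. u + (1 / real (Suc n)) *\<^sub>R h) \<longlonglongrightarrow> u + 0" by (intro tendsto_intros lim)
  then have 1: "\<forall>\<^sub>F n in sequentially. u + (1 / real (Suc n)) *\<^sub>R h \<in> ball u0 r"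
    using assms(1) topological_tendstoD[OF _ open_ball] by force
  have "(\<lambda>n. B * norm ((1 / real (Suc n)) *\<^sub>R h)) \<longlonglongrightarrow> B * norm (0 :: 'a)" by (intro tendsto_intros lim)
  then have 2: "\<forall>\<^sub>F n in sequentially. B * norm ((1 / real (Suc n)) *\<^sub>R h) < \<delta>"
    using assms(2) by (intro order_tendstoD) auto
  show ?thesis using 1 2 by eventually_elim simp
qed

lemma \<Delta>_homogeneous:
  assumes m: "modulus \<eta> \<delta>" and u: "u \<in> ball u0 r" "u + h \<in> ball u0 r" "u + a *\<^sub>R h \<in> ball u0 r"
    and t: "\<bar>t\<bar> \<le> \<epsilon>" and small: "B * norm h \<le> \<delta>" "B * norm (a *\<^sub>R h) \<le> \<delta>"
  shows "norm (\<Delta> t u (a *\<^sub>R h) - a *\<^sub>R \<Delta> t u h) \<le> 2 * B\<^sup>2 * \<eta> * norm (a *\<^sub>R h)"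
proof -
  have "norm (\<Delta> t u (a *\<^sub>R h) - a *\<^sub>R \<Delta> t u h - 0 *\<^sub>R \<Delta> t u 0)
    \<le> B\<^sup>2 * \<eta> * (norm (a *\<^sub>R h) + \<bar>a\<bar> * norm h + \<bar>0\<bar> * norm (0::'a))"
    by (rule \<Delta>_almost_linear[OF m u(1,3,2) _ t small(2,1)]) (use u m in \<open>simp_all add: modulus_def\<close>)
  then show ?thesis by simp
qed

text \<open>Increments are homogeneous up to a relative error \<eta>, so quotients at two small
  scales differ by a bound independent of the scales and of \<open>u\<close>. This gives convergence
  and, in \<open>Y_close\<close>, uniformity in the base point.\<close>

lemma q_close:
  assumes m: "modulus \<eta> \<delta>" and u: "u \<in> ball u0 r" and t: "\<bar>t\<bar> \<le> \<epsilon>" and "s > 0"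
    and s: "u + s *\<^sub>R h \<in> ball u0 r" "B * norm (s *\<^sub>R h) \<le> \<delta>"
    and n: "u + (1 / real (Suc n)) *\<^sub>R h \<in> ball u0 r" "B * norm ((1 / real (Suc n)) *\<^sub>R h) \<le> \<delta>"
  shows "norm (q t u h n - (1 / s) *\<^sub>R \<Delta> t u (s *\<^sub>R h)) \<le> 2 * B\<^sup>2 * \<eta> * norm h"
proof -
  define N where "N = real (Suc n)"
  have N: "N > 0" by (simp add: N_def)
  note n = n[folded N_def]
  have eq: "(1 / (N * s)) *\<^sub>R s *\<^sub>R h = (1 / N) *\<^sub>R h" using \<open>s > 0\<close> by simp
  have le: "norm (\<Delta> t u ((1 / N) *\<^sub>R h) - (1 / (N * s)) *\<^sub>R \<Delta> t u (s *\<^sub>R h)) \<le> 2 * B\<^sup>2 * \<eta> * norm ((1 / N) *\<^sub>R h)"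
    by (rule \<Delta>_homogeneous[OF m u s(1) _ t s(2), of "1 / (N * s)", unfolded eq]) (rule n)+
  have "q t u h n - (1 / s) *\<^sub>R \<Delta> t u (s *\<^sub>R h)
    = N *\<^sub>R (\<Delta> t u ((1 / N) *\<^sub>R h) - (1 / (N * s)) *\<^sub>R \<Delta> t u (s *\<^sub>R h))"
    unfolding q_def N_def[symmetric] using N by (simp add: scaleR_diff_right)
  then have "norm (q t u h n - (1 / s) *\<^sub>R \<Delta> t u (s *\<^sub>R h))
    = N * norm (\<Delta> t u ((1 / N) *\<^sub>R h) - (1 / (N * s)) *\<^sub>R \<Delta> t u (s *\<^sub>R h))"
    using N by simp
  also have "\<dots> \<le> N * (2 * B\<^sup>2 * \<eta> * norm ((1 / N) *\<^sub>R h))" by (rule mult_left_mono[OF le]) (use N in simp)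
  also have "\<dots> = 2 * B\<^sup>2 * \<eta> * norm h" using N by simp
  finally show ?thesis .
qed

lemma q_limit:
  assumes u: "u \<in> ball u0 r" and t: "\<bar>t\<bar> \<le> \<epsilon>"
  shows "q t u h \<longlonglongrightarrow> Y t u h"
proof -
  have "Cauchy (q t u h)"
    unfolding Cauchy_altdef2
  proof (intro allI impI)
    fix e :: real assume "e > 0"
    define \<eta> where "\<eta> = e / (2 * B\<^sup>2 * (norm h + 1))"
    have den: "2 * B\<^sup>2 * (norm h + 1) > 0" using B by (intro mult_pos_pos) (auto intro: add_nonneg_pos)
    then have \<eta>: "\<eta> > 0" using \<open>e > 0\<close> by (simp add: \<eta>_def)
    have lt: "2 * B\<^sup>2 * \<eta> * norm h < e"
    proof -
      have "2 * B\<^sup>2 * \<eta> * norm h < 2 * B\<^sup>2 * \<eta> * (norm h + 1)"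
        using B \<eta> by (intro mult_strict_left_mono) auto
      also have "\<dots> = \<eta> * (2 * B\<^sup>2 * (norm h + 1))" by (simp only: mult_ac)
      also have "\<dots> = e" unfolding \<eta>_def using den less_imp_neq[OF den] by simp
      finally show ?thesis .
    qed
    obtain \<delta> where m: "modulus \<eta> \<delta>" using modulus_exists[OF \<eta>] .
    then have "\<delta> > 0" by (simp add: modulus_def)
    obtain N where N: "\<And>n. n \<ge> N \<Longrightarrow>
        u + (1 / real (Suc n)) *\<^sub>R h \<in> ball u0 r \<and> B * norm ((1 / real (Suc n)) *\<^sub>R h) \<le> \<delta>"
      using eventually_small[OF u \<open>\<delta> > 0\<close>, of h] unfolding eventually_sequentially by auto
    have "dist (q t u h n) (q t u h N) < e" if "n \<ge> N" for n
    proof -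
      have "norm (q t u h n - (1 / (1 / real (Suc N))) *\<^sub>R \<Delta> t u ((1 / real (Suc N)) *\<^sub>R h)) \<le> 2 * B\<^sup>2 * \<eta> * norm h"
        using N[of N] N[OF that] by (intro q_close[OF m u t]) simp_all
      then show ?thesis using lt by (simp add: dist_norm q_def)
    qed
    then show "\<exists>N. \<forall>n\<ge>N. dist (q t u h n) (q t u h N) < e" by blast
  qed
  then have "convergent (q t u h)" by (rule Cauchy_convergent)
  then show ?thesis unfolding Y_def by (simp add: convergent_LIMSEQ_iff)
qed

lemma Y_close:
  assumes m: "modulus \<eta> \<delta>" and u: "u \<in> ball u0 r" and t: "\<bar>t\<bar> \<le> \<epsilon>" and "s > 0"
    and s: "u + s *\<^sub>R h \<in> ball u0 r" "B * norm (s *\<^sub>R h) \<le> \<delta>"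
  shows "norm (Y t u h - (1 / s) *\<^sub>R \<Delta> t u (s *\<^sub>R h)) \<le> 2 * B\<^sup>2 * \<eta> * norm h"
proof -
  have "(\<lambda>n. norm (q t u h n - (1 / s) *\<^sub>R \<Delta> t u (s *\<^sub>R h))) \<longlonglongrightarrow> norm (Y t u h - (1 / s) *\<^sub>R \<Delta> t u (s *\<^sub>R h))"
    by (intro tendsto_intros q_limit u t)
  moreover have "\<delta> > 0" using m by (simp add: modulus_def)
  have "\<forall>\<^sub>F n in sequentially. norm (q t u h n - (1 / s) *\<^sub>R \<Delta> t u (s *\<^sub>R h)) \<le> 2 * B\<^sup>2 * \<eta> * norm h"
    using eventually_small[OF u \<open>\<delta> > 0\<close>, of h]
    by eventually_elim (rule q_close[OF m u t \<open>s > 0\<close> s], simp_all)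
  ultimately show ?thesis by (rule tendsto_upperbound) simp
qed

lemma Y_bound:
  assumes u: "u \<in> ball u0 r" and t: "\<bar>t\<bar> \<le> \<epsilon>"
  shows "norm (Y t u h) \<le> B * norm h"
proof -
  have "(\<lambda>n. norm (q t u h n)) \<longlonglongrightarrow> norm (Y t u h)" by (intro tendsto_intros q_limit u t)
  moreover have "\<forall>\<^sub>F n in sequentially. norm (q t u h n) \<le> B * norm h"
    using eventually_small[OF u zero_less_one, of h]
  proof eventually_elim
    case (elim n)
    have "norm (q t u h n) = real (Suc n) * norm (\<Delta> t u ((1 / real (Suc n)) *\<^sub>R h))" by (simp add: q_def)
    also have "\<dots> \<le> real (Suc n) * (B * norm ((1 / real (Suc n)) *\<^sub>R h))"
      by (rule mult_left_mono[OF \<Delta>_bound[OF u _ t]]) (use elim in simp_all)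
    finally show ?case by simp
  qed
  ultimately show ?thesis by (rule tendsto_upperbound) simp
qed

lemma Y_combination:
  assumes u: "u \<in> ball u0 r" and t: "\<bar>t\<bar> \<le> \<epsilon>"
  shows "Y t u (a *\<^sub>R h + b *\<^sub>R h') = a *\<^sub>R Y t u h + b *\<^sub>R Y t u h'"
proof -
  let ?k = "a *\<^sub>R h + b *\<^sub>R h'"
  define N where "N = norm ?k + \<bar>a\<bar> * norm h + \<bar>b\<bar> * norm h'"
  have N: "N \<ge> 0" by (simp add: N_def)
  have lim: "(\<lambda>n. norm (q t u ?k n - a *\<^sub>R q t u h n - b *\<^sub>R q t u h' n))
      \<longlonglongrightarrow> norm (Y t u ?k - a *\<^sub>R Y t u h - b *\<^sub>R Y t u h')" by (intro tendsto_intros q_limit u t)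
  have le: "norm (Y t u ?k - a *\<^sub>R Y t u h - b *\<^sub>R Y t u h') \<le> B\<^sup>2 * \<eta> * N" if "\<eta> > 0" for \<eta>
  proof -
    obtain \<delta> where m: "modulus \<eta> \<delta>" using modulus_exists[OF \<open>\<eta> > 0\<close>] .
    then have \<delta>: "\<delta> > 0" by (simp add: modulus_def)
    have "\<forall>\<^sub>F n in sequentially. norm (q t u ?k n - a *\<^sub>R q t u h n - b *\<^sub>R q t u h' n) \<le> B\<^sup>2 * \<eta> * N"
      using eventually_small[OF u \<delta>, of ?k] eventually_small[OF u \<delta>, of h] eventually_small[OF u \<delta>, of h']
    proof eventually_elim
      case (elim n)
      define s where "s = 1 / real (Suc n)"
      have s: "s > 0" "real (Suc n) = 1 / s" "1 / (1 / s) = s" by (simp_all add: s_def)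
      note el = elim[folded s_def]
      have le: "norm (\<Delta> t u (s *\<^sub>R ?k) - a *\<^sub>R \<Delta> t u (s *\<^sub>R h) - b *\<^sub>R \<Delta> t u (s *\<^sub>R h'))
        \<le> B\<^sup>2 * \<eta> * (norm (s *\<^sub>R ?k) + \<bar>a\<bar> * norm (s *\<^sub>R h) + \<bar>b\<bar> * norm (s *\<^sub>R h'))"
        by (rule \<Delta>_almost_linear[OF m u _ _ _ t]) (use el in \<open>auto simp: algebra_simps\<close>)
      also have "\<dots> = s * (B\<^sup>2 * \<eta> * N)" using s(1) unfolding N_def norm_scaleR by (simp add: algebra_simps)
      finally have le: "norm (\<Delta> t u (s *\<^sub>R ?k) - a *\<^sub>R \<Delta> t u (s *\<^sub>R h) - b *\<^sub>R \<Delta> t u (s *\<^sub>R h')) \<le> s * (B\<^sup>2 * \<eta> * N)" .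
      have "q t u ?k n - a *\<^sub>R q t u h n - b *\<^sub>R q t u h' n
        = (1 / s) *\<^sub>R (\<Delta> t u (s *\<^sub>R ?k) - a *\<^sub>R \<Delta> t u (s *\<^sub>R h) - b *\<^sub>R \<Delta> t u (s *\<^sub>R h'))"
        unfolding q_def s(2,3) by (simp only: scaleR_diff_right scaleR_scaleR mult.commute)
      then have "norm (q t u ?k n - a *\<^sub>R q t u h n - b *\<^sub>R q t u h' n)
        = norm (\<Delta> t u (s *\<^sub>R ?k) - a *\<^sub>R \<Delta> t u (s *\<^sub>R h) - b *\<^sub>R \<Delta> t u (s *\<^sub>R h')) / s"
        using s(1) by simp
      also have "\<dots> \<le> B\<^sup>2 * \<eta> * N" using le s(1) by (simp only: pos_divide_le_eq mult.commute)
      finally show ?case .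
    qed
    with lim show ?thesis by (rule tendsto_upperbound) simp
  qed
  have "norm (Y t u ?k - a *\<^sub>R Y t u h - b *\<^sub>R Y t u h') \<le> 0"
  proof (rule field_le_epsilon)
    fix e :: real assume "e > 0"
    have pos: "B\<^sup>2 * (N + 1) > 0" using B N by (intro mult_pos_pos) auto
    have "norm (Y t u ?k - a *\<^sub>R Y t u h - b *\<^sub>R Y t u h') \<le> B\<^sup>2 * (e / (B\<^sup>2 * (N + 1))) * N"
      by (rule le) (use pos \<open>e > 0\<close> in simp)
    also have "\<dots> \<le> B\<^sup>2 * (e / (B\<^sup>2 * (N + 1))) * (N + 1)"
      using N \<open>e > 0\<close> by (intro mult_left_mono) auto
    also have "\<dots> = e" using pos by (simp add: field_simps)
    finally show "norm (Y t u ?k - a *\<^sub>R Y t u h - b *\<^sub>R Y t u h') \<le> 0 + e" by simp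
  qed
  then show ?thesis by (simp add: algebra_simps)
qed

lemma Y_linear:
  assumes u: "u \<in> ball u0 r" and t: "\<bar>t\<bar> \<le> \<epsilon>"
  shows "linear (Y t u)"
proof (rule linearI)
  fix h h' a
  show "Y t u (h + h') = Y t u h + Y t u h'" using Y_combination[OF u t, of 1 h 1 h'] by simp
  show "Y t u (a *\<^sub>R h) = a *\<^sub>R Y t u h" using Y_combination[OF u t, of a h 0 h] by simp
qed

text \<open>For \<open>s = 1\<close> the bound of \<open>Y_close\<close> is a small multiple of
  \<open>norm h\<close>, uniformly over all directions, which is Frechet differentiability and not
  merely a derivative along each line.\<close>

lemma flow_has_derivative:
  assumes u: "u \<in> ball u0 r" and t: "\<bar>t\<bar> \<le> \<epsilon>"
  shows "(\<xi> t has_derivative Y t u) (at u)"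
  unfolding has_derivative_at_alt
proof (intro conjI allI impI)
  show "bounded_linear (Y t u)" using Y_linear[OF u t] by (rule linear_conv_bounded_linear[THEN iffD1])
  fix e :: real assume "e > 0"
  have pos: "2 * B\<^sup>2 > 0" using B by simp
  then have "e / (2 * B\<^sup>2) > 0" using \<open>e > 0\<close> by simp
  then obtain \<delta> where m: "modulus (e / (2 * B\<^sup>2)) \<delta>" by (rule modulus_exists)
  obtain d where d: "d > 0" "ball u d \<subseteq> ball u0 r"
    using u open_ball[of u0 r] unfolding open_contains_ball by blast
  show "\<exists>d>0. \<forall>y. norm (y - u) < d \<longrightarrow> norm (\<xi> t y - \<xi> t u - Y t u (y - u)) \<le> e * norm (y - u)"
  proof (intro exI[of _ "min d (\<delta> / B)"] conjI allI impI)
    show "min d (\<delta> / B) > 0" using d m B by (simp add: modulus_def)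
    fix y assume y: "norm (y - u) < min d (\<delta> / B)"
    have "norm (Y t u (y - u) - (1 / 1) *\<^sub>R \<Delta> t u (1 *\<^sub>R (y - u))) \<le> 2 * B\<^sup>2 * (e / (2 * B\<^sup>2)) * norm (y - u)"
    proof (rule Y_close[OF m u t])
      have "y \<in> ball u d" using y by (simp add: dist_norm norm_minus_commute)
      then show "u + 1 *\<^sub>R (y - u) \<in> ball u0 r" using d by auto
      show "B * norm (1 *\<^sub>R (y - u)) \<le> \<delta>" using y B by (simp add: pos_less_divide_eq mult.commute)
    qed simp
    then show "norm (\<xi> t y - \<xi> t u - Y t u (y - u)) \<le> e * norm (y - u)"
      using pos by (simp add: \<Delta>_def norm_minus_commute)
  qed
qed

text \<open>Near \<open>u\<close> the quotient at one fixed small scale approximates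
  \<open>Y\<close> uniformly, and it is continuous because the flow is; three errors of at most
  \<open>e / 4\<close> add up.\<close>

lemma Y_continuous:
  assumes t: "\<bar>t\<bar> \<le> \<epsilon>" shows "continuous_on (ball u0 r) (\<lambda>u. Y t u h)"
proof (rule continuous_at_imp_continuous_on, rule ballI)
  fix u assume u: "u \<in> ball u0 r"
  show "isCont (\<lambda>u. Y t u h) u"
    unfolding continuous_at_eps_delta
  proof (intro allI impI)
    fix e :: real assume "e > 0"
    define \<eta> where "\<eta> = e / (8 * B\<^sup>2 * (norm h + 1))"
    have den: "8 * B\<^sup>2 * (norm h + 1) > 0" using B by (intro mult_pos_pos) (auto intro: add_nonneg_pos)
    then have \<eta>: "\<eta> > 0" using \<open>e > 0\<close> by (simp add: \<eta>_def)
    have small: "2 * B\<^sup>2 * \<eta> * norm h \<le> e / 4"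
    proof -
      have "2 * B\<^sup>2 * \<eta> * norm h \<le> 2 * B\<^sup>2 * \<eta> * (norm h + 1)" using B \<eta> by (intro mult_left_mono) auto
      also have "\<dots> = \<eta> * (8 * B\<^sup>2 * (norm h + 1)) / 4" by simp
      also have "\<dots> = e / 4" unfolding \<eta>_def using den less_imp_neq[OF den] by simp
      finally show ?thesis .
    qed
    obtain \<delta> where m: "modulus \<eta> \<delta>" using modulus_exists[OF \<eta>] .
    then have "\<delta> > 0" by (simp add: modulus_def)
    obtain n where n: "u + (1 / real (Suc n)) *\<^sub>R h \<in> ball u0 r" "B * norm ((1 / real (Suc n)) *\<^sub>R h) \<le> \<delta>"
      using eventually_happens[OF eventually_small[OF u \<open>\<delta> > 0\<close>, of h]] by auto
    define s where "s = 1 / real (Suc n)"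
    have s: "s > 0" by (simp add: s_def)
    define D where "D v = (1 / s) *\<^sub>R \<Delta> t v (s *\<^sub>R h)" for v
    have "isCont (\<lambda>v. \<xi> t (v + s *\<^sub>R h) - \<xi> t v) u"
    proof (rule continuous_diff[OF isCont_o2[of _ "\<lambda>v. v + s *\<^sub>R h"]])
      show "isCont (\<xi> t) u" "isCont (\<xi> t) (u + s *\<^sub>R h)"
        using has_derivative_continuous[OF flow_has_derivative[OF _ t]] u n by (simp_all add: s_def)
      show "isCont (\<lambda>v. v + s *\<^sub>R h) u" by (intro continuous_intros)
    qed
    then have "isCont D u" unfolding D_def \<Delta>_def by (rule continuous_scaleR[OF continuous_const])
    then have "\<forall>\<^sub>F v in at u. dist (D v) (D u) < e / 4"
      using \<open>e > 0\<close> unfolding isCont_def by (intro tendstoD) auto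
    moreover have "\<forall>\<^sub>F v in at u. v \<in> ball u0 r" by (rule eventually_at_in_open'[OF open_ball u])
    moreover have "\<forall>\<^sub>F v in at u. v + s *\<^sub>R h \<in> ball u0 r"
    proof -
      have "((\<lambda>v. v + s *\<^sub>R h) \<longlongrightarrow> u + s *\<^sub>R h) (at u)" by (intro tendsto_intros)
      then show ?thesis using n(1) unfolding s_def by (intro topological_tendstoD[OF _ open_ball]) auto
    qed
    ultimately have "\<forall>\<^sub>F v in at u. dist (Y t v h) (Y t u h) < e"
    proof eventually_elim
      case (elim v)
      have "norm (Y t v h - D v) \<le> 2 * B\<^sup>2 * \<eta> * norm h" unfolding D_def
        by (rule Y_close[OF m elim(2) t s elim(3)]) (use n in \<open>simp add: s_def\<close>)
      moreover have "norm (Y t u h - D u) \<le> 2 * B\<^sup>2 * \<eta> * norm h" unfolding D_def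
        by (rule Y_close[OF m u t s]) (use n in \<open>simp_all add: s_def\<close>)
      ultimately have "dist (Y t v h) (D v) \<le> e / 4" "dist (D u) (Y t u h) \<le> e / 4"
        using small by (auto simp: dist_norm norm_minus_commute)
      then show ?case using elim(1) dist_triangle[of "Y t v h" "Y t u h" "D v"]
          dist_triangle[of "D v" "Y t u h" "D u"] \<open>e > 0\<close> by linarith
    qed
    then show "\<exists>d>0. \<forall>x'. dist x' u < d \<longrightarrow> dist (Y t x' h) (Y t u h) < e"
      unfolding eventually_at
    proof (elim exE conjE, intro exI conjI allI impI)
      fix d x' assume d: "\<forall>x\<in>UNIV. x \<noteq> u \<and> dist x u < d \<longrightarrow> dist (Y t x h) (Y t u h) < e" "dist x' u < d"
      show "dist (Y t x' h) (Y t u h) < e" using d \<open>e > 0\<close> by (cases "x' = u") auto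
    qed
  qed
qed

text \<open>The variational equation to first order at time 0. This suffices for the trace formula
  there, and the cocycle property takes care of all other times.\<close>

lemma Y_expansion:
  assumes m: "modulus \<eta> \<delta>" and u: "u \<in> ball u0 r" and t: "\<bar>t\<bar> \<le> \<epsilon>"
    and near: "\<And>s. \<bar>s\<bar> \<le> \<bar>t\<bar> \<Longrightarrow> norm (\<xi> s u - u) \<le> \<delta>"
  shows "norm (Y t u h - h - t *\<^sub>R F u h) \<le> (2 * \<eta> * B + L\<^sup>2 * B * \<bar>t\<bar>) * norm h * \<bar>t\<bar>"
proof -
  define R where "R = (2 * \<eta> * B + L\<^sup>2 * B * \<bar>t\<bar>) * \<bar>t\<bar>"
  have uK: "u \<in> K" using \<xi>_in[OF u, of 0] \<xi>_0[OF u] \<epsilon> by simp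
  have le: "norm (\<Delta> t u k - k - t *\<^sub>R F u k) \<le> R * norm k"
    if k: "u + k \<in> ball u0 r" "B * norm k \<le> \<delta>" for k
  proof -
    \<comment> \<open>\<open>z\<close> is the deviation of an increment from its first-order
      expansion. Its derivative is small because \<open>F\<close> varies little along the short
      orbit and the increment has moved little from \<open>k\<close>.\<close>
    define z where "z s = \<Delta> s u k - k - s *\<^sub>R F u k" for s
    have diff: "norm (\<Delta> s u k - k) \<le> L * B * norm k * \<bar>s\<bar>" if s: "\<bar>s\<bar> \<le> \<epsilon>" for s
    proof -
      have "norm (\<Delta> s u k - \<Delta> 0 u k) \<le> L * (B * norm k) * \<bar>s\<bar>"
      proof (rule vector_increment_bound[of s "\<lambda>s. \<Delta> s u k"])
        fix s' assume "\<bar>s'\<bar> \<le> \<bar>s\<bar>"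
        then have s': "\<bar>s'\<bar> \<le> \<epsilon>" using s by simp
        then show "((\<lambda>s. \<Delta> s u k) has_vector_derivative f (\<xi> s' (u + k)) - f (\<xi> s' u)) (at s')"
          by (intro \<Delta>_ode u k)
        have "norm (f (\<xi> s' (u + k)) - f (\<xi> s' u)) \<le> L * norm (\<Delta> s' u k)"
          unfolding \<Delta>_def by (intro f_lipschitz \<xi>_in u k s')
        also have "\<dots> \<le> L * (B * norm k)"
          using \<Delta>_bound[OF u k(1) s'] L(1) by simp
        finally show "norm (f (\<xi> s' (u + k)) - f (\<xi> s' u)) \<le> L * (B * norm k)" .
      qed
      then show ?thesis using \<Delta>_0[OF u k(1)] by (simp add: mult.assoc)
    qed
    have "norm (z t - z 0) \<le> ((2 * \<eta> * B + L\<^sup>2 * B * \<bar>t\<bar>) * norm k) * \<bar>t\<bar>"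
    proof (rule vector_increment_bound[of t z])
      fix s assume st: "\<bar>s\<bar> \<le> \<bar>t\<bar>"
      then have s: "\<bar>s\<bar> \<le> \<epsilon>" using t by simp
      let ?g = "f (\<xi> s (u + k)) - f (\<xi> s u)"
      show "(z has_vector_derivative ?g - F u k) (at s)"
        unfolding z_def by (rule derivative_eq_intros \<Delta>_ode[OF u k(1) s] refl)+ simp
      have "?g - F u k = (?g - F (\<xi> s u) (\<Delta> s u k)) + ((F (\<xi> s u) - F u) (\<Delta> s u k) + F u (\<Delta> s u k - k))"
        by (simp add: blinfun.diff_left blinfun.diff_right)
      also have "norm \<dots> \<le> norm (?g - F (\<xi> s u) (\<Delta> s u k)) + (norm ((F (\<xi> s u) - F u) (\<Delta> s u k)) + norm (F u (\<Delta> s u k - k)))"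
        by (rule order_trans[OF norm_triangle_ineq add_left_mono[OF norm_triangle_ineq]])
      also have "\<dots> \<le> \<eta> * (B * norm k) + (\<eta> * (B * norm k) + L * (L * B * norm k * \<bar>t\<bar>))"
      proof (intro add_mono)
        show "norm (?g - F (\<xi> s u) (\<Delta> s u k)) \<le> \<eta> * (B * norm k)" by (rule remainder[OF m u k(1) s k(2)])
        have "norm (F (\<xi> s u) - F u) \<le> \<eta>"
          using m near[OF st] \<xi>_in[OF u s] uK by (auto simp: modulus_def)
        then have "norm (F (\<xi> s u) - F u) * norm (\<Delta> s u k) \<le> \<eta> * (B * norm k)"
          using \<Delta>_bound[OF u k(1) s] m by (intro mult_mono) (auto simp: modulus_def)
        then show "norm ((F (\<xi> s u) - F u) (\<Delta> s u k)) \<le> \<eta> * (B * norm k)"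
          by (rule order_trans[OF norm_blinfun])
        have "norm (F u (\<Delta> s u k - k)) \<le> L * norm (\<Delta> s u k - k)" by (rule F_bound[OF uK])
        also have "\<dots> \<le> L * (L * B * norm k * \<bar>s\<bar>)" using diff[OF s] L(1) by simp
        also have "\<dots> \<le> L * (L * B * norm k * \<bar>t\<bar>)"
          using st L(1) B by (intro mult_left_mono) auto
        finally show "norm (F u (\<Delta> s u k - k)) \<le> L * (L * B * norm k * \<bar>t\<bar>)" .
      qed
      also have "\<dots> = (2 * \<eta> * B + L\<^sup>2 * B * \<bar>t\<bar>) * norm k"
        by (simp add: power2_eq_square algebra_simps)
      finally show "norm (?g - F u k) \<le> (2 * \<eta> * B + L\<^sup>2 * B * \<bar>t\<bar>) * norm k" .
    qed
    moreover have "z 0 = 0" by (simp add: z_def \<Delta>_0[OF u k(1)])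
    ultimately have "norm (z t) \<le> R * norm k" by (simp add: R_def mult_ac)
    then show ?thesis by (simp only: z_def)
  qed
  have \<delta>: "\<delta> > 0" using m by (simp add: modulus_def)
  have "(\<lambda>n. norm (q t u h n - h - t *\<^sub>R F u h)) \<longlonglongrightarrow> norm (Y t u h - h - t *\<^sub>R F u h)"
    by (intro tendsto_intros q_limit u t)
  moreover have "\<forall>\<^sub>F n in sequentially. norm (q t u h n - h - t *\<^sub>R F u h) \<le> R * norm h"
    using eventually_small[OF u \<delta>, of h]
  proof eventually_elim
    case (elim n)
    define s where "s = 1 / real (Suc n)"
    have s: "s > 0" "real (Suc n) = 1 / s" "1 / (1 / s) = s" by (simp_all add: s_def)
    note el = elim[folded s_def]
    have "norm (\<Delta> t u (s *\<^sub>R h) - s *\<^sub>R h - t *\<^sub>R F u (s *\<^sub>R h)) \<le> R * norm (s *\<^sub>R h)"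
      using el by (intro le) auto
    then have le: "norm (\<Delta> t u (s *\<^sub>R h) - s *\<^sub>R h - t *\<^sub>R F u (s *\<^sub>R h)) \<le> (R * norm h) * s"
      using s(1) by (simp add: mult_ac)
    have "q t u h n - h - t *\<^sub>R F u h = (1 / s) *\<^sub>R (\<Delta> t u (s *\<^sub>R h) - s *\<^sub>R h - t *\<^sub>R F u (s *\<^sub>R h))"
      unfolding q_def s(2,3) using s(1) by (simp add: scaleR_diff_right blinfun.scaleR_right)
    then have "norm (q t u h n - h - t *\<^sub>R F u h)
      = norm (\<Delta> t u (s *\<^sub>R h) - s *\<^sub>R h - t *\<^sub>R F u (s *\<^sub>R h)) / s" using s(1) by simp
    also have "\<dots> \<le> R * norm h" using le s(1) by (simp only: pos_divide_le_eq)
    finally show ?case .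
  qed
  ultimately have "norm (Y t u h - h - t *\<^sub>R F u h) \<le> R * norm h" by (rule tendsto_upperbound) simp
  then show ?thesis by (simp add: R_def mult_ac)
qed

lemma Y_0: assumes u: "u \<in> ball u0 r" shows "Y 0 u h = h"
proof -
  obtain \<delta> where m: "modulus 1 \<delta>" using modulus_exists[OF zero_less_one] .
  then have "norm (Y 0 u h - h - 0 *\<^sub>R F u h) \<le> (2 * 1 * B + L\<^sup>2 * B * \<bar>0\<bar>) * norm h * \<bar>0\<bar>"
    using \<epsilon> \<xi>_0[OF u] by (intro Y_expansion[OF m u]) (auto simp: modulus_def)
  then show ?thesis by simp
qed

lemma Y_derivative_at_0:
  assumes u: "u \<in> ball u0 r"
  shows "((\<lambda>t. Y t u h) has_vector_derivative F u h) (at 0)"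
  unfolding has_vector_derivative_def has_derivative_at_alt
proof (intro conjI allI impI)
  show "bounded_linear (\<lambda>x. x *\<^sub>R F u h)" by (rule bounded_linear_scaleR_left)
  fix e :: real assume "e > 0"
  define M where "M = (2 * B + L\<^sup>2 * B) * (norm h + 1)"
  have "2 * B + L\<^sup>2 * B > 0" using B by (intro add_pos_nonneg) auto
  then have M: "M > 0" unfolding M_def by (intro mult_pos_pos) (auto intro: add_nonneg_pos)
  define \<eta> where "\<eta> = e / M"
  have \<eta>: "\<eta> > 0" using M \<open>e > 0\<close> by (simp add: \<eta>_def)
  obtain \<delta> where m: "modulus \<eta> \<delta>" using modulus_exists[OF \<eta>] .
  have "isCont (\<lambda>s. \<xi> s u) 0"
    using \<xi>_ode[OF u, of 0] \<epsilon> by (auto intro: has_vector_derivative_continuous)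
  then obtain d where d: "d > 0" "\<And>s. dist s 0 < d \<Longrightarrow> dist (\<xi> s u) (\<xi> 0 u) < \<delta>"
    using m unfolding continuous_at_eps_delta modulus_def by metis
  define d' where "d' = min d (min \<epsilon> \<eta>)"
  show "\<exists>d>0. \<forall>y. norm (y - 0) < d \<longrightarrow> norm (Y y u h - Y 0 u h - (y - 0) *\<^sub>R F u h) \<le> e * norm (y - 0)"
  proof (intro exI[of _ d'] conjI allI impI)
    show "d' > 0" using d \<epsilon> \<eta> by (simp add: d'_def)
    fix t :: real assume "norm (t - 0) < d'"
    then have t: "\<bar>t\<bar> < d" "\<bar>t\<bar> \<le> \<epsilon>" "\<bar>t\<bar> \<le> \<eta>" by (auto simp: d'_def)
    have "norm (Y t u h - h - t *\<^sub>R F u h) \<le> (2 * \<eta> * B + L\<^sup>2 * B * \<bar>t\<bar>) * norm h * \<bar>t\<bar>"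
    proof (rule Y_expansion[OF m u t(2)])
      fix s assume "\<bar>s\<bar> \<le> \<bar>t\<bar>"
      then show "norm (\<xi> s u - u) \<le> \<delta>" using d(2)[of s] t(1) \<xi>_0[OF u] by (simp add: dist_norm)
    qed
    also have "\<dots> \<le> e * \<bar>t\<bar>"
    proof (rule mult_right_mono)
      have "L\<^sup>2 * B * \<bar>t\<bar> \<le> L\<^sup>2 * B * \<eta>" using t(3) B by (intro mult_left_mono) auto
      then have "(2 * \<eta> * B + L\<^sup>2 * B * \<bar>t\<bar>) * norm h \<le> (2 * \<eta> * B + L\<^sup>2 * B * \<eta>) * (norm h + 1)"
        using B \<eta> by (intro mult_mono) auto
      also have "\<dots> = \<eta> * M" by (simp add: M_def algebra_simps)
      also have "\<dots> = e" using M by (simp add: \<eta>_def)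
      finally show "(2 * \<eta> * B + L\<^sup>2 * B * \<bar>t\<bar>) * norm h \<le> e" .
    qed simp
    finally show "norm (Y t u h - Y 0 u h - (t - 0) *\<^sub>R F u h) \<le> e * norm (t - 0)" by (simp add: Y_0[OF u])
  qed
qed

end

section \<open>Differentiable maps and fields of forms on a compact manifold\<close>

text \<open>In finite dimension continuity on each fixed vector gives joint continuity, by expanding
  the argument in a basis.\<close>

lemma continuous_on_linear_apply:
  fixes T :: "'b::topological_space \<Rightarrow> 'a::euclidean_space \<Rightarrow> 'c::real_normed_vector"
  assumes lin: "\<And>u. u \<in> S \<Longrightarrow> linear (T u)" and T: "\<And>v. continuous_on S (\<lambda>u. T u v)"
    and w: "continuous_on S w"
  shows "continuous_on S (\<lambda>u. T u (w u))"
proof -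
  have "T u (w u) = (\<Sum>b\<in>Basis. (w u \<bullet> b) *\<^sub>R T u b)" if "u \<in> S" for u
  proof -
    have "T u (w u) = T u (\<Sum>b\<in>Basis. (w u \<bullet> b) *\<^sub>R b)" by (simp add: euclidean_representation)
    then show ?thesis by (simp add: linear_sum[OF lin[OF that]] linear_scale[OF lin[OF that]])
  qed
  moreover have "continuous_on S (\<lambda>u. \<Sum>b\<in>Basis. (w u \<bullet> b) *\<^sub>R T u b)"
    by (intro continuous_on_sum continuous_on_scaleR continuous_on_inner w continuous_on_const T)
  ultimately show ?thesis by (simp cong: continuous_on_cong)
qed

text \<open>The coefficients are expressed through values at fixed vectors, whose continuity is what
  the definition of a field of forms provides.\<close>

lemma quadratic_form_expand:
  fixes Q :: "'a::euclidean_space \<Rightarrow> real"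
  assumes "quadratic_form Q"
  shows "Q w = (\<Sum>a\<in>Basis. \<Sum>b\<in>Basis. (w \<bullet> a) * (w \<bullet> b) * ((Q (a + b) - Q a - Q b) / 2))"
proof -
  obtain B where B: "bilinear B" "\<And>v w. B v w = B w v" "\<And>v. Q v = B v v"
    using quadratic_formE[OF assms] by metis
  have "Q w = B (\<Sum>a\<in>Basis. (w \<bullet> a) *\<^sub>R a) (\<Sum>b\<in>Basis. (w \<bullet> b) *\<^sub>R b)"
    by (simp add: B(3) euclidean_representation)
  also have "\<dots> = (\<Sum>(a, b)\<in>Basis \<times> Basis. B ((w \<bullet> a) *\<^sub>R a) ((w \<bullet> b) *\<^sub>R b))"
    by (rule bilinear_sum[OF B(1)])
  also have "\<dots> = (\<Sum>a\<in>Basis. \<Sum>b\<in>Basis. (w \<bullet> a) * (w \<bullet> b) * B a b)"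
    by (simp add: sum.cartesian_product[symmetric] bilinear_lmul[OF B(1)] bilinear_rmul[OF B(1)] mult_ac)
  also have "(\<lambda>a b. B a b) = (\<lambda>a b. (Q (a + b) - Q a - Q b) / 2)"
    using B(2) by (simp add: fun_eq_iff B(3) bilinear_ladd[OF B(1)] bilinear_radd[OF B(1)])
  finally show ?thesis .
qed

lemma compact_local_to_global:
  fixes P :: "real \<Rightarrow> 'm::topological_space \<Rightarrow> bool"
  assumes "compact (UNIV :: 'm set)"
    and loc: "\<And>x. \<exists>U \<kappa>. open U \<and> x \<in> U \<and> \<kappa> > 0 \<and> (\<forall>y\<in>U. P \<kappa> y)"
    and mono: "\<And>\<kappa> \<kappa>' y. P \<kappa> y \<Longrightarrow> 0 < \<kappa>' \<Longrightarrow> \<kappa>' \<le> \<kappa> \<Longrightarrow> P \<kappa>' y"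
  obtains \<kappa> where "\<kappa> > 0" "\<And>y. P \<kappa> y"
proof -
  obtain U k where U: "\<And>x. open (U x) \<and> x \<in> U x \<and> k x > (0::real) \<and> (\<forall>y\<in>U x. P (k x) y)"
    using loc by metis
  obtain D where D: "finite D" "UNIV \<subseteq> (\<Union>x\<in>D. U x)"
    by (rule compactE_image[OF assms(1), of UNIV U]) (use U in auto)
  have "D \<noteq> {}" using D by auto
  define \<kappa> where "\<kappa> = Min (k ` D)"
  have "\<kappa> > 0" unfolding \<kappa>_def using D(1) \<open>D \<noteq> {}\<close> U by (subst Min_gr_iff) auto
  moreover have "P \<kappa> y" for y
  proof -
    obtain x where x: "x \<in> D" "y \<in> U x" using D(2) by blast
    have "\<kappa> \<le> k x" unfolding \<kappa>_def using D(1) x by simp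
    then show ?thesis using mono[of "k x" y \<kappa>] U x \<open>\<kappa> > 0\<close> by blast
  qed
  ultimately show ?thesis by (rule that)
qed

lemma Ck_on_1: "Ck_on 1 f S \<longleftrightarrow> (\<forall>x\<in>S. f differentiable (at x)) \<and> (\<forall>v. continuous_on S (\<lambda>x. frechet_derivative f (at x) v))"
  by (simp add: One_nat_def)

locale compact_manifold =
  fixes A :: "('m::t2_space, 'n::finite) chart set"
  assumes atlas: "smooth_atlas A" and compact_UNIV: "compact (UNIV :: 'm set)"
begin

lemma chart_at: "chart_at A x \<in> A" "x \<in> fst (chart_at A x)"
proof -
  have "\<exists>c. c \<in> A \<and> x \<in> fst c" using atlas unfolding smooth_atlas_def by (metis UN_E UNIV_I)
  then have "chart_at A x \<in> A \<and> x \<in> fst (chart_at A x)" unfolding chart_at_def by (rule someI_ex)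
  then show "chart_at A x \<in> A" "x \<in> fst (chart_at A x)" by auto
qed

lemma chart:
  assumes "c \<in> A"
  shows "open (fst c)" "open (snd c ` fst c)" "continuous_on (fst c) (snd c)"
    "continuous_on (snd c ` fst c) (chart_inv c)"
    "\<And>x. x \<in> fst c \<Longrightarrow> chart_inv c (snd c x) = x"
    "\<And>u. u \<in> snd c ` fst c \<Longrightarrow> chart_inv c u \<in> fst c"
    "\<And>u. u \<in> snd c ` fst c \<Longrightarrow> snd c (chart_inv c u) = u"
proof -
  have *: "open (fst c) \<and> open (snd c ` fst c) \<and> homeomorphism (fst c) (snd c ` fst c) (snd c) (chart_inv c)"
    using atlas assms unfolding smooth_atlas_def by blast
  then have h: "homeomorphism (fst c) (snd c ` fst c) (snd c) (chart_inv c)" by blast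
  show "open (fst c)" "open (snd c ` fst c)" using * by auto
  show "continuous_on (fst c) (snd c)" "continuous_on (snd c ` fst c) (chart_inv c)"
    using h by (auto simp: homeomorphism_def)
  show inv: "chart_inv c (snd c x) = x" if "x \<in> fst c" for x using h that by (auto simp: homeomorphism_def)
  show "chart_inv c u \<in> fst c" "snd c (chart_inv c u) = u" if "u \<in> snd c ` fst c" for u
    using that inv by auto
qed

lemma open_chart_image:
  assumes "c \<in> A" "open U" "U \<subseteq> fst c" shows "open (snd c ` U)"
proof -
  have "snd c ` U = snd c ` fst c \<inter> chart_inv c -` U"
    using chart(5)[OF assms(1)] assms(3) by force
  then show ?thesis
    using continuous_open_preimage[OF chart(4)[OF assms(1)] chart(2)[OF assms(1)] assms(2)] by simp
qed

lemma open_chart_inv_image: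
  assumes "c \<in> A" "open W" "W \<subseteq> snd c ` fst c" shows "open (chart_inv c ` W)"
proof -
  have "chart_inv c ` W = fst c \<inter> snd c -` W"
    using chart(5,6,7)[OF assms(1)] assms(3) by force
  then show ?thesis
    using continuous_open_preimage[OF chart(3)[OF assms(1)] chart(1)[OF assms(1)] assms(2)] by simp
qed

section \<open>Maps of class C1 and their derivatives in charts\<close>

definition rep :: "('m, 'n) chart \<Rightarrow> ('m, 'n) chart \<Rightarrow> ('m \<Rightarrow> 'm) \<Rightarrow> real ^ 'n \<Rightarrow> real ^ 'n" where
  "rep c d F u = snd d (F (chart_inv c u))"

text \<open>Coordinate changes, tangent maps and the passages to and from coordinates are all
  instances of \<open>D\<close>, as \<open>coords_D\<close> records, so that the one chain rule
  \<open>chain_D\<close> governs them.\<close>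

definition D :: "('m, 'n) chart \<Rightarrow> ('m, 'n) chart \<Rightarrow> ('m \<Rightarrow> 'm) \<Rightarrow> 'm \<Rightarrow> real ^ 'n \<Rightarrow> real ^ 'n" where
  "D c d F x = frechet_derivative (rep c d F) (at (snd c x))"

lemma coords_D: "change_coords c d x = D c d (\<lambda>x. x) x" "to_coords A c x = D (chart_at A x) c (\<lambda>x. x) x"
  "from_coords A c x = D c (chart_at A x) (\<lambda>x. x) x"
  "tangent_map A F x = D (chart_at A x) (chart_at A (F x)) F x"
  by (simp_all add: change_coords_def to_coords_def from_coords_def tangent_map_def D_def rep_def[abs_def] o_def)

text \<open>Stated on a whole neighbourhood, so that the property is open in the point; continuity
  of \<open>F\<close> there makes the preimages open that occur under composition.\<close>

definition C1_in where
  "C1_in c d F x \<longleftrightarrow> c \<in> A \<and> d \<in> A \<and> (\<exists>V. open V \<and> x \<in> V \<and> V \<subseteq> fst c \<and> F ` V \<subseteq> fst d \<and>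
     continuous_on V F \<and> (\<forall>y\<in>V. rep c d F differentiable (at (snd c y))) \<and>
     (\<forall>v. continuous_on V (\<lambda>y. D c d F y v)))"

lemma C1_inE:
  assumes "C1_in c d F x"
  obtains V where "c \<in> A" "d \<in> A" "open V" "x \<in> V" "V \<subseteq> fst c" "F ` V \<subseteq> fst d" "continuous_on V F"
    "\<And>y. y \<in> V \<Longrightarrow> rep c d F differentiable (at (snd c y))" "\<And>v. continuous_on V (\<lambda>y. D c d F y v)"
  using assms unfolding C1_in_def by blast

lemma C1_in_D:
  assumes "C1_in c d F x" shows "(rep c d F has_derivative D c d F x) (at (snd c x))"
  using assms unfolding C1_in_def D_def by (metis frechet_derivative_works)

lemma C1_in_linear: "C1_in c d F x \<Longrightarrow> linear (D c d F x)"
  using C1_in_D has_derivative_linear by blast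

lemma chain_has_derivative:
  assumes F: "C1_in c d F x" and G: "C1_in d e G (F x)"
  shows "(rep c e (\<lambda>x. G (F x)) has_derivative (\<lambda>v. D d e G (F x) (D c d F x v))) (at (snd c x))"
proof -
  obtain V where V: "c \<in> A" "d \<in> A" "open V" "x \<in> V" "V \<subseteq> fst c" "F ` V \<subseteq> fst d"
    using C1_inE[OF F] by metis
  have fx: "rep c d F (snd c x) = snd d (F x)" using V chart(5)[OF V(1)] by (auto simp: rep_def)
  have "(rep d e G \<circ> rep c d F has_derivative D d e G (F x) \<circ> D c d F x) (at (snd c x))"
    using C1_in_D[OF G] by (intro diff_chain_at C1_in_D[OF F]) (simp add: fx)
  then have d: "((\<lambda>u. rep d e G (rep c d F u)) has_derivative (\<lambda>v. D d e G (F x) (D c d F x v))) (at (snd c x))"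
    by (simp add: o_def)
  show ?thesis
  proof (rule has_derivative_transform_within_open[OF d open_chart_image[OF V(1,3,5)]])
    show "snd c x \<in> snd c ` V" using V by auto
    fix u assume "u \<in> snd c ` V"
    then obtain y where y: "y \<in> V" "u = snd c y" by auto
    then have "F y \<in> fst d" "chart_inv c u = y" using V chart(5)[OF V(1)] by auto
    then show "rep d e G (rep c d F u) = rep c e (\<lambda>x. G (F x)) u"
      using chart(5)[OF V(2)] by (simp add: rep_def)
  qed
qed

lemma chain_D:
  assumes F: "C1_in c d F x" and G: "C1_in d e G (F x)"
  shows "D c e (\<lambda>x. G (F x)) x v = D d e G (F x) (D c d F x v)"
  using frechet_derivative_at[OF chain_has_derivative[OF assms]] unfolding D_def[of c e] by metis

lemma C1_in_neighbourhood:
  assumes "C1_in c d F x"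
  obtains V where "open V" "x \<in> V" "continuous_on V F" "V \<subseteq> fst c" "F ` V \<subseteq> fst d" "\<And>y. y \<in> V \<Longrightarrow> C1_in c d F y"
    "\<And>v. continuous_on V (\<lambda>y. D c d F y v)"
proof -
  obtain V where V: "c \<in> A" "d \<in> A" "open V" "x \<in> V" "V \<subseteq> fst c" "F ` V \<subseteq> fst d" "continuous_on V F"
    "\<And>y. y \<in> V \<Longrightarrow> rep c d F differentiable (at (snd c y))" "\<And>v. continuous_on V (\<lambda>y. D c d F y v)"
    using C1_inE[OF assms] by metis
  have "C1_in c d F y" if "y \<in> V" for y unfolding C1_in_def using V that by blast
  then show ?thesis using that V by blast
qed

lemma C1_in_compose:
  assumes F: "C1_in c d F x" and G: "C1_in d e G (F x)"
  shows "C1_in c e (\<lambda>x. G (F x)) x"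
proof -
  obtain V where V: "open V" "x \<in> V" "continuous_on V F" "V \<subseteq> fst c" "F ` V \<subseteq> fst d"
    "\<And>y. y \<in> V \<Longrightarrow> C1_in c d F y" "\<And>v. continuous_on V (\<lambda>y. D c d F y v)"
    using C1_in_neighbourhood[OF F] by metis
  obtain W where W: "open W" "F x \<in> W" "continuous_on W G" "W \<subseteq> fst d" "G ` W \<subseteq> fst e"
    "\<And>y. y \<in> W \<Longrightarrow> C1_in d e G y" "\<And>v. continuous_on W (\<lambda>y. D d e G y v)"
    using C1_in_neighbourhood[OF G] by metis
  let ?V = "V \<inter> F -` W"
  have sub: "?V \<subseteq> V" "F ` ?V \<subseteq> W" by auto
  have cF: "continuous_on ?V F" by (rule continuous_on_subset[OF V(3) sub(1)])
  have "c \<in> A" "e \<in> A" using F G by (auto simp: C1_in_def)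
  moreover have "open ?V" by (rule continuous_open_preimage[OF V(3,1) W(1)])
  moreover have "continuous_on ?V (\<lambda>x. G (F x))"
    by (rule continuous_on_compose2[OF W(3) cF sub(2)])
  moreover have "rep c e (\<lambda>x. G (F x)) differentiable (at (snd c y))" if "y \<in> ?V" for y
    using chain_has_derivative[OF V(6) W(6), of y] that unfolding differentiable_def by blast
  moreover have "continuous_on ?V (\<lambda>y. D c e (\<lambda>x. G (F x)) y v)" for v
  proof -
    have "continuous_on ?V (\<lambda>y. D d e G (F y) (D c d F y v))"
    proof (rule continuous_on_linear_apply[where T = "\<lambda>y. D d e G (F y)" and w = "\<lambda>y. D c d F y v"])
      show "linear (D d e G (F y))" if "y \<in> ?V" for y using that W(6) by (auto intro: C1_in_linear)
      show "continuous_on ?V (\<lambda>y. D d e G (F y) w)" for w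
        by (rule continuous_on_compose2[OF W(7) cF sub(2)])
      show "continuous_on ?V (\<lambda>y. D c d F y v)" by (rule continuous_on_subset[OF V(7) sub(1)])
    qed
    moreover have "D d e G (F y) (D c d F y v) = D c e (\<lambda>x. G (F x)) y v" if "y \<in> ?V" for y
      using chain_D[OF V(6) W(6), of y] that by auto
    ultimately show ?thesis by (rule continuous_on_eq)
  qed
  ultimately show ?thesis unfolding C1_in_def using V W by (intro conjI exI[of _ ?V]) auto
qed

text \<open>For the identity map this is the smoothness of coordinate changes; composing with it
  replaces one chart by another.\<close>

lemma C1_in_id:
  assumes "c \<in> A" "d \<in> A" "x \<in> fst c" "x \<in> fst d"
  shows "C1_in c d (\<lambda>x. x) x"
proof -
  let ?V = "fst c \<inter> fst d"
  have "Ck_on 1 (snd d \<circ> chart_inv c) (snd c ` ?V)"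
    using atlas assms unfolding smooth_atlas_def by blast
  then have ck: "Ck_on 1 (rep c d (\<lambda>x. x)) (snd c ` ?V)" by (simp add: rep_def[abs_def] o_def)
  have "continuous_on ?V (\<lambda>y. D c d (\<lambda>x. x) y v)" for v
  proof -
    have "continuous_on (snd c ` ?V) (\<lambda>u. frechet_derivative (rep c d (\<lambda>x. x)) (at u) v)"
      using ck unfolding Ck_on_1 by blast
    moreover have "continuous_on ?V (snd c)" by (rule continuous_on_subset[OF chart(3)[OF assms(1)]]) auto
    ultimately show ?thesis unfolding D_def by (rule continuous_on_compose2) auto
  qed
  moreover have "open ?V" by (intro open_Int chart(1) assms)
  ultimately show ?thesis using assms ck unfolding C1_in_def Ck_on_1 by (intro conjI exI[of _ ?V]) auto
qed

lemma D_id: assumes "c \<in> A" "x \<in> fst c" shows "D c c (\<lambda>x. x) x v = v"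
proof -
  have "(rep c c (\<lambda>x. x) has_derivative (\<lambda>v. v)) (at (snd c x))"
  proof (rule has_derivative_transform_within_open[OF has_derivative_ident chart(2)[OF assms(1)]])
    fix u assume "u \<in> snd c ` fst c"
    then show "u = rep c c (\<lambda>x. x) u" using chart(7)[OF assms(1)] by (simp add: rep_def)
  qed (use assms in auto)
  then show ?thesis unfolding D_def using frechet_derivative_at by metis
qed

definition C1_map :: "('m \<Rightarrow> 'm) \<Rightarrow> bool" where
  "C1_map F \<longleftrightarrow> (\<forall>x. \<exists>c d. C1_in c d F x)"

text \<open>Composing with the identity on either side changes the charts, so regularity in one pair
  of charts gives it in every pair around the point and its image.\<close>

lemma C1_map_in:
  assumes "C1_map F" "c \<in> A" "d \<in> A" "x \<in> fst c" "F x \<in> fst d"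
  shows "C1_in c d F x"
proof -
  obtain c' d' where F: "C1_in c' d' F x" using assms(1) unfolding C1_map_def by blast
  then have cd: "c' \<in> A" "d' \<in> A" "x \<in> fst c'" "F x \<in> fst d'" unfolding C1_in_def by auto
  have "C1_in c' d F x" using C1_in_compose[OF F C1_in_id[of d' d]] cd assms by simp
  then show ?thesis using C1_in_compose[OF C1_in_id[of c c' x], of d F] cd assms by simp
qed

lemma C1_map_id: "C1_map (\<lambda>x. x)"
  unfolding C1_map_def using C1_in_id chart_at by blast

lemma C1_map_compose:
  assumes "C1_map F" "C1_map G" shows "C1_map (\<lambda>x. G (F x))"
  unfolding C1_map_def
proof
  fix x
  obtain c d where F: "C1_in c d F x" using assms(1) unfolding C1_map_def by blast
  then have "d \<in> A" "F x \<in> fst d" unfolding C1_in_def by auto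
  then have "C1_in d (chart_at A (G (F x))) G (F x)" using chart_at by (intro C1_map_in assms)
  then show "\<exists>c d. C1_in c d (\<lambda>x. G (F x)) x" using C1_in_compose[OF F] by blast
qed

lemma tangent_map_linear: "C1_map F \<Longrightarrow> linear (tangent_map A F x)"
  unfolding coords_D by (intro C1_in_linear C1_map_in chart_at)

lemma tangent_map_compose:
  assumes "C1_map F" "C1_map G"
  shows "tangent_map A (\<lambda>x. G (F x)) x v = tangent_map A G (F x) (tangent_map A F x v)"
  unfolding coords_D by (intro chain_D C1_map_in chart_at assms)

lemma tangent_map_id: "tangent_map A (\<lambda>x. x) x v = v"
  unfolding coords_D by (intro D_id chart_at)

lemma coords_inverse:
  assumes "c \<in> A" "x \<in> fst c"
  shows "from_coords A c x (to_coords A c x v) = v" "to_coords A c x (from_coords A c x v) = v"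
proof -
  let ?d = "chart_at A x"
  note * = C1_in_id[OF chart_at(1) assms(1) chart_at(2) assms(2)] C1_in_id[OF assms(1) chart_at(1) assms(2) chart_at(2)]
  show "from_coords A c x (to_coords A c x v) = v"
    using chain_D[OF *(1) *(2), of v] by (simp add: coords_D D_id chart_at)
  show "to_coords A c x (from_coords A c x v) = v"
    using chain_D[OF *(2) *(1), of v] by (simp add: coords_D D_id assms)
qed

lemma coords_linear:
  assumes "c \<in> A" "x \<in> fst c" shows "linear (from_coords A c x)" "linear (to_coords A c x)"
  unfolding coords_D using assms by (auto intro!: C1_in_linear C1_in_id chart_at)

lemma to_coords_chart_at: "to_coords A (chart_at A x) x v = v" "from_coords A (chart_at A x) x v = v"
  unfolding coords_D by (intro D_id chart_at)+

lemma to_coords_change: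
  assumes "c \<in> A" "d \<in> A" "x \<in> fst c" "x \<in> fst d"
  shows "to_coords A d x v = D c d (\<lambda>x. x) x (to_coords A c x v)"
  unfolding coords_D
  using chain_D[OF C1_in_id[OF chart_at(1) assms(1) chart_at(2) assms(3)] C1_in_id[OF assms], of v] by simp

text \<open>The tangent map is defined through the selected charts, which jump with the point; here
  it is expressed in fixed charts, where continuity can be tested.\<close>

lemma tangent_map_from_coords:
  assumes "C1_map F" "c \<in> A" "d \<in> A" "x \<in> fst c" "F x \<in> fst d"
  shows "tangent_map A F x (from_coords A c x v) = from_coords A d (F x) (D c d F x v)"
proof -
  have 1: "C1_in c (chart_at A x) (\<lambda>x. x) x" by (intro C1_in_id assms chart_at)
  have 2: "C1_in (chart_at A x) (chart_at A (F x)) F x" by (intro C1_map_in assms chart_at)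
  have 3: "C1_in c d F x" by (intro C1_map_in assms)
  have 4: "C1_in d (chart_at A (F x)) (\<lambda>x. x) (F x)" by (intro C1_in_id assms chart_at)
  show ?thesis unfolding coords_D
    using chain_D[OF 1, of "chart_at A (F x)" F v] 2 chain_D[OF 3 4, of v] by simp
qed

section \<open>Continuous fields of quadratic forms\<close>

definition form_field :: "('m \<Rightarrow> real ^ 'n \<Rightarrow> real) \<Rightarrow> bool" where
  "form_field q \<longleftrightarrow> (\<forall>x. quadratic_form (q x)) \<and>
     (\<forall>c\<in>A. \<forall>w. continuous_on (fst c) (\<lambda>x. q x (from_coords A c x w)))"

lemma form_field_joint:
  fixes h :: "'b::topological_space \<Rightarrow> 'm"
  assumes q: "form_field q" and c: "c \<in> A" and h: "continuous_on S h" "h ` S \<subseteq> fst c" and w: "continuous_on S w"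
  shows "continuous_on S (\<lambda>z. q (h z) (from_coords A c (h z) (w z)))"
proof -
  define Q where "Q x w = q x (from_coords A c x w)" for x w
  have "Q (h z) (w z) = (\<Sum>a\<in>Basis. \<Sum>b\<in>Basis. (w z \<bullet> a) * (w z \<bullet> b) * ((Q (h z) (a + b) - Q (h z) a - Q (h z) b) / 2))"
    if "z \<in> S" for z
  proof (rule quadratic_form_expand)
    show "quadratic_form (Q (h z))" unfolding Q_def
      by (rule quadratic_form_compose[OF _ coords_linear(1)[OF c]]) (use q that h in \<open>auto simp: form_field_def\<close>)
  qed
  moreover have "continuous_on S (\<lambda>z. Q (h z) v)" for v
    using q c unfolding form_field_def Q_def by (intro continuous_on_compose2[OF _ h]) auto
  then have "continuous_on S (\<lambda>z. \<Sum>a\<in>Basis. \<Sum>b\<in>Basis. (w z \<bullet> a) * (w z \<bullet> b) * ((Q (h z) (a + b) - Q (h z) a - Q (h z) b) / 2))"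
    by (intro continuous_on_sum continuous_on_mult continuous_on_inner w continuous_on_const continuous_on_divide
        continuous_on_diff) auto
  ultimately have "continuous_on S (\<lambda>z. Q (h z) (w z))" by (simp cong: continuous_on_cong)
  then show ?thesis by (simp add: Q_def)
qed

text \<open>For the time-one map this turns separation into a comparison of two form fields over the
  same point.\<close>

lemma form_field_pullback:
  assumes q: "form_field q" and F: "C1_map F"
  shows "form_field (\<lambda>x v. q (F x) (tangent_map A F x v))"
  unfolding form_field_def
proof (intro conjI allI ballI)
  fix x show "quadratic_form (\<lambda>v. q (F x) (tangent_map A F x v))"
    using q quadratic_form_compose[OF _ tangent_map_linear[OF F]] by (simp add: form_field_def)
next
  fix c w assume c: "c \<in> A"
  show "continuous_on (fst c) (\<lambda>x. q (F x) (tangent_map A F x (from_coords A c x w)))"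
  proof (rule continuous_at_imp_continuous_on, rule ballI)
    fix x assume x: "x \<in> fst c"
    let ?d = "chart_at A (F x)"
    obtain V where V: "open V" "x \<in> V" "continuous_on V F" "V \<subseteq> fst c" "F ` V \<subseteq> fst ?d"
      "\<And>y. y \<in> V \<Longrightarrow> C1_in c ?d F y" "\<And>v. continuous_on V (\<lambda>y. D c ?d F y v)"
      using C1_in_neighbourhood[OF C1_map_in[OF F c chart_at(1) x chart_at(2)]] by metis
    have "continuous_on V (\<lambda>y. q (F y) (from_coords A ?d (F y) (D c ?d F y w)))"
      by (rule form_field_joint[OF q chart_at(1) V(3,5,7)])
    moreover have "tangent_map A F y (from_coords A c y w) = from_coords A ?d (F y) (D c ?d F y w)" if "y \<in> V" for y
      by (rule tangent_map_from_coords[OF F c chart_at(1)]) (use V that in auto)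
    ultimately have "continuous_on V (\<lambda>x. q (F x) (tangent_map A F x (from_coords A c x w)))"
      by (simp cong: continuous_on_cong)
    then show "isCont (\<lambda>x. q (F x) (tangent_map A F x (from_coords A c x w))) x"
      using V continuous_on_eq_continuous_at by blast
  qed
qed

lemma form_field_coords_box:
  fixes x0 :: 'm
  obtains c r where "c \<in> A" "x0 \<in> fst c" "r > 0" "cball (snd c x0) r \<subseteq> snd c ` fst c"
    "open (chart_inv c ` ball (snd c x0) r)" "x0 \<in> chart_inv c ` ball (snd c x0) r"
proof -
  let ?c = "chart_at A x0"
  have "snd ?c x0 \<in> snd ?c ` fst ?c" using chart_at by auto
  then obtain r where r: "r > 0" "cball (snd ?c x0) r \<subseteq> snd ?c ` fst ?c"
    using chart(2)[OF chart_at(1)] open_contains_cball by blast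
  have "ball (snd ?c x0) r \<subseteq> snd ?c ` fst ?c" using r(2) ball_subset_cball by blast
  then have "open (chart_inv ?c ` ball (snd ?c x0) r)" by (intro open_chart_inv_image chart_at) auto
  moreover have "x0 \<in> chart_inv ?c ` ball (snd ?c x0) r"
    using r(1) chart(5)[OF chart_at(1) chart_at(2)] by (intro image_eqI[of _ _ "snd ?c x0"]) auto
  ultimately show ?thesis using that chart_at r by blast
qed

lemma form_field_continuous_on_box:
  assumes q: "form_field q" and c: "c \<in> A" and K: "K \<subseteq> snd c ` fst c"
  shows "continuous_on (K \<times> T) (\<lambda>(u, w). q (chart_inv c u) (from_coords A c (chart_inv c u) w))"
  unfolding case_prod_beta
proof (rule form_field_joint[OF q c])
  show "continuous_on (K \<times> T) (\<lambda>z. chart_inv c (fst z))"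
    by (rule continuous_on_compose2[OF chart(4)[OF c] continuous_on_fst[OF continuous_on_id]]) (use K in auto)
  show "(\<lambda>z. chart_inv c (fst z)) ` (K \<times> T) \<subseteq> fst c" using chart(6)[OF c] K by auto
  show "continuous_on (K \<times> T) snd" by (intro continuous_intros)
qed

lemma form_in_unit_coords:
  assumes q: "form_field q" and c: "c \<in> A" and y: "y \<in> fst c" and v: "v \<noteq> 0"
  defines "w \<equiv> (1 / norm (to_coords A c y v)) *\<^sub>R to_coords A c y v"
  shows "norm w = 1" "q y v = (norm (to_coords A c y v))\<^sup>2 * q y (from_coords A c y w)" "norm (to_coords A c y v) > 0"
proof -
  have nz: "to_coords A c y v \<noteq> 0"
    using v coords_inverse(1)[OF c y, of v] linear_0[OF coords_linear(1)[OF c y]] by metis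
  then show "norm w = 1" "norm (to_coords A c y v) > 0" by (simp_all add: w_def)
  have qf: "quadratic_form (q y)" using q by (simp add: form_field_def)
  have "v = norm (to_coords A c y v) *\<^sub>R from_coords A c y w"
    using nz by (simp add: w_def linear_scale[OF coords_linear(1)[OF c y]] coords_inverse[OF c y])
  then show "q y v = (norm (to_coords A c y v))\<^sup>2 * q y (from_coords A c y w)"
    using quadratic_form_scale[OF qf] by metis
qed

text \<open>By homogeneity it suffices to look at unit coordinate vectors over a closed coordinate
  ball; there the ratio \<open>q2 / p\<close> attains a positive minimum on the compact set where
  \<open>q1 \<ge> 0\<close>, and finitely many balls cover. Positivity of \<open>p\<close> is asked
  on that cone only, so that \<open>form_field_bound\<close> can put an arbitrary form in its
  place.\<close>

lemma form_field_compare: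
  assumes q1: "form_field q1" and q2: "form_field q2" and p: "form_field p"
    and pos: "\<And>x v. v \<noteq> 0 \<Longrightarrow> q1 x v \<ge> 0 \<Longrightarrow> p x v > 0"
    and sep: "\<And>x v. v \<noteq> 0 \<Longrightarrow> q1 x v \<ge> 0 \<Longrightarrow> q2 x v > 0"
  obtains \<kappa> where "\<kappa> > 0" "\<And>x v. q1 x v \<ge> 0 \<Longrightarrow> q2 x v \<ge> \<kappa> * p x v"
proof -
  define P where "P \<kappa> x \<longleftrightarrow> (\<forall>v. q1 x v \<ge> 0 \<longrightarrow> q2 x v \<ge> \<kappa> * p x v)" for \<kappa> x
  have z: "p x 0 = 0" "q2 x 0 = 0" for x using p q2 by (auto simp: form_field_def quadratic_form_0)
  then have p0: "p x v \<ge> 0" if "q1 x v \<ge> 0" for x v using pos[of v x] that by (cases "v = 0") auto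
  obtain \<kappa> where "\<kappa> > 0" "\<And>x. P \<kappa> x"
  proof (rule compact_local_to_global[OF compact_UNIV, of P])
    fix \<kappa> \<kappa>' :: real and y assume "P \<kappa> y" "\<kappa>' \<le> \<kappa>"
    then show "P \<kappa>' y" unfolding P_def using mult_right_mono[OF \<open>\<kappa>' \<le> \<kappa>\<close> p0[of y]] by (meson order_trans)
  next
    fix x0 :: 'm
    obtain c r where c: "c \<in> A" "x0 \<in> fst c" "r > 0" "cball (snd c x0) r \<subseteq> snd c ` fst c"
      "open (chart_inv c ` ball (snd c x0) r)" "x0 \<in> chart_inv c ` ball (snd c x0) r"
      by (rule form_field_coords_box)
    define S where "S = cball (snd c x0) r \<times> sphere (0 :: real ^ 'n) 1"
    define E where "E q = (\<lambda>(u, w). q (chart_inv c u) (from_coords A c (chart_inv c u) w))"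
      for q :: "'m \<Rightarrow> real ^ 'n \<Rightarrow> real"
    have cont: "continuous_on S (E q)" if "form_field q" for q
      unfolding E_def S_def by (rule form_field_continuous_on_box[OF that c(1,4)])
    define T where "T = {z \<in> S. E q1 z \<ge> 0}"
    have compS: "compact S" unfolding S_def by (intro compact_Times compact_cball compact_sphere)
    have "closed (S \<inter> E q1 -` {0..})"
      by (rule continuous_closed_preimage[OF cont[OF q1] compact_imp_closed[OF compS] closed_atLeast])
    then have "compact (S \<inter> (S \<inter> E q1 -` {0..}))" by (rule compact_Int_closed[OF compS])
    moreover have "S \<inter> (S \<inter> E q1 -` {0..}) = T" by (auto simp: T_def)
    ultimately have compT: "compact T" by simp
    have nz: "from_coords A c (chart_inv c u) w \<noteq> 0" if "(u, w) \<in> S" for u w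
    proof -
      have y: "chart_inv c u \<in> fst c" using that c(4) chart(6)[OF c(1)] by (auto simp: S_def)
      have "w \<noteq> 0" using that by (auto simp: S_def)
      then show ?thesis using coords_inverse(2)[OF c(1) y, of w] linear_0[OF coords_linear(2)[OF c(1) y]] by metis
    qed
    have Epos: "E p z > 0" if "z \<in> T" for z using nz that pos by (cases z) (auto simp: E_def T_def)
    have E2pos: "E q2 z > 0" if "z \<in> T" for z using nz that sep by (cases z) (auto simp: E_def T_def)
    obtain \<kappa> where \<kappa>: "\<kappa> > 0" "\<And>z. z \<in> T \<Longrightarrow> \<kappa> \<le> E q2 z / E p z"
    proof (cases "T = {}")
      case True
      then show ?thesis using that[of 1] by auto
    next
      case False
      have TS: "T \<subseteq> S" by (auto simp: T_def)
      have cdiv: "continuous_on T (\<lambda>z. E q2 z / E p z)"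
      proof (rule continuous_on_divide)
        show "\<forall>z\<in>T. E p z \<noteq> 0" using Epos by force
      qed (rule continuous_on_subset[OF cont TS], rule q2 p)+
      obtain z where "z \<in> T" "\<forall>y\<in>T. E q2 z / E p z \<le> E q2 y / E p y"
        using continuous_attains_inf[OF compT False cdiv] by blast
      then show ?thesis using that[of "E q2 z / E p z"] Epos[of z] E2pos[of z] by auto
    qed
    have "P \<kappa> y" if y: "y \<in> chart_inv c ` ball (snd c x0) r" for y
      unfolding P_def
    proof (intro allI impI)
      fix v assume v: "q1 y v \<ge> 0"
      obtain u where u: "u \<in> ball (snd c x0) r" "y = chart_inv c u" using y by auto
      have "u \<in> snd c ` fst c" by (rule subsetD[OF c(4)]) (use u in simp)
      then have yc: "y \<in> fst c" using u(2) chart(6)[OF c(1)] by simp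
      show "\<kappa> * p y v \<le> q2 y v"
      proof (cases "v = 0")
        case False
        define w where "w = (1 / norm (to_coords A c y v)) *\<^sub>R to_coords A c y v"
        define l where "l = (norm (to_coords A c y v))\<^sup>2"
        have w: "norm w = 1" "l > 0" "q1 y v = l * E q1 (u, w)" "q2 y v = l * E q2 (u, w)" "p y v = l * E p (u, w)"
          using form_in_unit_coords[OF q1 c(1) yc False] form_in_unit_coords(2)[OF q2 c(1) yc False]
            form_in_unit_coords(2)[OF p c(1) yc False] u(2)
          by (simp_all add: w_def l_def E_def)
        have S: "(u, w) \<in> S" using u w by (auto simp: S_def)
        have T: "(u, w) \<in> T" using S v w by (auto simp: T_def zero_le_mult_iff)
        have "\<kappa> * E p (u, w) \<le> E q2 (u, w)" using \<kappa>(2)[OF T] Epos[OF T] by (simp add: pos_le_divide_eq)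
        then have "l * (\<kappa> * E p (u, w)) \<le> l * E q2 (u, w)" using w(2) by (intro mult_left_mono) auto
        then show ?thesis by (simp add: w mult_ac)
      qed (simp add: z)
    qed
    then show "\<exists>U \<kappa>. open U \<and> x0 \<in> U \<and> \<kappa> > 0 \<and> (\<forall>y\<in>U. P \<kappa> y)" using c \<kappa>(1) by blast
  qed blast
  then show ?thesis using that unfolding P_def by blast
qed

lemma form_field_combine:
  assumes "form_field p" "form_field q" shows "form_field (\<lambda>x v. a * p x v + b * q x v)"
  using assms unfolding form_field_def
  by (auto intro!: quadratic_form_combine continuous_on_add continuous_on_mult continuous_on_const)

lemma form_field_bound:
  assumes p: "form_field p" and q: "form_field q" and pos: "\<And>x v. v \<noteq> 0 \<Longrightarrow> p x v > 0"
  obtains C where "C > 0" "\<And>x v. \<bar>q x v\<bar> \<le> C * p x v"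
proof -
  have one: "\<exists>C>0. \<forall>x v. q x v \<le> C * p x v" if q: "form_field q" for q
  proof -
    have "p x 0 = 0" for x using p by (auto simp: form_field_def quadratic_form_0)
    then have p0: "p x v \<ge> 0" for x v using pos[of v x] by (cases "v = 0") auto
    \<comment> \<open>The comparison runs on the cone where \<open>q\<close> is at least
      \<open>p\<close>, with \<open>q\<close> in the place of the positive form; outside the cone
      \<open>q\<close> is bounded by \<open>p\<close> anyway.\<close>
    have d: "form_field (\<lambda>x v. 1 * q x v + (-1) * p x v)" by (rule form_field_combine[OF q p])
    have "q x v > 0" if "v \<noteq> 0" "1 * q x v + (-1) * p x v \<ge> 0" for x v
      using pos[OF that(1), of x] that(2) by simp
    then obtain \<kappa> where \<kappa>: "\<kappa> > 0" "\<And>x v. 1 * q x v + (-1) * p x v \<ge> 0 \<Longrightarrow> p x v \<ge> \<kappa> * q x v"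
      using form_field_compare[OF d p q] pos by metis
    have "q x v \<le> (1 + 1 / \<kappa>) * p x v" for x v
    proof (cases "q x v \<ge> p x v")
      case True
      then have "q x v \<le> 1 / \<kappa> * p x v" using \<kappa>(1) \<kappa>(2)[of x v] by (simp add: field_simps)
      then show ?thesis using p0[of x v] by (simp add: distrib_right)
    next
      case False
      moreover have "1 / \<kappa> * p x v \<ge> 0" using \<kappa>(1) p0[of x v] by simp
      ultimately show ?thesis by (simp add: distrib_right)
    qed
    moreover have "1 + 1 / \<kappa> > 0" using \<kappa>(1) by (simp add: add_pos_pos)
    ultimately show ?thesis by blast
  qed
  have p0: "p x v \<ge> 0" for x v
    using pos[of v x] p by (cases "v = 0") (auto simp: form_field_def quadratic_form_0)
  obtain C1 where C1: "C1 > 0" "\<And>x v. q x v \<le> C1 * p x v" using one[OF q] by blast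
  have "form_field (\<lambda>x v. (-1) * q x v + 0 * p x v)" by (rule form_field_combine[OF q p])
  then obtain C2 where C2: "C2 > 0" "\<And>x v. (-1) * q x v + 0 * p x v \<le> C2 * p x v" using one by blast
  have "\<bar>q x v\<bar> \<le> (C1 + C2) * p x v" for x v
  proof -
    have "0 \<le> C1 * p x v" "0 \<le> C2 * p x v" using C1 C2 p0[of x v] by simp_all
    then show ?thesis using C1(2)[of x v] C2(2)[of x v] unfolding distrib_right by linarith
  qed
  then show ?thesis using that[of "C1 + C2"] C1 C2 by simp
qed

end

section \<open>The derivative of a flow\<close>

context compact_manifold
begin

text \<open>A first exit time argument. Before the exit the speed bound confines the coordinates to
  the closed ball of radius \<open>B * t\<close>, which is less than \<rho>. Its image is compact,
  hence closed in the Hausdorff space, so the exit point still lies in it. The image is used at that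
  moment because the coordinates are meaningful only inside the chart.\<close>

lemma stays_in_box:
  assumes c: "c \<in> A" and \<gamma>: "continuous_on UNIV \<gamma>" "\<gamma> 0 = chart_inv c u"
    and box: "cball u \<rho> \<subseteq> snd c ` fst c" "\<rho> > 0"
    and deriv: "\<And>s. \<gamma> s \<in> chart_inv c ` ball u \<rho> \<Longrightarrow>
      \<exists>d. ((\<lambda>s. snd c (\<gamma> s)) has_vector_derivative d) (at s) \<and> norm d \<le> B"
    and B: "B \<ge> 0" "B * \<epsilon> < \<rho>" and t: "0 \<le> t" "t \<le> \<epsilon>"
  shows "\<gamma> t \<in> chart_inv c ` ball u \<rho>"
proof (rule ccontr)
  assume neg: "\<gamma> t \<notin> chart_inv c ` ball u \<rho>"
  let ?O = "chart_inv c ` ball u \<rho>"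
  have bsub: "ball u \<rho> \<subseteq> snd c ` fst c" using box(1) ball_subset_cball by (rule subset_trans[rotated])
  have "open ?O" by (rule open_chart_inv_image[OF c open_ball bsub])
  have ub: "u \<in> ball u \<rho>" using box(2) by simp
  then have "u \<in> snd c ` fst c" by (rule subsetD[OF bsub])
  then have u: "snd c (\<gamma> 0) = u" "u \<in> ball u \<rho>" using chart(7)[OF c] ub by (simp_all add: \<gamma>(2))
  define G where "G = {0..t} \<inter> \<gamma> -` (- ?O)"
  have "closed (\<gamma> -` (- ?O))"
    by (rule closed_vimage[OF closed_Compl[OF \<open>open ?O\<close>] \<gamma>(1)])
  then have "closed G" unfolding G_def by (intro closed_Int closed_atLeastAtMost)
  moreover have "t \<in> G" using neg t by (simp add: G_def)
  moreover have bdd: "bdd_below G" unfolding bdd_below_def G_def by (auto intro!: exI[of _ 0])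
  ultimately have T: "Inf G \<in> G" by (intro closed_contains_Inf) auto
  define T where "T = Inf G"
  have T': "0 \<le> T" "T \<le> t" "\<gamma> T \<notin> ?O" using T by (auto simp: G_def T_def)
  have before: "\<gamma> s \<in> ?O" if "0 \<le> s" "s < T" for s
  proof (rule ccontr)
    assume "\<gamma> s \<notin> ?O"
    then have "s \<in> G" using that T' by (simp add: G_def)
    then have "T \<le> s" unfolding T_def by (rule cInf_lower[OF _ bdd])
    then show False using that by simp
  qed
  have "\<gamma> s \<in> chart_inv c ` cball u (B * t)" if s: "0 \<le> s" "s < T" for s
  proof -
    have "\<forall>s'. \<exists>d. s' \<in> {0..s} \<longrightarrow> ((\<lambda>s. snd c (\<gamma> s)) has_vector_derivative d) (at s') \<and> norm d \<le> B"
      using deriv before s by (metis atLeastAtMost_iff le_less_trans)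
    then obtain d where d: "\<And>s'. s' \<in> {0..s} \<Longrightarrow> ((\<lambda>s. snd c (\<gamma> s)) has_vector_derivative d s') (at s')"
      "\<And>s'. s' \<in> {0..s} \<Longrightarrow> norm (d s') \<le> B" by metis
    have "norm (snd c (\<gamma> s) - snd c (\<gamma> 0)) \<le> B * norm (s - 0)"
    proof (rule differentiable_bound[of "{0..s}" _ "\<lambda>s' h. h *\<^sub>R d s'"])
      fix s' assume s': "s' \<in> {0..s}"
      show "((\<lambda>s. snd c (\<gamma> s)) has_derivative (\<lambda>h. h *\<^sub>R d s')) (at s' within {0..s})"
        using d(1)[OF s'] unfolding has_vector_derivative_def by (rule has_derivative_at_withinI)
      show "onorm (\<lambda>h. h *\<^sub>R d s') \<le> B"
      proof (rule onorm_le)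
        fix h :: real
        show "norm (h *\<^sub>R d s') \<le> B * norm h"
          using mult_right_mono[OF d(2)[OF s'] abs_ge_zero[of h]] by (simp add: mult.commute)
      qed
    qed (use s in auto)
    also have "\<dots> \<le> B * t" using s T' B by (intro mult_left_mono) auto
    finally have "snd c (\<gamma> s) \<in> cball u (B * t)" by (simp add: u dist_norm norm_minus_commute)
    moreover have "\<gamma> s = chart_inv c (snd c (\<gamma> s))"
      using before[OF s] chart(5,6)[OF c] bsub by auto
    ultimately show ?thesis by blast
  qed
  then have sub: "{0..<T} \<subseteq> \<gamma> -` (chart_inv c ` cball u (B * t))" by auto
  have "B * t \<le> B * \<epsilon>" using B t by (intro mult_left_mono) auto
  then have Bt: "B * t < \<rho>" using B by linarith
  then have csub: "cball u (B * t) \<subseteq> ball u \<rho>" by auto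
  have "compact (chart_inv c ` cball u (B * t))"
    by (rule compact_continuous_image[OF continuous_on_subset[OF chart(4)[OF c]] compact_cball])
      (use csub bsub in blast)
  then have "closed (chart_inv c ` cball u (B * t))" by (rule compact_imp_closed)
  then have cl: "closed (\<gamma> -` (chart_inv c ` cball u (B * t)))" by (rule closed_vimage[OF _ \<gamma>(1)])
  have "T \<noteq> 0"
  proof
    assume "T = 0"
    then have "\<gamma> 0 \<notin> ?O" using T' by simp
    then show False using u(2) unfolding \<gamma>(2) by blast
  qed
  then have "T \<in> closure {0..<T}" using T' by (simp add: closure_atLeastLessThan)
  then have "T \<in> \<gamma> -` (chart_inv c ` cball u (B * t))" using closure_minimal[OF sub cl] by blast
  then show False using T'(3) csub by blast
qed

end

locale manifold_flow = compact_manifold A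
  for A :: "('m::t2_space, 'n::finite) chart set" +
  fixes X :: "'m \<Rightarrow> real ^ 'n" and \<phi> :: "real \<Rightarrow> 'm \<Rightarrow> 'm"
  assumes X_C1: "Ck_vector_field A 1 X" and flow: "flow_of A X \<phi>"
begin

abbreviation f where "f c \<equiv> local_rep A c X"
abbreviation Df where "Df c u \<equiv> frechet_derivative (f c) (at u)"

lemma flow_0: "\<phi> 0 x = x" and flow_add: "\<phi> (s + t) x = \<phi> s (\<phi> t x)"
  and orbit_continuous: "continuous_on UNIV (\<lambda>t. \<phi> t x)"
  and orbit_derivative: "((\<lambda>s. snd (chart_at A (\<phi> t x)) (\<phi> s x)) has_vector_derivative X (\<phi> t x)) (at t)"
  using flow unfolding flow_of_def by blast+

lemma f_derivative: "c \<in> A \<Longrightarrow> u \<in> snd c ` fst c \<Longrightarrow> (f c has_derivative Df c u) (at u)"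
  using X_C1 unfolding Ck_vector_field_def Ck_on_1 by (metis frechet_derivative_works)

lemma Df_continuous: "c \<in> A \<Longrightarrow> continuous_on (snd c ` fst c) (\<lambda>u. Df c u v)"
  using X_C1 unfolding Ck_vector_field_def Ck_on_1 by blast

lemma f_continuous: "c \<in> A \<Longrightarrow> continuous_on (snd c ` fst c) (f c)"
  by (rule continuous_at_imp_continuous_on, rule ballI, rule has_derivative_continuous[OF f_derivative])

lemma to_coords_X: "c \<in> A \<Longrightarrow> x \<in> fst c \<Longrightarrow> to_coords A c x (X x) = f c (snd c x)"
  by (simp add: local_rep_def chart(5))

lemma open_orbit_preimage: "open U \<Longrightarrow> open {s. \<phi> s x \<in> U}"
  using open_vimage[OF _ orbit_continuous, of U x] by (simp add: vimage_def)

text \<open>\<open>flow_of\<close> states the equation at each time in the chart selected for that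
  moment, and these charts jump; a fixed chart is reached by a coordinate change near the
  point.\<close>

lemma orbit_derivative_chart:
  assumes c: "c \<in> A" "\<phi> t x \<in> fst c"
  shows "((\<lambda>s. snd c (\<phi> s x)) has_vector_derivative f c (snd c (\<phi> t x))) (at t)"
proof -
  let ?d = "chart_at A (\<phi> t x)"
  have C: "C1_in ?d c (\<lambda>x. x) (\<phi> t x)" by (intro C1_in_id chart_at c)
  have d0: "((\<lambda>s. snd ?d (\<phi> s x)) has_derivative (\<lambda>h. h *\<^sub>R X (\<phi> t x))) (at t)"
    using orbit_derivative by (simp add: has_vector_derivative_def)
  have "(rep ?d c (\<lambda>x. x) \<circ> (\<lambda>s. snd ?d (\<phi> s x)) has_derivative
      D ?d c (\<lambda>x. x) (\<phi> t x) \<circ> (\<lambda>h. h *\<^sub>R X (\<phi> t x))) (at t)"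
    by (rule diff_chain_at[OF d0], rule C1_in_D[OF C])
  moreover have "D ?d c (\<lambda>x. x) (\<phi> t x) \<circ> (\<lambda>h. h *\<^sub>R X (\<phi> t x)) = (\<lambda>h. h *\<^sub>R f c (snd c (\<phi> t x)))"
    using to_coords_X[OF c] by (simp add: fun_eq_iff linear_scale[OF C1_in_linear[OF C]] coords_D)
  ultimately have d: "(rep ?d c (\<lambda>x. x) \<circ> (\<lambda>s. snd ?d (\<phi> s x)) has_derivative (\<lambda>h. h *\<^sub>R f c (snd c (\<phi> t x)))) (at t)"
    by simp
  show ?thesis
    unfolding has_vector_derivative_def
  proof (rule has_derivative_transform_within_open[OF d open_orbit_preimage[OF chart(1)[OF chart_at(1)[of "\<phi> t x"]], of x]])
    show "t \<in> {s. \<phi> s x \<in> fst ?d}" using chart_at by simp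
    fix s assume "s \<in> {s. \<phi> s x \<in> fst ?d}"
    then show "(rep ?d c (\<lambda>x. x) \<circ> (\<lambda>s. snd ?d (\<phi> s x))) s = snd c (\<phi> s x)"
      using chart(5)[OF chart_at(1)] by (simp add: rep_def)
  qed
qed

lemma flow_box:
  assumes c: "c \<in> A" "x0 \<in> fst c"
  obtains r \<epsilon> where "r > 0" "0 < \<epsilon>" "\<epsilon> \<le> 1" "cball (snd c x0) (2 * r) \<subseteq> snd c ` fst c"
    "\<And>u t. u \<in> ball (snd c x0) r \<Longrightarrow> \<bar>t\<bar> \<le> \<epsilon> \<Longrightarrow> \<phi> t (chart_inv c u) \<in> chart_inv c ` cball (snd c x0) (2 * r)"
proof -
  let ?u0 = "snd c x0"
  have "?u0 \<in> snd c ` fst c" using c by auto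
  then obtain R where R: "R > 0" "cball ?u0 R \<subseteq> snd c ` fst c"
    using chart(2)[OF c(1)] open_contains_cball by blast
  define r where "r = R / 2"
  have r: "r > 0" "cball ?u0 (2 * r) \<subseteq> snd c ` fst c" using R by (simp_all add: r_def)
  have "bounded (f c ` cball ?u0 (2 * r))"
    by (intro compact_imp_bounded compact_continuous_image continuous_on_subset[OF f_continuous[OF c(1)] r(2)] compact_cball)
  then obtain B where B: "B > 0" "\<And>u. u \<in> cball ?u0 (2 * r) \<Longrightarrow> norm (f c u) \<le> B"
    unfolding bounded_pos by blast
  \<comment> \<open>Up to time \<epsilon> an orbit travels less than \<open>r\<close> in
    coordinates, so it stays within \<open>r\<close> of its start and within \<open>2 * r\<close> of
    the centre.\<close>
  define \<epsilon> where "\<epsilon> = min 1 (r / (2 * B))"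
  have \<epsilon>: "0 < \<epsilon>" "\<epsilon> \<le> 1" using r B by (simp_all add: \<epsilon>_def)
  have "B * \<epsilon> \<le> B * (r / (2 * B))" using B by (intro mult_left_mono) (auto simp: \<epsilon>_def)
  also have "\<dots> < r" using B r by simp
  finally have B\<epsilon>: "B * \<epsilon> < r" .
  have "\<phi> t (chart_inv c u) \<in> chart_inv c ` cball ?u0 (2 * r)" if u: "u \<in> ball ?u0 r" and t: "\<bar>t\<bar> \<le> \<epsilon>" for u t
  proof -
    have sub: "cball u r \<subseteq> cball ?u0 (2 * r)"
    proof
      fix v assume "v \<in> cball u r"
      then show "v \<in> cball ?u0 (2 * r)" using u dist_triangle[of ?u0 v u] by simp
    qed
    have sub': "ball u r \<subseteq> cball ?u0 (2 * r)" using sub ball_subset_cball by blast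
    \<comment> \<open>\<open>stays_in_box\<close> treats nonnegative times; the sign reverses the
      orbit for negative ones.\<close>
    define \<sigma> :: real where "\<sigma> = (if t \<ge> 0 then 1 else -1)"
    have \<sigma>: "\<sigma> * \<bar>t\<bar> = t" "\<bar>\<sigma>\<bar> = 1" by (auto simp: \<sigma>_def)
    have "\<phi> (\<sigma> * \<bar>t\<bar>) (chart_inv c u) \<in> chart_inv c ` ball u r"
    proof (rule stays_in_box[OF c(1), where \<gamma> = "\<lambda>s. \<phi> (\<sigma> * s) (chart_inv c u)" and B = B and \<epsilon> = \<epsilon>])
      show "continuous_on UNIV (\<lambda>s. \<phi> (\<sigma> * s) (chart_inv c u))"
        by (rule continuous_on_compose2[OF orbit_continuous]) (auto intro!: continuous_intros)
      show "cball u r \<subseteq> snd c ` fst c" using sub r(2) by blast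
      fix s assume s: "\<phi> (\<sigma> * s) (chart_inv c u) \<in> chart_inv c ` ball u r"
      let ?y = "\<phi> (\<sigma> * s) (chart_inv c u)"
      obtain v where v: "?y = chart_inv c v" "v \<in> ball u r" using s by blast
      have vK: "v \<in> cball ?u0 (2 * r)" using v sub' by blast
      then have vi: "v \<in> snd c ` fst c" using r(2) by blast
      then have y: "?y \<in> fst c" "snd c ?y = v" using v chart(6,7)[OF c(1)] by auto
      have "((\<lambda>s. \<sigma> * s) has_vector_derivative \<sigma>) (at s)"
        by (auto intro!: derivative_eq_intros simp: has_real_derivative_iff_has_vector_derivative[symmetric])
      then have "((\<lambda>s. snd c (\<phi> s (chart_inv c u))) \<circ> (\<lambda>s. \<sigma> * s) has_vector_derivative \<sigma> *\<^sub>R f c (snd c ?y)) (at s)"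
        by (rule vector_diff_chain_at) (rule orbit_derivative_chart[OF c(1) y(1)])
      moreover have "norm (\<sigma> *\<^sub>R f c (snd c ?y)) \<le> B" using B(2)[OF vK] y \<sigma> by simp
      ultimately show "\<exists>d. ((\<lambda>s. snd c (\<phi> (\<sigma> * s) (chart_inv c u))) has_vector_derivative d) (at s) \<and> norm d \<le> B"
        unfolding o_def by blast
    qed (use r B B\<epsilon> t in \<open>auto simp: flow_0\<close>)
    then show ?thesis using \<sigma> sub' by auto
  qed
  then show ?thesis using that r \<epsilon> by blast
qed

text \<open>Packages what \<open>smooth_local_flow\<close> yields in a chart around
  \<open>x0\<close>, so that it is available at every point without repeating the
  interpretation.\<close>

definition flow_data where
  "flow_data c x0 r \<epsilon> B Y \<longleftrightarrow> r > 0 \<and> 0 < \<epsilon> \<and> \<epsilon> \<le> 1 \<and> B > 0 \<and> cball (snd c x0) (2 * r) \<subseteq> snd c ` fst c \<and>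
     (\<forall>u\<in>ball (snd c x0) r. \<forall>t. \<bar>t\<bar> \<le> \<epsilon> \<longrightarrow> \<phi> t (chart_inv c u) \<in> fst c \<and>
        snd c (\<phi> t (chart_inv c u)) \<in> cball (snd c x0) (2 * r) \<and>
        (rep c c (\<phi> t) has_derivative Y t u) (at u) \<and> (\<forall>h. norm (Y t u h) \<le> B * norm h)) \<and>
     (\<forall>t h. \<bar>t\<bar> \<le> \<epsilon> \<longrightarrow> continuous_on (ball (snd c x0) r) (\<lambda>u. Y t u h)) \<and>
     (\<forall>u\<in>ball (snd c x0) r. \<forall>h. ((\<lambda>t. Y t u h) has_vector_derivative Df c u h) (at 0) \<and> Y 0 u h = h)"

lemma flow_dataD:
  assumes "flow_data c x0 r \<epsilon> B Y"
  shows "r > 0" "0 < \<epsilon>" "\<epsilon> \<le> 1" "B > 0" "cball (snd c x0) (2 * r) \<subseteq> snd c ` fst c"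
    "\<And>u t. u \<in> ball (snd c x0) r \<Longrightarrow> \<bar>t\<bar> \<le> \<epsilon> \<Longrightarrow> \<phi> t (chart_inv c u) \<in> fst c"
    "\<And>u t. u \<in> ball (snd c x0) r \<Longrightarrow> \<bar>t\<bar> \<le> \<epsilon> \<Longrightarrow> snd c (\<phi> t (chart_inv c u)) \<in> cball (snd c x0) (2 * r)"
    "\<And>u t. u \<in> ball (snd c x0) r \<Longrightarrow> \<bar>t\<bar> \<le> \<epsilon> \<Longrightarrow> (rep c c (\<phi> t) has_derivative Y t u) (at u)"
    "\<And>t h. \<bar>t\<bar> \<le> \<epsilon> \<Longrightarrow> continuous_on (ball (snd c x0) r) (\<lambda>u. Y t u h)"
    "\<And>u t h. u \<in> ball (snd c x0) r \<Longrightarrow> \<bar>t\<bar> \<le> \<epsilon> \<Longrightarrow> norm (Y t u h) \<le> B * norm h"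
    "\<And>u h. u \<in> ball (snd c x0) r \<Longrightarrow> ((\<lambda>t. Y t u h) has_vector_derivative Df c u h) (at 0)"
    "\<And>u h. u \<in> ball (snd c x0) r \<Longrightarrow> Y 0 u h = h"
  using assms unfolding flow_data_def by blast+

lemma flow_data_exists:
  assumes c: "c \<in> A" "x0 \<in> fst c"
  shows "\<exists>r \<epsilon> B Y. flow_data c x0 r \<epsilon> B Y"
proof -
  obtain r \<epsilon> where b: "r > 0" "0 < \<epsilon>" "\<epsilon> \<le> 1" "cball (snd c x0) (2 * r) \<subseteq> snd c ` fst c"
    "\<And>u t. u \<in> ball (snd c x0) r \<Longrightarrow> \<bar>t\<bar> \<le> \<epsilon> \<Longrightarrow> \<phi> t (chart_inv c u) \<in> chart_inv c ` cball (snd c x0) (2 * r)"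
    using flow_box[OF c] by metis
  let ?u0 = "snd c x0"
  have img: "u \<in> snd c ` fst c" if "u \<in> cball ?u0 (2 * r)" for u using that b(4) by blast
  have "ball ?u0 r \<subseteq> cball ?u0 (2 * r)" using b(1) by auto
  then have img': "u \<in> snd c ` fst c" if "u \<in> ball ?u0 r" for u using that b(4) by blast
  have in1: "\<phi> t (chart_inv c u) \<in> fst c" and in2: "snd c (\<phi> t (chart_inv c u)) \<in> cball ?u0 (2 * r)"
    if h: "u \<in> ball ?u0 r" "\<bar>t\<bar> \<le> \<epsilon>" for u t
  proof -
    obtain v where v: "\<phi> t (chart_inv c u) = chart_inv c v" "v \<in> cball ?u0 (2 * r)" using b(5)[OF h] by blast
    show "\<phi> t (chart_inv c u) \<in> fst c" "snd c (\<phi> t (chart_inv c u)) \<in> cball ?u0 (2 * r)"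
      using v chart(6,7)[OF c(1) img[OF v(2)]] by auto
  qed
  define F where "F u = Blinfun (Df c u)" for u
  have F_apply: "blinfun_apply (F u) = Df c u" if "u \<in> snd c ` fst c" for u
    unfolding F_def using has_derivative_bounded_linear[OF f_derivative[OF c(1) that]] by (rule bounded_linear_Blinfun_apply)
  interpret smooth_local_flow "f c" F ?u0 r \<epsilon> "\<lambda>t u. snd c (\<phi> t (chart_inv c u))"
  proof
    show "(f c has_derivative blinfun_apply (F x)) (at x)" if "x \<in> cball ?u0 (2 * r)" for x
      unfolding F_apply[OF img[OF that]] by (rule f_derivative[OF c(1) img[OF that]])
    show "continuous_on (cball ?u0 (2 * r)) F"
    proof (rule continuous_on_blinfun_componentwise)
      fix i :: "real ^ 'n"
      have "continuous_on (cball ?u0 (2 * r)) (\<lambda>u. Df c u i)"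
        by (rule continuous_on_subset[OF Df_continuous[OF c(1)] b(4)])
      then show "continuous_on (cball ?u0 (2 * r)) (\<lambda>x. blinfun_apply (F x) i)"
        by (rule continuous_on_eq) (simp add: F_apply[OF img])
    qed
    show "snd c (\<phi> t (chart_inv c u)) \<in> cball ?u0 (2 * r)" if "u \<in> ball ?u0 r" "\<bar>t\<bar> \<le> \<epsilon>" for u t
      using in2[OF that] .
    show "snd c (\<phi> 0 (chart_inv c u)) = u" if "u \<in> ball ?u0 r" for u
      using chart(7)[OF c(1) img'[OF that]] by (simp add: flow_0)
    show "((\<lambda>s. snd c (\<phi> s (chart_inv c u))) has_vector_derivative f c (snd c (\<phi> t (chart_inv c u)))) (at t)"
      if "u \<in> ball ?u0 r" "\<bar>t\<bar> \<le> \<epsilon>" for u t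
      by (rule orbit_derivative_chart[OF c(1) in1[OF that]])
  qed (use b in auto)
  have der: "(rep c c (\<phi> t) has_derivative Y t u) (at u)" if "u \<in> ball ?u0 r" "\<bar>t\<bar> \<le> \<epsilon>" for u t
    using flow_has_derivative[OF that] by (simp add: rep_def[abs_def])
  have der0: "((\<lambda>t. Y t u h) has_vector_derivative Df c u h) (at 0)" if "u \<in> ball ?u0 r" for u h
    using Y_derivative_at_0[OF that] by (simp add: F_apply[OF img'[OF that]])
  have "B > 0" using B by simp
  then have "flow_data c x0 r \<epsilon> B Y"
    unfolding flow_data_def using b in1 in2 der der0 Y_continuous Y_bound Y_0 by simp
  then show ?thesis by blast
qed

lemma D_eq: "(rep c d F has_derivative Y) (at (snd c x)) \<Longrightarrow> D c d F x v = Y v"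
  unfolding D_def using frechet_derivative_at by metis

lemma flow_C1_in:
  assumes c: "c \<in> A" "x0 \<in> fst c"
  obtains U \<epsilon> where "open U" "x0 \<in> U" "\<epsilon> > 0" "\<And>t x. \<bar>t\<bar> \<le> \<epsilon> \<Longrightarrow> x \<in> U \<Longrightarrow> C1_in c c (\<phi> t) x"
proof -
  obtain r \<epsilon> B Y where "flow_data c x0 r \<epsilon> B Y" using flow_data_exists[OF c] by blast
  note b = flow_dataD[OF this]
  let ?u0 = "snd c x0" and ?U = "chart_inv c ` ball (snd c x0) r"
  have bs: "ball ?u0 r \<subseteq> snd c ` fst c" proof -
    have "ball ?u0 r \<subseteq> cball ?u0 (2 * r)" using b(1) by auto
    then show ?thesis using b(5) by (rule subset_trans)
  qed
  have U: "open ?U" "x0 \<in> ?U"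
    using open_chart_inv_image[OF c(1) open_ball bs] b(1) chart(5)[OF c(1) c(2)]
    by (auto intro!: image_eqI[of _ _ ?u0])
  have sndU: "snd c y \<in> ball ?u0 r" "y \<in> fst c" "chart_inv c (snd c y) = y" if y: "y \<in> ?U" for y
  proof -
    obtain u where u: "u \<in> ball ?u0 r" "y = chart_inv c u" using y by blast
    then have "u \<in> snd c ` fst c" using bs by blast
    then show "snd c y \<in> ball ?u0 r" "y \<in> fst c" "chart_inv c (snd c y) = y"
      using u chart(6,7)[OF c(1)] by auto
  qed
  have "C1_in c c (\<phi> t) x" if t: "\<bar>t\<bar> \<le> \<epsilon>" and x: "x \<in> ?U" for t x
  proof -
    have DY: "D c c (\<phi> t) y v = Y t (snd c y) v" if "y \<in> ?U" for y v
      using b(8)[OF sndU(1)[OF that] t] by (rule D_eq)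
    have cU: "continuous_on ?U (snd c)" by (rule continuous_on_subset[OF chart(3)[OF c(1)]]) (use sndU in blast)
    have "continuous_on ?U (\<phi> t)"
    proof -
      have 1: "continuous_on (ball ?u0 r) (rep c c (\<phi> t))"
        by (rule continuous_at_imp_continuous_on, rule ballI, rule has_derivative_continuous[OF b(8)[OF _ t]])
      have "continuous_on ?U (\<lambda>y. rep c c (\<phi> t) (snd c y))"
        by (rule continuous_on_compose2[OF 1 cU]) (use sndU in blast)
      then have "continuous_on ?U (\<lambda>y. chart_inv c (rep c c (\<phi> t) (snd c y)))"
      proof (rule continuous_on_compose2[OF chart(4)[OF c(1)]])
        show "(\<lambda>y. rep c c (\<phi> t) (snd c y)) ` ?U \<subseteq> snd c ` fst c"
          using b(6)[OF sndU(1) t] by (auto simp: rep_def)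
      qed
      then show ?thesis
      proof (rule continuous_on_eq)
        fix y assume y: "y \<in> ?U"
        have "\<phi> t y \<in> fst c" using b(6)[OF sndU(1)[OF y] t] sndU(3)[OF y] by simp
        then show "chart_inv c (rep c c (\<phi> t) (snd c y)) = \<phi> t y"
          using sndU(3)[OF y] chart(5)[OF c(1)] by (simp add: rep_def)
      qed
    qed
    moreover have "continuous_on ?U (\<lambda>y. D c c (\<phi> t) y v)" for v
    proof -
      have "continuous_on ?U (\<lambda>y. Y t (snd c y) v)"
        by (rule continuous_on_compose2[OF b(9)[OF t] cU]) (use sndU in blast)
      then show ?thesis by (rule continuous_on_eq) (simp add: DY)
    qed
    moreover have "rep c c (\<phi> t) differentiable (at (snd c y))" if "y \<in> ?U" for y
      using b(8)[OF sndU(1)[OF that] t] unfolding differentiable_def by blast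
    moreover have "\<phi> t ` ?U \<subseteq> fst c" using b(6)[OF _ t] by blast
    moreover have "?U \<subseteq> fst c" using sndU(2) by blast
    ultimately show ?thesis unfolding C1_in_def using U x c by (intro conjI exI[of _ ?U]) blast+
  qed
  then show ?thesis using that[OF U b(2)] by blast
qed

text \<open>Compactness makes the short time of \<open>flow_C1_in\<close> uniform over the manifold,
  and every \<open>\<phi> t\<close> is a composition of such short-time maps.\<close>

lemma flow_C1: "C1_map (\<phi> t)"
proof -
  obtain \<epsilon> where \<epsilon>: "\<epsilon> > 0" "\<And>y. \<forall>t. \<bar>t\<bar> \<le> \<epsilon> \<longrightarrow> (\<exists>c d. C1_in c d (\<phi> t) y)"
  proof (rule compact_local_to_global[OF compact_UNIV, of "\<lambda>\<epsilon> y. \<forall>t. \<bar>t\<bar> \<le> \<epsilon> \<longrightarrow> (\<exists>c d. C1_in c d (\<phi> t) y)"])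
    fix x :: 'm
    obtain U \<epsilon> where "open U" "x \<in> U" "\<epsilon> > 0"
      "\<And>t y. \<bar>t\<bar> \<le> \<epsilon> \<Longrightarrow> y \<in> U \<Longrightarrow> C1_in (chart_at A x) (chart_at A x) (\<phi> t) y"
      using flow_C1_in[OF chart_at] by metis
    then show "\<exists>U \<kappa>. open U \<and> x \<in> U \<and> 0 < \<kappa> \<and> (\<forall>y\<in>U. \<forall>t. \<bar>t\<bar> \<le> \<kappa> \<longrightarrow> (\<exists>c d. C1_in c d (\<phi> t) y))"
      by blast
  next
    fix \<kappa> \<kappa>' :: real and y
    assume "\<forall>t. \<bar>t\<bar> \<le> \<kappa> \<longrightarrow> (\<exists>c d. C1_in c d (\<phi> t) y)" "\<kappa>' \<le> \<kappa>"
    then show "\<forall>t. \<bar>t\<bar> \<le> \<kappa>' \<longrightarrow> (\<exists>c d. C1_in c d (\<phi> t) y)" by (meson order_trans)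
  qed blast
  have small: "C1_map (\<phi> t)" if "\<bar>t\<bar> \<le> \<epsilon>" for t using \<epsilon>(2) that unfolding C1_map_def by blast
  obtain N :: nat where N: "\<bar>t\<bar> / \<epsilon> < real N" using reals_Archimedean2 by blast
  have Npos: "real N > 0" using N \<epsilon>(1) by (meson abs_ge_zero divide_nonneg_pos le_less_trans)
  define s where "s = t / real N"
  have "\<bar>s\<bar> \<le> \<epsilon>" using N Npos \<epsilon>(1) by (simp add: s_def field_simps)
  then have s: "C1_map (\<phi> s)" by (rule small)
  have "C1_map (\<phi> (real k * s))" for k
  proof (induction k)
    case 0
    have "\<phi> 0 = (\<lambda>x. x)" by (simp add: fun_eq_iff flow_0)
    then show ?case using C1_map_id by simp
  next
    case (Suc k)
    have "\<phi> (real (Suc k) * s) = (\<lambda>x. \<phi> s (\<phi> (real k * s) x))"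
      by (simp add: fun_eq_iff flow_add[symmetric] algebra_simps)
    then show ?case using C1_map_compose[OF Suc s] by simp
  qed
  from this[of N] show ?thesis using Npos by (simp add: s_def)
qed

section \<open>The derivative cocycle\<close>

lemma tangent_flow_0: "tangent_map A (\<phi> 0) x v = v"
proof -
  have "\<phi> 0 = (\<lambda>x. x)" by (simp add: fun_eq_iff flow_0)
  then show ?thesis using tangent_map_id by simp
qed

lemma tangent_flow_add: "tangent_map A (\<phi> (s + t)) x v = tangent_map A (\<phi> s) (\<phi> t x) (tangent_map A (\<phi> t) x v)"
proof -
  have "\<phi> (s + t) = (\<lambda>x. \<phi> s (\<phi> t x))" by (simp add: fun_eq_iff flow_add)
  then show ?thesis using tangent_map_compose[OF flow_C1 flow_C1] by simp
qed

lemma tangent_flow_linear: "linear (tangent_map A (\<phi> t) x)"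
  by (rule tangent_map_linear[OF flow_C1])

text \<open>Both sides are the velocity at \<open>s = 0\<close> of the curve
  \<open>\<phi> (s + t) x\<close>, once by the chain rule through \<open>\<phi> t\<close> and once
  because the curve is an orbit.\<close>

lemma tangent_flow_X: "tangent_map A (\<phi> t) x (X x) = X (\<phi> t x)"
proof -
  let ?c = "chart_at A x" and ?d = "chart_at A (\<phi> t x)"
  have C: "C1_in ?c ?d (\<phi> t) x" by (intro C1_map_in flow_C1 chart_at)
  have "((\<lambda>s. snd ?c (\<phi> s x)) has_derivative (\<lambda>h. h *\<^sub>R X x)) (at 0)"
    using orbit_derivative[of 0 x] by (simp add: has_vector_derivative_def flow_0)
  then have "(rep ?c ?d (\<phi> t) \<circ> (\<lambda>s. snd ?c (\<phi> s x)) has_derivative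
      D ?c ?d (\<phi> t) x \<circ> (\<lambda>h. h *\<^sub>R X x)) (at 0)"
    by (rule diff_chain_at) (use C1_in_D[OF C] in \<open>simp add: flow_0\<close>)
  moreover have "D ?c ?d (\<phi> t) x \<circ> (\<lambda>h. h *\<^sub>R X x) = (\<lambda>h. h *\<^sub>R tangent_map A (\<phi> t) x (X x))"
    by (simp add: fun_eq_iff linear_scale[OF C1_in_linear[OF C]] coords_D)
  ultimately have d: "(rep ?c ?d (\<phi> t) \<circ> (\<lambda>s. snd ?c (\<phi> s x)) has_derivative
      (\<lambda>h. h *\<^sub>R tangent_map A (\<phi> t) x (X x))) (at 0)" by simp
  have "((\<lambda>s. snd ?d (\<phi> (s + t) x)) has_derivative (\<lambda>h. h *\<^sub>R tangent_map A (\<phi> t) x (X x))) (at 0)"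
  proof (rule has_derivative_transform_within_open[OF d open_orbit_preimage[OF chart(1)[OF chart_at(1)[of x]], of x]])
    show "0 \<in> {s. \<phi> s x \<in> fst ?c}" using chart_at by (simp add: flow_0)
    fix s assume "s \<in> {s. \<phi> s x \<in> fst ?c}"
    then show "(rep ?c ?d (\<phi> t) \<circ> (\<lambda>s. snd ?c (\<phi> s x))) s = snd ?d (\<phi> (s + t) x)"
      using chart(5)[OF chart_at(1)] by (simp add: rep_def flow_add[symmetric] add.commute)
  qed
  then have 1: "((\<lambda>s. snd ?d (\<phi> (s + t) x)) has_vector_derivative tangent_map A (\<phi> t) x (X x)) (at 0)"
    by (simp add: has_vector_derivative_def)
  have "((\<lambda>s. s + t) has_vector_derivative 1) (at 0)"
    by (auto intro!: derivative_eq_intros simp: has_real_derivative_iff_has_vector_derivative[symmetric])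
  then have "((\<lambda>s. snd ?d (\<phi> s x)) \<circ> (\<lambda>s. s + t) has_vector_derivative 1 *\<^sub>R X (\<phi> t x)) (at 0)"
    by (rule vector_diff_chain_at) (use orbit_derivative[of t x] in simp)
  then have 2: "((\<lambda>s. snd ?d (\<phi> (s + t) x)) has_vector_derivative X (\<phi> t x)) (at 0)"
    by (simp add: o_def)
  show ?thesis using vector_derivative_unique_at[OF 1 2] .
qed

lemma form_field_X_continuous:
  assumes q: "form_field q" shows "continuous_on UNIV (\<lambda>x. q x (X x))"
proof (rule continuous_at_imp_continuous_on, rule ballI)
  fix x :: 'm
  let ?c = "chart_at A x"
  have 1: "continuous_on (fst ?c) (\<lambda>y. f ?c (snd ?c y))"
    by (rule continuous_on_compose2[OF f_continuous[OF chart_at(1)] chart(3)[OF chart_at(1)]]) auto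
  have "continuous_on (fst ?c) (\<lambda>y. q y (from_coords A ?c y (f ?c (snd ?c y))))"
    by (rule form_field_joint[OF q chart_at(1) continuous_on_id _ 1]) auto
  then have "continuous_on (fst ?c) (\<lambda>y. q y (X y))"
    by (rule continuous_on_eq) (simp add: to_coords_X[OF chart_at(1), symmetric] coords_inverse[OF chart_at(1)])
  then show "isCont (\<lambda>x. q x (X x)) x"
    using chart(1)[OF chart_at(1)] chart_at(2) continuous_on_eq_continuous_at by blast
qed

text \<open>Over a compact set in a chart the bundle of unit coordinate vectors is compact, so
  minimum and maximum of the form there compare it with the Euclidean norm.\<close>

lemma form_field_norm_box:
  assumes p: "form_field p" and pos: "\<And>x v. v \<noteq> 0 \<Longrightarrow> p x v > 0" and c: "c \<in> A"
    and K: "compact K" "K \<subseteq> snd c ` fst c" "K \<noteq> {}"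
  obtains a b where "a > 0" "b > 0"
    "\<And>u w. u \<in> K \<Longrightarrow> a * (norm w)\<^sup>2 \<le> p (chart_inv c u) (from_coords A c (chart_inv c u) w)"
    "\<And>u w. u \<in> K \<Longrightarrow> p (chart_inv c u) (from_coords A c (chart_inv c u) w) \<le> b * (norm w)\<^sup>2"
proof -
  define E where "E = (\<lambda>(u, w). p (chart_inv c u) (from_coords A c (chart_inv c u) w))"
  define S where "S = K \<times> sphere (0 :: real ^ 'n) 1"
  have y: "chart_inv c u \<in> fst c" if "u \<in> K" for u using that K(2) chart(6)[OF c] by blast
  have "continuous_on S E" unfolding E_def S_def by (rule form_field_continuous_on_box[OF p c K(2)])
  moreover have compS: "compact S" unfolding S_def by (intro compact_Times K(1) compact_sphere)
  moreover have "axis undefined 1 \<in> sphere (0 :: real ^ 'n) 1" by simp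
  then have ne: "S \<noteq> {}" using K(3) unfolding S_def by blast
  ultimately obtain z1 z2 where z: "z1 \<in> S" "\<forall>z\<in>S. E z1 \<le> E z" "z2 \<in> S" "\<forall>z\<in>S. E z \<le> E z2"
    using continuous_attains_inf[of S E] continuous_attains_sup[of S E] by blast
  have Epos: "E z > 0" if h: "z \<in> S" for z
  proof -
    obtain u w where uw: "z = (u, w)" "u \<in> K" "norm w = 1" using h by (auto simp: S_def)
    have "from_coords A c (chart_inv c u) w \<noteq> 0"
      using coords_inverse(2)[OF c y[OF uw(2)], of w] linear_0[OF coords_linear(2)[OF c y[OF uw(2)]]] uw(3)
      by (metis norm_zero zero_neq_one)
    then show ?thesis using pos uw by (simp add: E_def)
  qed
  have scale: "p (chart_inv c u) (from_coords A c (chart_inv c u) w) = (norm w)\<^sup>2 * E (u, (1 / norm w) *\<^sub>R w)"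
    if "u \<in> K" "w \<noteq> 0" for u w
  proof -
    have "quadratic_form (\<lambda>w. p (chart_inv c u) (from_coords A c (chart_inv c u) w))"
      by (rule quadratic_form_compose[OF _ coords_linear(1)[OF c y[OF that(1)]]]) (use p in \<open>simp add: form_field_def\<close>)
    from quadratic_form_scale[OF this, of "norm w" "(1 / norm w) *\<^sub>R w"]
    show ?thesis using that(2) by (simp add: E_def)
  qed
  have S: "(u, (1 / norm w) *\<^sub>R w) \<in> S" if "u \<in> K" "w \<noteq> 0" for u w
    using that by (simp add: S_def)
  have p0: "p x 0 = 0" for x using p by (simp add: form_field_def quadratic_form_0)
  show ?thesis
  proof (rule that[of "E z1" "E z2"])
    fix u w assume u: "u \<in> K"
    have l0: "from_coords A c (chart_inv c u) 0 = 0" by (rule linear_0[OF coords_linear(1)[OF c y[OF u]]])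
    show "E z1 * (norm w)\<^sup>2 \<le> p (chart_inv c u) (from_coords A c (chart_inv c u) w)"
      using z(2) S[OF u, of w] scale[OF u, of w] by (cases "w = 0") (auto simp: p0 l0 mult.commute intro: mult_right_mono)
    show "p (chart_inv c u) (from_coords A c (chart_inv c u) w) \<le> E z2 * (norm w)\<^sup>2"
      using z(4) S[OF u, of w] scale[OF u, of w] by (cases "w = 0") (auto simp: p0 l0 mult.commute intro: mult_right_mono)
  qed (use Epos z in auto)
qed

text \<open>In a chart the derivative of the flow is bounded for short times; compactness makes that
  time uniform, and a fixed number of steps reaches time 1.\<close>

lemma flow_bound:
  assumes p: "form_field p" and pos: "\<And>x v. v \<noteq> 0 \<Longrightarrow> p x v > 0"
  obtains C where "C > 0" "\<And>t x v. \<bar>t\<bar> \<le> 1 \<Longrightarrow> p (\<phi> t x) (tangent_map A (\<phi> t) x v) \<le> C * p x v"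
proof -
  have p0: "p x v \<ge> 0" for x v
    using pos[of v x] p by (cases "v = 0") (auto simp: form_field_def quadratic_form_0)
  \<comment> \<open>Here \<kappa> is both the admissible time and the reciprocal of the constant, so
    that a single parameter passes through \<open>compact_local_to_global\<close>.\<close>
  define P where "P \<kappa> x \<longleftrightarrow> (\<forall>t v. \<bar>t\<bar> \<le> \<kappa> \<longrightarrow> \<kappa> * p (\<phi> t x) (tangent_map A (\<phi> t) x v) \<le> p x v)" for \<kappa> x
  obtain \<kappa> where \<kappa>: "\<kappa> > 0" "\<And>x. P \<kappa> x"
  proof (rule compact_local_to_global[OF compact_UNIV, of P])
    fix \<kappa> \<kappa>' :: real and y assume "P \<kappa> y" "\<kappa>' \<le> \<kappa>"
    then show "P \<kappa>' y" unfolding P_def using mult_right_mono[OF \<open>\<kappa>' \<le> \<kappa>\<close> p0] by (meson order_trans)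
  next
    fix x0 :: 'm
    let ?c = "chart_at A x0"
    note c = chart_at[of x0]
    obtain r \<epsilon> B Y where "flow_data ?c x0 r \<epsilon> B Y" using flow_data_exists[OF c] by blast
    note b = flow_dataD[OF this]
    let ?K = "cball (snd ?c x0) (2 * r)"
    have "?K \<noteq> {}" using b(1) by auto
    then obtain a b' where ab: "a > 0" "b' > 0"
      "\<And>u w. u \<in> ?K \<Longrightarrow> a * (norm w)\<^sup>2 \<le> p (chart_inv ?c u) (from_coords A ?c (chart_inv ?c u) w)"
      "\<And>u w. u \<in> ?K \<Longrightarrow> p (chart_inv ?c u) (from_coords A ?c (chart_inv ?c u) w) \<le> b' * (norm w)\<^sup>2"
      using form_field_norm_box[OF p pos c(1) compact_cball b(5)] by metis
    define k where "k = a / (b' * B\<^sup>2)"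
    have k: "k > 0" using ab b by (simp add: k_def)
    have bK: "ball (snd ?c x0) r \<subseteq> ?K" using b(1) by auto
    have "P (min \<epsilon> k) y" if y: "y \<in> chart_inv ?c ` ball (snd ?c x0) r" for y
      unfolding P_def
    proof (intro allI impI)
      fix t v assume "\<bar>t\<bar> \<le> min \<epsilon> k"
      then have t: "\<bar>t\<bar> \<le> \<epsilon>" by simp
      obtain u where u: "u \<in> ball (snd ?c x0) r" "y = chart_inv ?c u" using y by blast
      have ui: "u \<in> snd ?c ` fst ?c" using u bK b(5) by blast
      have yc: "y \<in> fst ?c" "snd ?c y = u" using chart(6,7)[OF c(1) ui] u by auto
      have fy: "\<phi> t y \<in> fst ?c" using b(6)[OF u(1) t] u by simp
      define w where "w = to_coords A ?c y v"
      define z where "z = snd ?c (\<phi> t y)"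
      have v: "v = from_coords A ?c y w" by (simp add: w_def coords_inverse[OF c(1) yc(1)])
      have zz: "z \<in> ?K" "chart_inv ?c z = \<phi> t y" using b(7)[OF u(1) t] u chart(5)[OF c(1) fy] by (auto simp: z_def)
      have DY: "D ?c ?c (\<phi> t) y w = Y t u w" using b(8)[OF u(1) t] yc by (intro D_eq) simp
      have "tangent_map A (\<phi> t) y v = from_coords A ?c (\<phi> t y) (Y t u w)"
        unfolding v DY[symmetric] by (rule tangent_map_from_coords[OF flow_C1 c(1) c(1) yc(1) fy])
      then have "p (\<phi> t y) (tangent_map A (\<phi> t) y v) \<le> b' * (norm (Y t u w))\<^sup>2"
        using ab(4)[OF zz(1), of "Y t u w"] zz(2) by simp
      also have "\<dots> \<le> b' * (B * norm w)\<^sup>2"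
        using b(10)[OF u(1) t, of w] ab by (intro mult_left_mono power_mono) auto
      finally have le: "p (\<phi> t y) (tangent_map A (\<phi> t) y v) \<le> b' * B\<^sup>2 * (norm w)\<^sup>2"
        by (simp add: power_mult_distrib)
      have "min \<epsilon> k * p (\<phi> t y) (tangent_map A (\<phi> t) y v) \<le> k * p (\<phi> t y) (tangent_map A (\<phi> t) y v)"
        using p0 by (intro mult_right_mono) auto
      also have "\<dots> \<le> k * (b' * B\<^sup>2 * (norm w)\<^sup>2)" using le k by simp
      also have "\<dots> = a * (norm w)\<^sup>2" using ab b by (simp add: k_def)
      also have "\<dots> \<le> p y v" using ab(3)[of u w] u bK v by auto
      finally show "min \<epsilon> k * p (\<phi> t y) (tangent_map A (\<phi> t) y v) \<le> p y v" .
    qed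
    moreover have "open (chart_inv ?c ` ball (snd ?c x0) r)"
      by (rule open_chart_inv_image[OF c(1) open_ball]) (use bK b(5) in blast)
    moreover have "x0 \<in> chart_inv ?c ` ball (snd ?c x0) r"
      using b(1) chart(5)[OF c] by (auto intro!: image_eqI[of _ _ "snd ?c x0"])
    ultimately show "\<exists>U \<kappa>. open U \<and> x0 \<in> U \<and> 0 < \<kappa> \<and> (\<forall>y\<in>U. P \<kappa> y)"
      using b(2) k by (intro exI[of _ "chart_inv ?c ` ball (snd ?c x0) r"] exI[of _ "min \<epsilon> k"]) auto
  qed blast
  obtain N :: nat where N: "1 / \<kappa> < real N" using reals_Archimedean2 by blast
  have Npos: "real N > 0" using N \<kappa>(1) by (meson divide_pos_pos less_trans zero_less_one)
  show ?thesis
  proof (rule that[of "(1 / \<kappa>) ^ N"])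
    show "(1 / \<kappa>) ^ N > 0" using \<kappa>(1) by simp
    fix t x v assume t: "\<bar>t :: real\<bar> \<le> 1"
    define s where "s = t / real N"
    have "\<bar>s\<bar> \<le> 1 / real N" using t Npos by (simp add: s_def divide_right_mono)
    also have "\<dots> \<le> \<kappa>" using N Npos \<kappa>(1) by (simp add: field_simps)
    finally have s: "\<bar>s\<bar> \<le> \<kappa>" .
    have "p (\<phi> (real k * s) x) (tangent_map A (\<phi> (real k * s)) x v) \<le> (1 / \<kappa>) ^ k * p x v" for k
    proof (induction k)
      case 0
      then show ?case using flow_0[of x] tangent_flow_0[of x v] by (simp only: of_nat_0 mult_zero_left power_0 mult_1_left order_refl)
    next
      case (Suc k)
      have eq: "real (Suc k) * s = s + real k * s" by (simp add: algebra_simps)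
      let ?y = "\<phi> (real k * s) x" and ?w = "tangent_map A (\<phi> (real k * s)) x v"
      have "\<kappa> * p (\<phi> s ?y) (tangent_map A (\<phi> s) ?y ?w) \<le> p ?y ?w"
        using \<kappa>(2) s unfolding P_def by blast
      then have "p (\<phi> s ?y) (tangent_map A (\<phi> s) ?y ?w) \<le> 1 / \<kappa> * p ?y ?w" using \<kappa>(1) by (simp add: field_simps)
      also have "\<dots> \<le> 1 / \<kappa> * ((1 / \<kappa>) ^ k * p x v)" using Suc \<kappa>(1) by (intro mult_left_mono) auto
      finally show ?case unfolding eq tangent_flow_add flow_add[of s "real k * s" x] by simp
    qed
    from this[of N] show "p (\<phi> t x) (tangent_map A (\<phi> t) x v) \<le> (1 / \<kappa>) ^ N * p x v"
      using Npos by (simp add: s_def)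
  qed
qed

end

section \<open>Continuity of complementary fields of subspaces\<close>

text \<open>Closedness alone lets fibres jump to larger ones in the limit; a complementary field
  with closed graph rules this out.\<close>

definition closed_graph :: "'b::metric_space set \<Rightarrow> ('b \<Rightarrow> 'a::euclidean_space set) \<Rightarrow> bool" where
  "closed_graph V E \<longleftrightarrow> (\<forall>u w u' w'. (\<forall>k::nat. u k \<in> V \<and> w k \<in> E (u k)) \<longrightarrow>
     u \<longlonglongrightarrow> u' \<longrightarrow> u' \<in> V \<longrightarrow> w \<longlonglongrightarrow> w' \<longrightarrow> w' \<in> E u')"

lemma closed_graphD:
  assumes "closed_graph V E" "\<And>k. u k \<in> V" "\<And>k. w k \<in> E (u k)" "u \<longlonglongrightarrow> u'" "u' \<in> V" "w \<longlonglongrightarrow> w'"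
  shows "w' \<in> E u'"
  using assms unfolding closed_graph_def by blast

text \<open>Lets indices picked by choice run to infinity without being made monotone.\<close>

lemma filterlim_ge_id: "(\<And>n. n \<le> (r n :: nat)) \<Longrightarrow> filterlim r at_top sequentially"
  by (rule filterlim_at_top_mono[OF filterlim_ident]) auto

lemma bounded_subsequence:
  fixes s :: "nat \<Rightarrow> 'a::euclidean_space"
  assumes "\<And>n. norm (s n) \<le> B"
  obtains h l where "strict_mono h" "(\<lambda>n. s (h n)) \<longlonglongrightarrow> l"
proof -
  have "bounded (range s)" using assms by (auto simp: bounded_iff)
  then show ?thesis using bounded_imp_convergent_subsequence[of s] that by (auto simp: o_def)
qed

locale complementary_fields =
  fixes V :: "'b::metric_space set" and E1 E2 :: "'b \<Rightarrow> 'a::euclidean_space set"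
  assumes sub: "u \<in> V \<Longrightarrow> subspace (E1 u)" "u \<in> V \<Longrightarrow> subspace (E2 u)"
    and closed: "closed_graph V E1" "closed_graph V E2"
    and Int: "u \<in> V \<Longrightarrow> w \<in> E1 u \<Longrightarrow> w \<in> E2 u \<Longrightarrow> w = 0"
begin

text \<open>An unbounded sequence of \<open>E1\<close> parts, normalised, would have a unit limit in
  \<open>E1 u'\<close> whose negative is a limit of the rescaled \<open>E2\<close> parts, so that it
  would lie in both fibres.\<close>

lemma component_bounded:
  assumes u: "\<And>k. u k \<in> V" "u \<longlonglongrightarrow> u'" "u' \<in> V" and s: "\<And>k. s k \<in> E1 (u k)" and a: "\<And>k. a k \<in> E2 (u k)"
    and B: "\<And>k. norm (s k + a k) \<le> B"
  shows "\<exists>B'. \<forall>k. norm (s k) \<le> B'"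
proof (rule ccontr)
  assume neg: "\<not> ?thesis"
  have "\<exists>k. n \<le> k \<and> norm (s k) > real n + 1" for n
  proof (rule ccontr)
    assume "\<not> ?thesis"
    then have le: "norm (s k) \<le> real n + 1" if "n \<le> k" for k using that by (force simp: not_less)
    have "norm (s k) \<le> (\<Sum>j<n. norm (s j)) + (real n + 1)" for k
    proof (cases "n \<le> k")
      case True
      then show ?thesis using le[OF True] sum_nonneg[of "{..<n}" "\<lambda>j. norm (s j)"] by simp
    next
      case False
      then have "norm (s k) \<le> (\<Sum>j<n. norm (s j))" by (intro member_le_sum) auto
      then show ?thesis by simp
    qed
    then show False using neg by blast
  qed
  then obtain r where r: "\<And>n. n \<le> r n" "\<And>n. norm (s (r n)) > real n + 1" by metis
  have rl: "filterlim r at_top sequentially" using r(1) by (rule filterlim_ge_id)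
  have pos: "norm (s (r n)) > 0" for n using r(2)[of n] by linarith
  define \<sigma> where "\<sigma> n = (1 / norm (s (r n))) *\<^sub>R s (r n)" for n
  define \<alpha> where "\<alpha> n = (1 / norm (s (r n))) *\<^sub>R a (r n)" for n
  have \<sigma>1: "norm (\<sigma> n) = 1" for n using pos[of n] by (simp add: \<sigma>_def)
  obtain h l where h: "strict_mono h" "(\<lambda>n. \<sigma> (h n)) \<longlonglongrightarrow> l"
    using bounded_subsequence[of \<sigma> 1] \<sigma>1 by auto
  have B0: "B \<ge> 0" using order_trans[OF norm_ge_zero B] .
  have "(\<lambda>n. \<sigma> n + \<alpha> n) \<longlonglongrightarrow> 0"
  proof (rule Lim_null_comparison[where g = "\<lambda>n. B * inverse (real (Suc n))"])
    show "\<forall>\<^sub>F n in sequentially. norm (\<sigma> n + \<alpha> n) \<le> B * inverse (real (Suc n))"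
    proof (rule always_eventually, rule allI)
      fix n
      have "\<sigma> n + \<alpha> n = (1 / norm (s (r n))) *\<^sub>R (s (r n) + a (r n))" by (simp add: \<sigma>_def \<alpha>_def scaleR_add_right)
      then have "norm (\<sigma> n + \<alpha> n) = norm (s (r n) + a (r n)) / norm (s (r n))" using pos[of n] by simp
      also have "\<dots> \<le> B / (real n + 1)" using B[of "r n"] r(2)[of n] B0 by (intro frac_le) auto
      finally show "norm (\<sigma> n + \<alpha> n) \<le> B * inverse (real (Suc n))" by (simp add: divide_inverse add.commute)
    qed
    have "(\<lambda>n. B * inverse (real (Suc n))) \<longlonglongrightarrow> B * 0" by (intro tendsto_intros LIMSEQ_inverse_real_of_nat)
    then show "(\<lambda>n. B * inverse (real (Suc n))) \<longlonglongrightarrow> 0" by simp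
  qed
  then have "(\<lambda>n. \<sigma> (h n) + \<alpha> (h n)) \<longlonglongrightarrow> 0"
    using LIMSEQ_subseq_LIMSEQ[OF _ h(1)] by (fastforce simp: o_def)
  then have "(\<lambda>n. (\<sigma> (h n) + \<alpha> (h n)) - \<sigma> (h n)) \<longlonglongrightarrow> 0 - l" by (intro tendsto_diff h(2))
  then have \<alpha>l: "(\<lambda>n. \<alpha> (h n)) \<longlonglongrightarrow> - l" by simp
  have rh: "filterlim (\<lambda>n. r (h n)) at_top sequentially"
    by (rule filterlim_compose[OF rl filterlim_subseq[OF h(1)]])
  have ul: "(\<lambda>n. u (r (h n))) \<longlonglongrightarrow> u'" by (rule filterlim_compose[OF u(2) rh])
  have "l \<in> E1 u'"
    by (rule closed_graphD[OF closed(1) _ _ ul u(3) h(2)])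
      (auto simp: \<sigma>_def u(1) intro!: subspace_scale[OF sub(1)[OF u(1)]] s)
  moreover have "- l \<in> E2 u'"
    by (rule closed_graphD[OF closed(2) _ _ ul u(3) \<alpha>l])
      (auto simp: \<alpha>_def u(1) intro!: subspace_scale[OF sub(2)[OF u(1)]] a)
  then have "l \<in> E2 u'" using subspace_neg[OF sub(2)[OF u(3)]] by force
  ultimately have "l = 0" by (rule Int[OF u(3)])
  moreover have "norm l = 1"
    using tendsto_norm[OF h(2)] by (simp add: \<sigma>1 LIMSEQ_const_iff)
  ultimately show False by simp
qed

text \<open>Bounded sums have bounded parts, so the parts converge along a subsequence. In this way
  two of three summands merge into one closed complement of the third.\<close>

lemma closed_graph_sum: "closed_graph V (\<lambda>u. {s + a |s a. s \<in> E1 u \<and> a \<in> E2 u})"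
  unfolding closed_graph_def
proof (intro allI impI)
  fix u w u' w'
  assume uw: "\<forall>k::nat. u k \<in> V \<and> w k \<in> {s + a |s a. s \<in> E1 (u k) \<and> a \<in> E2 (u k)}"
    and u: "u \<longlonglongrightarrow> u'" "u' \<in> V" and w: "w \<longlonglongrightarrow> w'"
  then have "\<forall>k. \<exists>s a. s \<in> E1 (u k) \<and> a \<in> E2 (u k) \<and> w k = s + a" by blast
  then obtain s a where sa: "\<And>k. s k \<in> E1 (u k)" "\<And>k. a k \<in> E2 (u k)" "\<And>k. w k = s k + a k" by metis
  obtain B where "\<And>k. norm (w k) \<le> B" using convergent_imp_Bseq[of w] w unfolding convergent_def Bseq_def by blast
  then obtain B' where "\<And>k. norm (s k) \<le> B'"
    using component_bounded[of u u' s a B] uw u sa by force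
  then obtain h l where h: "strict_mono h" "(\<lambda>n. s (h n)) \<longlonglongrightarrow> l" using bounded_subsequence[of s B'] by blast
  have uh: "(\<lambda>n. u (h n)) \<longlonglongrightarrow> u'" using LIMSEQ_subseq_LIMSEQ[OF u(1) h(1)] by (simp add: o_def)
  have wh: "(\<lambda>n. w (h n)) \<longlonglongrightarrow> w'" using LIMSEQ_subseq_LIMSEQ[OF w h(1)] by (simp add: o_def)
  have "(\<lambda>n. w (h n) - s (h n)) \<longlonglongrightarrow> w' - l" by (intro tendsto_diff wh h(2))
  then have ah: "(\<lambda>n. a (h n)) \<longlonglongrightarrow> w' - l" by (simp add: sa(3))
  have "l \<in> E1 u'" by (rule closed_graphD[OF closed(1) _ _ uh u(2) h(2)]) (use uw sa in auto)
  moreover have "w' - l \<in> E2 u'" by (rule closed_graphD[OF closed(2) _ _ uh u(2) ah]) (use uw sa in auto)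
  ultimately show "w' \<in> {s + a |s a. s \<in> E1 u' \<and> a \<in> E2 u'}"
    by (intro CollectI exI[of _ l] exI[of _ "w' - l"]) simp
qed

end

locale splitting_fields = complementary_fields V E1 E2
  for V :: "'b::metric_space set" and E1 E2 :: "'b \<Rightarrow> 'a::euclidean_space set" +
  assumes sum: "u \<in> V \<Longrightarrow> \<exists>s a. s \<in> E1 u \<and> a \<in> E2 u \<and> w = s + a"
begin

definition \<pi> :: "'b \<Rightarrow> 'a \<Rightarrow> 'a" where "\<pi> u w = (SOME s. s \<in> E1 u \<and> w - s \<in> E2 u)"

lemma \<pi>: assumes "u \<in> V" shows "\<pi> u w \<in> E1 u" "w - \<pi> u w \<in> E2 u"
proof -
  obtain s a where "s \<in> E1 u" "a \<in> E2 u" "w = s + a" using sum[OF assms] by blast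
  then have "\<exists>s. s \<in> E1 u \<and> w - s \<in> E2 u" by (intro exI[of _ s]) auto
  then have "\<pi> u w \<in> E1 u \<and> w - \<pi> u w \<in> E2 u" unfolding \<pi>_def by (rule someI_ex)
  then show "\<pi> u w \<in> E1 u" "w - \<pi> u w \<in> E2 u" by auto
qed

lemma \<pi>_eq: assumes u: "u \<in> V" and "s \<in> E1 u" "w - s \<in> E2 u" shows "\<pi> u w = s"
proof -
  have "\<pi> u w - s \<in> E1 u" using subspace_diff[OF sub(1)[OF u] \<pi>(1)[OF u] assms(2)] .
  moreover have "(w - s) - (w - \<pi> u w) \<in> E2 u" using subspace_diff[OF sub(2)[OF u] assms(3) \<pi>(2)[OF u]] .
  then have "\<pi> u w - s \<in> E2 u" by simp
  ultimately show ?thesis using Int[OF u] by force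
qed

lemma \<pi>_linear: assumes u: "u \<in> V" shows "linear (\<pi> u)"
proof (rule linearI)
  fix v w a
  have eq: "v + w - (\<pi> u v + \<pi> u w) = (v - \<pi> u v) + (w - \<pi> u w)" by simp
  show "\<pi> u (v + w) = \<pi> u v + \<pi> u w"
  proof (rule \<pi>_eq[OF u])
    show "\<pi> u v + \<pi> u w \<in> E1 u" by (rule subspace_add[OF sub(1)[OF u] \<pi>(1)[OF u] \<pi>(1)[OF u]])
    show "v + w - (\<pi> u v + \<pi> u w) \<in> E2 u"
      unfolding eq by (rule subspace_add[OF sub(2)[OF u] \<pi>(2)[OF u] \<pi>(2)[OF u]])
  qed
  show "\<pi> u (a *\<^sub>R v) = a *\<^sub>R \<pi> u v"
  proof (rule \<pi>_eq[OF u])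
    show "a *\<^sub>R \<pi> u v \<in> E1 u" by (rule subspace_scale[OF sub(1)[OF u] \<pi>(1)[OF u]])
    show "a *\<^sub>R v - a *\<^sub>R \<pi> u v \<in> E2 u"
      unfolding scaleR_diff_right[symmetric] by (rule subspace_scale[OF sub(2)[OF u] \<pi>(2)[OF u]])
  qed
qed

text \<open>The projections stay bounded, and every limit point \<open>l\<close> of them satisfies
  \<open>l \<in> E1 u'\<close> and \<open>w - l \<in> E2 u'\<close>, which determines it.\<close>

lemma \<pi>_continuous: "continuous_on V (\<lambda>u. \<pi> u w)"
  unfolding continuous_on_sequentially
proof (intro allI impI ballI, elim conjE)
  fix u u' assume u': "u' \<in> V" and "\<forall>n. u n \<in> V" and ul: "u \<longlonglongrightarrow> u'"
  then have u: "\<And>n. u n \<in> V" by blast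
  have "(\<lambda>n. \<pi> (u n) w) \<longlonglongrightarrow> \<pi> u' w"
  proof (rule ccontr)
    assume "\<not> ?thesis"
    then obtain e where e: "e > 0" "\<not> (\<forall>\<^sub>F n in sequentially. dist (\<pi> (u n) w) (\<pi> u' w) < e)"
      unfolding tendsto_iff by blast
    then have "\<exists>k\<ge>n. \<not> dist (\<pi> (u k) w) (\<pi> u' w) < e" for n unfolding eventually_sequentially by blast
    then obtain r where r: "\<And>n. n \<le> r n" "\<And>n. \<not> dist (\<pi> (u (r n)) w) (\<pi> u' w) < e" by metis
    have ur: "(\<lambda>n. u (r n)) \<longlonglongrightarrow> u'" by (rule filterlim_compose[OF ul filterlim_ge_id[OF r(1)]])
    obtain B' where "\<And>k. norm (\<pi> (u (r k)) w) \<le> B'"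
      using component_bounded[of "\<lambda>n. u (r n)" u' "\<lambda>n. \<pi> (u (r n)) w" "\<lambda>n. w - \<pi> (u (r n)) w" "norm w"] u u' ur \<pi>
      by auto
    then obtain h l where h: "strict_mono h" "(\<lambda>n. \<pi> (u (r (h n))) w) \<longlonglongrightarrow> l"
      using bounded_subsequence[of "\<lambda>n. \<pi> (u (r n)) w" B'] by blast
    have uh: "(\<lambda>n. u (r (h n))) \<longlonglongrightarrow> u'" using LIMSEQ_subseq_LIMSEQ[OF ur h(1)] by (simp add: o_def)
    have "l \<in> E1 u'" by (rule closed_graphD[OF closed(1) _ _ uh u' h(2)]) (use u \<pi> in auto)
    moreover have "(\<lambda>n. w - \<pi> (u (r (h n))) w) \<longlonglongrightarrow> w - l" by (intro tendsto_intros h(2))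
    then have "w - l \<in> E2 u'" by (rule closed_graphD[OF closed(2) _ _ uh u', rotated 2]) (use u \<pi> in auto)
    ultimately have l: "\<pi> u' w = l" by (rule \<pi>_eq[OF u'])
    have "\<forall>\<^sub>F n in sequentially. dist (\<pi> (u (r (h n))) w) l < e" using h(2) e(1) by (rule tendstoD)
    then obtain n where "dist (\<pi> (u (r (h n))) w) l < e" using eventually_happens by fastforce
    then show False using r(2)[of "h n"] l by simp
  qed
  then show "((\<lambda>u. \<pi> u w) \<circ> u) \<longlonglongrightarrow> \<pi> u' w" by (simp add: o_def)
qed

end

text \<open>Near \<open>u0\<close> the map built from the projections at \<open>u\<close> and at \<open>u0\<close> is invertible, so it carries
  a basis of the fibre over \<open>u0\<close> to a basis of the fibre over \<open>u\<close>.\<close>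
lemma matrix_nth: "matrix T $ i $ j = T (axis j 1) $ i"
  by (simp add: matrix_def)

lemma local_frame:
  fixes E1 E2 :: "'b::metric_space \<Rightarrow> (real ^ 'n::finite) set"
  assumes "splitting_fields V E1 E2" and V: "open V" "u0 \<in> V"
  obtains W k z where "open W" "u0 \<in> W" "W \<subseteq> V" "\<And>i. continuous_on W (z (i::nat))"
    "\<And>u. u \<in> W \<Longrightarrow> inj_on (\<lambda>i. z i u) {..<k}" "\<And>u. u \<in> W \<Longrightarrow> independent ((\<lambda>i. z i u) ` {..<k})"
    "\<And>u. u \<in> W \<Longrightarrow> span ((\<lambda>i. z i u) ` {..<k}) = E1 u"
proof -
  interpret splitting_fields V E1 E2 by fact
  define \<Lambda> where "\<Lambda> u v = \<pi> u (\<pi> u0 v) + ((v - \<pi> u0 v) - \<pi> u (v - \<pi> u0 v))" for u v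
  have lin0: "linear (\<pi> u0)" by (rule \<pi>_linear[OF V(2)])
  have lin: "linear (\<Lambda> u)" if "u \<in> V" for u
    by (rule linearI) (simp_all add: \<Lambda>_def linear_add[OF \<pi>_linear[OF that]] linear_diff[OF \<pi>_linear[OF that]]
        linear_scale[OF \<pi>_linear[OF that]] linear_add[OF lin0] linear_scale[OF lin0] algebra_simps)
  have \<Lambda>0: "\<Lambda> u0 v = v" for v
  proof -
    have "\<pi> u0 (\<pi> u0 v) = \<pi> u0 v" by (rule \<pi>_eq[OF V(2) \<pi>(1)[OF V(2)]]) (simp add: subspace_0 sub V)
    moreover have "\<pi> u0 (v - \<pi> u0 v) = 0"
      by (rule \<pi>_eq[OF V(2)]) (use \<pi>(2)[OF V(2)] in \<open>simp_all add: subspace_0 sub V\<close>)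
    ultimately show ?thesis by (simp add: \<Lambda>_def)
  qed
  have cont: "continuous_on V (\<lambda>u. \<Lambda> u v)" for v
    unfolding \<Lambda>_def by (intro continuous_on_add continuous_on_diff continuous_on_const \<pi>_continuous)
  have "continuous_on V (\<lambda>u. det (matrix (\<Lambda> u)))"
    unfolding det_def matrix_nth
    by (intro continuous_on_sum continuous_on_mult continuous_on_prod continuous_on_const continuous_on_component cont)
  then have "open (V \<inter> (\<lambda>u. det (matrix (\<Lambda> u))) -` (- {0}))"
    by (rule continuous_open_preimage[OF _ V(1)]) auto
  moreover have "\<Lambda> u0 = id" using \<Lambda>0 by (simp add: fun_eq_iff)
  then have "det (matrix (\<Lambda> u0)) \<noteq> 0" by (simp add: det_I)
  ultimately obtain W where W: "open W" "u0 \<in> W" "W \<subseteq> V" "\<And>u. u \<in> W \<Longrightarrow> det (matrix (\<Lambda> u)) \<noteq> 0"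
    using V(2) by blast
  have inj: "inj (\<Lambda> u)" if "u \<in> W" for u
    using det_nz_iff_inj[OF lin] W that by blast
  have image: "\<Lambda> u ` E1 u0 = E1 u" if "u \<in> W" for u
  proof
    have uV: "u \<in> V" using that W by blast
    have E1: "\<Lambda> u v = \<pi> u v" if "v \<in> E1 u0" for v
    proof -
      have "\<pi> u0 v = v" by (rule \<pi>_eq[OF V(2) that]) (simp add: subspace_0 sub V)
      then show ?thesis using linear_0[OF \<pi>_linear[OF uV]] by (simp add: \<Lambda>_def)
    qed
    show "\<Lambda> u ` E1 u0 \<subseteq> E1 u" using E1 \<pi>(1)[OF uV] by auto
    show "E1 u \<subseteq> \<Lambda> u ` E1 u0"
    proof
      fix w assume w: "w \<in> E1 u"
      have "surj (\<Lambda> u)" using linear_injective_imp_surjective[OF lin[OF uV] inj[OF that] refl] .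
      then obtain v where v: "w = \<Lambda> u v" by (metis surjD)
      define a where "a = v - \<pi> u0 v"
      \<comment> \<open>The equation places an element of \<open>E2 u\<close> in
        \<open>E1 u\<close>, so it is 0: the complementary part of \<open>v\<close> contributes
        nothing to \<open>w\<close>.\<close>
      have "a - \<pi> u a = w - \<pi> u (\<pi> u0 v)" by (simp add: v \<Lambda>_def a_def)
      also have "\<dots> \<in> E1 u" by (rule subspace_diff[OF sub(1)[OF uV] w \<pi>(1)[OF uV]])
      finally have "a - \<pi> u a = 0" by (rule Int[OF uV]) (rule \<pi>(2)[OF uV])
      then have "w = \<pi> u (\<pi> u0 v)" using v by (simp add: \<Lambda>_def a_def)
      then have "w = \<Lambda> u (\<pi> u0 v)" using E1[OF \<pi>(1)[OF V(2)]] by simp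
      then show "w \<in> \<Lambda> u ` E1 u0" using \<pi>(1)[OF V(2)] by blast
    qed
  qed
  obtain b where b: "b \<subseteq> E1 u0" "independent b" "span b = E1 u0"
    using basis_exists[of "E1 u0"] span_subspace[OF _ _ sub(1)[OF V(2)]] by metis
  have "finite b" using b(2) by (rule independent_imp_finite)
  then obtain e where e: "bij_betw e {..<card b} b" using bij_betw_from_nat_into_finite by blast
  define z where "z i u = \<Lambda> u (e i)" for i u
  have zimg: "(\<lambda>i. z i u) ` {..<card b} = \<Lambda> u ` b" for u
    using e unfolding z_def bij_betw_def by force
  show ?thesis
  proof (rule that[of W z "card b"])
    show "continuous_on W (z i)" for i
      unfolding z_def[abs_def] by (rule continuous_on_subset[OF cont W(3)])
    fix u assume u: "u \<in> W"
    then have uV: "u \<in> V" using W by blast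
    have "inj_on e {..<card b}" using e by (simp add: bij_betw_def)
    then show "inj_on (\<lambda>i. z i u) {..<card b}"
      unfolding z_def using inj[OF u] by (auto simp: inj_on_def)
    show "independent ((\<lambda>i. z i u) ` {..<card b})"
      unfolding zimg by (rule linear_independent_injective_image[OF lin[OF uV] b(2) inj_on_subset[OF inj[OF u] subset_UNIV]])
    show "span ((\<lambda>i. z i u) ` {..<card b}) = E1 u"
      unfolding zimg by (simp add: linear_span_image[OF lin[OF uV]] b(3) image[OF u])
  qed (use W in auto)
qed

section \<open>Conservation of volume\<close>

text \<open>An orthonormal set of maximal cardinality replaces the Gram-Schmidt recursion: a nonzero
  residual \<open>R v\<close> could be normalised and added. \<open>L\<close> takes the coefficients
  in it.\<close>

lemma orthonormal_frame:
  fixes B :: "real ^ 'n \<Rightarrow> real ^ 'n \<Rightarrow> real"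
  assumes B: "bilinear B" "\<And>v w. B v w = B w v" "\<And>v. v \<noteq> 0 \<Longrightarrow> B v v > 0"
  obtains L :: "real ^ 'n \<Rightarrow> real ^ 'n::finite" where "linear L" "\<And>v w. B v w = L v \<bullet> L w"
proof -
  define P where "P S \<longleftrightarrow> finite S \<and> (\<forall>a\<in>S. \<forall>b\<in>S. B a b = (if a = b then 1 else 0))" for S
  have orth: "B w x = 0" if "\<And>a. a \<in> S \<Longrightarrow> B w a = 0" "x \<in> span S" for w x S
  proof -
    have "subspace {x. B w x = 0}"
      unfolding subspace_def using B(1) by (simp add: bilinear_rzero bilinear_radd bilinear_rmul)
    then have "span S \<subseteq> {x. B w x = 0}" using that(1) by (intro span_minimal) auto
    then show ?thesis using that(2) by auto
  qed
  have card: "card S \<le> CARD('n)" if S: "P S" for S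
  proof -
    have "independent S"
      unfolding dependent_def
    proof (intro notI, elim bexE)
      fix a assume a: "a \<in> S" "a \<in> span (S - {a})"
      then have "B a a = 0" using S by (intro orth[of "S - {a}" a a]) (auto simp: P_def)
      then show False using S a(1) by (simp add: P_def)
    qed
    then show ?thesis using independent_card_le[of S] by simp
  qed
  have "P {}" by (simp add: P_def)
  then have "\<exists>S. P S \<and> (\<forall>T. P T \<longrightarrow> card T \<le> card S)"
    by (rule ex_has_greatest_nat[of P "{}" card "Suc CARD('n)"]) (use card in \<open>auto simp: less_Suc_eq_le\<close>)
  then obtain S where S: "P S" "\<And>T. P T \<Longrightarrow> card T \<le> card S" by blast
  have fin: "finite S" and ortho: "\<And>a b. a \<in> S \<Longrightarrow> b \<in> S \<Longrightarrow> B a b = (if a = b then 1 else 0)"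
    using S(1) by (auto simp: P_def)
  define R where "R v = v - (\<Sum>a\<in>S. B v a *\<^sub>R a)" for v
  have RS: "B (R v) b = 0" if "b \<in> S" for v b
  proof -
    have "B (\<Sum>a\<in>S. B v a *\<^sub>R a) b = (\<Sum>a\<in>S. B (B v a *\<^sub>R a) b)"
      using B(1) linear_sum[of "\<lambda>x. B x b"] by (auto simp: bilinear_def)
    also have "\<dots> = (\<Sum>a\<in>S. if a = b then B v a else 0)"
      using that by (intro sum.cong) (auto simp: bilinear_lmul[OF B(1)] ortho)
    also have "\<dots> = B v b" using that fin by simp
    finally show ?thesis by (simp add: R_def bilinear_lsub[OF B(1)])
  qed
  have R0: "R v = 0" for v
  proof (rule ccontr)
    assume nz: "R v \<noteq> 0"
    define k where "k = 1 / sqrt (B (R v) (R v))"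
    define w where "w = k *\<^sub>R R v"
    have pos: "B (R v) (R v) > 0" using B(3)[OF nz] .
    have "B w w = k\<^sup>2 * B (R v) (R v)"
      by (simp add: w_def bilinear_lmul[OF B(1)] bilinear_rmul[OF B(1)] power2_eq_square)
    then have w1: "B w w = 1" using pos by (simp add: k_def power_divide)
    have w0: "B w b = 0" if "b \<in> S" for b using RS[OF that] by (simp add: w_def bilinear_lmul[OF B(1)])
    then have "w \<notin> S" using w1 by force
    have w0': "B b w = 0" if "b \<in> S" for b using w0[OF that] B(2) by metis
    have "P (insert w S)"
      unfolding P_def using fin w1 w0 w0' ortho \<open>w \<notin> S\<close> by auto
    then show False using S(2)[of "insert w S"] fin \<open>w \<notin> S\<close> by simp
  qed
  have expand: "v = (\<Sum>a\<in>S. B v a *\<^sub>R a)" for v using R0[of v] by (simp add: R_def)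
  have "independent S"
      unfolding dependent_def
  proof (intro notI, elim bexE)
    fix a assume a: "a \<in> S" "a \<in> span (S - {a})"
    then have "B a a = 0" using S by (intro orth[of "S - {a}" a a]) (auto simp: P_def)
    then show False using ortho[of a a] a(1) by simp
  qed
  moreover have "UNIV \<subseteq> span S"
  proof
    fix v show "v \<in> span S" by (subst expand[of v]) (intro span_sum span_scale span_base)
  qed
  ultimately have "card S = dim (UNIV :: (real ^ 'n) set)" by (intro basis_card_eq_dim) auto
  then have "card S = CARD('n)" by simp
  then obtain b where b: "bij_betw b (UNIV :: 'n set) S"
    using finite_same_card_bij[of "UNIV::'n set" S] fin by auto
  define L where "L v = (\<chi> i. B v (b i))" for v
  have "linear L"
    by (rule linearI) (simp_all add: L_def vec_eq_iff bilinear_ladd[OF B(1)] bilinear_lmul[OF B(1)])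
  moreover have "B v w = L v \<bullet> L w" for v w
  proof -
    have "B v w = B v (\<Sum>a\<in>S. B w a *\<^sub>R a)" using expand[of w] by simp
    also have "\<dots> = (\<Sum>a\<in>S. B v (B w a *\<^sub>R a))"
      using B(1) linear_sum[of "B v"] by (auto simp: bilinear_def)
    also have "\<dots> = (\<Sum>a\<in>S. B v a * B w a)" by (simp add: bilinear_rmul[OF B(1)] mult.commute)
    also have "\<dots> = (\<Sum>i\<in>UNIV. B v (b i) * B w (b i))"
      by (rule sum.reindex_bij_betw[OF b, symmetric])
    finally show ?thesis by (simp add: L_def inner_vec_def)
  qed
  ultimately show ?thesis by (rule that)
qed

lemma det_has_derivative:
  fixes M :: "'a::real_normed_vector \<Rightarrow> real ^ 'n ^ 'n::finite"
  assumes M: "\<And>i j. ((\<lambda>u. M u $ i $ j) has_derivative M' i j) (at u)"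
  shows "((\<lambda>u. det (M u)) has_derivative
    (\<lambda>h. \<Sum>p | p permutes UNIV. of_int (sign p) * (\<Sum>i\<in>UNIV. M' i (p i) h * (\<Prod>j\<in>UNIV - {i}. M u $ j $ p j)))) (at u)"
  unfolding det_def
  by (intro has_derivative_sum has_derivative_mult_right has_derivative_prod M)

text \<open>Jacobi's formula at the identity. Each product omits one factor only, and a permutation
  other than the identity moves at least two indices, so a vanishing off-diagonal entry survives in
  each of its terms.\<close>

lemma det_has_derivative_at_identity:
  fixes M :: "'a::real_normed_vector \<Rightarrow> real ^ 'n ^ 'n::finite"
  assumes M: "\<And>i j. ((\<lambda>u. M u $ i $ j) has_derivative M' i j) (at u)" and one: "M u = mat 1"
  shows "((\<lambda>u. det (M u)) has_derivative (\<lambda>h. \<Sum>i\<in>UNIV. M' i i h)) (at u)"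
proof (rule has_derivative_eq_rhs[OF det_has_derivative[OF M]], rule ext)
  fix h
  let ?t = "\<lambda>p. of_int (sign p) * (\<Sum>i\<in>UNIV. M' i (p i) h * (\<Prod>j\<in>UNIV - {i}. M u $ j $ p j))"
  have zero: "?t p = 0" if p: "p permutes UNIV" "p \<noteq> id" for p
  proof -
    obtain k where k: "p k \<noteq> k" using p(2) by (auto simp: fun_eq_iff)
    have k2: "p (p k) \<noteq> p k" using k permutes_inj[OF p(1)] by (auto dest: injD)
    have "(\<Prod>j\<in>UNIV - {i}. M u $ j $ p j) = 0" for i
    proof -
      define j where "j = (if i = k then p k else k)"
      have "j \<in> UNIV - {i}" "p j \<noteq> j" using k k2 by (auto simp: j_def)
      then show ?thesis unfolding one by (intro prod_zero bexI[of _ j]) (auto simp: mat_def)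
    qed
    then show ?thesis by (simp only: mult_zero_right sum.neutral_const)
  qed
  have "(\<Sum>p | p permutes UNIV. ?t p) = (\<Sum>p\<in>{id}. ?t p)"
    by (rule sum.mono_neutral_right) (use zero permutes_id in \<open>auto simp: finite_permutations\<close>)
  also have "\<dots> = (\<Sum>i\<in>UNIV. M' i i h)" by (simp add: one mat_def sign_id)
  finally show "(\<Sum>p | p permutes UNIV. ?t p) = (\<Sum>i\<in>UNIV. M' i i h)" .
qed

lemma matrix_comp:
  fixes S T :: "real ^ 'n \<Rightarrow> real ^ 'n::finite"
  shows "linear S \<Longrightarrow> linear T \<Longrightarrow> matrix (\<lambda>v. S (T v)) = matrix S ** matrix T"
  using matrix_compose[of T S] by (simp add: o_def)

locale riemannian_flow = manifold_flow A X \<phi>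
  for A :: "('m::t2_space, 'n::finite) chart set" and X \<phi> +
  fixes g :: "'m \<Rightarrow> real ^ 'n \<Rightarrow> real ^ 'n \<Rightarrow> real"
  assumes metric: "riemannian_metric A g" and divergence_free: "incompressible A g X"
begin

lemma g: "bilinear (g x)" "g x v w = g x w v" "v \<noteq> 0 \<Longrightarrow> g x v v > 0"
  using metric unfolding riemannian_metric_def by blast+

lemma g_smooth: "c \<in> A \<Longrightarrow> Ck_on k (\<lambda>u. g (chart_inv c u) (from_coords A c (chart_inv c u) v)
    (from_coords A c (chart_inv c u) w)) (snd c ` fst c)"
  using metric unfolding riemannian_metric_def by blast

lemma form_field_g: "form_field (\<lambda>x v. g x v v)"
  unfolding form_field_def
proof (intro conjI allI ballI)
  fix x show "quadratic_form (\<lambda>v. g x v v)" unfolding quadratic_form_def using g(1) by blast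
next
  fix c w assume c: "c \<in> A"
  have 1: "continuous_on (snd c ` fst c) (\<lambda>u. g (chart_inv c u) (from_coords A c (chart_inv c u) w)
    (from_coords A c (chart_inv c u) w))" using g_smooth[OF c, of 0] by simp
  have "continuous_on (fst c) (\<lambda>x. g (chart_inv c (snd c x)) (from_coords A c (chart_inv c (snd c x)) w)
    (from_coords A c (chart_inv c (snd c x)) w))"
    by (rule continuous_on_compose2[OF 1 chart(3)[OF c]]) simp
  then show "continuous_on (fst c) (\<lambda>x. g x (from_coords A c x w) (from_coords A c x w))"
    by (rule continuous_on_eq) (simp add: chart(5)[OF c])
qed

text \<open>A pointwise choice of an isometry onto the Euclidean space; no continuity in
  \<open>x\<close> is claimed.\<close>

definition L :: "'m \<Rightarrow> real ^ 'n \<Rightarrow> real ^ 'n" where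
  "L x = (SOME L. linear L \<and> (\<forall>v w. g x v w = L v \<bullet> L w))"

lemma L: "linear (L x)" "g x v w = L x v \<bullet> L x w"
proof -
  obtain L' :: "real ^ 'n \<Rightarrow> real ^ 'n" where "linear L'" "\<And>v w. g x v w = L' v \<bullet> L' w"
    using orthonormal_frame[OF g(1) g(2) g(3)] by metis
  then have "\<exists>L :: real ^ 'n \<Rightarrow> real ^ 'n. linear L \<and> (\<forall>v w. g x v w = L v \<bullet> L w)" by blast
  from someI_ex[OF this] show "linear (L x)" "g x v w = L x v \<bullet> L x w" unfolding L_def by blast+
qed

lemma norm_L: "norm (L x v) = riemannian_norm g x v"
  by (simp add: riemannian_norm_def L(2) norm_eq_sqrt_inner)

lemma L_inj: "inj (L x)"
proof -
  have "v = 0" if "L x v = 0" for v using g(3)[of v x] L(2)[of x v v] that by force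
  then show ?thesis using linear_injective_0[OF L(1)] by blast
qed

lemma det_nonzero_of_inj:
  fixes T :: "real ^ 'n \<Rightarrow> real ^ 'n"
  assumes "linear T" "inj T" shows "det (matrix T) \<noteq> 0"
  using det_nz_iff_inj[OF assms(1)] assms(2) by simp

text \<open>The Riemannian volume density in the selected chart at \<open>x\<close>, which jumps
  with that chart; \<theta> is the density in a fixed chart, where it can be differentiated.\<close>

definition \<omega> :: "'m \<Rightarrow> real" where "\<omega> x = \<bar>det (matrix (L x))\<bar>"

definition \<theta> where "\<theta> c u = sqrt (det (gram_matrix A g c u))"

lemma from_coords_inj: "c \<in> A \<Longrightarrow> x \<in> fst c \<Longrightarrow> inj (from_coords A c x)"
  by (rule inj_on_inverseI[of _ "to_coords A c x"]) (rule coords_inverse(2))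

text \<open>The Gram matrix is \<open>transpose N ** N\<close> for the isometry \<open>L x\<close>
  read in coordinates. So its determinant is a square, and the two densities differ by the Jacobian
  of the coordinate change.\<close>

lemma \<theta>_eq:
  assumes c: "c \<in> A" "x \<in> fst c"
  shows "\<theta> c (snd c x) = \<omega> x * \<bar>det (matrix (from_coords A c x))\<bar>" "det (gram_matrix A g c (snd c x)) > 0"
proof -
  let ?P = "from_coords A c x"
  have lin: "linear ?P" by (rule coords_linear[OF c])
  define N where "N = matrix (\<lambda>v. L x (?P v))"
  have "gram_matrix A g c (snd c x) = transpose N ** N"
    by (simp add: gram_matrix_def chart(5)[OF c] N_def vec_eq_iff matrix_matrix_mult_def transpose_def
        matrix_nth L(2) inner_vec_def)
  then have det: "det (gram_matrix A g c (snd c x)) = (det N)\<^sup>2"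
    by (simp add: det_mul det_transpose power2_eq_square)
  have N: "det N = det (matrix (L x)) * det (matrix ?P)"
    unfolding N_def by (simp add: matrix_comp[OF L(1) lin] det_mul)
  show "\<theta> c (snd c x) = \<omega> x * \<bar>det (matrix ?P)\<bar>"
    by (simp add: \<theta>_def det N \<omega>_def abs_mult)
  show "det (gram_matrix A g c (snd c x)) > 0"
    using det_nonzero_of_inj[OF L(1) L_inj[of x]] det_nonzero_of_inj[OF lin from_coords_inj[OF c]]
    by (simp add: det N)
qed

lemma \<theta>_pos: "c \<in> A \<Longrightarrow> x \<in> fst c \<Longrightarrow> \<theta> c (snd c x) > 0"
  unfolding \<theta>_def using \<theta>_eq(2) by simp

lemma \<theta>_differentiable:
  assumes c: "c \<in> A" "x \<in> fst c"
  obtains \<theta>' where "(\<theta> c has_derivative \<theta>') (at (snd c x))"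
proof -
  let ?u = "snd c x"
  have "?u \<in> snd c ` fst c" using c by auto
  then have "(\<lambda>u. gram_matrix A g c u $ i $ j) differentiable (at ?u)" for i j
    using g_smooth[OF c(1), of 1 "axis i 1" "axis j 1"] unfolding Ck_on_1 gram_matrix_def vec_lambda_beta
    by blast
  then have "((\<lambda>u. gram_matrix A g c u $ i $ j) has_derivative
      frechet_derivative (\<lambda>u. gram_matrix A g c u $ i $ j) (at ?u)) (at ?u)" for i j
    by (simp add: frechet_derivative_works)
  note d = det_has_derivative[OF this]
  show ?thesis by (rule that[OF has_derivative_real_sqrt[OF \<theta>_eq(2)[OF c] d, folded \<theta>_def]])
qed

text \<open>Time zero suffices: the cocycle property moves the derivative to any other time.\<close>
lemma volume_derivative_at_0:
  fixes y :: 'm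
  shows "((\<lambda>s. \<omega> (\<phi> s y) * \<bar>det (matrix (tangent_map A (\<phi> s) y))\<bar>) has_real_derivative 0) (at 0)"
proof -
  let ?c = "chart_at A y"
  note c = chart_at[of y]
  let ?u = "snd ?c y"
  obtain r \<epsilon> B Y where "flow_data ?c y r \<epsilon> B Y" using flow_data_exists[OF c] by blast
  note b = flow_dataD[OF this]
  have u: "?u \<in> ball ?u r" using b(1) by simp
  have ui: "?u \<in> snd ?c ` fst ?c" using c by auto
  have yy: "chart_inv ?c ?u = y" by (rule chart(5)[OF c])
  obtain \<theta>' where \<theta>': "(\<theta> ?c has_derivative \<theta>') (at ?u)" using \<theta>_differentiable[OF c] .
  define M where "M s = matrix (Y s ?u)" for s
  have Ylin: "linear (Y s ?u)" if "\<bar>s\<bar> \<le> \<epsilon>" for s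
    using has_derivative_linear[OF b(8)[OF u that]] .
  have M0: "M 0 = mat 1" using b(12)[OF u] by (simp add: M_def vec_eq_iff matrix_nth mat_def axis_def)
  have "((\<lambda>s. M s $ i $ j) has_derivative (\<lambda>h. h * Df ?c ?u (axis j 1) $ i)) (at 0)" for i j
  proof -
    have "((\<lambda>s. Y s ?u (axis j 1)) has_derivative (\<lambda>h. h *\<^sub>R Df ?c ?u (axis j 1))) (at 0)"
      using b(11)[OF u] by (simp add: has_vector_derivative_def)
    then have "((\<lambda>s. Y s ?u (axis j 1) $ i) has_derivative (\<lambda>h. (h *\<^sub>R Df ?c ?u (axis j 1)) $ i)) (at 0)"
      by (rule bounded_linear.has_derivative[OF bounded_linear_vec_nth])
    then show ?thesis by (simp add: M_def matrix_nth)
  qed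
  note detM = det_has_derivative_at_identity[OF this M0]
  define tr where "tr = (\<Sum>i\<in>UNIV. Df ?c ?u (axis i 1) $ i)"
  have detM': "((\<lambda>s. det (M s)) has_real_derivative tr) (at 0)"
    unfolding has_field_derivative_def
    by (rule has_derivative_eq_rhs[OF detM]) (simp add: fun_eq_iff tr_def sum_distrib_left mult.commute)
  define z where "z s = snd ?c (\<phi> s y)" for s
  have z0: "z 0 = ?u" by (simp add: z_def flow_0)
  have "(z has_derivative (\<lambda>h. h *\<^sub>R f ?c ?u)) (at 0)"
    using orbit_derivative_chart[OF c(1), of 0 y] c(2)
    by (simp add: z_def[abs_def] flow_0 has_vector_derivative_def)
  then have "((\<lambda>s. \<theta> ?c (z s)) has_derivative (\<lambda>h. \<theta>' (h *\<^sub>R f ?c ?u))) (at 0)"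
    by (rule has_derivative_compose) (simp add: z0 \<theta>')
  then have d\<theta>: "((\<lambda>s. \<theta> ?c (z s)) has_real_derivative \<theta>' (f ?c ?u)) (at 0)"
    unfolding has_field_derivative_def
    by (rule has_derivative_eq_rhs) (simp add: fun_eq_iff linear_scale[OF has_derivative_linear[OF \<theta>']])
  \<comment> \<open>Up to the factor \<theta>, the product rule expands the divergence into the
    change of the density along the flow plus the density times the trace, which is the derivative
    of \<open>\<theta> * det M\<close> at 0.\<close>
  have div: "\<theta>' (f ?c ?u) + \<theta> ?c ?u * tr = 0"
  proof -
    have 1: "frechet_derivative (\<lambda>w. \<theta> ?c w * f ?c w $ i) (at ?u) (axis i 1)
      = \<theta>' (axis i 1) * f ?c ?u $ i + \<theta> ?c ?u * Df ?c ?u (axis i 1) $ i" for i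
    proof -
      have "((\<lambda>w. f ?c w $ i) has_derivative (\<lambda>h. Df ?c ?u h $ i)) (at ?u)"
        by (rule bounded_linear.has_derivative[OF bounded_linear_vec_nth f_derivative[OF c(1) ui]])
      from has_derivative_mult[OF \<theta>' this]
      have "((\<lambda>w. \<theta> ?c w * f ?c w $ i) has_derivative (\<lambda>h. \<theta> ?c ?u * Df ?c ?u h $ i + \<theta>' h * f ?c ?u $ i)) (at ?u)" .
      from frechet_derivative_at[OF this, symmetric] show ?thesis by (simp add: add.commute)
    qed
    have "divergence A g X ?c ?u = 0" using divergence_free c(1) ui unfolding incompressible_def by blast
    then have "(\<Sum>i\<in>UNIV. frechet_derivative (\<lambda>w. \<theta> ?c w * f ?c w $ i) (at ?u) (axis i 1)) = 0"
      using \<theta>_pos[OF c] unfolding divergence_def \<theta>_def by simp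
    then have "(\<Sum>i\<in>UNIV. \<theta>' (axis i 1) * f ?c ?u $ i) + \<theta> ?c ?u * tr = 0"
      by (simp add: 1 sum.distrib tr_def sum_distrib_left)
    moreover have "(\<Sum>i\<in>UNIV. \<theta>' (axis i 1) * f ?c ?u $ i) = \<theta>' (f ?c ?u)"
    proof -
      have "f ?c ?u = (\<Sum>i\<in>UNIV. f ?c ?u $ i *\<^sub>R axis i 1)"
        by (simp add: vec_eq_iff axis_def if_distrib cong: if_cong)
      then have "\<theta>' (f ?c ?u) = \<theta>' (\<Sum>i\<in>UNIV. f ?c ?u $ i *\<^sub>R axis i 1)" by simp
      also have "\<dots> = (\<Sum>i\<in>UNIV. f ?c ?u $ i * \<theta>' (axis i 1))"
        by (simp add: linear_sum[OF has_derivative_linear[OF \<theta>']] linear_scale[OF has_derivative_linear[OF \<theta>']])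
      finally show ?thesis by (simp add: mult.commute)
    qed
    ultimately show ?thesis by simp
  qed
  have "((\<lambda>s. \<theta> ?c (z s) * det (M s)) has_real_derivative \<theta>' (f ?c ?u) * det (M 0) + tr * \<theta> ?c (z 0)) (at 0)"
    by (rule DERIV_mult[OF d\<theta> detM'])
  then have h: "((\<lambda>s. \<theta> ?c (z s) * det (M s)) has_real_derivative 0) (at 0)"
    using div by (simp add: M0 z0 det_I mult.commute)
  have "isCont (\<lambda>s. det (M s)) 0" using detM' by (rule DERIV_isCont)
  then have "((\<lambda>s. det (M s)) \<longlongrightarrow> 1) (at 0)" by (simp add: isCont_def M0 det_I)
  then have "\<forall>\<^sub>F s in at 0. det (M s) > 0" by (rule order_tendstoD) simp
  then have ev: "\<forall>\<^sub>F s in nhds 0. det (M s) > 0" unfolding eventually_nhds_conv_at by (simp add: M0 det_I)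
  have "\<forall>\<^sub>F s in nhds 0. \<bar>s\<bar> < \<epsilon>"
    using eventually_nhds_in_open[of "ball 0 \<epsilon>" "0::real"] b(2) by simp
  with ev have "\<forall>\<^sub>F s in nhds 0. \<theta> ?c (z s) * det (M s)
      = \<omega> (\<phi> s y) * \<bar>det (matrix (tangent_map A (\<phi> s) y))\<bar>"
  proof eventually_elim
    case (elim s)
    then have s: "\<bar>s\<bar> \<le> \<epsilon>" by simp
    have fy: "\<phi> s y \<in> fst ?c" using b(6)[OF u s] yy by simp
    have "tangent_map A (\<phi> s) y = (\<lambda>v. from_coords A ?c (\<phi> s y) (Y s ?u v))"
    proof
      fix v
      have "tangent_map A (\<phi> s) y v = tangent_map A (\<phi> s) y (from_coords A ?c y v)" by (simp add: to_coords_chart_at)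
      also have "\<dots> = from_coords A ?c (\<phi> s y) (D ?c ?c (\<phi> s) y v)"
        by (rule tangent_map_from_coords[OF flow_C1 c(1) c(1) c(2) fy])
      also have "D ?c ?c (\<phi> s) y v = Y s ?u v" by (rule D_eq[OF b(8)[OF u s]])
      finally show "tangent_map A (\<phi> s) y v = from_coords A ?c (\<phi> s y) (Y s ?u v)" .
    qed
    then have "det (matrix (tangent_map A (\<phi> s) y)) = det (matrix (from_coords A ?c (\<phi> s y))) * det (M s)"
      by (simp add: matrix_comp[OF coords_linear(1)[OF c(1) fy] Ylin[OF s]] det_mul M_def)
    then show ?case using \<theta>_eq(1)[OF c(1) fy] elim by (simp add: z_def abs_mult)
  qed
  from DERIV_cong_ev[OF refl this refl] show ?thesis using h by simp
qed

lemma volume_preserved: "\<omega> (\<phi> t x) * \<bar>det (matrix (tangent_map A (\<phi> t) x))\<bar> = \<omega> x"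
proof -
  define H where "H t = \<omega> (\<phi> t x) * \<bar>det (matrix (tangent_map A (\<phi> t) x))\<bar>" for t
  have "DERIV H t :> 0" for t
  proof -
    let ?y = "\<phi> t x" and ?k = "\<bar>det (matrix (tangent_map A (\<phi> t) x))\<bar>"
    have eq: "H (s + t) = \<omega> (\<phi> s ?y) * \<bar>det (matrix (tangent_map A (\<phi> s) ?y))\<bar> * ?k" for s
    proof -
      have "tangent_map A (\<phi> (s + t)) x = (\<lambda>v. tangent_map A (\<phi> s) ?y (tangent_map A (\<phi> t) x v))"
        by (rule ext) (rule tangent_flow_add)
      then show ?thesis unfolding H_def
        by (simp add: matrix_comp[OF tangent_flow_linear tangent_flow_linear] det_mul abs_mult flow_add)
    qed
    have "((\<lambda>s. \<omega> (\<phi> s ?y) * \<bar>det (matrix (tangent_map A (\<phi> s) ?y))\<bar> * ?k) has_real_derivative 0 * ?k) (at 0)"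
      by (rule DERIV_cmult_right[OF volume_derivative_at_0])
    then have "((\<lambda>s. H (s + t)) has_real_derivative 0) (at 0)" by (simp add: eq)
    then show ?thesis using DERIV_shift[of H 0 0 t] by simp
  qed
  then have "H t = H 0" by (rule DERIV_isconst_all[OF allI])
  then show ?thesis
    by (simp add: H_def flow_0 tangent_flow_0[abs_def] det_I flip: id_def matrix_id_mat_1)
qed

end

section \<open>The Anosov splitting\<close>

context compact_manifold
begin

lemma D_id_continuous:
  assumes "c \<in> A" "d \<in> A"
  shows "continuous_on (fst c \<inter> fst d) (\<lambda>y. D c d (\<lambda>x. x) y v)"
proof (rule continuous_at_imp_continuous_on, rule ballI)
  fix x assume "x \<in> fst c \<inter> fst d"
  then have "C1_in c d (\<lambda>x. x) x" using assms by (intro C1_in_id) auto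
  then obtain V where "open V" "x \<in> V" "continuous_on V (\<lambda>y. D c d (\<lambda>x. x) y v)"
    using C1_in_neighbourhood by metis
  then show "isCont (\<lambda>y. D c d (\<lambda>x. x) y v) x" using continuous_on_eq_continuous_at by blast
qed

definition fibre :: "('m \<Rightarrow> (real ^ 'n) set) \<Rightarrow> ('m, 'n) chart \<Rightarrow> real ^ 'n \<Rightarrow> (real ^ 'n) set" where
  "fibre E c u = {w. from_coords A c (chart_inv c u) w \<in> E (chart_inv c u)}"

lemma fibre_eq:
  assumes "c \<in> A" "y \<in> fst c"
  shows "from_coords A c y ` fibre E c (snd c y) = E y"
proof
  show "from_coords A c y ` fibre E c (snd c y) \<subseteq> E y" using assms by (auto simp: fibre_def chart(5))
  show "E y \<subseteq> from_coords A c y ` fibre E c (snd c y)"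
  proof
    fix v assume "v \<in> E y"
    then show "v \<in> from_coords A c y ` fibre E c (snd c y)"
      using assms by (intro image_eqI[of _ _ "to_coords A c y v"]) (auto simp: fibre_def chart(5) coords_inverse)
  qed
qed

text \<open>The frame is built in the coordinates of one chart and carried to the manifold; in any
  other chart it is continuous because the coordinate change is C1.\<close>

lemma continuous_subbundleI:
  assumes split: "\<And>c. c \<in> A \<Longrightarrow> splitting_fields (snd c ` fst c) (fibre E c) (E' c)"
  shows "continuous_subbundle A E"
  unfolding continuous_subbundle_def
proof
  fix x0 :: 'm
  let ?c = "chart_at A x0"
  note c = chart_at[of x0]
  have u0: "snd ?c x0 \<in> snd ?c ` fst ?c" using c by auto
  obtain W k z where W: "open W" "snd ?c x0 \<in> W" "W \<subseteq> snd ?c ` fst ?c" "\<And>i. continuous_on W (z (i::nat))"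
    "\<And>u. u \<in> W \<Longrightarrow> inj_on (\<lambda>i. z i u) {..<k}" "\<And>u. u \<in> W \<Longrightarrow> independent ((\<lambda>i. z i u) ` {..<k})"
    "\<And>u. u \<in> W \<Longrightarrow> span ((\<lambda>i. z i u) ` {..<k}) = fibre E ?c u"
    by (rule local_frame[OF split[OF c(1)] chart(2)[OF c(1)] u0]) (rule that)
  define U where "U = chart_inv ?c ` W"
  define Z where "Z i y = from_coords A ?c y (z i (snd ?c y))" for i y
  have U: "open U" "x0 \<in> U"
    using open_chart_inv_image[OF c(1) W(1,3)] W(2) chart(5)[OF c] by (auto simp: U_def intro!: image_eqI[of _ _ "snd ?c x0"])
  have yU: "y \<in> fst ?c" "snd ?c y \<in> W" if "y \<in> U" for y
    using that W(3) chart(6,7)[OF c(1)] by (auto simp: U_def)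
  have cont: "continuous_on (U \<inter> fst d) (\<lambda>y. to_coords A d y (Z i y))" if d: "d \<in> A" for d i
  proof -
    let ?S = "U \<inter> fst d"
    have S: "?S \<subseteq> fst ?c \<inter> fst d" using yU by auto
    have "continuous_on ?S (\<lambda>y. D ?c d (\<lambda>x. x) y (z i (snd ?c y)))"
    proof (rule continuous_on_linear_apply[where T = "\<lambda>y. D ?c d (\<lambda>x. x) y" and w = "\<lambda>y. z i (snd ?c y)"])
      show "linear (D ?c d (\<lambda>x. x) y)" if "y \<in> ?S" for y
        using that S c(1) d by (intro C1_in_linear C1_in_id) auto
      show "continuous_on ?S (\<lambda>y. D ?c d (\<lambda>x. x) y v)" for v
        by (rule continuous_on_subset[OF D_id_continuous[OF c(1) d] S])
      have "continuous_on ?S (snd ?c)" by (rule continuous_on_subset[OF chart(3)[OF c(1)]]) (use S in auto)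
      then show "continuous_on ?S (\<lambda>y. z i (snd ?c y))"
        by (rule continuous_on_compose2[OF W(4)]) (use yU in auto)
    qed
    then show ?thesis
    proof (rule continuous_on_eq)
      fix y assume y: "y \<in> ?S"
      then have y': "y \<in> fst ?c" "y \<in> fst d" using S by auto
      show "D ?c d (\<lambda>x. x) y (z i (snd ?c y)) = to_coords A d y (Z i y)"
        unfolding Z_def to_coords_change[OF c(1) d y'] coords_inverse(2)[OF c(1) y'(1)] ..
    qed
  qed
  have frame: "inj_on (\<lambda>i. Z i y) {..<k} \<and> independent ((\<lambda>i. Z i y) ` {..<k}) \<and> span ((\<lambda>i. Z i y) ` {..<k}) = E y"
    if y: "y \<in> U" for y
  proof -
    let ?P = "from_coords A ?c y"
    have lin: "linear ?P" by (rule coords_linear[OF c(1) yU(1)[OF y]])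
    have inj: "inj ?P" by (rule inj_on_inverseI[of _ "to_coords A ?c y"]) (rule coords_inverse(2)[OF c(1) yU(1)[OF y]])
    have img: "(\<lambda>i. Z i y) ` {..<k} = ?P ` (\<lambda>i. z i (snd ?c y)) ` {..<k}"
      unfolding Z_def by (simp add: image_image)
    have "inj_on (\<lambda>i. Z i y) {..<k}"
      using W(5)[OF yU(2)[OF y]] inj unfolding Z_def inj_on_def by blast
    moreover have "independent ((\<lambda>i. Z i y) ` {..<k})"
      unfolding img by (rule linear_independent_injective_image[OF lin W(6)[OF yU(2)[OF y]] inj_on_subset[OF inj subset_UNIV]])
    moreover have "span ((\<lambda>i. Z i y) ` {..<k}) = E y"
      unfolding img linear_span_image[OF lin] W(7)[OF yU(2)[OF y]] by (rule fibre_eq[OF c(1) yU(1)[OF y]])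
    ultimately show ?thesis by blast
  qed
  show "\<exists>U k Z. open U \<and> x0 \<in> U \<and>
      (\<forall>i<k::nat. \<forall>c\<in>A. continuous_on (U \<inter> fst c) (\<lambda>y. to_coords A c y (Z i y))) \<and>
      (\<forall>y\<in>U. inj_on (\<lambda>i. Z i y) {..<k} \<and> independent ((\<lambda>i. Z i y) ` {..<k}) \<and> span ((\<lambda>i. Z i y) ` {..<k}) = E y)"
    using U cont frame by (intro exI[of _ U] exI[of _ k] exI[of _ Z]) blast
qed

lemma form_field_tendsto:
  assumes q: "form_field q" and c: "c \<in> A" and u: "\<And>k::nat. u k \<in> snd c ` fst c" "u \<longlonglongrightarrow> u'" "u' \<in> snd c ` fst c"
    and w: "w \<longlonglongrightarrow> w'"
  shows "(\<lambda>k. q (chart_inv c (u k)) (from_coords A c (chart_inv c (u k)) (w k)))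
    \<longlonglongrightarrow> q (chart_inv c u') (from_coords A c (chart_inv c u') w')"
proof -
  let ?V = "snd c ` fst c"
  have "continuous_on (?V \<times> UNIV) (\<lambda>(u, w). q (chart_inv c u) (from_coords A c (chart_inv c u) w))"
    by (rule form_field_continuous_on_box[OF q c subset_refl])
  moreover have "(\<lambda>k. (u k, w k)) \<longlonglongrightarrow> (u', w')" by (intro tendsto_Pair u w)
  ultimately have "(\<lambda>k. (\<lambda>(u, w). q (chart_inv c u) (from_coords A c (chart_inv c u) w)) (u k, w k))
      \<longlonglongrightarrow> (\<lambda>(u, w). q (chart_inv c u) (from_coords A c (chart_inv c u) w)) (u', w')"
    by (rule continuous_on_tendsto_compose) (use u in auto)
  then show ?thesis by simp
qed

text \<open>Arbitrary intersections of closed conditions are closed; \<open>I\<close> is going to be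
  the half-line of times.\<close>

lemma closed_graph_of_inequalities:
  assumes q: "\<And>i. i \<in> I \<Longrightarrow> form_field (q i)"
    and E: "\<And>x. E x = {v. \<forall>i\<in>I. q i x v \<le> 0}" and c: "c \<in> A"
  shows "closed_graph (snd c ` fst c) (fibre E c)"
  unfolding closed_graph_def fibre_def E mem_Collect_eq
proof (intro allI impI ballI)
  fix u w u' w' i
  assume uw: "\<forall>k::nat. u k \<in> snd c ` fst c \<and> (\<forall>i\<in>I. q i (chart_inv c (u k)) (from_coords A c (chart_inv c (u k)) (w k)) \<le> 0)"
    and u: "u \<longlonglongrightarrow> u'" "u' \<in> snd c ` fst c" and w: "w \<longlonglongrightarrow> w'" and i: "i \<in> I"
  have "(\<lambda>k. q i (chart_inv c (u k)) (from_coords A c (chart_inv c (u k)) (w k)))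
      \<longlonglongrightarrow> q i (chart_inv c u') (from_coords A c (chart_inv c u') w')"
    by (rule form_field_tendsto[OF q[OF i] c _ u w]) (use uw in blast)
  then show "q i (chart_inv c u') (from_coords A c (chart_inv c u') w') \<le> 0"
    by (rule LIMSEQ_le_const2) (use uw i in blast)
qed

lemma fibre_subspace:
  assumes "c \<in> A" "u \<in> snd c ` fst c" "\<And>x. subspace (E x)"
  shows "subspace (fibre E c u)"
proof -
  have "linear (from_coords A c (chart_inv c u))" by (rule coords_linear[OF assms(1) chart(6)[OF assms(1,2)]])
  then show ?thesis
    using assms(3)[of "chart_inv c u"]
    unfolding fibre_def subspace_def by (simp add: linear_0 linear_add linear_scale)
qed

lemma direct_sum3_zero:
  assumes "direct_sum3 P Q R" "a \<in> P" "b \<in> Q" "c \<in> R" "a + b + c = 0"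
  shows "a = 0" "b = 0" "c = 0"
proof -
  have "0 \<in> P" "0 \<in> Q" "0 \<in> R" using assms(1) by (auto simp: direct_sum3_def subspace_0)
  moreover have "\<exists>!p. p \<in> P \<times> Q \<times> R \<and> 0 = (case p of (a, b, c) \<Rightarrow> a + b + c)"
    using assms(1) unfolding direct_sum3_def by blast
  then have uniq: "p = q" if "p \<in> P \<times> Q \<times> R \<and> 0 = (case p of (a, b, c) \<Rightarrow> a + b + c)"
      "q \<in> P \<times> Q \<times> R \<and> 0 = (case q of (a, b, c) \<Rightarrow> a + b + c)" for p q
    using that by blast
  ultimately have "(a, b, c) = (0, 0, 0)" using assms(2-5) by (intro uniq) simp_all
  then show "a = 0" "b = 0" "c = 0" by auto
qed

lemma direct_sum3_sum:
  assumes "direct_sum3 P Q R" obtains a b c where "a \<in> P" "b \<in> Q" "c \<in> R" "v = a + b + c"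
proof -
  obtain p where "p \<in> P \<times> Q \<times> R" "v = (case p of (a, b, c) \<Rightarrow> a + b + c)"
    using assms unfolding direct_sum3_def by blast
  then show ?thesis using that by (cases p) auto
qed

text \<open>\<open>subbundle_of_direct_sum\<close> handles the first summand, so each of the three
  has to be movable to the front.\<close>

lemma direct_sum3_commute:
  assumes "direct_sum3 P Q R" shows "direct_sum3 R Q P" "direct_sum3 Q P R"
proof -
  have sub: "subspace P" "subspace Q" "subspace R" using assms by (auto simp: direct_sum3_def)
  have main: "direct_sum3 P' Q' R'"
    if s: "subspace P'" "subspace Q'" "subspace R'" and ex: "\<And>v. \<exists>a b c. a \<in> P' \<and> b \<in> Q' \<and> c \<in> R' \<and> v = a + b + c"
      and z: "\<And>a b c. a \<in> P' \<Longrightarrow> b \<in> Q' \<Longrightarrow> c \<in> R' \<Longrightarrow> a + b + c = 0 \<Longrightarrow> a = 0 \<and> b = 0 \<and> c = 0"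
    for P' Q' R' :: "'b::real_vector set"
    unfolding direct_sum3_def
  proof (intro conjI s allI)
    fix v
    obtain a b c where abc: "a \<in> P'" "b \<in> Q'" "c \<in> R'" "v = a + b + c" using ex by blast
    show "\<exists>!p. p \<in> P' \<times> Q' \<times> R' \<and> v = (case p of (a, b, c) \<Rightarrow> a + b + c)"
    proof (rule ex1I[of _ "(a, b, c)"])
      fix p assume p: "p \<in> P' \<times> Q' \<times> R' \<and> v = (case p of (a, b, c) \<Rightarrow> a + b + c)"
      obtain a' b' c' where p': "p = (a', b', c')" by (cases p) auto
      have "a' - a = 0 \<and> b' - b = 0 \<and> c' - c = 0"
      proof (rule z)
        show "a' - a \<in> P'" "b' - b \<in> Q'" "c' - c \<in> R'" using p abc s unfolding p' by (auto intro: subspace_diff)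
        have "a' + b' + c' = a + b + c" using p abc unfolding p' by simp
        then show "a' - a + (b' - b) + (c' - c) = 0" by (simp add: algebra_simps)
      qed
      then show "p = (a, b, c)" by (simp add: p')
    qed (use abc in simp)
  qed
  show "direct_sum3 R Q P"
  proof (rule main[OF sub(3,2,1)])
    fix v
    obtain a b c where "a \<in> P" "b \<in> Q" "c \<in> R" "v = a + b + c" using direct_sum3_sum[OF assms] .
    then show "\<exists>a b c. a \<in> R \<and> b \<in> Q \<and> c \<in> P \<and> v = a + b + c"
      by (intro exI[of _ c] exI[of _ b] exI[of _ a]) (simp add: add_ac)
  next
    fix a b c assume h: "a \<in> R" "b \<in> Q" "c \<in> P" "a + b + c = 0"
    then have "c + b + a = 0" by (simp add: add_ac)
    then show "a = 0 \<and> b = 0 \<and> c = 0" using direct_sum3_zero[OF assms h(3,2,1)] by blast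
  qed
  show "direct_sum3 Q P R"
  proof (rule main[OF sub(2,1,3)])
    fix v
    obtain a b c where "a \<in> P" "b \<in> Q" "c \<in> R" "v = a + b + c" using direct_sum3_sum[OF assms] .
    then show "\<exists>a b c. a \<in> Q \<and> b \<in> P \<and> c \<in> R \<and> v = a + b + c"
      by (intro exI[of _ b] exI[of _ a] exI[of _ c]) (simp add: add_ac)
  next
    fix a b c assume h: "a \<in> Q" "b \<in> P" "c \<in> R" "a + b + c = 0"
    then have "b + a + c = 0" by (simp add: add_ac)
    then show "a = 0 \<and> b = 0 \<and> c = 0" using direct_sum3_zero[OF assms h(2,1,3)] by blast
  qed
qed

text \<open>The complement of \<open>P\<close> is the sum of the other two, closed by
  \<open>closed_graph_sum\<close>; complementary fields with closed graphs have continuous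
  projections and hence local frames.\<close>

lemma subbundle_of_direct_sum:
  assumes ds: "\<And>x. direct_sum3 (P x) (Q x) (R x)"
    and cl: "\<And>c. c \<in> A \<Longrightarrow> closed_graph (snd c ` fst c) (fibre P c)"
      "\<And>c. c \<in> A \<Longrightarrow> closed_graph (snd c ` fst c) (fibre Q c)"
      "\<And>c. c \<in> A \<Longrightarrow> closed_graph (snd c ` fst c) (fibre R c)"
  shows "continuous_subbundle A P"
proof (rule continuous_subbundleI)
  fix c assume c: "c \<in> A"
  let ?V = "snd c ` fst c"
  have sub: "subspace (P x)" "subspace (Q x)" "subspace (R x)" for x using ds[of x] by (auto simp: direct_sum3_def)
  have lin: "linear (from_coords A c (chart_inv c u))" if "u \<in> ?V" for u
    by (rule coords_linear[OF c chart(6)[OF c that]])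
  have zero: "a = 0 \<and> b = 0 \<and> d = 0"
    if "u \<in> ?V" "a \<in> fibre P c u" "b \<in> fibre Q c u" "d \<in> fibre R c u" "a + b + d = 0" for u a b d
  proof -
    let ?F = "from_coords A c (chart_inv c u)"
    have "?F a + ?F b + ?F d = ?F (a + b + d)" by (simp add: linear_add[OF lin[OF that(1)]])
    also have "\<dots> = 0" using that(5) linear_0[OF lin[OF that(1)]] by simp
    finally have "?F a = 0" "?F b = 0" "?F d = 0"
      using direct_sum3_zero[OF ds[of "chart_inv c u"], of "?F a" "?F b" "?F d"] that by (auto simp: fibre_def)
    moreover have "w = 0" if "?F w = 0" for w
      using coords_inverse(2)[OF c chart(6)[OF c \<open>u \<in> ?V\<close>], of w] that
        linear_0[OF coords_linear(2)[OF c chart(6)[OF c \<open>u \<in> ?V\<close>]]] by simp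
    ultimately show ?thesis by blast
  qed
  interpret QR: complementary_fields ?V "fibre Q c" "fibre R c"
  proof
    fix u w assume u: "u \<in> ?V" and w: "w \<in> fibre Q c u" "w \<in> fibre R c u"
    have "- w \<in> fibre R c u" by (rule subspace_neg[OF fibre_subspace[OF c u sub(3)] w(2)])
    then show "w = 0"
      using zero[OF u subspace_0[OF fibre_subspace[OF c u sub(1)]] w(1), of "- w"] by simp
  qed (use cl[OF c] fibre_subspace[OF c] sub in auto)
  show "splitting_fields ?V (fibre P c) (\<lambda>u. {s + a |s a. s \<in> fibre Q c u \<and> a \<in> fibre R c u})"
  proof
    fix u assume u: "u \<in> ?V"
    show "subspace (fibre P c u)" by (rule fibre_subspace[OF c u sub(1)])
    show "subspace {s + a |s a. s \<in> fibre Q c u \<and> a \<in> fibre R c u}"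
      by (rule subspace_sums[OF fibre_subspace[OF c u sub(2)] fibre_subspace[OF c u sub(3)]])
  next
    show "closed_graph ?V (fibre P c)" by (rule cl(1)[OF c])
    show "closed_graph ?V (\<lambda>u. {s + a |s a. s \<in> fibre Q c u \<and> a \<in> fibre R c u})" by (rule QR.closed_graph_sum)
  next
    fix u w assume u: "u \<in> ?V" and w: "w \<in> fibre P c u" "w \<in> {s + a |s a. s \<in> fibre Q c u \<and> a \<in> fibre R c u}"
    then obtain s a where sa: "s \<in> fibre Q c u" "a \<in> fibre R c u" "w = s + a" by blast
    have "- w \<in> fibre P c u" by (rule subspace_neg[OF fibre_subspace[OF c u sub(1)] w(1)])
    then show "w = 0" using zero[OF u _ sa(1,2), of "- w"] sa(3) by simp
  next
    fix u w assume u: "u \<in> ?V"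
    let ?y = "chart_inv c u"
    note y = chart(6)[OF c u]
    obtain a b d where abd: "a \<in> P ?y" "b \<in> Q ?y" "d \<in> R ?y" "from_coords A c ?y w = a + b + d"
      using direct_sum3_sum[OF ds] by metis
    have eq: "w = to_coords A c ?y a + (to_coords A c ?y b + to_coords A c ?y d)"
      using arg_cong[OF abd(4), of "to_coords A c ?y"]
      by (simp add: coords_inverse[OF c y] linear_add[OF coords_linear(2)[OF c y]] add.assoc)
    have "to_coords A c ?y a \<in> fibre P c u" "to_coords A c ?y b \<in> fibre Q c u" "to_coords A c ?y d \<in> fibre R c u"
      using abd by (auto simp: fibre_def coords_inverse[OF c y])
    then show "\<exists>s a. s \<in> fibre P c u \<and> a \<in> {s + a |s a. s \<in> fibre Q c u \<and> a \<in> fibre R c u} \<and> w = s + a"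
      using eq by blast
  qed
qed

end

lemma form_index_properties:
  fixes Q :: "'a::euclidean_space \<Rightarrow> real"
  assumes "form_index Q = k" and Q: "quadratic_form Q"
  shows "\<exists>N. subspace N \<and> dim N = k \<and> (\<forall>v\<in>N. Q v \<le> 0)"
    and "subspace N \<Longrightarrow> (\<And>v. v \<in> N \<Longrightarrow> Q v \<le> 0) \<Longrightarrow> dim N \<le> k"
proof -
  let ?D = "{dim S |S. subspace S \<and> (\<forall>v\<in>S. Q v \<le> 0)}"
  have "?D \<subseteq> {..DIM('a)}" using dim_subset_UNIV by auto
  then have fin: "finite ?D" by (rule finite_subset) simp
  have "dim {0::'a} \<in> ?D"
    by (intro CollectI exI[of _ "{0}"]) (simp add: subspace_single_0 quadratic_form_0[OF Q])
  then have "?D \<noteq> {}" by blast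
  then have "Max ?D \<in> ?D" using fin by (rule Max_in[rotated])
  then have "k \<in> ?D" using assms(1) by (simp add: form_index_def)
  then show "\<exists>N. subspace N \<and> dim N = k \<and> (\<forall>v\<in>N. Q v \<le> 0)" by blast
  show "dim N \<le> k" if "subspace N" "\<And>v. v \<in> N \<Longrightarrow> Q v \<le> 0"
    using Max_ge[OF fin, of "dim N"] that assms(1) unfolding form_index_def by blast
qed

lemma direct_sum3_vimage:
  assumes ds: "direct_sum3 P Q R" and T: "linear T" "bij T"
  shows "direct_sum3 (T -` P) (T -` Q) (T -` R)"
proof -
  have sub: "subspace (T -` S)" if "subspace S" for S
    using that T(1) unfolding subspace_def by (simp add: linear_0 linear_add linear_scale)
  have "\<exists>!q. q \<in> T -` P \<times> T -` Q \<times> T -` R \<and> v = (case q of (a, b, c) \<Rightarrow> a + b + c)" for v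
  proof -
    have "\<forall>v. \<exists>!q. q \<in> P \<times> Q \<times> R \<and> v = (case q of (a, b, c) \<Rightarrow> a + b + c)"
      using ds unfolding direct_sum3_def by (elim conjE)
    then have ex1: "\<exists>!q. q \<in> P \<times> Q \<times> R \<and> T v = (case q of (a, b, c) \<Rightarrow> a + b + c)" by (rule spec)
    then have "\<exists>q. q \<in> P \<times> Q \<times> R \<and> T v = (case q of (a, b, c) \<Rightarrow> a + b + c)" by (rule ex1_implies_ex)
    then obtain q where "q \<in> P \<times> Q \<times> R \<and> T v = (case q of (a, b, c) \<Rightarrow> a + b + c)" ..
    then obtain a b c where abc: "a \<in> P" "b \<in> Q" "c \<in> R" "T v = a + b + c" by (cases q) auto
    obtain a' b' c' where T': "a = T a'" "b = T b'" "c = T c'" using T(2) by (metis bij_pointE)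
    have "T v = T (a' + b' + c')" using abc(4) T' by (simp add: linear_add[OF T(1)])
    then have v: "v = a' + b' + c'" using T(2) by (simp add: bij_def inj_eq)
    show ?thesis
    proof (rule ex1I[of _ "(a', b', c')"])
      show "(a', b', c') \<in> T -` P \<times> T -` Q \<times> T -` R \<and> v = (case (a', b', c') of (a, b, c) \<Rightarrow> a + b + c)"
        using abc T' v by simp
      fix q assume q: "q \<in> T -` P \<times> T -` Q \<times> T -` R \<and> v = (case q of (a, b, c) \<Rightarrow> a + b + c)"
      obtain x y z where xyz: "q = (x, y, z)" by (cases q) auto
      have Tv: "T v = T x + T y + T z" using q by (simp add: xyz linear_add[OF T(1)])
      from ex1 have uniq: "p = p'" if "p \<in> P \<times> Q \<times> R \<and> T v = (case p of (a, b, c) \<Rightarrow> a + b + c)"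
          "p' \<in> P \<times> Q \<times> R \<and> T v = (case p' of (a, b, c) \<Rightarrow> a + b + c)" for p p'
        using that by blast
      have "(T x, T y, T z) = (a, b, c)"
        using q abc Tv unfolding xyz by (intro uniq) simp_all
      then show "q = (a', b', c')" using T' T(2) by (simp add: xyz bij_def inj_eq)
    qed
  qed
  then show ?thesis using ds sub by (simp add: direct_sum3_def)
qed

locale separated_flow = riemannian_flow A X \<phi> g
  for A :: "('m::t2_space, 'n::finite) chart set" and X \<phi> g +
  fixes J :: "'m \<Rightarrow> real ^ 'n \<Rightarrow> real"
  assumes dimension: "CARD('n) \<ge> 3"
    and singularities: "X p = 0 \<Longrightarrow> hyperbolic_singularity A X p"
    and J_field: "quadratic_form_field A \<phi> J"
    and J_indefinite: "indefinite (J x)"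
    and J_index: "form_index (J x) = CARD('n) - 2"
    and J_nonnegative: "form_nonnegative J X"
    and J_separated: "strictly_separated A \<phi> J"
begin

lemma form_field_J: "form_field J"
  using J_field unfolding quadratic_form_field_def form_field_def by blast

lemma J_quadratic: "quadratic_form (J x)"
  using form_field_J by (simp add: form_field_def)

lemma tangent_flow_inverse: "tangent_map A (\<phi> (- t)) (\<phi> t x) (tangent_map A (\<phi> t) x v) = v"
  using tangent_flow_add[of "- t" t x v] tangent_flow_0[of x v] by simp

lemma tangent_flow_nonzero: "v \<noteq> 0 \<Longrightarrow> tangent_map A (\<phi> t) x v \<noteq> 0"
  using tangent_flow_inverse[of t x v] linear_0[OF tangent_flow_linear[of "- t" "\<phi> t x"]] by metis

lemma separated: "t > 0 \<Longrightarrow> v \<noteq> 0 \<Longrightarrow> J x v \<ge> 0 \<Longrightarrow> J (\<phi> t x) (tangent_map A (\<phi> t) x v) > 0"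
proof -
  assume t: "t > 0" and v: "v \<noteq> 0" "J x v \<ge> 0"
  have "v \<in> pos_cone J x \<union> null_cone J x" using v by (auto simp: pos_cone_def null_cone_def)
  then have "tangent_map A (\<phi> t) x v \<in> pos_cone J (\<phi> t x)"
    using J_separated t unfolding strictly_separated_def by blast
  then show ?thesis using tangent_flow_nonzero[OF v(1)] by (simp add: pos_cone_def)
qed

text \<open>At a singularity the directions of \<open>X\<close> nearby exhaust all directions, as the derivative of
  \<open>X\<close> there is invertible; so \<open>J(X) \<ge> 0\<close> would make \<open>J\<close> semidefinite.\<close>
lemma X_nonzero: "X p \<noteq> 0"
proof
  assume Xp: "X p = 0"
  let ?c = "chart_at A p"
  note c = chart_at[of p]
  define u0 where "u0 = snd ?c p"
  have u0: "u0 \<in> snd ?c ` fst ?c" using c by (auto simp: u0_def)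
  have p: "chart_inv ?c u0 = p" using chart(5)[OF c] by (simp add: u0_def)
  have hyp: "\<And>z. complex_eigenvalue (matrix (Df ?c u0)) z \<Longrightarrow> Re z \<noteq> 0"
    using singularities[OF Xp] unfolding hyperbolic_singularity_def u0_def by blast
  have d: "(f ?c has_derivative Df ?c u0) (at u0)" by (rule f_derivative[OF c(1) u0])
  note lin = has_derivative_linear[OF d]
  have f0: "f ?c u0 = 0" using to_coords_X[OF c] Xp to_coords_chart_at(1)[of p 0] by (simp add: u0_def)
  \<comment> \<open>A kernel vector would be an eigenvector with eigenvalue 0, which hyperbolicity
    excludes.\<close>
  have "w = 0" if w: "Df ?c u0 w = 0" for w
  proof (rule ccontr)
    assume "w \<noteq> 0"
    let ?B = "matrix (Df ?c u0)" and ?v = "\<chi> i. complex_of_real (w $ i)"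
    have Bw: "?B *v w = 0" using w matrix_works[of "Df ?c u0" w] lin by simp
    have "?v \<noteq> 0" using \<open>w \<noteq> 0\<close> by (auto simp: vec_eq_iff)
    moreover have "(\<chi> i j. complex_of_real (?B $ i $ j)) *v ?v = 0 *s ?v"
    proof -
      have "(\<Sum>j\<in>UNIV. complex_of_real (?B $ i $ j) * complex_of_real (w $ j)) = complex_of_real ((?B *v w) $ i)" for i
        by (simp add: matrix_vector_mult_def)
      then show ?thesis unfolding Bw by (simp add: vec_eq_iff matrix_vector_mult_def)
    qed
    ultimately have "complex_eigenvalue ?B 0" unfolding complex_eigenvalue_def by blast
    then show False using hyp[of 0] by simp
  qed
  then have "inj (Df ?c u0)" using linear_injective_0[OF lin] by blast
  then have surj: "surj (Df ?c u0)" by (rule linear_injective_imp_surjective[OF lin _ refl])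
  obtain v where v: "J p v < 0" using J_indefinite unfolding indefinite_def by blast
  obtain w where w: "v = Df ?c u0 w" using surj by (metis surjD)
  \<comment> \<open>\<open>h s\<close> is \<open>X\<close> along the coordinate segment in direction
    \<open>w\<close>, so \<open>h s / s\<close> tends to the negative vector \<open>v\<close>, while
    division by \<open>s\<close> leaves the sign of \<open>J\<close> unchanged.\<close>
  define h where "h s = f ?c (u0 + s *\<^sub>R w)" for s
  have "((\<lambda>s. u0 + s *\<^sub>R w) has_derivative (\<lambda>s. s *\<^sub>R w)) (at 0)"
    by (auto intro!: derivative_eq_intros)
  then have "(h has_derivative (\<lambda>s. Df ?c u0 (s *\<^sub>R w))) (at 0)"
    unfolding h_def by (rule has_derivative_compose) (simp add: d)
  then have hv: "(h has_vector_derivative v) (at 0)"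
    by (simp add: has_vector_derivative_def linear_scale[OF lin] w)
  define e where "e n = inverse (real (Suc n))" for n
  have e: "e n > 0" "e \<longlonglongrightarrow> 0" for n unfolding e_def by (simp, rule LIMSEQ_inverse_real_of_nat)
  have quot: "(\<lambda>n. (1 / e n) *\<^sub>R h (e n)) \<longlonglongrightarrow> v"
  proof -
    have h0: "h 0 = 0" by (simp add: h_def f0)
    show ?thesis
    proof (rule tendstoI)
      fix \<eta> :: real assume "\<eta> > 0"
      then have "\<eta> / 2 > 0" by simp
      then obtain d where d: "d > 0" "\<And>y. norm (y - 0) < d \<Longrightarrow> norm (h y - h 0 - (y - 0) *\<^sub>R v) \<le> \<eta> / 2 * norm (y - 0)"
        using hv unfolding has_vector_derivative_def has_derivative_at_alt by blast
      have "\<forall>\<^sub>F n in sequentially. e n < d" using e(2) d(1) by (rule order_tendstoD)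
      then show "\<forall>\<^sub>F n in sequentially. dist ((1 / e n) *\<^sub>R h (e n)) v < \<eta>"
      proof eventually_elim
        case (elim n)
        have "norm (h (e n) - e n *\<^sub>R v) \<le> \<eta> / 2 * e n" using d(2)[of "e n"] elim e(1)[of n] by (simp add: h0)
        moreover have "(1 / e n) *\<^sub>R h (e n) - v = (1 / e n) *\<^sub>R (h (e n) - e n *\<^sub>R v)"
          using e(1)[of n] by (simp add: scaleR_diff_right)
        then have "dist ((1 / e n) *\<^sub>R h (e n)) v = norm (h (e n) - e n *\<^sub>R v) / e n"
          using e(1)[of n] by (simp add: dist_norm)
        ultimately have "dist ((1 / e n) *\<^sub>R h (e n)) v \<le> \<eta> / 2" using e(1)[of n] by (simp add: pos_divide_le_eq)
        then show ?case using \<open>\<eta> > 0\<close> by simp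
      qed
    qed
  qed
  have "(\<lambda>n. u0 + e n *\<^sub>R w) \<longlonglongrightarrow> u0 + 0 *\<^sub>R w" by (intro tendsto_intros e(2))
  then have ul: "(\<lambda>n. u0 + e n *\<^sub>R w) \<longlonglongrightarrow> u0" by simp
  then have "\<forall>\<^sub>F n in sequentially. u0 + e n *\<^sub>R w \<in> snd ?c ` fst ?c"
    by (rule topological_tendstoD[OF _ chart(2)[OF c(1)] u0])
  then obtain N where N: "\<And>n. n \<ge> N \<Longrightarrow> u0 + e n *\<^sub>R w \<in> snd ?c ` fst ?c" unfolding eventually_sequentially by blast
  \<comment> \<open>The shift by \<open>N\<close> keeps the whole sequence inside the chart image,
    as \<open>form_field_tendsto\<close> requires.\<close>
  define u where "u n = u0 + e (n + N) *\<^sub>R w" for n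
  have "(\<lambda>n. J (chart_inv ?c (u n)) (from_coords A ?c (chart_inv ?c (u n)) ((1 / e (n + N)) *\<^sub>R h (e (n + N)))))
      \<longlonglongrightarrow> J (chart_inv ?c u0) (from_coords A ?c (chart_inv ?c u0) v)"
    by (rule form_field_tendsto[OF form_field_J c(1) _ _ u0])
      (use N LIMSEQ_ignore_initial_segment[OF ul, of N] LIMSEQ_ignore_initial_segment[OF quot, of N]
        in \<open>simp_all add: u_def\<close>)
  moreover have "J (chart_inv ?c (u n)) (from_coords A ?c (chart_inv ?c (u n)) ((1 / e (n + N)) *\<^sub>R h (e (n + N)))) \<ge> 0" for n
  proof -
    have un: "u n \<in> snd ?c ` fst ?c" using N[of "n + N"] by (simp add: u_def)
    note y = chart(6)[OF c(1) un]
    let ?y = "chart_inv ?c (u n)"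
    have "h (e (n + N)) = to_coords A ?c ?y (X ?y)"
      using to_coords_X[OF c(1) y] chart(7)[OF c(1) un] by (simp add: h_def u_def)
    then have "from_coords A ?c ?y ((1 / e (n + N)) *\<^sub>R h (e (n + N))) = (1 / e (n + N)) *\<^sub>R X ?y"
      by (simp add: linear_scale[OF coords_linear(1)[OF c(1) y]] coords_inverse[OF c(1) y])
    then show ?thesis
      using J_nonnegative by (simp add: quadratic_form_scale[OF J_quadratic] form_nonnegative_def)
  qed
  ultimately have "J p (from_coords A ?c p v) \<ge> 0" unfolding p by (intro LIMSEQ_le_const) auto
  then show False using v by (simp add: to_coords_chart_at)
qed

definition Li :: "'m \<Rightarrow> real ^ 'n \<Rightarrow> real ^ 'n" where
  "Li x = (SOME T. linear T \<and> (\<forall>v. T (L x v) = v) \<and> (\<forall>v. L x (T v) = v))"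

lemma Li: "linear (Li x)" "Li x (L x v) = v" "L x (Li x v) = v"
proof -
  have "\<exists>T. linear T \<and> (\<forall>v. T (L x v) = v) \<and> (\<forall>v. L x (T v) = v)"
    using linear_injective_isomorphism[OF L(1) L_inj] by blast
  from someI_ex[OF this] show "linear (Li x)" "Li x (L x v) = v" "L x (Li x v) = v" unfolding Li_def by blast+
qed

lemma g_norm: "g x v v = (norm (L x v))\<^sup>2"
  by (simp add: L(2) power2_norm_eq_inner)

text \<open>The derivative in orthonormal frames: here the Euclidean norm is the Riemannian one, and
  preservation of volume becomes a determinant of absolute value 1.\<close>

definition DL :: "real \<Rightarrow> 'm \<Rightarrow> real ^ 'n \<Rightarrow> real ^ 'n" where
  "DL t x v = L (\<phi> t x) (tangent_map A (\<phi> t) x (Li x v))"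
definition JL :: "'m \<Rightarrow> real ^ 'n \<Rightarrow> real" where "JL x v = J x (Li x v)"
definition XL :: "'m \<Rightarrow> real ^ 'n" where "XL x = L x (X x)"

text \<open>The uniform estimates of \<open>volume_cone_cocycle\<close> come from compactness of the
  manifold; \<open>c\<close> and \<open>C\<close> merge the separate constants.\<close>

lemma bounds_exist:
  "\<exists>c C. c > 0 \<and> C > 0 \<and>
    (\<forall>t x v. \<bar>t\<bar> \<le> 1 \<longrightarrow> norm (DL t x v) \<le> C * norm v) \<and> (\<forall>x v. \<bar>JL x v\<bar> \<le> C * (norm v)\<^sup>2) \<and>
    (\<forall>x v. JL x v \<ge> 0 \<longrightarrow> JL (\<phi> 1 x) (DL 1 x v) \<ge> c * (norm v)\<^sup>2) \<and>
    (\<forall>x. c \<le> norm (XL x) \<and> norm (XL x) \<le> C)"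
proof -
  obtain C1 where C1: "C1 > 0" "\<And>t x v. \<bar>t\<bar> \<le> 1 \<Longrightarrow>
      g (\<phi> t x) (tangent_map A (\<phi> t) x v) (tangent_map A (\<phi> t) x v) \<le> C1 * g x v v"
    using flow_bound[OF form_field_g g(3)] by metis
  obtain C2 where C2: "C2 > 0" "\<And>x v. \<bar>J x v\<bar> \<le> C2 * g x v v"
    using form_field_bound[OF form_field_g form_field_J g(3)] by metis
  \<comment> \<open>\<open>J\<close> is compared with its pullback under the time-one map: strict
    separation is qualitative, and compactness supplies the constant.\<close>
  obtain c1 where c1: "c1 > 0" "\<And>x v. J x v \<ge> 0 \<Longrightarrow> J (\<phi> 1 x) (tangent_map A (\<phi> 1) x v) \<ge> c1 * g x v v"
    using form_field_compare[OF form_field_J form_field_pullback[OF form_field_J flow_C1[of 1]] form_field_g]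
      g(3) separated[of 1] by (metis zero_less_one)
  have cX: "continuous_on UNIV (\<lambda>x. g x (X x) (X x))" by (rule form_field_X_continuous[OF form_field_g])
  obtain x1 x2 where x12: "\<And>x. g x1 (X x1) (X x1) \<le> g x (X x) (X x)" "\<And>x. g x (X x) (X x) \<le> g x2 (X x2) (X x2)"
    using continuous_attains_inf[OF compact_UNIV UNIV_not_empty cX] continuous_attains_sup[OF compact_UNIV UNIV_not_empty cX]
    by blast
  define c2 where "c2 = norm (XL x1)"
  define C3 where "C3 = norm (XL x2)"
  have XL: "c2 \<le> norm (XL x)" "norm (XL x) \<le> C3" for x
    using x12[of x] unfolding g_norm c2_def C3_def XL_def by (auto intro: power2_le_imp_le)
  have "L x1 (X x1) \<noteq> 0" using X_nonzero Li(2)[of x1 "X x1"] linear_0[OF Li(1)] by metis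
  then have c2: "c2 > 0" by (simp add: c2_def XL_def)
  define c where "c = min c1 c2"
  define C where "C = sqrt C1 + C2 + C3"
  have C3: "C3 \<ge> 0" by (simp add: C3_def)
  have c: "c > 0" "c \<le> c1" "c \<le> c2" using c1 c2 by (simp_all add: c_def)
  have C: "C > 0" "sqrt C1 \<le> C" "C2 \<le> C" "C3 \<le> C"
    using C1(1) C2(1) C3 by (simp_all add: C_def add_pos_nonneg add_pos_pos)
  have Li_g: "g x (Li x v) (Li x v) = (norm v)\<^sup>2" for x v by (simp add: g_norm Li)
  have 1: "norm (DL t x v) \<le> C * norm v" if "\<bar>t\<bar> \<le> 1" for t x v
  proof -
    have "(norm (DL t x v))\<^sup>2 \<le> C1 * (norm v)\<^sup>2"
      using C1(2)[OF that, of x "Li x v"] by (simp add: g_norm Li DL_def)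
    also have "\<dots> = (sqrt C1 * norm v)\<^sup>2" using C1(1) by (simp add: power_mult_distrib)
    finally have "norm (DL t x v) \<le> sqrt C1 * norm v" by (rule power2_le_imp_le) (use C1(1) in simp)
    also have "\<dots> \<le> C * norm v" using C(2) by (rule mult_right_mono) simp
    finally show ?thesis .
  qed
  have 2: "\<bar>JL x v\<bar> \<le> C * (norm v)\<^sup>2" for x v
  proof -
    have "\<bar>JL x v\<bar> \<le> C2 * (norm v)\<^sup>2" using C2(2)[of x "Li x v"] by (simp add: JL_def Li_g)
    also have "\<dots> \<le> C * (norm v)\<^sup>2" using C(3) by (rule mult_right_mono) simp
    finally show ?thesis .
  qed
  have 3: "JL (\<phi> 1 x) (DL 1 x v) \<ge> c * (norm v)\<^sup>2" if "JL x v \<ge> 0" for x v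
  proof -
    have "c * (norm v)\<^sup>2 \<le> c1 * (norm v)\<^sup>2" using c(2) by (rule mult_right_mono) simp
    also have "\<dots> \<le> JL (\<phi> 1 x) (DL 1 x v)"
      using c1(2)[of x "Li x v"] that by (simp add: JL_def DL_def Li_g Li)
    finally show ?thesis .
  qed
  have 4: "c \<le> norm (XL x)" "norm (XL x) \<le> C" for x using XL[of x] c C by auto
  show ?thesis by (rule exI[of _ c], rule exI[of _ C]) (use c(1) C(1) 1 2 3 4 in blast)
qed

lemma DL_det: "\<bar>det (matrix (DL t x))\<bar> = 1"
proof -
  have lin: "linear (\<lambda>v. tangent_map A (\<phi> t) x (Li x v))"
    using linear_compose[OF Li(1) tangent_flow_linear] by (simp add: o_def)
  have "matrix (DL t x) = matrix (L (\<phi> t x)) ** (matrix (tangent_map A (\<phi> t) x) ** matrix (Li x))"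
    unfolding DL_def[abs_def] matrix_comp[OF L(1) lin] matrix_comp[OF tangent_flow_linear Li(1)] ..
  then have "\<bar>det (matrix (DL t x))\<bar> = \<omega> (\<phi> t x) * \<bar>det (matrix (tangent_map A (\<phi> t) x))\<bar> * \<bar>det (matrix (Li x))\<bar>"
    by (simp add: det_mul abs_mult \<omega>_def)
  also have "\<dots> = \<omega> x * \<bar>det (matrix (Li x))\<bar>" by (simp add: volume_preserved)
  also have "\<dots> = \<bar>det (matrix (L x) ** matrix (Li x))\<bar>" by (simp add: det_mul abs_mult \<omega>_def)
  also have "matrix (L x) ** matrix (Li x) = matrix (\<lambda>v. v)"
    using matrix_comp[OF L(1)[of x] Li(1)[of x]] by (simp add: Li)
  also have "\<bar>det (matrix (\<lambda>v :: real ^ 'n. v))\<bar> = 1"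
  proof -
    have "matrix (\<lambda>v :: real ^ 'n. v) = mat 1" by (simp add: matrix_def mat_def vec_eq_iff axis_def)
    then show ?thesis by simp
  qed
  finally show ?thesis .
qed

text \<open>As \<open>X\<close> has no zeros, a vector in the flow direction equals its orthogonal
  projection to the local representative of \<open>X\<close>, an expression continuous in point and
  vector.\<close>

lemma closed_graph_flow_direction:
  assumes c: "c \<in> A" shows "closed_graph (snd c ` fst c) (fibre (flow_direction X) c)"
  unfolding closed_graph_def
proof (intro allI impI)
  fix u w u' w'
  assume uw: "\<forall>k::nat. u k \<in> snd c ` fst c \<and> w k \<in> fibre (flow_direction X) c (u k)"
    and u: "u \<longlonglongrightarrow> u'" "u' \<in> snd c ` fst c" and w: "w \<longlonglongrightarrow> w'"
  have X: "from_coords A c (chart_inv c v) (f c v) = X (chart_inv c v)" if "v \<in> snd c ` fst c" for v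
    using coords_inverse(1)[OF c chart(6)[OF c that]] to_coords_X[OF c chart(6)[OF c that]] chart(7)[OF c that] by metis
  have f_nz: "f c v \<noteq> 0" if "v \<in> snd c ` fst c" for v
    using X[OF that] X_nonzero linear_0[OF coords_linear(1)[OF c chart(6)[OF c that]]] by metis
  have wk: "w k = ((w k \<bullet> f c (u k)) / (f c (u k) \<bullet> f c (u k))) *\<^sub>R f c (u k)" for k
  proof -
    have uk: "u k \<in> snd c ` fst c" and "from_coords A c (chart_inv c (u k)) (w k) \<in> span {X (chart_inv c (u k))}"
      using uw by (auto simp: fibre_def flow_direction_def)
    then obtain a where "from_coords A c (chart_inv c (u k)) (w k) = a *\<^sub>R X (chart_inv c (u k))"
      by (auto simp: span_singleton)
    also have "\<dots> = from_coords A c (chart_inv c (u k)) (a *\<^sub>R f c (u k))"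
      by (simp add: X[OF uk] linear_scale[OF coords_linear(1)[OF c chart(6)[OF c uk]]])
    finally have "w k = a *\<^sub>R f c (u k)" using coords_inverse(2)[OF c chart(6)[OF c uk]] by metis
    then show ?thesis using f_nz[OF uk] by simp
  qed
  have fl: "(\<lambda>k. f c (u k)) \<longlonglongrightarrow> f c u'"
    by (rule continuous_on_tendsto_compose[OF f_continuous[OF c] u]) (use uw in auto)
  have "(\<lambda>k. ((w k \<bullet> f c (u k)) / (f c (u k) \<bullet> f c (u k))) *\<^sub>R f c (u k))
      \<longlonglongrightarrow> ((w' \<bullet> f c u') / (f c u' \<bullet> f c u')) *\<^sub>R f c u'"
    by (intro tendsto_intros w fl) (use f_nz[OF u(2)] in simp)
  then have "w \<longlonglongrightarrow> ((w' \<bullet> f c u') / (f c u' \<bullet> f c u')) *\<^sub>R f c u'" using wk by simp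
  then have "w' = ((w' \<bullet> f c u') / (f c u' \<bullet> f c u')) *\<^sub>R f c u'" by (rule LIMSEQ_unique[OF w])
  then have "from_coords A c (chart_inv c u') w' = ((w' \<bullet> f c u') / (f c u' \<bullet> f c u')) *\<^sub>R X (chart_inv c u')"
    using linear_scale[OF coords_linear(1)[OF c chart(6)[OF c u(2)]]] X[OF u(2)] by metis
  then show "w' \<in> fibre (flow_direction X) c u'" by (simp add: fibre_def flow_direction_def span_base span_scale)
qed

lemma flow_direction_invariant: "tangent_map A (\<phi> t) x ` flow_direction X x = flow_direction X (\<phi> t x)"
  using linear_span_image[OF tangent_flow_linear, of t x "{X x}"] by (simp add: flow_direction_def tangent_flow_X)

theorem anosov: "anosov_flow A g X \<phi>"
proof -
  obtain c C where cC: "c > 0" "C > 0" "\<And>t x v. \<bar>t\<bar> \<le> 1 \<Longrightarrow> norm (DL t x v) \<le> C * norm v"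
    "\<And>x v. \<bar>JL x v\<bar> \<le> C * (norm v)\<^sup>2"
    "\<And>x v. JL x v \<ge> 0 \<Longrightarrow> JL (\<phi> 1 x) (DL 1 x v) \<ge> c * (norm v)\<^sup>2"
    "\<And>x. c \<le> norm (XL x)" "\<And>x. norm (XL x) \<le> C"
    using bounds_exist by metis
  have DL_L: "DL t x (L x v) = L (\<phi> t x) (tangent_map A (\<phi> t) x v)" for t x v by (simp add: DL_def Li)
  interpret V: volume_cone_cocycle \<phi> DL JL XL c C
  proof (rule volume_cone_cocycle.intro)
    fix t x show "linear (DL t x)"
      using linear_compose[OF linear_compose[OF Li(1) tangent_flow_linear] L(1)] by (simp add: DL_def[abs_def] o_def)
    fix v show "DL 0 x v = v" by (simp add: DL_def flow_0 tangent_flow_0 Li)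
    fix s show "DL (s + t) x v = DL s (\<phi> t x) (DL t x v)"
      unfolding DL_def tangent_flow_add flow_add[of s t x] Li(2) ..
    show "\<phi> (s + t) x = \<phi> s (\<phi> t x)" by (rule flow_add)
    show "DL t x (XL x) = XL (\<phi> t x)" by (simp add: XL_def DL_L tangent_flow_X)
  next
    fix x show "quadratic_form (JL x)" unfolding JL_def[abs_def] by (rule quadratic_form_compose[OF J_quadratic Li(1)])
    show "JL x (XL x) \<ge> 0" using J_nonnegative by (simp add: JL_def XL_def Li form_nonnegative_def)
    obtain N where N: "subspace N" "dim N = CARD('n) - 2" "\<forall>v\<in>N. J x v \<le> 0"
      using form_index_properties(1)[OF J_index J_quadratic] by blast
    have "dim (L x ` N) = CARD('n) - 2"
      using dim_image_eq[OF L(1) inj_on_subset[OF L_inj subset_UNIV], of x N] N(2) by simp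
    then show "\<exists>N. subspace N \<and> dim N = CARD('n) - 2 \<and> (\<forall>v\<in>N. JL x v \<le> 0)"
      using N linear_subspace_image[OF L(1) N(1)] by (intro exI[of _ "L x ` N"]) (auto simp: JL_def Li)
    fix N assume N: "subspace N" "\<And>v. v \<in> N \<Longrightarrow> JL x v \<le> 0"
    have "inj (Li x)" by (rule inj_on_inverseI[of _ "L x"]) (rule Li(3))
    then have "dim (Li x ` N) = dim N" by (rule dim_image_eq[OF Li(1) inj_on_subset[OF _ subset_UNIV]])
    moreover have "dim (Li x ` N) \<le> CARD('n) - 2"
      by (rule form_index_properties(2)[OF J_index J_quadratic linear_subspace_image[OF Li(1) N(1)]])
        (use N(2) in \<open>auto simp: JL_def\<close>)
    ultimately show "dim N \<le> CARD('n) - 2" by simp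
  qed (rule dimension flow_0 DL_det cC | assumption)+
  have bij: "bij (L x)" for x by (rule bij_betw_byWitness[of _ "Li x"]) (auto simp: Li)
  define Es where "Es x = L x -` V.Es x" for x
  define Eu where "Eu x = L x -` V.Eu x" for x
  have ds: "direct_sum3 (Es x) (flow_direction X x) (Eu x)" for x
  proof -
    have "L x -` span {XL x} = span {X x}"
    proof -
      have "L x ` span {X x} = span {XL x}" using linear_span_image[OF L(1)[of x], of "{X x}"] by (simp add: XL_def)
      then show ?thesis using inj_vimage_image_eq[OF L_inj] by metis
    qed
    then show ?thesis using direct_sum3_vimage[OF V.splitting[of x] L(1)[of x] bij[of x]]
      by (simp add: Es_def Eu_def flow_direction_def)
  qed
  have invariant: "tangent_map A (\<phi> t) x ` (L x -` E x) = L (\<phi> t x) -` E (\<phi> t x)"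
    if E: "DL t x ` E x = E (\<phi> t x)" for E t x
  proof
    show "tangent_map A (\<phi> t) x ` (L x -` E x) \<subseteq> L (\<phi> t x) -` E (\<phi> t x)"
    proof (rule image_subsetI)
      fix v assume "v \<in> L x -` E x"
      then have "DL t x (L x v) \<in> E (\<phi> t x)" using E by blast
      then show "tangent_map A (\<phi> t) x v \<in> L (\<phi> t x) -` E (\<phi> t x)" by (simp add: DL_L)
    qed
    show "L (\<phi> t x) -` E (\<phi> t x) \<subseteq> tangent_map A (\<phi> t) x ` (L x -` E x)"
    proof
      fix w assume "w \<in> L (\<phi> t x) -` E (\<phi> t x)"
      then obtain z where z: "z \<in> E x" "L (\<phi> t x) w = DL t x z" using E by auto
      have "L (\<phi> t x) w = L (\<phi> t x) (tangent_map A (\<phi> t) x (Li x z))" using z(2) by (simp add: DL_def)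
      then have "w = tangent_map A (\<phi> t) x (Li x z)" using L_inj by (simp add: inj_eq)
      then show "w \<in> tangent_map A (\<phi> t) x ` (L x -` E x)" using z(1) by (intro image_eqI) (auto simp: Li)
    qed
  qed
  have inv: "flow_invariant A \<phi> Es" "flow_invariant A \<phi> Eu" "flow_invariant A \<phi> (flow_direction X)"
    using invariant[OF V.invariant(1)] invariant[OF V.invariant(2)] flow_direction_invariant
    by (simp_all add: flow_invariant_def Es_def Eu_def)
  \<comment> \<open>The decay inequality, squared, says that a continuous form field is nonpositive;
    the sign \<sigma> chooses forward or backward time.\<close>
  define q where "q \<sigma> t x v = 1 * g (\<phi> (\<sigma> * t) x) (tangent_map A (\<phi> (\<sigma> * t)) x v) (tangent_map A (\<phi> (\<sigma> * t)) x v)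
      + (- (V.K * exp (- V.rate * t))\<^sup>2) * g x v v" for \<sigma> t x v
  have q: "form_field (q \<sigma> t)" for \<sigma> t
    unfolding q_def by (rule form_field_combine[OF form_field_pullback[OF form_field_g flow_C1] form_field_g])
  have q_le: "q \<sigma> t x v \<le> 0 \<longleftrightarrow> norm (DL (\<sigma> * t) x (L x v)) \<le> V.K * exp (- V.rate * t) * norm (L x v)" for \<sigma> t x v
  proof -
    have "q \<sigma> t x v \<le> 0 \<longleftrightarrow> (norm (DL (\<sigma> * t) x (L x v)))\<^sup>2 \<le> (V.K * exp (- V.rate * t) * norm (L x v))\<^sup>2"
      by (simp add: q_def g_norm DL_L power_mult_distrib)
    also have "\<dots> \<longleftrightarrow> norm (DL (\<sigma> * t) x (L x v)) \<le> V.K * exp (- V.rate * t) * norm (L x v)"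
      using V.K by (intro power_mono_iff) auto
    finally show ?thesis .
  qed
  have E_eq: "Es x = {v. \<forall>t\<in>{0..}. q 1 t x v \<le> 0}" "Eu x = {v. \<forall>t\<in>{0..}. q (-1) t x v \<le> 0}" for x
    unfolding Es_def Eu_def V.Es_characterization V.Eu_characterization q_le by auto
  have cl: "closed_graph (snd c ` fst c) (fibre Es c)" "closed_graph (snd c ` fst c) (fibre Eu c)" if "c \<in> A" for c
    using closed_graph_of_inequalities[of "{0..}" "q 1" Es c, OF q E_eq(1) that]
      closed_graph_of_inequalities[of "{0..}" "q (-1)" Eu c, OF q E_eq(2) that] .
  have sub: "continuous_subbundle A Es" "continuous_subbundle A Eu" "continuous_subbundle A (flow_direction X)"
    using subbundle_of_direct_sum[OF ds cl(1) closed_graph_flow_direction cl(2)]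
      subbundle_of_direct_sum[OF direct_sum3_commute(1)[OF ds] cl(2) closed_graph_flow_direction cl(1)]
      subbundle_of_direct_sum[OF direct_sum3_commute(2)[OF ds] closed_graph_flow_direction cl(1) cl(2)] by auto
  have stable: "riemannian_norm g (\<phi> t x) (tangent_map A (\<phi> t) x v) \<le> V.K * exp (- V.rate * t) * riemannian_norm g x v"
    if "t > 0" "v \<in> Es x" for t x v
  proof -
    have "norm (DL t x (L x v)) \<le> V.K * exp (- V.rate * t) * norm (L x v)"
      using that unfolding Es_def V.Es_characterization by auto
    then show ?thesis by (simp add: norm_L[symmetric] DL_L)
  qed
  have unstable: "riemannian_norm g x (inv_into (Eu x) (tangent_map A (\<phi> t) x) w)
      \<le> V.K * exp (- V.rate * t) * riemannian_norm g (\<phi> t x) w"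
    if "t > 0" "w \<in> Eu (\<phi> t x)" for t x w
  proof -
    define v where "v = inv_into (Eu x) (tangent_map A (\<phi> t) x) w"
    have "w \<in> tangent_map A (\<phi> t) x ` Eu x" using inv(2) that(2) unfolding flow_invariant_def by blast
    then have v: "tangent_map A (\<phi> t) x v = w" unfolding v_def by (rule f_inv_into_f)
    \<comment> \<open>The inverse of the tangent map on the unstable space is the cocycle at time
      \<open>- t\<close>, so the backward characterization applies.\<close>
    have "L x v = DL (- t) (\<phi> t x) (L (\<phi> t x) w)"
      using V.D_inverse(1)[of t x "L x v"] by (simp add: DL_L v)
    then have "norm (L x v) \<le> V.K * exp (- V.rate * t) * norm (L (\<phi> t x) w)"
      using that unfolding Eu_def V.Eu_characterization by auto
    then show ?thesis unfolding v_def[symmetric] by (simp add: norm_L[symmetric])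
  qed
  show ?thesis
    unfolding anosov_flow_def
  proof (rule exI[of _ Es], rule exI[of _ Eu], intro conjI)
    show "\<forall>x. direct_sum3 (Es x) (flow_direction X x) (Eu x)" using ds by blast
    show "\<forall>E\<in>{Es, flow_direction X, Eu}. continuous_subbundle A E \<and> flow_invariant A \<phi> E" using sub inv by blast
    show "\<exists>K>0. \<exists>r>0. \<forall>x. \<forall>t>0.
       (\<forall>v\<in>Es x. riemannian_norm g (\<phi> t x) (tangent_map A (\<phi> t) x v) \<le> K * exp (- r * t) * riemannian_norm g x v) \<and>
       (\<forall>w\<in>Eu (\<phi> t x). riemannian_norm g x (inv_into (Eu x) (tangent_map A (\<phi> t) x) w)
          \<le> K * exp (- r * t) * riemannian_norm g (\<phi> t x) w)"
      by (rule exI[of _ V.K], rule conjI[OF V.K], rule exI[of _ V.rate], rule conjI[OF V.rate])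
        (use stable unstable in blast)
  qed
qed

end

theorem corollary3:
  fixes A :: "('m::t2_space, 'n::finite) chart set"
    and g :: "'m \<Rightarrow> real ^ 'n \<Rightarrow> real ^ 'n \<Rightarrow> real"
    and X :: "'m \<Rightarrow> real ^ 'n"
    and \<phi> :: "real \<Rightarrow> 'm \<Rightarrow> 'm"
    and J :: "'m \<Rightarrow> real ^ 'n \<Rightarrow> real"
  assumes "CARD('n) \<ge> 3"
    and "compact (UNIV :: 'm set)"
    and "connected (UNIV :: 'm set)"
    and "smooth_atlas A"
    and "riemannian_metric A g"
    and "Ck_vector_field A 1 X"
    and "flow_of A X \<phi>"
    and "\<forall>p. X p = 0 \<longrightarrow> hyperbolic_singularity A X p"
    and "incompressible A g X"
    and "quadratic_form_field A \<phi> J"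
    and "\<forall>x. nondegenerate (J x)"
    and "\<forall>x. indefinite (J x)"
    and "\<forall>x. form_index (J x) = CARD('n) - 2"
    and "form_nonnegative J X"
    and "strictly_separated A \<phi> J"
  shows "anosov_flow A g X \<phi>"
proof -
  interpret separated_flow A X \<phi> g J
    by unfold_locales (use assms in blast)+
  show ?thesis by (rule anosov)
qed

end
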